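(* Let $n$ and $r$ be integers with $n\ge 2$ and $1\le r<n$. The set $\mathrm{PENCIL}^s_{n\times n}(r)$ of $n\times n$ complex symmetric matrix pencils with rank at most $r$ is an algebraic set having exactly $\lfloor r/2\rfloor+1$ irreducible components, and these are the closures (either in the Zariski or in the Euclidean topology) of the congruence bundles $\mathrm{B}^c(\mathcal{K}_a)$, for $a=0,1,\ldots,\lfloor r/2\rfloor$, where $$ \mathcal{K}_a(\lambda):=\operatorname{diag}\bigl(\underbrace{\mathcal{M}_{\alpha+1},\ldots,\mathcal{M}_{\alpha+1}}_{s},\underbrace{\mathcal{M}_{\alpha},\ldots,\mathcal{M}_{\alpha}}_{n-r-s},\mathcal{J}^s_1(\mu_1),\ldots,\mathcal{J}^s_1(\mu_{r-2a})\bigr), $$ with $a=(n-r)\alpha+s$, $0\le s<n-r$, the Euclidean division of $a$ by $n-r$, and $\mu_1,\ldots,\mu_{r-2a}$ arbitrary complex numbers, different from each other.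
   Context: All matrices have complex entries. An $n\times n$ matrix pencil is $\lambda A+B$ with $A,B\in\mathbb{C}^{n\times n}$; it is symmetric if $A^\top=A$ and $B^\top=B$. The set of all $n\times n$ pencils is identified with $\mathbb{C}^{2n^2}$, equipped with either the Euclidean or the Zariski topology; "algebraic set" means Zariski closed subset. The rank of a pencil is the size of its largest non-identically-zero minor (i.e. its rank over the field of rational functions in $\lambda$). Blocks. For $d\ge 0$, let $F_d=[\,0\ \ I_d\,]$ and $G_d=[\,I_d\ \ 0\,]$, both of size $d\times(d+1)$, $\mathcal{L}_d(\lambda)=\lambda G_d+F_d$, and $$\mathcal{M}_d(\lambda)=\begin{bmatrix}0&\mathcal{L}_d(\lambda)^\top\\ \mathcal{L}_d(\lambda)&0\end{bmatrix}\quad\text{of size }(2d+1)\times(2d+1);$$ $\mathcal{M}_0$ is the $1\times1$ zero matrix. For $\mu\in\mathbb{C}$, $\mathcal{J}^s_\ell(\mu)$ is the $\ell\times\ell$ symmetric pencil with entries $\lambda-\mu$ at positions $(i,j)$ with $i+j=\ell+1$, entries $1$ at positions with $i+j=\ell$, and zeros elsewhere; so $\mathcal{J}^s_1(\mu)=\lambda-\mu$. $\mathcal{J}^s_k(\infty)$ is the $k\times k$ symmetric pencil with entries $1$ at positions with $i+j=k+1$, entries $\lambda$ at positions with $i+j=k$, and zeros elsewhere; so $\mathcal{J}^s_1(\infty)=1$. Canonical form (known result). The congruence orbit of a symmetric pencil is $\mathrm{O}^c(\lambda A+B)=\{W^\top(\lambda A+B)W: W\in \mathrm{GL}_n(\mathbb{C})\}$.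 Every symmetric pencil is congruent to a direct sum of blocks of the forms $\mathcal{M}_d$, $\mathcal{J}^s_\ell(\mu)$ ($\mu\in\mathbb{C}$) and $\mathcal{J}^s_k(\infty)$, unique up to the order of the blocks. Bundle. For a symmetric pencil $\mathcal{S}(\lambda)$, the congruence bundle $\mathrm{B}^c(\mathcal{S})$ is the union of all congruence orbits of symmetric pencils whose canonical form has the same block structure (same block sizes) as that of $\mathcal{S}$, but where the values of the eigenvalues are unspecified: that is, the distinct eigenvalues of $\mathcal{S}$ in $\mathbb{C}\cup\{\infty\}$ may be replaced by any other distinct elements of $\mathbb{C}\cup\{\infty\}$, keeping the sizes of the blocks attached to each of them. In particular $\mathrm{B}^c(\mathcal{K}_a)$ does not depend on the choice of the distinct $\mu_i$. *)

theory Defs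
  imports
    "HOL-Analysis.Function_Topology"
    "Jordan_Normal_Form.DL_Submatrix"
    "Jordan_Normal_Form.Determinant"
begin

section \<open>The Zariski topology on affine space\<close>

text \<open>Affine space \<open>\<complex>\<^sup>I\<close> is the set of extensional functions \<open>I \<rightarrow>\<^sub>E UNIV\<close>, as in
  \<^const>\<open>product_topology\<close>. Polynomials in the coordinates are represented by the functions that
  they induce.\<close>

inductive polynomial_fun :: "'i set \<Rightarrow> (('i \<Rightarrow> complex) \<Rightarrow> complex) \<Rightarrow> bool"
  for I :: "'i set" where
  const: "polynomial_fun I (\<lambda>x. c)"
| coord: "i \<in> I \<Longrightarrow> polynomial_fun I (\<lambda>x. x i)"
| add: "polynomial_fun I p \<Longrightarrow> polynomial_fun I q \<Longrightarrow> polynomial_fun I (\<lambda>x. p x + q x)"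
| mult: "polynomial_fun I p \<Longrightarrow> polynomial_fun I q \<Longrightarrow> polynomial_fun I (\<lambda>x. p x * q x)"

definition zero_locus :: "'i set \<Rightarrow> (('i \<Rightarrow> complex) \<Rightarrow> complex) set \<Rightarrow> ('i \<Rightarrow> complex) set" where
  "zero_locus I F = {x \<in> I \<rightarrow>\<^sub>E UNIV. \<forall>p\<in>F. p x = 0}"

definition zariski_topology :: "'i set \<Rightarrow> ('i \<Rightarrow> complex) topology" where
  "zariski_topology I = topology (\<lambda>U. \<exists>F. (\<forall>p\<in>F. polynomial_fun I p) \<and>
     U = (I \<rightarrow>\<^sub>E UNIV) - zero_locus I F)"

definition euclidean_topology_on :: "'i set \<Rightarrow> ('i \<Rightarrow> complex) topology" where
  "euclidean_topology_on I = product_topology (\<lambda>_. euclidean) I"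

lemma istopology_zariski:
  "istopology (\<lambda>U. \<exists>F. (\<forall>p\<in>F. polynomial_fun I p) \<and> U = (I \<rightarrow>\<^sub>E UNIV) - zero_locus I F)"
  (is "istopology ?open")
  unfolding istopology_def
proof (intro conjI allI impI)
  fix U V assume "?open U" "?open V"
  then obtain F G where FG: "\<forall>p\<in>F. polynomial_fun I p" "\<forall>p\<in>G. polynomial_fun I p"
    and U: "U = (I \<rightarrow>\<^sub>E UNIV) - zero_locus I F" and V: "V = (I \<rightarrow>\<^sub>E UNIV) - zero_locus I G"
    by blast
  let ?H = "{\<lambda>x. p x * q x |p q. p \<in> F \<and> q \<in> G}"
  have "\<forall>p\<in>?H. polynomial_fun I p"
    using FG by (auto intro: polynomial_fun.mult)
  moreover have "U \<inter> V = (I \<rightarrow>\<^sub>E UNIV) - zero_locus I ?H"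
  proof -
    have "zero_locus I ?H = zero_locus I F \<union> zero_locus I G"
    proof (intro equalityI subsetI)
      fix x assume x: "x \<in> zero_locus I ?H"
      then have "p x * q x = 0" if "p \<in> F" "q \<in> G" for p q
      proof -
        have "(\<lambda>x. p x * q x) \<in> ?H" using that by blast
        then have "(\<lambda>x. p x * q x) x = 0" using x unfolding zero_locus_def by fast
        then show ?thesis .
      qed
      then have "(\<forall>p\<in>F. p x = 0) \<or> (\<forall>q\<in>G. q x = 0)"
        unfolding mult_eq_0_iff by meson
      moreover have "x \<in> I \<rightarrow>\<^sub>E UNIV" using x by (simp add: zero_locus_def)
      ultimately show "x \<in> zero_locus I F \<union> zero_locus I G"
        by (simp add: zero_locus_def)
    qed (auto simp: zero_locus_def)
    then show ?thesis unfolding U V by blast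
  qed
  ultimately show "?open (U \<inter> V)" by blast
next
  fix K assume "\<forall>U\<in>K. ?open U"
  then obtain F where F: "\<And>U. U \<in> K \<Longrightarrow> (\<forall>p\<in>F U. polynomial_fun I p) \<and>
      U = (I \<rightarrow>\<^sub>E UNIV) - zero_locus I (F U)"
    by metis
  have "\<forall>p\<in>(\<Union>U\<in>K. F U). polynomial_fun I p"
    using F by blast
  moreover have "\<Union>K = (I \<rightarrow>\<^sub>E UNIV) - zero_locus I (\<Union>U\<in>K. F U)"
  proof -
    have "(\<Union>U\<in>K. U) = (\<Union>U\<in>K. (I \<rightarrow>\<^sub>E UNIV) - zero_locus I (F U))"
      using F by (intro SUP_cong refl) blast
    then show ?thesis unfolding zero_locus_def by auto
  qed
  ultimately show "?open (\<Union>K)" by blast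
qed

lemma openin_zariski:
  "openin (zariski_topology I) U \<longleftrightarrow>
     (\<exists>F. (\<forall>p\<in>F. polynomial_fun I p) \<and> U = (I \<rightarrow>\<^sub>E UNIV) - zero_locus I F)"
  unfolding zariski_topology_def using istopology_zariski[of I]
  by (simp add: topology_inverse')

lemma topspace_zariski [simp]: "topspace (zariski_topology I) = I \<rightarrow>\<^sub>E UNIV"
proof
  show "topspace (zariski_topology I) \<subseteq> I \<rightarrow>\<^sub>E UNIV"
    unfolding topspace_def openin_zariski by blast
  have "openin (zariski_topology I) (I \<rightarrow>\<^sub>E UNIV)"
    unfolding openin_zariski zero_locus_def
    by (rule exI[of _ "{\<lambda>x. 1}"]) (auto intro: polynomial_fun.const)
  then show "I \<rightarrow>\<^sub>E UNIV \<subseteq> topspace (zariski_topology I)"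
    by (rule openin_subset)
qed

lemma closedin_zariski:
  "closedin (zariski_topology I) C \<longleftrightarrow> (\<exists>F. (\<forall>p\<in>F. polynomial_fun I p) \<and> C = zero_locus I F)"
proof -
  have sub: "zero_locus I F \<subseteq> I \<rightarrow>\<^sub>E UNIV" for F
    unfolding zero_locus_def by blast
  show ?thesis
    unfolding closedin_def openin_zariski topspace_zariski
    using sub by (metis double_diff order_refl)
qed


section \<open>Irreducible components\<close>

definition irreducible_set_in :: "'a topology \<Rightarrow> 'a set \<Rightarrow> bool" where
  "irreducible_set_in T S \<longleftrightarrow> S \<subseteq> topspace T \<and> S \<noteq> {} \<and>
     (\<forall>C D. closedin T C \<and> closedin T D \<and> S \<subseteq> C \<union> D \<longrightarrow> S \<subseteq> C \<or> S \<subseteq> D)"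

definition irreducible_components :: "'a topology \<Rightarrow> 'a set \<Rightarrow> 'a set set" where
  "irreducible_components T X = {Z. Z \<subseteq> X \<and> irreducible_set_in T Z \<and>
     (\<forall>Z'. Z' \<subseteq> X \<and> irreducible_set_in T Z' \<and> Z \<subseteq> Z' \<longrightarrow> Z' = Z)}"


section \<open>Matrix pencils\<close>

text \<open>The pair \<open>(A, B)\<close> stands for the pencil \<open>\<lambda>A + B\<close>.\<close>

type_synonym pencil = "complex mat \<times> complex mat"

definition pencils :: "nat \<Rightarrow> pencil set" where
  "pencils n = carrier_mat n n \<times> carrier_mat n n"

definition symmetric_pencils :: "nat \<Rightarrow> pencil set" where
  "symmetric_pencils n =
     {(A, B). (A, B) \<in> pencils n \<and> transpose_mat A = A \<and> transpose_mat B = B}"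

definition pencil_poly_mat :: "pencil \<Rightarrow> complex poly mat" where
  "pencil_poly_mat P =
     [:0, 1:] \<cdot>\<^sub>m map_mat (\<lambda>c. [:c:]) (fst P) + map_mat (\<lambda>c. [:c:]) (snd P)"

text \<open>The empty minor, which is \<open>1\<close>, is included, so that the zero pencil has rank \<open>0\<close>.\<close>

definition pencil_rank :: "pencil \<Rightarrow> nat" where
  "pencil_rank P = Max {card I |I J.
     I \<subseteq> {..<dim_row (pencil_poly_mat P)} \<and> J \<subseteq> {..<dim_col (pencil_poly_mat P)} \<and>
     card I = card J \<and> det (submatrix (pencil_poly_mat P) I J) \<noteq> 0}"

definition symmetric_pencils_rank_le :: "nat \<Rightarrow> nat \<Rightarrow> pencil set" where
  "symmetric_pencils_rank_le n r = {P \<in> symmetric_pencils n. pencil_rank P \<le> r}"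

text \<open>The identification of the set of all \<open>n \<times> n\<close> pencils with \<open>\<complex>\<^bsup>2n\<^sup>2\<^esup>\<close>: coordinate
  \<open>(True, i, j)\<close> is an entry of the leading coefficient \<open>A\<close>, and \<open>(False, i, j)\<close> is an entry
  of \<open>B\<close>.\<close>

definition pencil_index :: "nat \<Rightarrow> (bool \<times> nat \<times> nat) set" where
  "pencil_index n = UNIV \<times> {..<n} \<times> {..<n}"

definition pencil_coords :: "nat \<Rightarrow> pencil \<Rightarrow> bool \<times> nat \<times> nat \<Rightarrow> complex" where
  "pencil_coords n P = (\<lambda>(b, i, j) \<in> pencil_index n. (if b then fst P else snd P) $$ (i, j))"

lemma pencil_coords_bij: "bij_betw (pencil_coords n) (pencils n) (pencil_index n \<rightarrow>\<^sub>E UNIV)"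
proof (rule bij_betw_imageI)
  have eq: "(if b then A else B) $$ (i, j) = (if b then A' else B') $$ (i, j)"
    if "pencil_coords n (A, B) = pencil_coords n (A', B')" "i < n" "j < n" for A B A' B' b i j
    using fun_cong[OF that(1), of "(b, i, j)"] that(2,3)
    by (cases b) (simp_all add: pencil_coords_def pencil_index_def)
  show "inj_on (pencil_coords n) (pencils n)"
  proof (rule inj_onI)
    fix P Q assume "P \<in> pencils n" "Q \<in> pencils n" and e: "pencil_coords n P = pencil_coords n Q"
    moreover obtain A B A' B' where "P = (A, B)" "Q = (A', B')" by fastforce
    ultimately have
      "A \<in> carrier_mat n n" "B \<in> carrier_mat n n" "A' \<in> carrier_mat n n" "B' \<in> carrier_mat n n"
      "P = (A, B)" "Q = (A', B')"
      by (auto simp: pencils_def)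
    then show "P = Q"
      using eq[of A B A' B' _ _ True] eq[of A B A' B' _ _ False] e by auto
  qed
  show "pencil_coords n ` pencils n = pencil_index n \<rightarrow>\<^sub>E UNIV"
  proof (intro equalityI subsetI)
    fix x assume "x \<in> pencil_coords n ` pencils n"
    then show "x \<in> pencil_index n \<rightarrow>\<^sub>E UNIV" by (auto simp: pencil_coords_def)
  next
    fix x :: "bool \<times> nat \<times> nat \<Rightarrow> complex" assume x: "x \<in> pencil_index n \<rightarrow>\<^sub>E UNIV"
    let ?P = "(mat n n (\<lambda>(i, j). x (True, i, j)), mat n n (\<lambda>(i, j). x (False, i, j)))"
    have "pencil_coords n ?P = x"
    proof
      fix k :: "bool \<times> nat \<times> nat"
      obtain b i j where "k = (b, i, j)" by (cases k) auto
      then show "pencil_coords n ?P k = x k"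
        using x by (cases "k \<in> pencil_index n")
          (auto simp: pencil_coords_def pencil_index_def PiE_def extensional_def)
    qed
    moreover have "?P \<in> pencils n" by (simp add: pencils_def)
    ultimately show "x \<in> pencil_coords n ` pencils n" by (metis imageI)
  qed
qed

definition pencil_zariski :: "nat \<Rightarrow> pencil topology" where
  "pencil_zariski n =
     pullback_topology (pencils n) (pencil_coords n) (zariski_topology (pencil_index n))"

definition pencil_euclidean :: "nat \<Rightarrow> pencil topology" where
  "pencil_euclidean n =
     pullback_topology (pencils n) (pencil_coords n) (euclidean_topology_on (pencil_index n))"

lemma topspace_pencil [simp]:
  "topspace (pencil_zariski n) = pencils n" "topspace (pencil_euclidean n) = pencils n"
  using bij_betw_imp_surj_on[OF pencil_coords_bij[of n]]
  by (auto simp: pencil_zariski_def pencil_euclidean_def euclidean_topology_on_def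
      topspace_pullback_topology)


section \<open>Canonical form under congruence\<close>

definition congruence_orbit :: "pencil \<Rightarrow> pencil set" where
  "congruence_orbit P =
     {(transpose_mat W * fst P * W, transpose_mat W * snd P * W) |W.
        W \<in> carrier_mat (dim_row (fst P)) (dim_row (fst P)) \<and> invertible_mat W}"

definition diag_pencil :: "pencil list \<Rightarrow> pencil" where
  "diag_pencil Ps = (diag_block_mat (map fst Ps), diag_block_mat (map snd Ps))"

definition F_mat :: "nat \<Rightarrow> complex mat" where
  "F_mat d = mat d (d + 1) (\<lambda>(i, j). if j = i + 1 then 1 else 0)"

definition G_mat :: "nat \<Rightarrow> complex mat" where
  "G_mat d = mat d (d + 1) (\<lambda>(i, j). if j = i then 1 else 0)"

definition off_diag_sym :: "complex mat \<Rightarrow> complex mat" where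
  "off_diag_sym L = four_block_mat (0\<^sub>m (dim_col L) (dim_col L)) (transpose_mat L)
     L (0\<^sub>m (dim_row L) (dim_row L))"

definition M_pencil :: "nat \<Rightarrow> pencil" where
  "M_pencil d = (off_diag_sym (G_mat d), off_diag_sym (F_mat d))"

datatype eigval = Fin complex | Infty

text \<open>Matrix indices start at \<open>0\<close>: the positions \<open>i + j = k + 1\<close> and \<open>i + j = k\<close> in the usual
  numbering from \<open>1\<close> become \<open>i + j + 1 = k\<close> and \<open>i + j + 2 = k\<close>.\<close>

fun J_pencil :: "nat \<Rightarrow> eigval \<Rightarrow> pencil" where
  "J_pencil k (Fin \<mu>) =
     (mat k k (\<lambda>(i, j). if i + j + 1 = k then 1 else 0),
      mat k k (\<lambda>(i, j). if i + j + 1 = k then - \<mu> else if i + j + 2 = k then 1 else 0))"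
| "J_pencil k Infty =
     (mat k k (\<lambda>(i, j). if i + j + 2 = k then 1 else 0),
      mat k k (\<lambda>(i, j). if i + j + 1 = k then 1 else 0))"

datatype 'e block = M_block nat | J_block nat 'e

fun block_pencil :: "eigval block \<Rightarrow> pencil" where
  "block_pencil (M_block d) = M_pencil d"
| "block_pencil (J_block k e) = J_pencil k e"

fun proper_block :: "'e block \<Rightarrow> bool" where
  "proper_block (M_block d) \<longleftrightarrow> True"
| "proper_block (J_block k e) \<longleftrightarrow> k \<ge> 1"

definition blocks_pencil :: "eigval block list \<Rightarrow> pencil" where
  "blocks_pencil bs = diag_pencil (map block_pencil bs)"

definition eigenvalues_of_blocks :: "'e block list \<Rightarrow> 'e set" where
  "eigenvalues_of_blocks bs = (\<Union>b\<in>set bs. set_block b)"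

definition is_canonical_form :: "eigval block list \<Rightarrow> pencil \<Rightarrow> bool" where
  "is_canonical_form bs P \<longleftrightarrow>
     (\<forall>b\<in>set bs. proper_block b) \<and> P \<in> congruence_orbit (blocks_pencil bs)"

text \<open>Replacing the eigenvalues by distinct elements of \<open>\<complex> \<union> {\<infinity>}\<close> is applying to them a
  function that is injective on the set of eigenvalues.\<close>

definition congruence_bundle :: "pencil \<Rightarrow> pencil set" where
  "congruence_bundle S =
     (\<Union>{congruence_orbit (blocks_pencil (map (map_block f) bs)) |bs f.
          is_canonical_form bs S \<and> inj_on f (eigenvalues_of_blocks bs)})"

definition K_pencil :: "nat \<Rightarrow> nat \<Rightarrow> nat \<Rightarrow> complex list \<Rightarrow> pencil" where
  "K_pencil n r a \<mu>s =
     (let \<alpha> = a div (n - r); s = a mod (n - r)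
      in blocks_pencil (replicate s (M_block (\<alpha> + 1)) @ replicate (n - r - s) (M_block \<alpha>) @
           map (\<lambda>\<mu>. J_block 1 (Fin \<mu>)) \<mu>s))"

text \<open>The pencils \<^const>\<open>K_pencil\<close> do have size \<open>n\<close>.\<close>

lemma off_diag_sym_props:
  "off_diag_sym L \<in> carrier_mat (dim_row L + dim_col L) (dim_row L + dim_col L)"
  "transpose_mat (off_diag_sym L) = off_diag_sym L"
  by (auto simp: off_diag_sym_def)

fun block_size :: "'e block \<Rightarrow> nat" where
  "block_size (M_block d) = 2 * d + 1"
| "block_size (J_block k e) = k"

lemma block_pencil_symmetric: "block_pencil b \<in> symmetric_pencils (block_size b)"
proof (cases b)
  case (M_block d)
  have "off_diag_sym L \<in> carrier_mat (2 * d + 1) (2 * d + 1)" if "L \<in> carrier_mat d (d + 1)" for L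
    using off_diag_sym_props(1)[of L] that by (simp add: mult_2)
  then show ?thesis
    using M_block
    by (simp add: symmetric_pencils_def pencils_def M_pencil_def off_diag_sym_props
        G_mat_def F_mat_def)
next
  case (J_block k e)
  then show ?thesis
    by (cases e) (auto simp: symmetric_pencils_def pencils_def add.commute)
qed

lemma diag_block_mat_symmetric:
  assumes "list_all2 (\<lambda>A k. A \<in> carrier_mat k k \<and> transpose_mat A = A) As ks"
  shows "diag_block_mat As \<in> carrier_mat (sum_list ks) (sum_list ks) \<and>
    transpose_mat (diag_block_mat As) = diag_block_mat As"
  using assms
proof (induction rule: list_all2_induct)
  case (Cons A As k ks)
  then show ?case
    by (auto simp: Let_def transpose_four_block_mat[of _ k k _ "sum_list ks" _ "sum_list ks"])
qed auto

lemma blocks_pencil_symmetric: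
  "blocks_pencil bs \<in> symmetric_pencils (\<Sum>b\<leftarrow>bs. block_size b)"
proof -
  have "list_all2 (\<lambda>A k. A \<in> carrier_mat k k \<and> transpose_mat A = A)
      (map (\<lambda>b. fst (block_pencil b)) bs) (map block_size bs)"
    "list_all2 (\<lambda>A k. A \<in> carrier_mat k k \<and> transpose_mat A = A)
      (map (\<lambda>b. snd (block_pencil b)) bs) (map block_size bs)"
    using block_pencil_symmetric
    by (auto simp: symmetric_pencils_def pencils_def list_all2_conv_all_nth case_prod_beta mem_Times_iff)
  from this[THEN diag_block_mat_symmetric] show ?thesis
    by (simp add: blocks_pencil_def diag_pencil_def symmetric_pencils_def pencils_def comp_def)
qed

lemma K_pencil_symmetric:
  assumes "r < n" "2 * a \<le> r" "length \<mu>s = r - 2 * a"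
  shows "K_pencil n r a \<mu>s \<in> symmetric_pencils n"
proof -
  define m where "m = n - r"
  define \<alpha> s where "\<alpha> = a div m" and "s = a mod m"
  have a: "a = m * \<alpha> + s" and s: "s < m"
    using assms(1) by (simp_all add: m_def \<alpha>_def s_def)
  let ?t = "m - s"
  have m: "m = s + ?t" using s by simp
  have "s * (2 * (\<alpha> + 1) + 1) + ?t * (2 * \<alpha> + 1) = m * (2 * \<alpha> + 1) + 2 * s"
    by (subst (2) m) (simp add: algebra_simps)
  also have "\<dots> = 2 * a + m" by (simp add: a algebra_simps)
  finally have "s * (2 * (\<alpha> + 1) + 1) + (?t * (2 * \<alpha> + 1) + (r - 2 * a)) = n"
    using assms(1,2) by (simp add: m_def)
  then show ?thesis
    using blocks_pencil_symmetric[of "replicate s (M_block (\<alpha> + 1)) @ replicate ?t (M_block \<alpha>) @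
        map (\<lambda>\<mu>. J_block 1 (Fin \<mu>)) \<mu>s"] assms(3)
    by (simp add: K_pencil_def Let_def m_def \<alpha>_def s_def sum_list_replicate sum_list_triv comp_def
        del: mult_Suc)
qed

end

theory Submission
  imports
    Defs
    "HOL-Library.Function_Algebras"
    "HOL-Computational_Algebra.Fundamental_Theorem_Algebra"
    "Jordan_Normal_Form.Char_Poly"
begin

text \<open>A symmetric pencil of size \<open>n\<close> has rank at most \<open>r\<close> iff, for some \<open>a \<le> r / 2\<close>, it vanishes on
  \<open>V \<times> N\<close> for subspaces \<open>V \<subseteq> N\<close> of dimensions \<open>n - r + a\<close> and \<open>n - a\<close>: kernel vectors at distinct
  values of \<open>\<lambda>\<close> are orthogonal to each other, so the span \<open>V\<close> of the kernels at infinitely many values is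
  isotropic when these values are chosen so that its dimension is minimal. Let \<open>Z\<^sub>a\<close> be the set of these
  pencils.

  The pencils in \<open>Z\<^sub>a\<close> are the \<open>W\<^sup>T Q W\<close> with \<open>W\<close> an arbitrary matrix and \<open>Q\<close> in the linear space of
  symmetric pencils with one fixed block of zeros. That space is stable under upper triangular \<open>W\<close>, and
  an arbitrary \<open>W\<close> becomes upper triangular after finitely many operations on two adjacent columns;
  so \<open>Z\<^sub>a\<close> arises by repeatedly eliminating a point of a projective line, and it is Zariski closed by the
  theory of resultants. It is irreducible since any two of its points lie on a polynomial curve inside it.

  The bundle of \<open>K\<^sub>a\<close> lies in \<open>Z\<^sub>a\<close>. It is dense there in the Euclidean topology: by induction on \<open>a\<close> and on
  the number \<open>r - 2 a\<close> of eigenvalues, a pencil with the block of zeros can be perturbed so that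
  changes of basis turn it into \<open>K\<^sub>a\<close> with some distinct eigenvalues. Hence both closures of the bundle
  are \<open>Z\<^sub>a\<close>. Finally \<open>K\<^sub>a\<close> lies in no \<open>Z\<^sub>b\<close> with \<open>b \<noteq> a\<close>, so the \<open>Z\<^sub>a\<close> are the irreducible components.\<close>

section \<open>Linear algebra on finite index sets\<close>

text \<open>The sum \<open>(n - r + a) + (n - a) = n + (n - r)\<close> forces the rank bound:
  \<open>\<zeta>A + B\<close> maps \<open>V\<close> into the orthogonal complement of
  \<open>N\<close>, of dimension only \<open>a\<close>, so its kernel has dimension at least
  \<open>n - r\<close> for every \<open>\<zeta>\<close>. How the sum is split, that is
  \<open>a\<close>, distinguishes the components; for \<open>K_a\<close> it is the sum of the
  indices of its singular blocks. Orthogonality of kernel vectors comes from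
  \<open>(\<zeta> - \<mu>) x\<^sup>T A y = 0\<close>, the difference of
  \<open>x\<^sup>T (\<zeta>A + B) y = 0\<close> and \<open>x\<^sup>T (\<mu>A + B) y = 0\<close>. The
  obstacle is closedness, since the invertible matrices do not form a projective variety.
  Eliminating points of projective lines, \<open>n (n - 1) / 2\<close> times, does the work of the
  projectivity of the flag variety. It also reaches the singular \<open>W\<close>, so that two
  matrices can be joined by a straight line in the proof of irreducibility.\<close>

definition fscale :: "complex \<Rightarrow> ('i \<Rightarrow> complex) \<Rightarrow> 'i \<Rightarrow> complex" where
  "fscale c f = (\<lambda>i. c * f i)"

lemma fscale_apply [simp]: "fscale c f i = c * f i"
  by (simp add: fscale_def)

interpretation fv: vector_space "fscale :: complex \<Rightarrow> ('i \<Rightarrow> complex) \<Rightarrow> _"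
  by unfold_locales (auto simp: fun_eq_iff algebra_simps)

interpretation fvp: vector_space_pair "fscale :: complex \<Rightarrow> ('i \<Rightarrow> complex) \<Rightarrow> _"
  "fscale :: complex \<Rightarrow> ('j \<Rightarrow> complex) \<Rightarrow> _" ..

text \<open>The space \<open>\<complex>\<^sup>I\<close> consists of the functions vanishing outside \<open>I\<close>, so that a single vector space serves all
  index sets.\<close>

definition supported :: "'i set \<Rightarrow> ('i \<Rightarrow> complex) set" where
  "supported I = {f. \<forall>i. i \<notin> I \<longrightarrow> f i = 0}"

definition unit_fun :: "'i \<Rightarrow> 'i \<Rightarrow> complex" where
  "unit_fun i = (\<lambda>j. if j = i then 1 else 0)"

lemma supportedD: "f \<in> supported I \<Longrightarrow> i \<notin> I \<Longrightarrow> f i = 0"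
  by (simp add: supported_def)

lemma subspace_supported: "fv.subspace (supported I)"
  by (auto simp: fv.subspace_def supported_def)

lemma sum_apply: "(\<Sum>k\<in>A. g k) i = (\<Sum>k\<in>A. g k (i::'i) :: complex)"
  by (induction A rule: infinite_finite_induct) auto

lemma supported_expand:
  assumes "finite I" "f \<in> supported I"
  shows "f = (\<Sum>i\<in>I. fscale (f i) (unit_fun i))"
  using assms by (auto simp: fun_eq_iff sum_apply unit_fun_def supported_def sum.delta' if_distrib
      cong: if_cong)

lemma inj_unit_fun: "inj unit_fun"
  by (rule injI) (metis unit_fun_def zero_neq_one)

lemma unit_fun_supported: "i \<in> I \<Longrightarrow> unit_fun i \<in> supported I"
  by (auto simp: supported_def unit_fun_def)

lemma independent_unit_fun: "fv.independent (unit_fun ` I)"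
proof (unfold fv.independent_explicit_finite_subsets)
  show "\<forall>A\<subseteq>unit_fun ` I. finite A \<longrightarrow> (\<forall>u. (\<Sum>v\<in>A. fscale (u v) v) = 0 \<longrightarrow> (\<forall>v\<in>A. u v = 0))"
  proof (intro allI impI ballI)
    fix A u v
    assume A: "A \<subseteq> unit_fun ` I" "finite A" and s: "(\<Sum>v\<in>A. fscale (u v) v) = 0" and v: "v \<in> A"
    obtain i where i: "v = unit_fun i" using A v by auto
    have "0 = (\<Sum>v\<in>A. fscale (u v) v) i" using s by simp
    also have "\<dots> = (\<Sum>w\<in>A. if w = v then u v else 0)"
      unfolding sum_apply
    proof (rule sum.cong)
      fix w assume "w \<in> A"
      then obtain j where "w = unit_fun j" using A by auto
      then show "fscale (u w) w i = (if w = v then u v else 0)"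
        using i injD[OF inj_unit_fun, of j i] by (auto simp: unit_fun_def)
    qed simp
    finally show "u v = 0" using A v by simp
  qed
qed

lemma span_unit_fun: "finite I \<Longrightarrow> fv.span (unit_fun ` I) = supported I"
proof (intro equalityI)
  show "fv.span (unit_fun ` I) \<subseteq> supported I"
    by (intro fv.span_minimal subspace_supported) (auto intro: unit_fun_supported)
  assume "finite I"
  show "supported I \<subseteq> fv.span (unit_fun ` I)"
  proof
    fix f assume "f \<in> supported I"
    then have "f = (\<Sum>i\<in>I. fscale (f i) (unit_fun i))" using \<open>finite I\<close> supported_expand by blast
    also have "\<dots> \<in> fv.span (unit_fun ` I)"
      by (intro fv.span_sum fv.span_scale fv.span_base) auto
    finally show "f \<in> fv.span (unit_fun ` I)" .
  qed
qed

lemma dim_supported: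
  assumes "finite I" shows "fv.dim (supported I) = card I"
proof -
  have "fv.dim (supported I) = card (unit_fun ` I)"
    using fv.dim_span_eq_card_independent[OF independent_unit_fun[of I]] span_unit_fun[OF assms] by metis
  then show ?thesis using inj_unit_fun by (metis card_image inj_on_subset subset_UNIV)
qed

section \<open>Subspaces of finite dimension\<close>

text \<open>The functions on an infinite type form a space of infinite dimension, so finiteness is
  asked of the sets at hand and not of the ambient space.\<close>

definition fin_dim :: "('i \<Rightarrow> complex) set \<Rightarrow> bool" where
  "fin_dim S \<longleftrightarrow> (\<exists>X. finite X \<and> S \<subseteq> fv.span X)"

lemma fin_dim_supported: "finite I \<Longrightarrow> S \<subseteq> supported I \<Longrightarrow> fin_dim S"
  unfolding fin_dim_def using span_unit_fun by blast

lemma fin_dim_subset: "fin_dim S \<Longrightarrow> T \<subseteq> S \<Longrightarrow> fin_dim T"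
  unfolding fin_dim_def by blast

lemma fin_dim_independent_finite: "fin_dim S \<Longrightarrow> B \<subseteq> S \<Longrightarrow> fv.independent B \<Longrightarrow> finite B"
  unfolding fin_dim_def using fv.independent_span_bound by (meson order_trans)

lemma fin_dim_card_le_dim:
  assumes "fin_dim S" "B \<subseteq> S" "fv.independent B" shows "card B \<le> fv.dim S"
proof -
  obtain C where C: "C \<subseteq> S" "fv.independent C" "S \<subseteq> fv.span C" "card C = fv.dim S"
    using fv.basis_exists by blast
  then have "finite C" using assms fin_dim_independent_finite by blast
  then show ?thesis using fv.independent_span_bound[of C B] assms C by auto
qed

lemma fin_dim_extend_basis:
  assumes "fin_dim S" "B \<subseteq> S" "fv.independent B"
  obtains C where "B \<subseteq> C" "C \<subseteq> S" "fv.independent C" "S \<subseteq> fv.span C" "finite C" "card C = fv.dim S"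
proof -
  obtain C where C: "B \<subseteq> C" "C \<subseteq> S" "fv.independent C" "S \<subseteq> fv.span C"
    using fv.maximal_independent_subset_extend[OF assms(2,3)] by blast
  then show thesis
    using that[OF C fin_dim_independent_finite[OF assms(1) C(2,3)]] fv.basis_card_eq_dim by blast
qed

lemma fin_dim_mono:
  assumes "fin_dim T" "S \<subseteq> T" shows "fv.dim S \<le> fv.dim T"
  using fv.basis_exists[of S] fin_dim_card_le_dim[OF assms(1)] assms(2) by (metis order_trans)

lemma fin_dim_subspace_eq:
  assumes "fin_dim T" "S \<subseteq> T" "fv.subspace S" "fv.subspace T" "fv.dim T \<le> fv.dim S"
  shows "S = T"
proof -
  obtain B where B: "B \<subseteq> S" "fv.independent B" "S \<subseteq> fv.span B" "card B = fv.dim S"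
    using fv.basis_exists by blast
  obtain C where C: "B \<subseteq> C" "C \<subseteq> T" "fv.independent C" "T \<subseteq> fv.span C" "finite C" "card C = fv.dim T"
    using fin_dim_extend_basis[OF assms(1), of B] B assms(2) by (metis order_trans)
  then have "B = C" using B assms(5) by (metis card_seteq)
  then have "T \<subseteq> fv.span B" using C by simp
  also have "\<dots> \<subseteq> S" using B assms(3) fv.span_minimal by blast
  finally show ?thesis using assms(2) by blast
qed

text \<open>A basis \<open>B\<close> of the kernel is extended to a basis \<open>C\<close> of
  \<open>S\<close>; then \<open>f\<close> is injective on \<open>C - B\<close> and maps it to a
  basis of the image.\<close>

lemma rank_nullity:
  fixes f :: "('i \<Rightarrow> complex) \<Rightarrow> 'j \<Rightarrow> complex"
  assumes S: "fv.subspace S" "fin_dim S" and f: "Vector_Spaces.linear fscale fscale f"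
  shows "fv.dim S = fv.dim (f ` S) + fv.dim {x \<in> S. f x = 0}"
proof -
  interpret f: Vector_Spaces.linear fscale fscale f by (rule f)
  let ?K = "{x \<in> S. f x = 0}"
  have K: "fv.subspace ?K"
    using S(1) by (auto simp: fv.subspace_def f.add f.scale f.zero)
  obtain B where B: "B \<subseteq> ?K" "fv.independent B" "?K \<subseteq> fv.span B" "card B = fv.dim ?K"
    using fv.basis_exists by blast
  obtain C where C: "B \<subseteq> C" "C \<subseteq> S" "fv.independent C" "S \<subseteq> fv.span C" "finite C" "card C = fv.dim S"
  proof -
    have "B \<subseteq> S" using B(1) by blast
    from fin_dim_extend_basis[OF S(2) this B(2)] that show thesis by blast
  qed
  have finB: "finite B" using C finite_subset by blast
  let ?D = "C - B"
  have key: "u d = 0" if z: "f (\<Sum>d\<in>?D. fscale (u d) d) = 0" and d: "d \<in> ?D" for u d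
  proof -
    have "(\<Sum>d\<in>?D. fscale (u d) d) \<in> S"
      using C by (intro fv.subspace_sum[OF S(1)] fv.subspace_scale[OF S(1)]) auto
    then have "(\<Sum>d\<in>?D. fscale (u d) d) \<in> fv.span B" using z B by blast
    then obtain v where v: "(\<Sum>d\<in>?D. fscale (u d) d) = (\<Sum>b\<in>B. fscale (v b) b)"
      using fv.span_finite[OF finB] by auto
    \<comment> \<open>The relation over \<open>C\<close> that arises when the expansion in the
      kernel basis is moved to the other side.\<close>
    let ?w = "\<lambda>c. if c \<in> B then - v c else u c"
    have "(\<Sum>c\<in>C. fscale (?w c) c) = (\<Sum>c\<in>B. fscale (?w c) c) + (\<Sum>c\<in>?D. fscale (?w c) c)"
      using sum.subset_diff[OF C(1) C(5), of "\<lambda>c. fscale (?w c) c"] by (simp add: add.commute)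
    also have "(\<Sum>c\<in>B. fscale (?w c) c) = - (\<Sum>b\<in>B. fscale (v b) b)"
    proof -
      have "(\<Sum>c\<in>B. fscale (?w c) c) = (\<Sum>c\<in>B. - fscale (v c) c)"
        by (rule sum.cong) (auto simp: fv.scale_minus_left)
      then show ?thesis by (simp only: sum_negf)
    qed
    also have "(\<Sum>c\<in>?D. fscale (?w c) c) = (\<Sum>d\<in>?D. fscale (u d) d)"
      by (rule sum.cong) auto
    finally have z: "(\<Sum>c\<in>C. fscale (?w c) c) = 0" by (simp only: v left_minus)
    have "d \<in> C" using d by blast
    then have "?w d = 0"
      by (rule fv.independentD[where u = ?w, OF C(3) C(5) subset_refl z])
    then show ?thesis using d by simp
  qed
  have lin: "f (\<Sum>d\<in>?D. fscale (u d) d) = (\<Sum>d\<in>?D. fscale (u d) (f d))" for u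
    by (simp add: f.sum f.scale)
  have inj: "inj_on f ?D"
  proof (rule inj_onI, rule ccontr)
    fix x y assume xy: "x \<in> ?D" "y \<in> ?D" "f x = f y" "x \<noteq> y"
    let ?u = "\<lambda>d. if d = x then 1 else if d = y then - 1 else (0::complex)"
    have fD: "finite ?D" using C by simp
    have "(\<Sum>d\<in>?D. fscale (?u d) d) = (\<Sum>d\<in>{x,y}. fscale (?u d) d)"
      using xy fD by (intro sum.mono_neutral_right) auto
    also have "\<dots> = x - y" using xy by (auto simp: fun_eq_iff)
    finally have "f (\<Sum>d\<in>?D. fscale (?u d) d) = 0" using xy by (simp add: f.diff)
    from key[OF this xy(1)] show False by simp
  qed
  have ind: "fv.independent (f ` ?D)"
  proof (unfold fv.independent_explicit_finite_subsets, intro allI impI ballI)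
    fix A u v
    assume A: "A \<subseteq> f ` ?D" "finite A" and s: "(\<Sum>v\<in>A. fscale (u v) v) = 0" and v: "v \<in> A"
    obtain d where d: "d \<in> ?D" "v = f d" using A v by auto
    let ?u = "\<lambda>d. if f d \<in> A then u (f d) else 0"
    have fD: "finite ?D" using C by simp
    have "f (\<Sum>d\<in>?D. fscale (?u d) d) = (\<Sum>d\<in>?D. fscale (?u d) (f d))" by (rule lin)
    also have "\<dots> = (\<Sum>w\<in>f ` ?D. fscale (if w \<in> A then u w else 0) w)"
      by (simp add: sum.reindex[OF inj])
    also have "\<dots> = (\<Sum>w\<in>A. fscale (u w) w)"
      using A fD by (intro sum.mono_neutral_cong_right) auto
    finally have z: "f (\<Sum>d\<in>?D. fscale (?u d) d) = 0" by (simp only: s)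
    have "?u d = 0" by (rule key[where u = ?u, OF z d(1)])
    then show "u v = 0" using d v by simp
  qed
  have sp: "f ` S \<subseteq> fv.span (f ` ?D)"
  proof
    fix y assume "y \<in> f ` S"
    then obtain x where x: "x \<in> S" "y = f x" by blast
    then obtain u where "x = (\<Sum>c\<in>C. fscale (u c) c)"
      using C(4) fv.span_finite[OF C(5)] by auto
    then have "y = (\<Sum>c\<in>C. fscale (u c) (f c))" using x by (simp add: f.sum f.scale)
    also have "\<dots> = (\<Sum>c\<in>?D. fscale (u c) (f c))"
    proof (rule sum.mono_neutral_right[OF C(5)])
      show "\<forall>i\<in>C - ?D. fscale (u i) (f i) = 0"
      proof
        fix i assume "i \<in> C - ?D"
        then have "f i = 0" using B by blast
        then show "fscale (u i) (f i) = 0" by (simp only: fv.scale_zero_right)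
      qed
    qed auto
    also have "\<dots> \<in> fv.span (f ` ?D)"
      by (intro fv.span_sum fv.span_scale fv.span_base) auto
    finally show "y \<in> fv.span (f ` ?D)" .
  qed
  have "fv.dim (f ` S) = card (f ` ?D)"
    using fv.basis_card_eq_dim[OF _ sp ind] C by fastforce
  also have "\<dots> = card C - card B" using inj C finB by (simp add: card_image card_Diff_subset)
  finally show ?thesis using B C by (metis C(5) card_mono add.commute le_add_diff_inverse2)
qed

section \<open>Matrices as linear maps\<close>

definition lin_map :: "'i set \<Rightarrow> 'j set \<Rightarrow> ('i \<Rightarrow> 'j \<Rightarrow> complex) \<Rightarrow> ('j \<Rightarrow> complex) \<Rightarrow> 'i \<Rightarrow> complex" where
  "lin_map I J W x = (\<lambda>i. if i \<in> I then \<Sum>j\<in>J. W i j * x j else 0)"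

lemma linear_lin_map: "Vector_Spaces.linear fscale fscale (lin_map I J W)"
  unfolding Vector_Spaces.linear_iff
  by (auto simp: lin_map_def fun_eq_iff algebra_simps sum.distrib sum_distrib_left
      fv.vector_space_axioms)

lemma lin_map_supported: "lin_map I J W x \<in> supported I"
  by (simp add: lin_map_def supported_def)

text \<open>Row and column indices may have different types. Both products are prescribed, which
  makes the notion symmetric without a comparison of cardinalities.\<close>

definition inverse_on :: "'i set \<Rightarrow> 'j set \<Rightarrow> ('i \<Rightarrow> 'j \<Rightarrow> complex) \<Rightarrow> ('j \<Rightarrow> 'i \<Rightarrow> complex) \<Rightarrow> bool" where
  "inverse_on I J W V \<longleftrightarrow>
     (\<forall>i\<in>I. \<forall>i'\<in>I. (\<Sum>j\<in>J. W i j * V j i') = (if i = i' then 1 else 0)) \<and>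
     (\<forall>j\<in>J. \<forall>j'\<in>J. (\<Sum>i\<in>I. V j i * W i j') = (if j = j' then 1 else 0))"

lemma inverse_on_sym: "inverse_on I J W V \<Longrightarrow> inverse_on J I V W"
  by (auto simp: inverse_on_def)

lemma sum_delta_mult:
  assumes "finite I" "i \<in> I"
  shows "(\<Sum>k\<in>I. (if i = k then 1 else 0) * f k) = (f i :: complex)"
    "(\<Sum>k\<in>I. (if k = i then 1 else 0) * f k) = (f i :: complex)"
    "(\<Sum>k\<in>I. f k * (if i = k then 1 else 0)) = (f i :: complex)"
    "(\<Sum>k\<in>I. f k * (if k = i then 1 else 0)) = (f i :: complex)"
  using assms by (simp_all add: if_distrib[of "\<lambda>x. x * _"] if_distrib[of "\<lambda>x. _ * x"] cong: if_cong)

lemma inverse_onD: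
  assumes "finite I" "inverse_on I J W V" "i \<in> I"
  shows "(\<Sum>j\<in>J. W i j * (\<Sum>k\<in>I. V j k * f k)) = f i"
proof -
  have "(\<Sum>j\<in>J. W i j * (\<Sum>k\<in>I. V j k * f k)) = (\<Sum>j\<in>J. \<Sum>k\<in>I. W i j * V j k * f k)"
    by (simp add: sum_distrib_left mult.assoc)
  also have "\<dots> = (\<Sum>k\<in>I. \<Sum>j\<in>J. W i j * V j k * f k)" by (rule sum.swap)
  also have "\<dots> = (\<Sum>k\<in>I. (\<Sum>j\<in>J. W i j * V j k) * f k)" by (simp add: sum_distrib_right)
  also have "\<dots> = (\<Sum>k\<in>I. (if i = k then 1 else 0) * f k)"
    using assms by (intro sum.cong) (auto simp: inverse_on_def)
  finally show ?thesis using sum_delta_mult assms by simp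
qed

lemma inverse_on_trans:
  assumes "finite I" "finite J" "finite K" "inverse_on I J W V" "inverse_on J K W' V'"
  shows "inverse_on I K (\<lambda>i k. \<Sum>j\<in>J. W i j * W' j k) (\<lambda>k i. \<Sum>j\<in>J. V' k j * V j i)"
proof -
  have *: "(\<Sum>k\<in>K. (\<Sum>j\<in>J. W i j * W' j k) * (\<Sum>j\<in>J. V' k j * V j i')) = (if i = i' then 1 else 0)"
    if "finite J" "finite K" "inverse_on I J W V" "inverse_on J K W' V'" "i \<in> I" "i' \<in> I"
    for I :: "'x set" and J :: "'y set" and K :: "'z set" and W V W' V' i i'
  proof -
    have "(\<Sum>k\<in>K. (\<Sum>j\<in>J. W i j * W' j k) * (\<Sum>j\<in>J. V' k j * V j i'))
        = (\<Sum>k\<in>K. \<Sum>j\<in>J. W i j * (W' j k * (\<Sum>j\<in>J. V' k j * V j i')))"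
      by (simp add: sum_distrib_right mult.assoc)
    also have "\<dots> = (\<Sum>j\<in>J. W i j * (\<Sum>k\<in>K. W' j k * (\<Sum>j\<in>J. V' k j * V j i')))"
      by (subst sum.swap) (simp add: sum_distrib_left)
    also have "\<dots> = (\<Sum>j\<in>J. W i j * V j i')"
      using inverse_onD[OF that(1,4)] by simp
    finally show ?thesis using that by (simp add: inverse_on_def)
  qed
  show ?thesis
    unfolding inverse_on_def
    using *[OF assms(2,3,4,5)] *[OF assms(2,1) inverse_on_sym[OF assms(5)] inverse_on_sym[OF assms(4)]]
    by auto
qed

lemma inverse_on_id: "finite I \<Longrightarrow> inverse_on I I (\<lambda>i j. if i = j then 1 else 0) (\<lambda>i j. if i = j then 1 else 0)"
  by (auto simp: inverse_on_def sum_delta_mult)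

lemma inverse_on_bij:
  assumes "finite I" "finite J" "bij_betw \<pi> J I"
  shows "inverse_on I J (\<lambda>i j. if i = \<pi> j then 1 else 0) (\<lambda>j i. if i = \<pi> j then 1 else 0)"
proof -
  have "(\<Sum>j\<in>J. (if i = \<pi> j then 1 else 0) * (if i' = \<pi> j then 1 else 0)) = (if i = i' then 1 else (0::complex))"
    if "i \<in> I" "i' \<in> I" for i i'
  proof -
    have "(\<Sum>j\<in>J. (if i = \<pi> j then 1 else 0) * (if i' = \<pi> j then 1 else 0)) =
        (\<Sum>k\<in>I. (if i = k then 1 else 0) * (if i' = k then 1 else (0::complex)))"
      by (rule sum.reindex_bij_betw[OF assms(3)])
    then show ?thesis using sum_delta_mult(1)[OF assms(1) that(1)] by simp
  qed
  moreover have "(\<Sum>i\<in>I. (if i = \<pi> j then 1 else 0) * (if i = \<pi> j' then 1 else 0)) = (if j = j' then 1 else (0::complex))"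
    if "j \<in> J" "j' \<in> J" for j j'
  proof -
    have "\<pi> j \<in> I" "\<pi> j = \<pi> j' \<longleftrightarrow> j = j'"
      using assms(3) that by (auto simp: bij_betw_def inj_on_def)
    then show ?thesis using sum_delta_mult(2)[OF assms(1), of "\<pi> j"] by simp
  qed
  ultimately show ?thesis by (simp add: inverse_on_def)
qed

lemma subspace_image_lin_map: "fv.subspace S \<Longrightarrow> fv.subspace (lin_map I J W ` S)"
  using linear_lin_map by (rule fvp.linear_subspace_image)

lemma dim_zero: "fv.dim {0 :: 'i \<Rightarrow> complex} = 0"
  using fv.dim_le_card[of "{0}" "{}"] by simp

lemma dim_image_inj:
  fixes f :: "('i \<Rightarrow> complex) \<Rightarrow> 'j \<Rightarrow> complex"
  assumes "fv.subspace S" "fin_dim S" "Vector_Spaces.linear fscale fscale f" "\<And>x. x \<in> S \<Longrightarrow> f x = 0 \<Longrightarrow> x = 0"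
  shows "fv.dim (f ` S) = fv.dim S"
proof -
  have "{x \<in> S. f x = 0} = {0}"
    using assms(1,4) fvp.linear_0[OF assms(3)] fv.subspace_0 by auto
  then show ?thesis using rank_nullity[OF assms(1-3)] by (simp add: dim_zero)
qed

text \<open>An injective map between spaces of equal dimension is onto, and preimages of the unit
  vectors are the columns of a right inverse \<open>V\<close>. It is a left inverse too, since
  \<open>W\<close> annihilates the columns of \<open>VW - 1\<close>.\<close>

lemma inverse_onI:
  assumes fin: "finite I" "finite J" and card: "card I = card J"
    and inj: "\<And>u. (\<forall>i\<in>I. (\<Sum>j\<in>J. W i j * u j) = 0) \<Longrightarrow> \<forall>j\<in>J. u j = 0"
  shows "\<exists>V. inverse_on I J W V"
proof -
  let ?T = "lin_map I J W"
  have T0: "x = 0" if "x \<in> supported J" "?T x = 0" for x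
  proof -
    have "(\<Sum>j\<in>J. W i j * x j) = 0" if "i \<in> I" for i
      using fun_cong[OF \<open>?T x = 0\<close>, of i] that by (simp add: lin_map_def)
    then have "\<forall>j\<in>J. x j = 0" using inj[of x] by blast
    then show ?thesis using that(1) by (auto simp: supported_def fun_eq_iff)
  qed
  have fd: "fin_dim (supported J)" "fin_dim (supported I)"
    by (rule fin_dim_supported[OF fin(2) order_refl], rule fin_dim_supported[OF fin(1) order_refl])
  have "fv.dim (?T ` supported J) = fv.dim (supported I)"
    using dim_image_inj[OF subspace_supported fd(1) linear_lin_map T0] fin card
    by (simp add: dim_supported)
  moreover have "?T ` supported J \<subseteq> supported I"
    using lin_map_supported[of I J W] by blast
  ultimately have surj: "?T ` supported J = supported I"
    by (intro fin_dim_subspace_eq[OF fd(2)] subspace_image_lin_map subspace_supported) simp_all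
  have "\<forall>i\<in>I. \<exists>x. x \<in> supported J \<and> ?T x = unit_fun i"
  proof
    fix i assume "i \<in> I"
    then have "unit_fun i \<in> ?T ` supported J" by (simp add: surj unit_fun_supported)
    then show "\<exists>x. x \<in> supported J \<and> ?T x = unit_fun i" by auto
  qed
  from bchoice[OF this] obtain X where
    X: "\<And>i. i \<in> I \<Longrightarrow> X i \<in> supported J" "\<And>i. i \<in> I \<Longrightarrow> ?T (X i) = unit_fun i"
    by auto
  have WV: "(\<Sum>j\<in>J. W i j * X i' j) = (if i = i' then 1 else 0)" if "i \<in> I" "i' \<in> I" for i i'
    using fun_cong[OF X(2)[OF that(2)], of i] that by (simp add: lin_map_def unit_fun_def)
  have VW: "(\<Sum>i\<in>I. X i j * W i j') = (if j = j' then 1 else 0)" if j: "j \<in> J" "j' \<in> J" for j j'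
  proof -
    \<comment> \<open>The column \<open>j'\<close> of \<open>VW - 1\<close>.\<close>
    let ?u = "\<lambda>j. (\<Sum>i\<in>I. X i j * W i j') - (if j = j' then 1 else 0)"
    have "(\<Sum>j\<in>J. W k j * ?u j) = 0" if "k \<in> I" for k
    proof -
      have "(\<Sum>j\<in>J. W k j * (\<Sum>i\<in>I. X i j * W i j')) = (\<Sum>j\<in>J. \<Sum>i\<in>I. W k j * X i j * W i j')"
        by (simp add: sum_distrib_left mult.assoc)
      also have "\<dots> = (\<Sum>i\<in>I. \<Sum>j\<in>J. W k j * X i j * W i j')" by (rule sum.swap)
      also have "\<dots> = (\<Sum>i\<in>I. (\<Sum>j\<in>J. W k j * X i j) * W i j')" by (simp add: sum_distrib_right)
      also have "\<dots> = (\<Sum>i\<in>I. (if k = i then 1 else 0) * W i j')"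
        using WV that by (intro sum.cong) auto
      also have "\<dots> = W k j'" using sum_delta_mult(1)[OF fin(1) that] by simp
      finally show ?thesis
        using sum_delta_mult(4)[OF fin(2) j(2), of "W k"] by (simp add: right_diff_distrib sum_subtractf)
    qed
    then have "\<forall>j\<in>J. ?u j = 0" by (intro inj ballI)
    then have "?u j = 0" using j(1) by (rule bspec)
    then show ?thesis by simp
  qed
  have "inverse_on I J W (\<lambda>j i. X i j)"
    using WV VW by (simp add: inverse_on_def)
  then show ?thesis by blast
qed

section \<open>Pairs of bilinear forms\<close>

definition bil :: "'i set \<Rightarrow> ('i \<Rightarrow> 'i \<Rightarrow> complex) \<Rightarrow> ('i \<Rightarrow> complex) \<Rightarrow> ('i \<Rightarrow> complex) \<Rightarrow> complex" where
  "bil I Q x y = (\<Sum>i\<in>I. \<Sum>j\<in>I. x i * Q i j * y j)"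

text \<open>A pencil \<open>\<lambda>A + B\<close> on \<open>\<complex>\<^sup>I\<close> is a function \<open>Q\<close> with \<open>Q True = A\<close> and \<open>Q False = B\<close>, of which only the values on
  \<open>I \<times> I\<close> matter.\<close>

definition form_congruent ::
  "'i set \<Rightarrow> (bool \<Rightarrow> 'i \<Rightarrow> 'i \<Rightarrow> complex) \<Rightarrow> 'j set \<Rightarrow> (bool \<Rightarrow> 'j \<Rightarrow> 'j \<Rightarrow> complex) \<Rightarrow> bool" where
  "form_congruent I Q J Q' \<longleftrightarrow> (\<exists>W V. inverse_on I J W V \<and>
     (\<forall>b. \<forall>j\<in>J. \<forall>j'\<in>J. Q' b j j' = bil I (Q b) (\<lambda>i. W i j) (\<lambda>i. W i j')))"

lemma bil_lin_map:
  assumes "finite I" "finite J"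
    and "\<And>j j'. j \<in> J \<Longrightarrow> j' \<in> J \<Longrightarrow> Q' j j' = bil I Q (\<lambda>i. W i j) (\<lambda>i. W i j')"
  shows "bil J Q' x y = bil I Q (lin_map I J W x) (lin_map I J W y)"
proof -
  have "bil J Q' x y = (\<Sum>j\<in>J. \<Sum>j'\<in>J. x j * bil I Q (\<lambda>i. W i j) (\<lambda>i. W i j') * y j')"
    unfolding bil_def[of J] using assms(3) by simp
  also have "\<dots> = (\<Sum>j\<in>J. \<Sum>j'\<in>J. \<Sum>i\<in>I. \<Sum>i'\<in>I. (W i j * x j) * Q i i' * (W i' j' * y j'))"
    by (simp add: bil_def sum_distrib_left sum_distrib_right mult_ac)
  also have "\<dots> = (\<Sum>j\<in>J. \<Sum>i\<in>I. \<Sum>j'\<in>J. \<Sum>i'\<in>I. (W i j * x j) * Q i i' * (W i' j' * y j'))"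
    by (intro sum.cong refl sum.swap)
  also have "\<dots> = (\<Sum>i\<in>I. \<Sum>j\<in>J. \<Sum>j'\<in>J. \<Sum>i'\<in>I. (W i j * x j) * Q i i' * (W i' j' * y j'))"
    by (rule sum.swap)
  also have "\<dots> = (\<Sum>i\<in>I. \<Sum>j\<in>J. \<Sum>i'\<in>I. \<Sum>j'\<in>J. (W i j * x j) * Q i i' * (W i' j' * y j'))"
    by (intro sum.cong refl sum.swap)
  also have "\<dots> = (\<Sum>i\<in>I. \<Sum>i'\<in>I. \<Sum>j\<in>J. \<Sum>j'\<in>J. (W i j * x j) * Q i i' * (W i' j' * y j'))"
    by (intro sum.cong refl sum.swap)
  also have "\<dots> = (\<Sum>i\<in>I. \<Sum>i'\<in>I. (\<Sum>j\<in>J. W i j * x j) * Q i i' * (\<Sum>j'\<in>J. W i' j' * y j'))"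
    by (simp add: sum_product sum_distrib_left sum_distrib_right mult_ac)
  also have "\<dots> = bil I Q (lin_map I J W x) (lin_map I J W y)"
    by (simp add: bil_def lin_map_def)
  finally show ?thesis .
qed

lemma bil_cong:
  assumes "\<And>i j. i \<in> I \<Longrightarrow> j \<in> I \<Longrightarrow> x i * Q i j * y j = x' i * Q' i j * y' j"
  shows "bil I Q x y = bil I Q' x' y'"
  unfolding bil_def using assms by (intro sum.cong) auto

lemma bil_unit:
  assumes "finite I" "i \<in> I" "j \<in> I"
  shows "bil I Q (\<lambda>k. if k = i then 1 else 0) (\<lambda>k. if k = j then 1 else 0) = Q i j"
  using assms by (simp add: bil_def if_distrib[of "\<lambda>x. x * _"] if_distrib[of "\<lambda>x. _ * x"] cong: if_cong)

lemma form_congruent_bij: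
  assumes "finite I" "finite J" "bij_betw \<pi> J I"
    "\<And>b j j'. j \<in> J \<Longrightarrow> j' \<in> J \<Longrightarrow> Q' b j j' = Q b (\<pi> j) (\<pi> j')"
  shows "form_congruent I Q J Q'"
  unfolding form_congruent_def
proof (intro exI conjI allI ballI)
  show "inverse_on I J (\<lambda>i j. if i = \<pi> j then 1 else 0) (\<lambda>j i. if i = \<pi> j then 1 else 0)"
    by (rule inverse_on_bij[OF assms(1-3)])
  fix b j j' assume j: "j \<in> J" "j' \<in> J"
  then have "\<pi> j \<in> I" "\<pi> j' \<in> I" using assms(3) by (auto simp: bij_betw_def)
  then show "Q' b j j' = bil I (Q b) (\<lambda>i. if i = \<pi> j then 1 else 0) (\<lambda>i. if i = \<pi> j' then 1 else 0)"
    using bil_unit[OF assms(1)] assms(4) j by simp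
qed

lemma form_congruent_cong:
  assumes "finite I" "\<And>b i j. i \<in> I \<Longrightarrow> j \<in> I \<Longrightarrow> Q' b i j = Q b i j"
  shows "form_congruent I Q I Q'"
  using form_congruent_bij[of I I id Q' Q] assms by simp

lemma form_congruent_refl: "finite I \<Longrightarrow> form_congruent I Q I Q"
  by (rule form_congruent_cong) auto

lemma form_congruent_trans:
  assumes fin: "finite I" "finite J" "finite K"
    and "form_congruent I Q J Q'" "form_congruent J Q' K Q''"
  shows "form_congruent I Q K Q''"
proof -
  obtain W V where W: "inverse_on I J W V"
    "\<And>b j j'. j \<in> J \<Longrightarrow> j' \<in> J \<Longrightarrow> Q' b j j' = bil I (Q b) (\<lambda>i. W i j) (\<lambda>i. W i j')"
    using assms(4) unfolding form_congruent_def by blast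
  obtain W' V' where W': "inverse_on J K W' V'"
    "\<And>b j j'. j \<in> K \<Longrightarrow> j' \<in> K \<Longrightarrow> Q'' b j j' = bil J (Q' b) (\<lambda>i. W' i j) (\<lambda>i. W' i j')"
    using assms(5) unfolding form_congruent_def by blast
  show ?thesis
    unfolding form_congruent_def
  proof (intro exI conjI allI ballI)
    show "inverse_on I K (\<lambda>i k. \<Sum>j\<in>J. W i j * W' j k) (\<lambda>k i. \<Sum>j\<in>J. V' k j * V j i)"
      by (rule inverse_on_trans[OF fin W(1) W'(1)])
    fix b k k' assume k: "k \<in> K" "k' \<in> K"
    have "Q'' b k k' = bil I (Q b) (lin_map I J W (\<lambda>i. W' i k)) (lin_map I J W (\<lambda>i. W' i k'))"
      unfolding W'(2)[OF k] by (rule bil_lin_map[OF fin(1,2) W(2)])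
    also have "\<dots> = bil I (Q b) (\<lambda>i. \<Sum>j\<in>J. W i j * W' j k) (\<lambda>i. \<Sum>j\<in>J. W i j * W' j k')"
      by (rule bil_cong) (simp add: lin_map_def)
    finally show "Q'' b k k' = bil I (Q b) (\<lambda>i. \<Sum>j\<in>J. W i j * W' j k) (\<lambda>i. \<Sum>j\<in>J. W i j * W' j k')" .
  qed
qed

lemma form_congruent_sym:
  assumes fin: "finite I" "finite J" and "form_congruent I Q J Q'"
  shows "form_congruent J Q' I Q"
proof -
  obtain W V where W: "inverse_on I J W V"
    "\<And>b j j'. j \<in> J \<Longrightarrow> j' \<in> J \<Longrightarrow> Q' b j j' = bil I (Q b) (\<lambda>i. W i j) (\<lambda>i. W i j')"
    using assms(3) unfolding form_congruent_def by blast
  show ?thesis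
    unfolding form_congruent_def
  proof (intro exI conjI allI ballI)
    show "inverse_on J I V W" by (rule inverse_on_sym[OF W(1)])
    fix b i i' assume i: "i \<in> I" "i' \<in> I"
    have "bil J (Q' b) (\<lambda>j. V j i) (\<lambda>j. V j i') =
        bil I (Q b) (lin_map I J W (\<lambda>j. V j i)) (lin_map I J W (\<lambda>j. V j i'))"
      by (rule bil_lin_map[OF fin W(2)])
    also have "\<dots> = bil I (Q b) (\<lambda>k. if k = i then 1 else 0) (\<lambda>k. if k = i' then 1 else 0)"
      using W(1) i by (intro bil_cong) (simp add: lin_map_def inverse_on_def)
    also have "\<dots> = Q b i i'" using bil_unit[OF fin(1) i] by simp
    finally show "Q b i i' = bil J (Q' b) (\<lambda>j. V j i) (\<lambda>j. V j i')" by simp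
  qed
qed

lemma form_congruent_symmetric:
  assumes "form_congruent I Q J Q'" "\<And>b i j. i \<in> I \<Longrightarrow> j \<in> I \<Longrightarrow> Q b i j = Q b j i" "i \<in> J" "j \<in> J"
  shows "Q' b i j = Q' b j i"
proof -
  obtain W V where W:
    "\<And>b j j'. j \<in> J \<Longrightarrow> j' \<in> J \<Longrightarrow> Q' b j j' = bil I (Q b) (\<lambda>i. W i j) (\<lambda>i. W i j')"
    using assms(1) unfolding form_congruent_def by blast
  have "bil I (Q b) x y = bil I (Q b) y x" for x y
    unfolding bil_def by (subst sum.swap) (intro sum.cong, auto simp: assms(2) mult_ac)
  then show ?thesis unfolding W[OF assms(3,4)] W[OF assms(4,3)] .
qed

section \<open>Isotropic flags and adapted bases\<close>

definition isotropic_flag :: "'i set \<Rightarrow> (bool \<Rightarrow> 'i \<Rightarrow> 'i \<Rightarrow> complex) \<Rightarrow> nat \<Rightarrow> nat \<Rightarrow> bool" where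
  "isotropic_flag I Q p q \<longleftrightarrow> (\<exists>V N. fv.subspace V \<and> fv.subspace N \<and> V \<subseteq> N \<and> N \<subseteq> supported I \<and>
     fv.dim V = p \<and> fv.dim N = q \<and> (\<forall>b. \<forall>x\<in>V. \<forall>y\<in>N. bil I (Q b) x y = 0))"

text \<open>The matrix \<open>W\<close> has a left inverse, so it maps both members of the flag
  injectively and keeps their dimensions.\<close>

lemma isotropic_flag_congruent:
  assumes fin: "finite I" "finite J" and c: "form_congruent I Q J Q'" and z: "isotropic_flag J Q' p q"
  shows "isotropic_flag I Q p q"
proof -
  obtain W V' where W: "inverse_on I J W V'"
    "\<And>b j j'. j \<in> J \<Longrightarrow> j' \<in> J \<Longrightarrow> Q' b j j' = bil I (Q b) (\<lambda>i. W i j) (\<lambda>i. W i j')"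
    using c unfolding form_congruent_def by blast
  obtain V N where V: "fv.subspace V" "fv.subspace N" "V \<subseteq> N" "N \<subseteq> supported J" "fv.dim V = p" "fv.dim N = q"
    "\<And>b x y. x \<in> V \<Longrightarrow> y \<in> N \<Longrightarrow> bil J (Q' b) x y = 0"
    using z unfolding isotropic_flag_def by blast
  let ?T = "lin_map I J W"
  have T0: "x = 0" if "x \<in> supported J" "?T x = 0" for x
  proof -
    have "x j = 0" if "j \<in> J" for j
    proof -
      have "(\<Sum>i\<in>I. V' j i * (\<Sum>j\<in>J. W i j * x j)) = x j"
        by (rule inverse_onD[OF fin(2) inverse_on_sym[OF W(1)] that])
      moreover have "(\<Sum>j\<in>J. W i j * x j) = 0" if "i \<in> I" for i
        using fun_cong[OF \<open>?T x = 0\<close>, of i] that by (simp add: lin_map_def)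
      ultimately show ?thesis by simp
    qed
    then show ?thesis using that(1) by (auto simp: supported_def fun_eq_iff)
  qed
  have dim: "fv.dim (?T ` S) = fv.dim S" if "fv.subspace S" "S \<subseteq> supported J" for S
    using that T0 by (intro dim_image_inj linear_lin_map fin_dim_supported[OF fin(2)]) auto
  show ?thesis
    unfolding isotropic_flag_def
  proof (intro exI conjI allI ballI)
    show "fv.subspace (?T ` V)" "fv.subspace (?T ` N)" using V subspace_image_lin_map by blast+
    show "?T ` V \<subseteq> ?T ` N" "?T ` N \<subseteq> supported I" using V lin_map_supported by blast+
    show "fv.dim (?T ` V) = p" "fv.dim (?T ` N) = q"
      using dim[OF V(1)] dim[OF V(2)] V by auto
    fix b x y assume "x \<in> ?T ` V" "y \<in> ?T ` N"
    then obtain x' y' where "x = ?T x'" "y = ?T y'" "x' \<in> V" "y' \<in> N" by blast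
    then show "bil I (Q b) x y = 0"
      using bil_lin_map[where Q' = "Q' b" and Q = "Q b" and W = W, OF fin W(2), of x' y'] V(7)[of x' y' b]
      by simp
  qed
qed

lemma bij_betw_filtration:
  assumes "JV \<subseteq> JN" "JN \<subseteq> J" "BV \<subseteq> BN" "BN \<subseteq> B" "finite J" "finite B"
    "card JV = card BV" "card JN = card BN" "card J = card B"
  obtains \<beta> where "bij_betw \<beta> J B" "\<beta> ` JV = BV" "\<beta> ` JN = BN"
proof -
  have fin: "finite JV" "finite JN" "finite BV" "finite BN"
    using assms by (meson finite_subset)+
  obtain f1 where f1: "bij_betw f1 JV BV" using finite_same_card_bij fin assms(7) by blast
  obtain f2 where f2: "bij_betw f2 (JN - JV) (BN - BV)"
    using finite_same_card_bij[of "JN - JV" "BN - BV"] fin assms by (auto simp: card_Diff_subset)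
  obtain f3 where f3: "bij_betw f3 (J - JN) (B - BN)"
    using finite_same_card_bij[of "J - JN" "B - BN"] fin assms by (auto simp: card_Diff_subset)
  let ?b = "\<lambda>j. if j \<in> JV then f1 j else if j \<in> JN then f2 j else f3 j"
  have 1: "bij_betw ?b JV BV" using f1 by (rule bij_betw_cong[THEN iffD1, rotated]) auto
  have 2: "bij_betw ?b (JN - JV) (BN - BV)" using f2 by (rule bij_betw_cong[THEN iffD1, rotated]) auto
  have 3: "bij_betw ?b (J - JN) (B - BN)"
    using f3 by (rule bij_betw_cong[THEN iffD1, rotated]) (use assms(1) in auto)
  have 12: "bij_betw ?b JN BN"
    using bij_betw_combine[OF 1 2] assms(1,3) by (simp add: Un_absorb1)
  have "bij_betw ?b J B"
    using bij_betw_combine[OF 12 3] assms(2,4) by (simp add: Un_absorb1)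
  then show thesis by (rule that) (use bij_betw_imp_surj_on[OF 1] bij_betw_imp_surj_on[OF 12] in \<open>simp_all only:\<close>)
qed

text \<open>Bases of \<open>V\<close>, of \<open>N\<close> and of the whole space are chosen nested.
  Their vectors become the columns of \<open>W\<close>, distributed so that \<open>JV\<close> and
  \<open>JN\<close> index the first two.\<close>

lemma adapted_basis:
  assumes fin: "finite I" "finite J" and card: "card I = card J"
    and V: "fv.subspace V" "fv.subspace N" "V \<subseteq> N" "N \<subseteq> supported I"
    and J: "JV \<subseteq> JN" "JN \<subseteq> J" "card JV = fv.dim V" "card JN = fv.dim N"
  obtains W V' where "inverse_on I J W V'" "\<forall>j\<in>JV. (\<lambda>i. W i j) \<in> V" "\<forall>j\<in>JN. (\<lambda>i. W i j) \<in> N"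
proof -
  have fd: "fin_dim V" "fin_dim N" "fin_dim (supported I)"
    using fin_dim_supported[OF fin(1)] V by auto
  obtain BV where BV: "BV \<subseteq> V" "fv.independent BV" "V \<subseteq> fv.span BV" "finite BV" "card BV = fv.dim V"
  proof (rule fin_dim_extend_basis[OF fd(1) empty_subsetI fv.independent_empty])
    fix C assume "C \<subseteq> V" "fv.independent C" "V \<subseteq> fv.span C" "finite C" "card C = fv.dim V"
    then show thesis by (rule that)
  qed
  have "BV \<subseteq> N" using BV(1) V(3) by (rule order_trans)
  obtain BN where BN: "BV \<subseteq> BN" "BN \<subseteq> N" "fv.independent BN" "N \<subseteq> fv.span BN" "finite BN" "card BN = fv.dim N"
  proof (rule fin_dim_extend_basis[OF fd(2) \<open>BV \<subseteq> N\<close> BV(2)])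
    fix C assume "BV \<subseteq> C" "C \<subseteq> N" "fv.independent C" "N \<subseteq> fv.span C" "finite C" "card C = fv.dim N"
    then show thesis by (rule that)
  qed
  have "BN \<subseteq> supported I" using BN V by blast
  from fin_dim_extend_basis[OF fd(3) this BN(3)] obtain B where
    B: "BN \<subseteq> B" "B \<subseteq> supported I" "fv.independent B" "supported I \<subseteq> fv.span B" "finite B" "card B = card I"
    unfolding dim_supported[OF fin(1)] by blast
  obtain \<beta> where \<beta>: "bij_betw \<beta> J B" "\<beta> ` JV = BV" "\<beta> ` JN = BN"
  proof (rule bij_betw_filtration[OF J(1,2) BN(1) B(1) fin(2) B(5)])
    show "card JV = card BV" "card JN = card BN" "card J = card B"
      using J BV BN B card by simp_all
  qed
  have "\<exists>V. inverse_on I J (\<lambda>i j. \<beta> j i) V"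
  proof (rule inverse_onI[OF fin card])
    fix u assume u: "\<forall>i\<in>I. (\<Sum>j\<in>J. \<beta> j i * u j) = 0"
    let ?g = "the_inv_into J \<beta>"
    have inj: "inj_on \<beta> J" and im: "\<beta> ` J = B" using \<beta>(1) by (auto simp: bij_betw_def)
    have "(\<Sum>v\<in>B. fscale (u (?g v)) v) = (\<Sum>j\<in>J. fscale (u j) (\<beta> j))"
      unfolding im[symmetric] by (simp add: sum.reindex[OF inj] the_inv_into_f_f[OF inj])
    also have "\<dots> = 0"
    proof
      fix i
      show "(\<Sum>j\<in>J. fscale (u j) (\<beta> j)) i = 0 i"
      proof (cases "i \<in> I")
        case True then show ?thesis using u by (simp add: sum_apply mult.commute)
      next
        case False
        then have "\<beta> j i = 0" if "j \<in> J" for j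
          using B(2) im that by (auto simp: supported_def)
        then show ?thesis by (simp add: sum_apply)
      qed
    qed
    finally have z: "(\<Sum>v\<in>B. fscale (u (?g v)) v) = 0" .
    show "\<forall>j\<in>J. u j = 0"
    proof
      fix j assume "j \<in> J"
      then have "\<beta> j \<in> B" using im by blast
      then have "u (?g (\<beta> j)) = 0"
        by (rule fv.independentD[where u = "\<lambda>v. u (?g v)", OF B(3,5) subset_refl z])
      then show "u j = 0" using the_inv_into_f_f[OF inj] \<open>j \<in> J\<close> by simp
    qed
  qed
  then obtain V' where V': "inverse_on I J (\<lambda>i j. \<beta> j i) V'" by blast
  show thesis
  proof (rule that[OF V'])
    show "\<forall>j\<in>JV. (\<lambda>i. \<beta> j i) \<in> V"
    proof
      fix j assume "j \<in> JV"
      then have "\<beta> j \<in> BV" unfolding \<beta>(2)[symmetric] by (rule imageI)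
      then show "(\<lambda>i. \<beta> j i) \<in> V" using BV(1) by (simp add: subsetD)
    qed
    show "\<forall>j\<in>JN. (\<lambda>i. \<beta> j i) \<in> N"
    proof
      fix j assume "j \<in> JN"
      then have "\<beta> j \<in> BN" unfolding \<beta>(3)[symmetric] by (rule imageI)
      then show "(\<lambda>i. \<beta> j i) \<in> N" using BN(2) by (simp add: subsetD)
    qed
  qed
qed

text \<open>A flag becomes a block of zeros at a prescribed place; the index set \<open>J\<close> of
  the new basis can be chosen to suit later computations.\<close>

lemma isotropic_flag_basis:
  assumes fin: "finite I" "finite J" and card: "card I = card J" and z: "isotropic_flag I Q p q"
    and J: "JV \<subseteq> JN" "JN \<subseteq> J" "card JV = p" "card JN = q"
  shows "\<exists>Q'. form_congruent I Q J Q' \<and> (\<forall>b. \<forall>i\<in>JV. \<forall>j\<in>JN. Q' b i j = 0)"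
proof -
  obtain V N where V: "fv.subspace V" "fv.subspace N" "V \<subseteq> N" "N \<subseteq> supported I" "fv.dim V = p" "fv.dim N = q"
    "\<And>b x y. x \<in> V \<Longrightarrow> y \<in> N \<Longrightarrow> bil I (Q b) x y = 0"
    using z unfolding isotropic_flag_def by blast
  obtain W V' where W: "inverse_on I J W V'" "\<forall>j\<in>JV. (\<lambda>i. W i j) \<in> V" "\<forall>j\<in>JN. (\<lambda>i. W i j) \<in> N"
  proof (rule adapted_basis[OF fin card V(1-4) J(1,2)])
    show "card JV = fv.dim V" "card JN = fv.dim N" using J(3,4) V(5,6) by (simp_all only:)
  qed
  let ?Q = "\<lambda>b j j'. bil I (Q b) (\<lambda>i. W i j) (\<lambda>i. W i j')"
  have "form_congruent I Q J ?Q"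
    unfolding form_congruent_def using W(1) by blast
  moreover have "?Q b j j' = 0" if "j \<in> JV" "j' \<in> JN" for b j j'
    using bspec[OF W(2) that(1)] bspec[OF W(3) that(2)] by (rule V(7))
  ultimately show ?thesis by blast
qed

section \<open>Elimination of a point of the projective line\<close>

lemma polynomial_fun_sum:
  "(\<And>k. k \<in> A \<Longrightarrow> polynomial_fun I (f k)) \<Longrightarrow> polynomial_fun I (\<lambda>x. \<Sum>k\<in>A. f k x)"
  by (induction A rule: infinite_finite_induct) (auto intro: polynomial_fun.intros)

lemma polynomial_fun_prod:
  "(\<And>k. k \<in> A \<Longrightarrow> polynomial_fun I (f k)) \<Longrightarrow> polynomial_fun I (\<lambda>x. \<Prod>k\<in>A. f k x)"
  by (induction A rule: infinite_finite_induct) (auto intro: polynomial_fun.intros)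

lemma polynomial_fun_det:
  assumes "\<And>i j. polynomial_fun I (\<lambda>x. M x i j)"
  shows "polynomial_fun I (\<lambda>x. det (mat n n (\<lambda>(i, j). M x i j)))"
proof -
  have "polynomial_fun I (\<lambda>x. \<Sum>p\<in>{p. p permutes {0..<n}}. signof p * (\<Prod>i = 0..<n. M x i (p i)))"
    by (intro polynomial_fun_sum polynomial_fun.mult polynomial_fun_prod polynomial_fun.const assms)
  moreover have "det (mat n n (\<lambda>(i, j). M x i j)) =
      (\<Sum>p\<in>{p. p permutes {0..<n}}. signof p * (\<Prod>i = 0..<n. M x i (p i)))" for x
    unfolding det_def
    by (auto intro!: sum.cong prod.cong arg_cong[where f = "(*) _"] simp: permutes_in_image)
  ultimately show ?thesis by simp
qed

text \<open>In contrast to \<^const>\<open>zariski_topology\<close>, the points are not required to be extensional.\<close>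

definition poly_closed :: "'k set \<Rightarrow> ('k \<Rightarrow> complex) set \<Rightarrow> bool" where
  "poly_closed I S \<longleftrightarrow> (\<exists>F. (\<forall>p\<in>F. polynomial_fun I p) \<and> S = {x. \<forall>p\<in>F. p x = 0})"

text \<open>The polynomial may depend on the point to be excluded, so no uniform system of equations
  has to be exhibited.\<close>

lemma poly_closedI:
  assumes "\<And>x0. x0 \<notin> S \<Longrightarrow> \<exists>p. polynomial_fun I p \<and> (\<forall>x\<in>S. p x = 0) \<and> p x0 \<noteq> 0"
  shows "poly_closed I S"
  unfolding poly_closed_def
proof (intro exI conjI)
  let ?F = "{p. polynomial_fun I p \<and> (\<forall>x\<in>S. p x = 0)}"
  show "\<forall>p\<in>?F. polynomial_fun I p" by simp
  show "S = {x. \<forall>p\<in>?F. p x = 0}" using assms by blast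
qed

section \<open>Resultants of binary forms\<close>

text \<open>Over the complex numbers, coprimality is the absence of common roots. A root of
  \<open>F\<close> has to be a root of \<open>b\<close>; the linear factor is cancelled and the
  degree drops.\<close>

lemma dvd_mult_no_common_root:
  fixes F G b :: "complex poly"
  assumes "F \<noteq> 0" "\<And>z. poly F z = 0 \<Longrightarrow> poly G z \<noteq> 0" "F dvd b * G"
  shows "F dvd b"
  using assms
proof (induction "degree F" arbitrary: F b rule: less_induct)
  case less
  show ?case
  proof (cases "degree F = 0")
    case True
    then show ?thesis using less.prems(1) by (simp add: is_unit_iff_degree unit_imp_dvd)
  next
    case False
    then obtain z where z: "poly F z = 0"
      using fundamental_theorem_of_algebra[of F] by (auto simp: constant_degree)
    then obtain F' where F': "F = [:- z, 1:] * F'" by (metis dvdE poly_eq_0_iff_dvd)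
    have F0: "F' \<noteq> 0" using less.prems(1) F' by auto
    have "poly (b * G) z = 0" using less.prems(3) z by (metis dvd_trans poly_eq_0_iff_dvd)
    then have "poly b z = 0" using less.prems(2)[OF z] by simp
    then obtain b' where b': "b = [:- z, 1:] * b'" by (metis dvdE poly_eq_0_iff_dvd)
    have "[:- z, 1:] * F' dvd [:- z, 1:] * (b' * G)"
      using less.prems(3) by (simp only: F' b' mult.assoc)
    then have "F' dvd b' * G" by (subst (asm) dvd_times_left_cancel_iff) auto
    moreover have "degree F' < degree F" unfolding F' using F0 by (subst degree_mult_eq) auto
    moreover have "poly G w \<noteq> 0" if "poly F' w = 0" for w using less.prems(2)[of w] that F' by simp
    ultimately have "F' dvd b'" using less.hyps F0 by blast
    then show ?thesis unfolding F' b' by (rule mult_dvd_mono[OF dvd_refl])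
  qed
qed

text \<open>For each \<open>z\<close> the sum is a nonzero polynomial in \<open>\<tau>\<close>, so
  finitely many \<open>z\<close> exclude only finitely many \<open>\<tau>\<close>.\<close>

lemma finite_avoid_combination:
  fixes v :: "nat \<Rightarrow> 'a \<Rightarrow> complex"
  assumes "finite Z" "\<And>z. z \<in> Z \<Longrightarrow> \<exists>k<m. v k z \<noteq> 0"
  shows "\<exists>\<tau>. \<forall>z\<in>Z. (\<Sum>k<m. \<tau> ^ k * v k z) \<noteq> 0"
proof -
  define P where "P z = (\<Sum>k<m. monom (v k z) k)" for z
  have P: "poly (P z) \<tau> = (\<Sum>k<m. \<tau> ^ k * v k z)" for z \<tau>
    by (simp add: P_def poly_sum poly_monom mult.commute)
  have "P z \<noteq> 0" if z: "z \<in> Z" for z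
  proof -
    obtain k where k: "k < m" "v k z \<noteq> 0" using assms(2)[OF z] by blast
    have "coeff (P z) k = v k z"
      using k by (simp add: P_def coeff_sum)
    then show ?thesis using k by auto
  qed
  then have "finite (\<Union>z\<in>Z. {\<tau>. poly (P z) \<tau> = 0})"
    using assms(1) poly_roots_finite by blast
  then obtain \<tau> where "\<tau> \<notin> (\<Union>z\<in>Z. {\<tau>. poly (P z) \<tau> = 0})"
    using ex_new_if_finite[OF infinite_UNIV_char_0] by blast
  then show ?thesis using P by auto
qed

text \<open>A shifted row of coefficients, paired with the vector of all monomials of degree
  \<open>N - 1\<close>, is the form of degree \<open>d\<close> times a monomial.\<close>

lemma shifted_row_sum:
  fixes s t :: complex
  assumes "r + d < N"
  shows "(\<Sum>j<N. (if r \<le> j \<and> j \<le> r + d then c (j - r) else 0) * (s ^ j * t ^ (N - 1 - j)))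
    = s ^ r * t ^ (N - 1 - (r + d)) * (\<Sum>i\<le>d. c i * s ^ i * t ^ (d - i))"
proof -
  have "(\<Sum>j<N. (if r \<le> j \<and> j \<le> r + d then c (j - r) else 0) * (s ^ j * t ^ (N - 1 - j)))
      = (\<Sum>j\<in>{r..r + d}. c (j - r) * (s ^ j * t ^ (N - 1 - j)))"
    using assms by (intro sum.mono_neutral_cong_right) auto
  also have "\<dots> = (\<Sum>i\<in>{0..d}. c i * (s ^ (i + r) * t ^ (N - 1 - (i + r))))"
    using sum.shift_bounds_cl_nat_ivl[of "\<lambda>j. c (j - r) * (s ^ j * t ^ (N - 1 - j))" 0 r d]
    by (simp add: add.commute)
  also have "\<dots> = (\<Sum>i\<in>{0..d}. s ^ r * t ^ (N - 1 - (r + d)) * (c i * s ^ i * t ^ (d - i)))"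
  proof (rule sum.cong)
    fix i assume "i \<in> {0..d}"
    then have "N - 1 - (i + r) = (N - 1 - (r + d)) + (d - i)" using assms by auto
    then show "c i * (s ^ (i + r) * t ^ (N - 1 - (i + r))) =
        s ^ r * t ^ (N - 1 - (r + d)) * (c i * s ^ i * t ^ (d - i))"
      by (simp only: power_add) (simp add: mult_ac)
  qed simp
  finally show ?thesis by (simp add: sum_distrib_left atMost_atLeast0)
qed

text \<open>The entries of the Sylvester matrix: \<open>e\<close> shifts of the coefficients of
  \<open>f\<close>, then \<open>d\<close> shifts of those of \<open>g\<close>. Its determinant is,
  up to sign, the resultant of the two forms.\<close>

definition sylvester :: "nat \<Rightarrow> nat \<Rightarrow> (nat \<Rightarrow> complex) \<Rightarrow> (nat \<Rightarrow> complex) \<Rightarrow> nat \<Rightarrow> nat \<Rightarrow> complex" where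
  "sylvester d e f g r j = (if r < e then (if r \<le> j \<and> j \<le> r + d then f (j - r) else 0)
     else (if r - e \<le> j \<and> j \<le> r - e + e then g (j - (r - e)) else 0))"

lemma sylvester_row_sum:
  fixes s t :: complex
  assumes "r < d + e"
  shows "(\<Sum>j<d + e. sylvester d e f g r j * (s ^ j * t ^ (d + e - 1 - j))) =
    (if r < e then s ^ r * t ^ (e - 1 - r) * (\<Sum>i\<le>d. f i * s ^ i * t ^ (d - i))
     else s ^ (r - e) * t ^ (d - 1 - (r - e)) * (\<Sum>i\<le>e. g i * s ^ i * t ^ (e - i)))"
proof (cases "r < e")
  case True
  then show ?thesis
    using shifted_row_sum[of r d "d + e" f s t] by (simp add: sylvester_def add.commute diff_diff_add)
next
  case False
  have "d + e - 1 - (r - e + e) = d - 1 - (r - e)" using False by linarith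
  then show ?thesis
    using False assms shifted_row_sum[of "r - e" e "d + e" g s t] by (simp add: sylvester_def)
qed

text \<open>The monomials of degree \<open>d + e - 1\<close>, evaluated at a common zero, form a
  nonzero vector in the kernel.\<close>

lemma det_sylvester_zero:
  fixes s t :: complex
  assumes "(s, t) \<noteq> (0, 0)" "0 < d + e"
    "(\<Sum>i\<le>d. f i * s ^ i * t ^ (d - i)) = 0" "(\<Sum>i\<le>e. g i * s ^ i * t ^ (e - i)) = 0"
  shows "det (mat (d + e) (d + e) (\<lambda>(r, j). sylvester d e f g r j)) = 0"
proof -
  let ?N = "d + e" let ?M = "mat ?N ?N (\<lambda>(r, j). sylvester d e f g r j)"
  let ?v = "vec ?N (\<lambda>j. s ^ j * t ^ (?N - 1 - j))"
  have "?v \<noteq> 0\<^sub>v ?N"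
  proof
    assume v: "?v = 0\<^sub>v ?N"
    have *: "?v $ j = 0" if "j < ?N" for j unfolding v using that by simp
    show False
    \<comment> \<open>The first or the last monomial is a pure power of a nonzero
      coordinate.\<close>
    proof (cases "s = 0")
      case True
      then show False using *[of 0] assms(1,2) by simp
    next
      case False
      then show False using *[of "?N - 1"] assms(2) by simp
    qed
  qed
  moreover have "?M *\<^sub>v ?v = 0\<^sub>v ?N"
  proof (rule eq_vecI)
    fix r assume "r < dim_vec (0\<^sub>v ?N :: complex vec)"
    then have r: "r < ?N" by simp
    then have "(?M *\<^sub>v ?v) $ r = (\<Sum>j<?N. sylvester d e f g r j * (s ^ j * t ^ (?N - 1 - j)))"
      by (simp add: scalar_prod_def atLeast0LessThan)
    also have "\<dots> = 0" using sylvester_row_sum[OF r] assms(3,4) by simp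
    finally show "(?M *\<^sub>v ?v) $ r = 0\<^sub>v ?N $ r" using r by simp
  qed simp
  moreover have "?M \<in> carrier_mat ?N ?N" "?v \<in> carrier_vec ?N" by simp_all
  ultimately show ?thesis using det_0_iff_vec_prod_zero by blast
qed

text \<open>A vector in the left kernel is a pair of polynomials with \<open>a F + b G = 0\<close>,
  where \<open>a\<close> has degree below \<open>e\<close> and \<open>b\<close> degree below
  \<open>d\<close>. Without common roots \<open>F\<close> divides \<open>b\<close>, and both vanish
  by degree. The condition on \<open>f d\<close> rules out a common zero at
  \<open>(1, 0)\<close>.\<close>

lemma det_sylvester_nonzero:
  fixes f g :: "nat \<Rightarrow> complex"
  assumes "f d \<noteq> 0" "\<And>z. (\<Sum>i\<le>d. f i * z ^ i) = 0 \<Longrightarrow> (\<Sum>i\<le>e. g i * z ^ i) \<noteq> 0"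
  shows "det (mat (d + e) (d + e) (\<lambda>(r, j). sylvester d e f g r j)) \<noteq> 0"
proof
  let ?N = "d + e" let ?M = "mat ?N ?N (\<lambda>(r, j). sylvester d e f g r j)"
  assume "det ?M = 0"
  then have "det ?M\<^sup>T = 0" using det_transpose[of ?M ?N] by simp
  moreover have "?M\<^sup>T \<in> carrier_mat ?N ?N" by simp
  ultimately obtain w where w: "w \<in> carrier_vec ?N" "w \<noteq> 0\<^sub>v ?N" "?M\<^sup>T *\<^sub>v w = 0\<^sub>v ?N"
    using det_0_iff_vec_prod_zero by blast
  have w0: "(\<Sum>r<?N. sylvester d e f g r j * w $ r) = 0" if "j < ?N" for j
  proof -
    have "(?M\<^sup>T *\<^sub>v w) $ j = (\<Sum>r<?N. sylvester d e f g r j * w $ r)"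
      using that w(1) by (simp add: scalar_prod_def atLeast0LessThan)
    then show ?thesis using w(3) that by simp
  qed
  define F where "F = (\<Sum>i\<le>d. monom (f i) i)"
  define G where "G = (\<Sum>i\<le>e. monom (g i) i)"
  define a where "a = (\<Sum>r<e. monom (w $ r) r)"
  define b where "b = (\<Sum>r<d. monom (w $ (e + r)) r)"
  have pF: "poly F z = (\<Sum>i\<le>d. f i * z ^ i)" and pG: "poly G z = (\<Sum>i\<le>e. g i * z ^ i)"
    and pa: "poly a z = (\<Sum>r<e. w $ r * z ^ r)" and pb: "poly b z = (\<Sum>r<d. w $ (e + r) * z ^ r)" for z
    by (simp_all add: F_def G_def a_def b_def poly_sum poly_monom)
  have cF: "coeff F d = f d" by (simp add: F_def coeff_sum)
  have ca: "coeff a r = w $ r" if "r < e" for r using that by (simp add: a_def coeff_sum)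
  have cb: "coeff b r = w $ (e + r)" if "r < d" for r using that by (simp add: b_def coeff_sum)
  have cb0: "coeff b r = 0" if "d \<le> r" for r using that by (simp add: b_def coeff_sum)
  have F0: "F \<noteq> 0" using cF assms(1) by auto
  have "poly (a * F + b * G) z = poly 0 z" for z
  proof -
    have "0 = (\<Sum>j<?N. (\<Sum>r<?N. sylvester d e f g r j * w $ r) * z ^ j)" using w0 by simp
    also have "\<dots> = (\<Sum>j<?N. \<Sum>r<?N. w $ r * (sylvester d e f g r j * z ^ j))"
      by (simp add: sum_distrib_right sum_distrib_left mult_ac)
    also have "\<dots> = (\<Sum>r<?N. w $ r * (\<Sum>j<?N. sylvester d e f g r j * z ^ j))"
      by (subst sum.swap) (simp add: sum_distrib_left)
    also have "\<dots> = (\<Sum>r<?N. w $ r * (if r < e then z ^ r * poly F z else z ^ (r - e) * poly G z))"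
      using sylvester_row_sum[of _ d e f g z 1] by (intro sum.cong) (auto simp: pF pG)
    also have "{..<?N} = {0..<e} \<union> {e..<e + d}" by auto
    also have "(\<Sum>r\<in>{0..<e} \<union> {e..<e + d}. w $ r * (if r < e then z ^ r * poly F z else z ^ (r - e) * poly G z))
        = (\<Sum>r<e. w $ r * (if r < e then z ^ r * poly F z else z ^ (r - e) * poly G z))
        + (\<Sum>r=e..<e + d. w $ r * (if r < e then z ^ r * poly F z else z ^ (r - e) * poly G z))"
      by (subst sum.union_disjoint) (auto simp: atLeast0LessThan)
    also have "(\<Sum>r=e..<e + d. w $ r * (if r < e then z ^ r * poly F z else z ^ (r - e) * poly G z))
        = (\<Sum>r<d. w $ (e + r) * z ^ r * poly G z)"
      using sum.shift_bounds_nat_ivl[of "\<lambda>r. w $ r * (if r < e then z ^ r * poly F z else z ^ (r - e) * poly G z)" 0 e d]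
      by (simp add: atLeast0LessThan add.commute mult.assoc)
    also have "(\<Sum>r<e. w $ r * (if r < e then z ^ r * poly F z else z ^ (r - e) * poly G z))
        = poly a z * poly F z" by (simp add: pa sum_distrib_right mult.assoc)
    finally show ?thesis by (simp add: pb sum_distrib_right)
  qed
  then have eq: "a * F + b * G = 0" using poly_eq_poly_eq_iff by blast
  have "b * G = F * (- a)" using eq by (simp add: eq_neg_iff_add_eq_0 add.commute mult.commute)
  then have "F dvd b * G" by (metis dvd_triv_left)
  then have dvd: "F dvd b" by (rule dvd_mult_no_common_root[OF F0, rotated]) (use assms(2) in \<open>simp add: pF pG\<close>)
  have b0: "b = 0"
  proof (rule ccontr)
    assume b: "b \<noteq> 0"
    have "d \<le> degree F" using cF assms(1) by (simp add: le_degree)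
    also have "\<dots> \<le> degree b" using dvd b by (rule dvd_imp_degree_le)
    finally have "coeff b (degree b) = 0" by (rule cb0)
    then show False using b by simp
  qed
  then have a0: "a = 0" using eq F0 by simp
  have "w $ r = 0" if "r < ?N" for r
  proof (cases "r < e")
    case True then show ?thesis using ca[of r] a0 by simp
  next
    case False then show ?thesis using cb[of "r - e"] b0 that by simp
  qed
  then have "w = 0\<^sub>v ?N" using w(1) by (intro eq_vecI) auto
  then show False using w(2) by simp
qed

text \<open>A point \<open>x0\<close> outside the set is excluded by the resultant of one form that does not vanish at
  \<open>(1, 0)\<close> over \<open>x0\<close> and a combination of forms that does not vanish at the zeros of the first.\<close>

lemma binary_elimination:
  fixes H :: "(nat \<times> (nat \<Rightarrow> ('k \<Rightarrow> complex) \<Rightarrow> complex)) set"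
  assumes H: "\<And>d c i. (d, c) \<in> H \<Longrightarrow> polynomial_fun I (c i)"
  shows "poly_closed I {x. \<exists>s t. (s, t) \<noteq> (0, 0) \<and>
    (\<forall>(d, c)\<in>H. (\<Sum>i\<le>d. c i x * s ^ i * t ^ (d - i)) = 0)}" (is "poly_closed I ?S")
proof (rule poly_closedI)
  fix x0 assume x0: "x0 \<notin> ?S"
  then have no: "\<exists>(d, c)\<in>H. (\<Sum>i\<le>d. c i x0 * s ^ i * t ^ (d - i)) \<noteq> 0" if "(s, t) \<noteq> (0, 0)" for s t
    using that by blast
  \<comment> \<open>At \<open>(1, 0)\<close> a form takes its leading coefficient as value.\<close>
  obtain d f where f: "(d, f) \<in> H" "(\<Sum>i\<le>d. f i x0 * 1 ^ i * 0 ^ (d - i)) \<noteq> 0"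
    using no[of 1 0] by auto
  have "(\<Sum>i\<le>d. f i x0 * 1 ^ i * 0 ^ (d - i)) = (\<Sum>i\<le>d. if i = d then f i x0 else 0)"
    by (intro sum.cong) auto
  then have fd: "f d x0 \<noteq> 0" using f(2) by simp
  define Z where "Z = {z. (\<Sum>i\<le>d. f i x0 * z ^ i) = 0}"
  have "Z = {z. poly (\<Sum>i\<le>d. monom (f i x0) i) z = 0}"
    by (simp add: Z_def poly_sum poly_monom)
  moreover have "coeff (\<Sum>i\<le>d. monom (f i x0) i) d \<noteq> 0" using fd by (simp add: coeff_sum)
  ultimately have finZ: "finite Z" by (metis coeff_0 poly_roots_finite)
  obtain z' where z': "bij_betw z' {..<card Z} Z" using ex_bij_betw_nat_finite[OF finZ] by (auto simp: atLeast0LessThan)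
  have "\<forall>k. \<exists>h. h \<in> H \<and> (\<Sum>i\<le>fst h. snd h i x0 * z' k ^ i * 1 ^ (fst h - i)) \<noteq> 0"
  proof
    fix k
    obtain d c where "(d, c) \<in> H" "(\<Sum>i\<le>d. c i x0 * z' k ^ i * 1 ^ (d - i)) \<noteq> 0"
      using no[of "z' k" 1] by auto
    then show "\<exists>h. h \<in> H \<and> (\<Sum>i\<le>fst h. snd h i x0 * z' k ^ i * 1 ^ (fst h - i)) \<noteq> 0"
      by (intro exI[of _ "(d, c)"]) simp
  qed
  from choice[OF this] obtain h where
    h': "\<forall>k. h k \<in> H \<and> (\<Sum>i\<le>fst (h k). snd (h k) i x0 * z' k ^ i * 1 ^ (fst (h k) - i)) \<noteq> 0" ..
  have h: "h k \<in> H" "(\<Sum>i\<le>fst (h k). snd (h k) i x0 * z' k ^ i * 1 ^ (fst (h k) - i)) \<noteq> 0" for k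
    using h'[rule_format, of k] by simp_all
  let ?m = "card Z"
  define D where "D k = fst (h k)" for k
  define c where "c k = snd (h k)" for k
  have Dc: "(D k, c k) \<in> H" for k using h(1)[of k] by (simp add: D_def c_def)
  have "\<exists>\<tau>. \<forall>z\<in>Z. (\<Sum>k<?m. \<tau> ^ k * (\<Sum>i\<le>D k. c k i x0 * z ^ i)) \<noteq> 0"
  proof (rule finite_avoid_combination[OF finZ])
    fix z assume "z \<in> Z"
    then obtain k where "k < ?m" "z = z' k" using z' by (auto simp: bij_betw_def)
    then show "\<exists>k<?m. (\<Sum>i\<le>D k. c k i x0 * z ^ i) \<noteq> 0" using h(2)[of k] by (auto simp: D_def c_def)
  qed
  then obtain \<tau> where \<tau>: "\<And>z. z \<in> Z \<Longrightarrow> (\<Sum>k<?m. \<tau> ^ k * (\<Sum>i\<le>D k. c k i x0 * z ^ i)) \<noteq> 0" by blast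
  \<comment> \<open>At least every degree \<open>D k\<close>, and positive so that the Sylvester
    matrix is not empty when \<open>d = 0\<close>.\<close>
  define e where "e = Suc (\<Sum>k<?m. D k)"
  have De: "D k \<le> e" if "k < ?m" for k
    using member_le_sum[of k "{..<?m}" D] that by (simp add: e_def)
  \<comment> \<open>The coefficients of the combination, each form being raised to degree
    \<open>e\<close> by a power of \<open>t\<close>. This changes nothing at \<open>t = 1\<close>,
    where the zeros \<open>Z\<close> are taken.\<close>
  define g where "g i x = (\<Sum>k<?m. if i \<le> D k then \<tau> ^ k * c k i x else 0)" for i x
  have gsum: "(\<Sum>i\<le>e. g i x * s ^ i * t ^ (e - i)) =
      (\<Sum>k<?m. \<tau> ^ k * t ^ (e - D k) * (\<Sum>i\<le>D k. c k i x * s ^ i * t ^ (D k - i)))" for x s t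
  proof -
    have "(\<Sum>i\<le>e. g i x * s ^ i * t ^ (e - i)) =
        (\<Sum>i\<le>e. \<Sum>k<?m. (if i \<le> D k then \<tau> ^ k * c k i x * s ^ i * t ^ (e - i) else 0))"
      unfolding g_def sum_distrib_right by (intro sum.cong refl) auto
    also have "\<dots> = (\<Sum>k<?m. \<Sum>i\<le>e. (if i \<le> D k then \<tau> ^ k * c k i x * s ^ i * t ^ (e - i) else 0))"
      by (rule sum.swap)
    also have "\<dots> = (\<Sum>k<?m. \<Sum>i\<le>D k. \<tau> ^ k * t ^ (e - D k) * (c k i x * s ^ i * t ^ (D k - i)))"
    proof (rule sum.cong)
      fix k assume k: "k \<in> {..<?m}"
      have "(\<Sum>i\<le>e. (if i \<le> D k then \<tau> ^ k * c k i x * s ^ i * t ^ (e - i) else 0)) =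
          (\<Sum>i\<le>D k. \<tau> ^ k * c k i x * s ^ i * t ^ (e - i))"
        using De[of k] k by (intro sum.mono_neutral_cong_right) auto
      also have "\<dots> = (\<Sum>i\<le>D k. \<tau> ^ k * t ^ (e - D k) * (c k i x * s ^ i * t ^ (D k - i)))"
      proof (rule sum.cong)
        fix i assume "i \<in> {..D k}"
        then have "e - i = (e - D k) + (D k - i)" using De[of k] k by auto
        then show "\<tau> ^ k * c k i x * s ^ i * t ^ (e - i) = \<tau> ^ k * t ^ (e - D k) * (c k i x * s ^ i * t ^ (D k - i))"
          by (simp add: power_add mult_ac)
      qed simp
      finally show "(\<Sum>i\<le>e. (if i \<le> D k then \<tau> ^ k * c k i x * s ^ i * t ^ (e - i) else 0)) =
          (\<Sum>i\<le>D k. \<tau> ^ k * t ^ (e - D k) * (c k i x * s ^ i * t ^ (D k - i)))" .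
    qed simp
    finally show ?thesis by (simp add: sum_distrib_left)
  qed
  let ?p = "\<lambda>x. det (mat (d + e) (d + e) (\<lambda>(r, j). sylvester d e (\<lambda>i. f i x) (\<lambda>i. g i x) r j))"
  have pg: "polynomial_fun I (g i)" for i
  proof -
    have "polynomial_fun I (\<lambda>x. if i \<le> D k then \<tau> ^ k * c k i x else 0)" for k
      by (cases "i \<le> D k") (auto intro: polynomial_fun.intros H[OF Dc])
    then show ?thesis unfolding g_def[abs_def] by (intro polynomial_fun_sum)
  qed
  have "polynomial_fun I (\<lambda>x. sylvester d e (\<lambda>i. f i x) (\<lambda>i. g i x) r j)" for r j
    unfolding sylvester_def
    by (cases "r < e"; cases "r \<le> j \<and> j \<le> r + d"; cases "r - e \<le> j \<and> j \<le> r - e + e")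
      (auto intro: polynomial_fun.const pg H[OF f(1)])
  then have "polynomial_fun I ?p" by (rule polynomial_fun_det)
  moreover have "?p x = 0" if xS: "x \<in> ?S" for x
  proof -
    obtain s t where st: "(s, t) \<noteq> (0, 0)" and z': "\<forall>(d, c)\<in>H. (\<Sum>i\<le>d. c i x * s ^ i * t ^ (d - i)) = 0"
      using xS unfolding mem_Collect_eq by (elim exE conjE) (rule that)
    have z: "(\<Sum>i\<le>d. c i x * s ^ i * t ^ (d - i)) = 0" if "(d, c) \<in> H" for d c
      using bspec[OF z' that] by simp
    show ?thesis
    proof (rule det_sylvester_zero[OF st])
      show "(\<Sum>i\<le>d. f i x * s ^ i * t ^ (d - i)) = 0" by (rule z[OF f(1)])
      show "(\<Sum>i\<le>e. g i x * s ^ i * t ^ (e - i)) = 0" unfolding gsum z[OF Dc] by simp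
    qed (simp add: e_def)
  qed
  moreover have "?p x0 \<noteq> 0"
  proof (rule det_sylvester_nonzero)
    show "f d x0 \<noteq> 0" by (rule fd)
    fix z assume "(\<Sum>i\<le>d. f i x0 * z ^ i) = 0"
    then have "z \<in> Z" by (simp add: Z_def)
    then show "(\<Sum>i\<le>e. g i x0 * z ^ i) \<noteq> 0" using \<tau>[of z] gsum[of x0 z 1] by simp
  qed
  ultimately show "\<exists>p. polynomial_fun I p \<and> (\<forall>x\<in>?S. p x = 0) \<and> p x0 \<noteq> 0" by blast
qed

section \<open>Polynomials in two variables with conic zero sets\<close>

text \<open>Polynomials in \<open>s\<close> and \<open>t\<close> over the polynomial functions. The
  explicit list of monomials gives \<open>conic_elimination\<close> access to the homogeneous
  components.\<close>

definition bipoly :: "'k set \<Rightarrow> (complex \<Rightarrow> complex \<Rightarrow> ('k \<Rightarrow> complex) \<Rightarrow> complex) \<Rightarrow> bool" where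
  "bipoly I h \<longleftrightarrow> (\<exists>ms. (\<forall>(i, j, c)\<in>set ms. polynomial_fun I c) \<and>
     h = (\<lambda>s t x. \<Sum>(i, j, c)\<leftarrow>ms. c x * s ^ i * t ^ j))"

lemma bipoly_polynomial: "polynomial_fun I p \<Longrightarrow> bipoly I (\<lambda>s t x. p x)"
  unfolding bipoly_def by (rule exI[of _ "[(0, 0, p)]"]) auto

lemma bipoly_const: "bipoly I (\<lambda>s t x. c)"
  by (rule bipoly_polynomial) (rule polynomial_fun.const)

lemma bipoly_vars: "bipoly I (\<lambda>s t x. s)" "bipoly I (\<lambda>s t x. t)"
  unfolding bipoly_def
  by (rule exI[of _ "[(1, 0, \<lambda>x. 1)]"], auto intro: polynomial_fun.const)
    (rule exI[of _ "[(0, 1, \<lambda>x. 1)]"], auto intro: polynomial_fun.const)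

lemma bipoly_add: "bipoly I h \<Longrightarrow> bipoly I h' \<Longrightarrow> bipoly I (\<lambda>s t x. h s t x + h' s t x)"
  unfolding bipoly_def
proof (elim exE conjE)
  fix ms ms' :: "(nat \<times> nat \<times> (('a \<Rightarrow> complex) \<Rightarrow> complex)) list"
  assume "\<forall>(i, j, c)\<in>set ms. polynomial_fun I c" "\<forall>(i, j, c)\<in>set ms'. polynomial_fun I c"
    "h = (\<lambda>s t x. \<Sum>(i, j, c)\<leftarrow>ms. c x * s ^ i * t ^ j)" "h' = (\<lambda>s t x. \<Sum>(i, j, c)\<leftarrow>ms'. c x * s ^ i * t ^ j)"
  then show "\<exists>ms. (\<forall>(i, j, c)\<in>set ms. polynomial_fun I c) \<and>
      (\<lambda>s t x. h s t x + h' s t x) = (\<lambda>s t x. \<Sum>(i, j, c)\<leftarrow>ms. c x * s ^ i * t ^ j)"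
    by (intro exI[of _ "ms @ ms'"]) auto
qed

lemma bipoly_mult: "bipoly I h \<Longrightarrow> bipoly I h' \<Longrightarrow> bipoly I (\<lambda>s t x. h s t x * h' s t x)"
proof -
  assume "bipoly I h" "bipoly I h'"
  then obtain ms ms' where m: "\<forall>(i, j, c)\<in>set ms. polynomial_fun I c"
      "h = (\<lambda>s t x. \<Sum>(i, j, c)\<leftarrow>ms. c x * s ^ i * t ^ j)"
    and m': "\<forall>(i, j, c)\<in>set ms'. polynomial_fun I c"
      "h' = (\<lambda>s t x. \<Sum>(i, j, c)\<leftarrow>ms'. c x * s ^ i * t ^ j)"
    unfolding bipoly_def by blast
  have one: "bipoly I (\<lambda>s t x. (c x * s ^ i * t ^ j) * h' s t x)" if "polynomial_fun I c" for c i j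
    unfolding bipoly_def
    by (rule exI[of _ "map (\<lambda>(i', j', c'). (i + i', j + j', \<lambda>x. c x * c' x)) ms'"])
      (use that m' in \<open>auto simp: sum_list_const_mult[symmetric] power_add comp_def case_prod_beta mult_ac fun_eq_iff
        intro!: polynomial_fun.mult arg_cong[where f = sum_list] split: prod.splits\<close>)
  have "bipoly I (\<lambda>s t x. (\<Sum>(i, j, c)\<leftarrow>ms. c x * s ^ i * t ^ j) * h' s t x)" using m(1)
  proof (induction ms)
    case Nil
    then show ?case by (simp add: bipoly_const)
  next
    case (Cons a ms)
    obtain i j c where "a = (i, j, c)" by (cases a) auto
    then show ?case using Cons bipoly_add[OF one[of c i j] Cons.IH] by (simp add: distrib_right)
  qed
  then show ?thesis by (simp add: m(2))
qed

lemma bipoly_sum: "(\<And>k. k \<in> A \<Longrightarrow> bipoly I (h k)) \<Longrightarrow> bipoly I (\<lambda>s t x. \<Sum>k\<in>A. h k s t x)"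
  by (induction A rule: infinite_finite_induct) (auto intro: bipoly_const bipoly_add)

lemma bipoly_compose:
  assumes "polynomial_fun K p" "\<And>k. k \<in> K \<Longrightarrow> bipoly I (\<lambda>s t x. y s t x k)"
  shows "bipoly I (\<lambda>s t x. p (y s t x))"
  using assms(1) by induction (auto intro: bipoly_const assms(2) bipoly_add bipoly_mult)

lemma sum_list_sum_swap: "(\<Sum>m\<leftarrow>ms. \<Sum>d\<in>A. f d m) = (\<Sum>d\<in>A. \<Sum>m\<leftarrow>ms. f d m :: complex)"
  by (induction ms) (auto simp: sum.distrib)

text \<open>The members of \<open>H\<close> may be inhomogeneous. Where all of them vanish, the cone
  condition makes \<open>h (u * s) (u * t) x\<close> a polynomial in \<open>u\<close> with
  infinitely many zeros, so each homogeneous component vanishes there as well, and elimination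
  applies to the components.\<close>

lemma conic_elimination:
  assumes H: "\<And>h. h \<in> H \<Longrightarrow> bipoly I h"
    and conic: "\<And>s t u x. u \<noteq> 0 \<Longrightarrow> \<forall>h\<in>H. h s t x = 0 \<Longrightarrow> \<forall>h\<in>H. h (u * s) (u * t) x = 0"
  shows "poly_closed I {x. \<exists>s t. (s, t) \<noteq> (0, 0) \<and> (\<forall>h\<in>H. h s t x = 0)}"
proof -
  \<comment> \<open>The coefficient of \<open>s ^ i * t ^ (d - i)\<close>, collected over the
    list.\<close>
  define co :: "(nat \<times> nat \<times> (('a \<Rightarrow> complex) \<Rightarrow> complex)) list \<Rightarrow> nat \<Rightarrow> nat \<Rightarrow> ('a \<Rightarrow> complex) \<Rightarrow> complex"
    where "co ms d i x = (\<Sum>(i', j, c)\<leftarrow>ms. if i' = i \<and> i' + j = d then c x else 0)" for ms d i x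
  define ev :: "(nat \<times> nat \<times> (('a \<Rightarrow> complex) \<Rightarrow> complex)) list \<Rightarrow> complex \<Rightarrow> complex \<Rightarrow> ('a \<Rightarrow> complex) \<Rightarrow> complex"
    where "ev ms s t x = (\<Sum>(i, j, c)\<leftarrow>ms. c x * s ^ i * t ^ j)" for ms s t x
  have "\<forall>h\<in>H. \<exists>ms. (\<forall>(i, j, c)\<in>set ms. polynomial_fun I c) \<and> h = ev ms"
  proof
    fix h assume "h \<in> H"
    from H[OF this] obtain ms where ms: "\<forall>(i, j, c)\<in>set ms. polynomial_fun I c"
      "h = (\<lambda>s t x. \<Sum>(i, j, c)\<leftarrow>ms. c x * s ^ i * t ^ j)"
      unfolding bipoly_def by (elim exE conjE) (rule that; assumption)
    have "h = ev ms" unfolding ms(2) by (simp add: fun_eq_iff ev_def)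
    with ms(1) show "\<exists>ms. (\<forall>(i, j, c)\<in>set ms. polynomial_fun I c) \<and> h = ev ms" by (intro exI conjI)
  qed
  from bchoice[OF this] obtain M where
    M: "\<And>h. h \<in> H \<Longrightarrow> \<forall>(i, j, c)\<in>set (M h). polynomial_fun I c" "\<And>h. h \<in> H \<Longrightarrow> h = ev (M h)"
    by blast
  let ?H = "{(d, co (M h) d) |d h. h \<in> H}"
  let ?hom = "\<lambda>ms d s t x. (\<Sum>i\<le>d. co ms d i x * s ^ i * t ^ (d - i))"
  have hom: "?hom ms d s t x = (\<Sum>(i, j, c)\<leftarrow>ms. if i + j = d then c x * s ^ i * t ^ j else 0)" for ms d s t x
  proof -
    have "?hom ms d s t x =
        (\<Sum>i\<le>d. \<Sum>(i', j, c)\<leftarrow>ms. if i' = i \<and> i' + j = d then c x * s ^ i' * t ^ j else 0)"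
      unfolding co_def sum_list_mult_const[symmetric]
      by (intro sum.cong refl arg_cong[where f = sum_list] map_cong) (auto split: prod.splits)
    also have "\<dots> = (\<Sum>m\<leftarrow>ms. \<Sum>i\<le>d. (case m of (i', j, c) \<Rightarrow>
        if i' = i \<and> i' + j = d then c x * s ^ i' * t ^ j else 0))"
      by (rule sum_list_sum_swap[symmetric])
    also have "\<dots> = (\<Sum>(i, j, c)\<leftarrow>ms. if i + j = d then c x * s ^ i * t ^ j else 0)"
      by (intro arg_cong[where f = sum_list] map_cong refl) (auto split: prod.splits intro: sum.neutral)
    finally show ?thesis .
  qed
  have ev: "\<exists>n. (\<forall>u s t x. ev ms (u * s) (u * t) x = (\<Sum>d\<le>n. ?hom ms d s t x * u ^ d)) \<and>
      (\<forall>d s t x. n < d \<longrightarrow> ?hom ms d s t x = 0)" for ms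
  proof -
    let ?n = "\<Sum>(i, j, c)\<leftarrow>ms. i + j"
    have deg: "i + j \<le> ?n" if "(i, j, c) \<in> set ms" for i j c
    proof -
      have "i + j \<in> set (map (\<lambda>(i, j, c). i + j) ms)" using that by force
      then show ?thesis by (rule member_le_sum_list) simp
    qed
    have "ev ms (u * s) (u * t) x = (\<Sum>d\<le>?n. ?hom ms d s t x * u ^ d)" for u s t x
    proof -
      have "(\<Sum>d\<le>?n. ?hom ms d s t x * u ^ d) =
          (\<Sum>d\<le>?n. \<Sum>m\<leftarrow>ms. (case m of (i, j, c) \<Rightarrow> if i + j = d then c x * (u * s) ^ i * (u * t) ^ j else 0))"
        unfolding hom sum_list_mult_const[symmetric]
        by (intro sum.cong refl arg_cong[where f = sum_list] map_cong)
          (auto split: prod.splits simp: power_mult_distrib power_add)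
      also have "\<dots> = (\<Sum>m\<leftarrow>ms. \<Sum>d\<le>?n. (case m of (i, j, c) \<Rightarrow> if i + j = d then c x * (u * s) ^ i * (u * t) ^ j else 0))"
        by (rule sum_list_sum_swap[symmetric])
      also have "\<dots> = ev ms (u * s) (u * t) x"
        unfolding ev_def
      proof (intro arg_cong[where f = sum_list] map_cong refl)
        fix m assume m: "m \<in> set ms"
        obtain i j c where ijc: "m = (i, j, c)" by (cases m) auto
        then show "(\<Sum>d\<le>?n. (case m of (i, j, c) \<Rightarrow> if i + j = d then c x * (u * s) ^ i * (u * t) ^ j else 0)) =
            (case m of (i, j, c) \<Rightarrow> c x * (u * s) ^ i * (u * t) ^ j)"
          using ijc deg[of i j c] m by simp
      qed
      finally show ?thesis by simp
    qed
    moreover have "?hom ms d s t x = 0" if "?n < d" for d s t x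
    proof -
      have "(\<Sum>(i, j, c)\<leftarrow>ms. if i + j = d then c x * s ^ i * t ^ j else 0) = (\<Sum>m\<leftarrow>ms. 0)"
        using deg that by (intro arg_cong[where f = sum_list] map_cong refl) fastforce
      then show ?thesis unfolding hom by simp
    qed
    ultimately show ?thesis by blast
  qed
  have vanish: "(\<forall>h\<in>H. h s t x = 0) \<longleftrightarrow> (\<forall>(d, c)\<in>?H. (\<Sum>i\<le>d. c i x * s ^ i * t ^ (d - i)) = 0)" for s t x
  proof
    assume z: "\<forall>h\<in>H. h s t x = 0"
    have "?hom (M h) d s t x = 0" if h: "h \<in> H" for h d
    proof -
      obtain n where n: "\<And>u s t x. ev (M h) (u * s) (u * t) x = (\<Sum>d\<le>n. ?hom (M h) d s t x * u ^ d)"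
        and n0: "\<And>d s t x. n < d \<Longrightarrow> ?hom (M h) d s t x = 0"
        using ev[of "M h"] by blast
      let ?p = "\<Sum>d\<le>n. monom (?hom (M h) d s t x) d"
      have "poly ?p u = 0" if "u \<noteq> 0" for u
      proof -
        have "ev (M h) (u * s) (u * t) x = 0" using conic[OF that z] h M(2)[OF h] by metis
        then show ?thesis using n[of u s t x] by (simp add: poly_sum poly_monom)
      qed
      then have "- {0} \<subseteq> {u. poly ?p u = 0}" by auto
      moreover have "infinite (- {0 :: complex})" by (simp add: infinite_UNIV_char_0)
      ultimately have "infinite {u. poly ?p u = 0}" by (rule infinite_super)
      then have p0: "?p = 0" by (rule contrapos_np) (rule poly_roots_finite)
      show ?thesis
      proof (cases "d \<le> n")
        case True
        then have "coeff ?p d = ?hom (M h) d s t x" by (simp add: coeff_sum)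
        then show ?thesis using p0 by simp
      next
        case False
        then show ?thesis using n0 by simp
      qed
    qed
    then show "\<forall>(d, c)\<in>?H. (\<Sum>i\<le>d. c i x * s ^ i * t ^ (d - i)) = 0" by blast
  next
    assume z: "\<forall>(d, c)\<in>?H. (\<Sum>i\<le>d. c i x * s ^ i * t ^ (d - i)) = 0"
    show "\<forall>h\<in>H. h s t x = 0"
    proof
      fix h assume h: "h \<in> H"
      obtain n where n: "\<And>u s t x. ev (M h) (u * s) (u * t) x = (\<Sum>d\<le>n. ?hom (M h) d s t x * u ^ d)"
        using ev[of "M h"] by blast
      have "?hom (M h) d s t x = 0" for d using z h by blast
      then have "ev (M h) (1 * s) (1 * t) x = 0" unfolding n by simp
      then show "h s t x = 0" using M(2)[OF h] by simp
    qed
  qed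
  have "polynomial_fun I (co (M h) d i)" if "h \<in> H" for h d i
  proof -
    have "polynomial_fun I (co ms d i)" if "\<forall>(i, j, c)\<in>set ms. polynomial_fun I c" for ms
      using that
    proof (induction ms)
      case Nil
      then show ?case by (simp add: co_def[abs_def] polynomial_fun.const)
    next
      case (Cons a ms)
      obtain i' j c where a: "a = (i', j, c)" by (cases a) auto
      have "polynomial_fun I (\<lambda>x. if i' = i \<and> i' + j = d then c x else 0)"
        using Cons.prems a
        by (cases "i' = i \<and> i' + j = d") (simp_all only: if_True if_False polynomial_fun.const, simp)
      from polynomial_fun.add[OF this, of "co ms d i"] Cons show ?case
        by (simp add: a co_def[abs_def])
    qed
    then show ?thesis using M(1)[OF that] by blast
  qed
  then have "poly_closed I {x. \<exists>s t. (s, t) \<noteq> (0, 0) \<and>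
      (\<forall>(d, c)\<in>?H. (\<Sum>i\<le>d. c i x * s ^ i * t ^ (d - i)) = 0)}"
    by (intro binary_elimination) auto
  then show ?thesis by (simp only: vanish)
qed

section \<open>Matrices acting on a space stable under upper triangular ones\<close>

type_synonym coords = "bool \<times> nat \<times> nat \<Rightarrow> complex"

definition act :: "nat \<Rightarrow> (nat \<Rightarrow> nat \<Rightarrow> complex) \<Rightarrow> coords \<Rightarrow> coords" where
  "act n M x = (\<lambda>(b, j, j'). if j < n \<and> j' < n
     then bil {..<n} (\<lambda>i i'. x (b, i, i')) (\<lambda>i. M i j) (\<lambda>i. M i j') else 0)"

definition mmul :: "nat \<Rightarrow> (nat \<Rightarrow> nat \<Rightarrow> complex) \<Rightarrow> (nat \<Rightarrow> nat \<Rightarrow> complex) \<Rightarrow> nat \<Rightarrow> nat \<Rightarrow> complex" where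
  "mmul n M N i k = (\<Sum>j<n. M i j * N j k)"

lemma act_cong:
  assumes "\<And>i j. i < n \<Longrightarrow> j < n \<Longrightarrow> M i j = M' i j"
    "\<And>b i j. i < n \<Longrightarrow> j < n \<Longrightarrow> x (b, i, j) = x' (b, i, j)"
  shows "act n M x = act n M' x'"
  using assms by (auto simp: act_def fun_eq_iff intro!: bil_cong)

text \<open>Congruence is a right action: of a product, the left factor acts first.\<close>

lemma act_mmul: "act n (mmul n M N) x = act n N (act n M x)"
proof
  fix k :: "bool \<times> nat \<times> nat"
  obtain b j j' where k: "k = (b, j, j')" by (cases k) auto
  have "bil {..<n} (\<lambda>i i'. act n M x (b, i, i')) (\<lambda>i. N i j) (\<lambda>i. N i j') =
      bil {..<n} (\<lambda>i i'. x (b, i, i')) (lin_map {..<n} {..<n} M (\<lambda>i. N i j)) (lin_map {..<n} {..<n} M (\<lambda>i. N i j'))"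
    by (rule bil_lin_map) (auto simp: act_def)
  also have "\<dots> = bil {..<n} (\<lambda>i i'. x (b, i, i')) (\<lambda>i. mmul n M N i j) (\<lambda>i. mmul n M N i j')"
    by (rule bil_cong) (simp add: lin_map_def mmul_def)
  finally show "act n (mmul n M N) x k = act n N (act n M x) k"
    unfolding k by (simp add: act_def)
qed

definition upper :: "nat \<Rightarrow> (nat \<Rightarrow> nat \<Rightarrow> complex) \<Rightarrow> bool" where
  "upper n u \<longleftrightarrow> (\<forall>i j. j < i \<and> i < n \<longrightarrow> u i j = 0)"

definition upper_stable :: "nat \<Rightarrow> coords set \<Rightarrow> bool" where
  "upper_stable n S \<longleftrightarrow> (\<forall>x\<in>S. \<forall>u. upper n u \<longrightarrow> act n u x \<in> S)"

text \<open>The identity matrix with the block of columns \<open>(s, t)\<close> and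
  \<open>(p, q)\<close> put in at \<open>k\<close> and \<open>k + 1\<close>.\<close>

definition elem2 :: "nat \<Rightarrow> complex \<Rightarrow> complex \<Rightarrow> complex \<Rightarrow> complex \<Rightarrow> nat \<Rightarrow> nat \<Rightarrow> complex" where
  "elem2 k s t p q i j = (if j = k then (if i = k then s else if i = Suc k then t else 0)
     else if j = Suc k then (if i = k then p else if i = Suc k then q else 0)
     else (if i = j then 1 else 0))"

lemma mmul_elem2_right:
  assumes "Suc k < n" "j < n"
  shows "mmul n M (elem2 k s t p q) i j = (if j = k then M i k * s + M i (Suc k) * t
    else if j = Suc k then M i k * p + M i (Suc k) * q else M i j)"
proof -
  have "mmul n M (elem2 k s t p q) i j =
      (\<Sum>l<n. (if l = k then M i k * elem2 k s t p q k j else 0)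
        + (if l = Suc k then M i (Suc k) * elem2 k s t p q (Suc k) j else 0)
        + (if l = j then (if j = k \<or> j = Suc k then 0 else M i j) else 0))"
    unfolding mmul_def by (intro sum.cong refl) (auto simp: elem2_def)
  also have "\<dots> = M i k * elem2 k s t p q k j + M i (Suc k) * elem2 k s t p q (Suc k) j
      + (if j = k \<or> j = Suc k then 0 else M i j)"
    using assms by (simp add: sum.distrib)
  finally show ?thesis by (auto simp: elem2_def)
qed

lemma mmul_elem2_left:
  assumes "Suc k < n" "i < n"
  shows "mmul n (elem2 k s t p q) M i j = (if i = k then s * M k j + p * M (Suc k) j
    else if i = Suc k then t * M k j + q * M (Suc k) j else M i j)"
proof -
  have "mmul n (elem2 k s t p q) M i j =
      (\<Sum>l<n. (if l = k then elem2 k s t p q i k * M k j else 0)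
        + (if l = Suc k then elem2 k s t p q i (Suc k) * M (Suc k) j else 0)
        + (if l = i then (if i = k \<or> i = Suc k then 0 else M i j) else 0))"
    unfolding mmul_def by (intro sum.cong refl) (auto simp: elem2_def)
  also have "\<dots> = elem2 k s t p q i k * M k j + elem2 k s t p q i (Suc k) * M (Suc k) j
      + (if i = k \<or> i = Suc k then 0 else M i j)"
    using assms by (simp add: sum.distrib)
  finally show ?thesis by (auto simp: elem2_def)
qed

lemma elem2_inverse:
  assumes "Suc k < n" "s * q - t * p = 1"
  shows "inverse_on {..<n} {..<n} (elem2 k s t p q) (elem2 k q (- t) (- p) s)"
proof -
  have "mmul n (elem2 k s t p q) (elem2 k q (- t) (- p) s) i j = (if i = j then 1 else 0)"
    "mmul n (elem2 k q (- t) (- p) s) (elem2 k s t p q) i j = (if i = j then 1 else 0)" if "i < n" "j < n" for i j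
    using assms that by (auto simp: mmul_elem2_left elem2_def algebra_simps)
  then show ?thesis by (simp add: inverse_on_def mmul_def)
qed

lemma mmul_assoc: "mmul n (mmul n A B) C i j = mmul n A (mmul n B C) i j"
proof -
  have "mmul n (mmul n A B) C i j = (\<Sum>l<n. \<Sum>m<n. A i m * B m l * C l j)"
    by (simp add: mmul_def sum_distrib_right)
  also have "\<dots> = (\<Sum>m<n. \<Sum>l<n. A i m * B m l * C l j)" by (rule sum.swap)
  finally show ?thesis by (simp add: mmul_def sum_distrib_left mult.assoc)
qed

lemma inverse_on_mmul_cancel:
  assumes "inverse_on {..<n} {..<n} A B" "i < n"
  shows "mmul n A (mmul n B C) i j = C i j"
  using inverse_onD[OF _ assms(1), of i "\<lambda>k. C k j"] assms(2) by (simp add: mmul_def)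

text \<open>The columns \<open>k\<close> and \<open>k + 1\<close> are combined by an arbitrary \<open>2 \<times> 2\<close> matrix with first column \<open>(s, t)\<close>. If
  \<open>S\<close> is stable under upper triangular matrices, only the point \<open>[s : t]\<close> of the projective line matters.\<close>

definition step :: "nat \<Rightarrow> nat \<Rightarrow> coords set \<Rightarrow> coords set" where
  "step n k S = {x. \<exists>s t. (s, t) \<noteq> (0, 0) \<and> (\<forall>p q. act n (elem2 k s t p q) x \<in> S)}"

lemma ex_unimodular:
  fixes s t :: complex
  assumes "(s, t) \<noteq> (0, 0)" obtains p q where "s * q - t * p = 1"
proof (cases "s = 0")
  case True
  then show thesis using that[of 0 "- 1 / t"] assms by simp
next
  case False
  then show thesis using that[of "1 / s" 0] by simp
qed

text \<open>For fixed \<open>p\<close> and \<open>q\<close> the conditions are polynomial in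
  \<open>s\<close>, \<open>t\<close> and the coordinates. They define a cone because scaling
  \<open>(s, t)\<close> amounts to multiplication by a diagonal matrix, under which \<open>S\<close>
  is stable.\<close>

lemma poly_closed_step:
  assumes cl: "poly_closed (pencil_index n) S" and st: "upper_stable n S" and k: "Suc k < n"
  shows "poly_closed (pencil_index n) (step n k S)"
proof -
  obtain F where F: "\<And>f. f \<in> F \<Longrightarrow> polynomial_fun (pencil_index n) f" and S: "S = {x. \<forall>f\<in>F. f x = 0}"
    using cl unfolding poly_closed_def by auto
  let ?H = "(\<lambda>(f, p, q) s t x. f (act n (elem2 k s t p q) x)) ` (F \<times> UNIV \<times> UNIV)"
  have vanish: "(\<forall>h\<in>?H. h s t x = 0) \<longleftrightarrow> (\<forall>p q. act n (elem2 k s t p q) x \<in> S)" for s t x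
    by (auto simp: S)
  have "poly_closed (pencil_index n) {x. \<exists>s t. (s, t) \<noteq> (0, 0) \<and> (\<forall>h\<in>?H. h s t x = 0)}"
  proof (rule conic_elimination)
    fix h assume "h \<in> ?H"
    then obtain f p q where h: "h = (\<lambda>s t x. f (act n (elem2 k s t p q) x))" "f \<in> F" by auto
    have e: "bipoly (pencil_index n) (\<lambda>s t x. elem2 k s t p q i j)" for i j
      unfolding elem2_def
      by (cases "j = k"; cases "i = k"; cases "i = Suc k"; cases "j = Suc k"; cases "i = j")
        (simp_all add: bipoly_const bipoly_vars)
    have x: "bipoly (pencil_index n) (\<lambda>s t x. x (b, i, j))" if "i < n" "j < n" for b i j
      using that by (intro bipoly_polynomial polynomial_fun.coord) (simp add: pencil_index_def)
    show "bipoly (pencil_index n) h" unfolding h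
    proof (rule bipoly_compose[OF F[OF h(2)]])
      fix c assume "c \<in> pencil_index n"
      then obtain b j j' where c: "c = (b, j, j')" "j < n" "j' < n" by (auto simp: pencil_index_def)
      have "bipoly (pencil_index n) (\<lambda>s t x. \<Sum>i<n. \<Sum>i'<n. elem2 k s t p q i j * x (b, i, i') * elem2 k s t p q i' j')"
        by (intro bipoly_sum bipoly_mult e x) auto
      then show "bipoly (pencil_index n) (\<lambda>s t x. act n (elem2 k s t p q) x c)"
        using c by (simp add: act_def bil_def)
    qed
  next
    fix s t u x assume u: "u \<noteq> (0 :: complex)" and z: "\<forall>h\<in>?H. h s t x = 0"
    have "act n (elem2 k (u * s) (u * t) p q) x \<in> S" for p q
    proof -
      have "act n (elem2 k (u * s) (u * t) p q) x = act n (mmul n (elem2 k s t p q) (elem2 k u 0 0 1)) x"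
        using k by (intro act_cong refl) (auto simp: mmul_elem2_right elem2_def)
      also have "\<dots> = act n (elem2 k u 0 0 1) (act n (elem2 k s t p q) x)" by (rule act_mmul)
      also have "\<dots> \<in> S"
      proof -
        have "upper n (elem2 k u 0 0 1)" by (auto simp: upper_def elem2_def)
        moreover have "act n (elem2 k s t p q) x \<in> S" using z vanish[of s t x] by simp
        ultimately show ?thesis using st unfolding upper_stable_def by blast
      qed
      finally show ?thesis .
    qed
    then show "\<forall>h\<in>?H. h (u * s) (u * t) x = 0" unfolding vanish by simp
  qed
  then show ?thesis unfolding vanish step_def .
qed

text \<open>A point \<open>(s', t')\<close> is chosen that the diagonal block of \<open>u\<close> at
  \<open>k\<close>, \<open>k + 1\<close> maps to a multiple of \<open>(s, t)\<close>. Then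
  \<open>u\<close> times the operation for \<open>(s', t')\<close> equals the operation for
  \<open>(s, t)\<close> times an upper triangular matrix.\<close>

lemma upper_stable_step:
  assumes st: "upper_stable n S" and k: "Suc k < n"
  shows "upper_stable n (step n k S)"
  unfolding upper_stable_def
proof (intro ballI allI impI)
  fix x u assume x: "x \<in> step n k S" and u: "upper n u"
  obtain s t where s0: "(s, t) \<noteq> (0, 0)" and sx: "\<And>p q. act n (elem2 k s t p q) x \<in> S"
    using x unfolding step_def by auto
  have u0: "u i j = 0" if "j < i" "i < n" for i j using u that by (simp add: upper_def)
  define \<alpha> \<beta> \<gamma> where "\<alpha> = u k k" and "\<beta> = u k (Suc k)" and "\<gamma> = u (Suc k) (Suc k)"
  \<comment> \<open>If the block of \<open>u\<close> is singular, a vector that it annihilates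
    serves, with \<open>\<kappa> = 0\<close>.\<close>
  have "\<exists>s' t' \<kappa>. (s', t') \<noteq> (0, 0) \<and> \<alpha> * s' + \<beta> * t' = \<kappa> * s \<and> \<gamma> * t' = \<kappa> * t"
  proof (cases "\<alpha> = 0")
    case True
    then show ?thesis by (intro exI[of _ 1] exI[of _ 0] exI[of _ 0]) auto
  next
    case \<alpha>: False
    show ?thesis
    proof (cases "\<gamma> = 0")
      case True
      then show ?thesis using \<alpha> by (intro exI[of _ "- \<beta>"] exI[of _ \<alpha>] exI[of _ 0]) auto
    next
      case False
      then show ?thesis using \<alpha> s0
        by (intro exI[of _ "(s - \<beta> * t / \<gamma>) / \<alpha>"] exI[of _ "t / \<gamma>"] exI[of _ 1]) auto
    qed
  qed
  then obtain s' t' \<kappa> where s': "(s', t') \<noteq> (0, 0)" and \<kappa>: "\<alpha> * s' + \<beta> * t' = \<kappa> * s" "\<gamma> * t' = \<kappa> * t"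
    by auto
  obtain p0 q0 where pq: "s * q0 - t * p0 = 1" using ex_unimodular[OF s0] by blast
  let ?E = "elem2 k s t p0 q0" and ?Ei = "elem2 k q0 (- t) (- p0) s"
  have "act n (elem2 k s' t' p q) (act n u x) \<in> S" for p q
  proof -
    let ?v = "mmul n u (elem2 k s' t' p q)"
    let ?u = "mmul n ?Ei ?v"
    have "act n (elem2 k s' t' p q) (act n u x) = act n ?v x" by (simp add: act_mmul)
    also have "\<dots> = act n (mmul n ?E ?u) x"
      by (rule act_cong) (simp_all add: inverse_on_mmul_cancel[OF elem2_inverse[OF k pq]])
    also have "\<dots> = act n ?u (act n ?E x)" by (rule act_mmul)
    also have "\<dots> \<in> S"
    proof -
      have "?u i j = 0" if ij: "j < i" "i < n" for i j
      proof -
        \<comment> \<open>The entry at \<open>(k + 1, k)\<close>, the only one below the diagonal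
          that does not vanish by its position alone.\<close>
        have "- t * (u k k * s' + u k (Suc k) * t') + s * (u (Suc k) (Suc k) * t') = 0"
          using \<kappa> unfolding \<alpha>_def \<beta>_def \<gamma>_def by (simp add: algebra_simps)
        then show ?thesis
          using ij k u0[of j i] u0[of k i] u0[of "Suc k" i] u0[of j k] u0[of j "Suc k"] u0[of k "Suc k"]
          by (auto simp: mmul_elem2_left mmul_elem2_right less_Suc_eq)
      qed
      then have "upper n ?u" by (simp add: upper_def)
      then show ?thesis using st sx unfolding upper_stable_def by blast
    qed
    finally show ?thesis .
  qed
  then show "act n u x \<in> step n k S" using s' unfolding step_def by auto
qed

text \<open>The required point is the first column \<open>(q, - t)\<close> of the inverse: it is
  mapped to \<open>(1, 0)\<close>, so the product is upper triangular for every choice of the second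
  column.\<close>

lemma act_elem2_step:
  assumes st: "upper_stable n S" and k: "Suc k < n" and x: "x \<in> S" and d: "s * q - t * p = 1"
  shows "act n (elem2 k s t p q) x \<in> step n k S"
proof -
  have "act n (elem2 k q (- t) p' q') (act n (elem2 k s t p q) x) \<in> S" for p' q'
  proof -
    let ?u = "mmul n (elem2 k s t p q) (elem2 k q (- t) p' q')"
    have "upper n ?u"
      unfolding upper_def
    proof (intro allI impI)
      fix i j assume "j < i \<and> i < n"
      then show "?u i j = 0" using k d by (auto simp: mmul_elem2_right elem2_def algebra_simps)
    qed
    then have "act n ?u x \<in> S" using st x unfolding upper_stable_def by blast
    then show ?thesis by (simp add: act_mmul)
  qed
  moreover have "(q, - t) \<noteq> (0, 0)" using d by auto
  ultimately show ?thesis unfolding step_def by blast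
qed

text \<open>The adjacent columns that are combined in turn to make a matrix upper triangular, working upwards
  from the last row and in each row from left to right.\<close>

fun word :: "nat \<Rightarrow> nat list" where
  "word 0 = []"
| "word (Suc \<rho>) = [0..<Suc \<rho>] @ word \<rho>"

text \<open>The head of the list is the outermost step: it undoes the first of the column operations
  in \<open>act_saturation\<close>.\<close>

definition saturation :: "nat \<Rightarrow> nat list \<Rightarrow> coords set \<Rightarrow> coords set" where
  "saturation n w L = foldr (step n) w L"

lemma set_word: "k \<in> set (word \<rho>) \<Longrightarrow> Suc k \<le> \<rho>"
  by (induction \<rho>) auto

lemma saturation_props:
  assumes "poly_closed (pencil_index n) L" "upper_stable n L" "\<forall>k\<in>set w. Suc k < n"
  shows "poly_closed (pencil_index n) (saturation n w L) \<and> upper_stable n (saturation n w L)"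
  using assms(3) by (induction w) (auto simp: saturation_def assms intro: poly_closed_step upper_stable_step)

lemma upper_stable_saturation:
  assumes "upper_stable n L" "\<forall>k\<in>set w. Suc k < n"
  shows "upper_stable n (saturation n w L)"
  using assms(2) by (induction w) (auto simp: saturation_def assms intro: upper_stable_step)

text \<open>The matrix \<open>M\<close> is arbitrary, possibly singular. Column operations of
  determinant one make it upper triangular, and each of them is undone by one \<open>step\<close>.
  The rows below \<open>\<rho>\<close> have the final shape already.\<close>

lemma act_saturation:
  assumes st: "upper_stable n L" and x: "x \<in> L"
  shows "\<rho> < n \<Longrightarrow> (\<And>i j. \<rho> < i \<Longrightarrow> i < n \<Longrightarrow> j < i \<Longrightarrow> M i j = 0) \<Longrightarrow>
    act n M x \<in> saturation n (word \<rho>) L"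
proof (induction \<rho> arbitrary: M)
  case 0
  then have "upper n M" unfolding upper_def by auto
  then show ?case using st x by (auto simp: saturation_def upper_stable_def)
next
  case (Suc \<rho>)
  \<comment> \<open>In row \<open>Suc \<rho>\<close> the columns before \<open>k\<close> are cleared
    already.\<close>
  have "k \<le> Suc \<rho> \<Longrightarrow> (\<And>i j. Suc \<rho> < i \<Longrightarrow> i < n \<Longrightarrow> j < i \<Longrightarrow> M i j = 0) \<Longrightarrow>
      (\<And>j. j < k \<Longrightarrow> M (Suc \<rho>) j = 0) \<Longrightarrow> act n M x \<in> saturation n ([k..<Suc \<rho>] @ word \<rho>) L" for k M
  proof (induction "Suc \<rho> - k" arbitrary: k M)
    case 0
    then have k: "k = Suc \<rho>" by simp
    have "M i j = 0" if "\<rho> < i" "i < n" "j < i" for i j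
      using 0(3)[of i j] 0(4)[of j] that k by (cases "i = Suc \<rho>") auto
    then show ?case using Suc.IH[of M] Suc.prems(1) k by simp
  next
    case (Suc d)
    then have k: "k \<le> \<rho>" by simp
    then have kn: "Suc k < n" using \<open>Suc \<rho> < n\<close> by simp
    define a b where "a = M (Suc \<rho>) k" and "b = M (Suc \<rho>) (Suc k)"
    \<comment> \<open>The new column \<open>k\<close> is the combination of the columns
      \<open>k\<close> and \<open>k + 1\<close> whose entry in row \<open>Suc \<rho>\<close> is
      0.\<close>
    have "\<exists>s t p q. s * q - t * p = 1 \<and> a * s + b * t = 0"
    proof (cases "a = 0")
      case True
      then show ?thesis by (intro exI[of _ 1] exI[of _ 0] exI[of _ 0] exI[of _ 1]) simp
    next
      case False
      then show ?thesis by (intro exI[of _ b] exI[of _ "- a"] exI[of _ "1 / a"] exI[of _ 0]) simp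
    qed
    then obtain s t p q where d: "s * q - t * p = 1" and ab: "a * s + b * t = 0" by blast
    let ?M = "mmul n M (elem2 k s t p q)"
    have wk: "[k..<Suc \<rho>] = k # [Suc k..<Suc \<rho>]" using k by (simp add: upt_conv_Cons)
    have "act n ?M x \<in> saturation n ([Suc k..<Suc \<rho>] @ word \<rho>) L"
    proof (rule Suc.hyps(1))
      show "d = Suc \<rho> - Suc k" using Suc.hyps(2) by simp
      show "Suc k \<le> Suc \<rho>" using k by simp
      fix i j assume "Suc \<rho> < i" "i < n" "j < i"
      then show "?M i j = 0" using Suc.prems(2)[of i] kn k by (auto simp: mmul_elem2_right)
    next
      fix j assume "j < Suc k"
      then show "?M (Suc \<rho>) j = 0"
        using Suc.prems(3)[of j] kn k ab by (auto simp: mmul_elem2_right a_def b_def)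
    qed
    moreover have "upper_stable n (saturation n ([Suc k..<Suc \<rho>] @ word \<rho>) L)"
      using \<open>Suc \<rho> < n\<close> by (intro upper_stable_saturation[OF st]) (auto dest: set_word)
    moreover have "q * s - (- t) * (- p) = 1" using d by (simp add: mult.commute)
    ultimately have "act n (elem2 k q (- t) (- p) s) (act n ?M x) \<in> step n k (saturation n ([Suc k..<Suc \<rho>] @ word \<rho>) L)"
      using kn by (intro act_elem2_step) auto
    moreover have "act n (elem2 k q (- t) (- p) s) (act n ?M x) = act n M x"
    proof -
      have "mmul n ?M (elem2 k q (- t) (- p) s) i j = M i j" if "i < n" "j < n" for i j
      proof -
        have "mmul n ?M (elem2 k q (- t) (- p) s) i j = mmul n M (mmul n (elem2 k s t p q) (elem2 k q (- t) (- p) s)) i j"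
          by (rule mmul_assoc)
        also have "\<dots> = (\<Sum>l<n. M i l * (if l = j then 1 else 0))"
          unfolding mmul_def[of n M] using elem2_inverse[OF kn d] that
          by (intro sum.cong) (auto simp: inverse_on_def mmul_def)
        also have "\<dots> = M i j" using that by (intro sum_delta_mult) auto
        finally show ?thesis .
      qed
      then show ?thesis unfolding act_mmul[symmetric] by (intro act_cong) auto
    qed
    ultimately have "act n M x \<in> step n k (saturation n ([Suc k..<Suc \<rho>] @ word \<rho>) L)" by simp
    then show ?case unfolding wk by (simp only: saturation_def append_Cons foldr.simps comp_apply)
  qed
  from this[of 0 M] Suc.prems(2) show ?case by simp
qed

text \<open>Each point \<open>(s, t)\<close> is completed to a block of determinant one, so an
  element of the saturation is carried into \<open>L\<close> by an invertible matrix. This is the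
  converse of \<open>act_saturation\<close>.\<close>

lemma saturation_obtain:
  assumes "\<forall>k\<in>set w. Suc k < n" "y \<in> saturation n w L" "\<And>x x'. x \<in> L \<Longrightarrow> (\<And>b i j. i < n \<Longrightarrow> j < n \<Longrightarrow> x (b, i, j) = x' (b, i, j)) \<Longrightarrow> x' \<in> L"
  shows "\<exists>M V. inverse_on {..<n} {..<n} M V \<and> act n M y \<in> L"
  using assms(1,2)
proof (induction w arbitrary: y)
  case Nil
  have "act n (\<lambda>i j. if i = j then 1 else 0) y (b, i, j) = y (b, i, j)" if "i < n" "j < n" for b i j
    using bil_unit[of "{..<n}" i j "\<lambda>i j. y (b, i, j)"] that by (simp add: act_def)
  then have "act n (\<lambda>i j. if i = j then 1 else 0) y \<in> L"
    using assms(3)[of y] Nil by (auto simp: saturation_def)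
  then show ?case using inverse_on_id[of "{..<n}"] by blast
next
  case (Cons k w)
  have "y \<in> step n k (saturation n w L)" using Cons.prems(2) by (simp add: saturation_def)
  then obtain s t where s: "(s, t) \<noteq> (0, 0)" and y: "\<And>p q. act n (elem2 k s t p q) y \<in> saturation n w L"
    unfolding step_def by auto
  obtain p q where pq: "s * q - t * p = 1" using ex_unimodular[OF s] by blast
  obtain M V where M: "inverse_on {..<n} {..<n} M V" "act n M (act n (elem2 k s t p q) y) \<in> L"
    using Cons.IH[OF _ y[of p q]] Cons.prems(1) by auto
  have "inverse_on {..<n} {..<n} (mmul n (elem2 k s t p q) M) (\<lambda>k' i. \<Sum>j<n. V k' j * elem2 k q (- t) (- p) s j i)"
    using inverse_on_trans[OF _ _ _ elem2_inverse[OF _ pq] M(1)] Cons.prems(1)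
    by (simp add: mmul_def[abs_def])
  moreover have "act n (mmul n (elem2 k s t p q) M) y \<in> L" using M(2) by (simp add: act_mmul)
  ultimately show ?case by blast
qed

section \<open>The orbit of the forms with a block of zeros\<close>

definition flag_forms :: "nat \<Rightarrow> nat \<Rightarrow> nat \<Rightarrow> coords set" where
  "flag_forms n p q = {x. \<forall>b. \<forall>i<n. \<forall>j<n. x (b, i, j) = x (b, j, i) \<and> (i < p \<and> j < q \<longrightarrow> x (b, i, j) = 0)}"

lemma polynomial_fun_diff:
  assumes "polynomial_fun I f" "polynomial_fun I g"
  shows "polynomial_fun I (\<lambda>x. f x - g x)"
  using polynomial_fun.add[OF assms(1) polynomial_fun.mult[OF polynomial_fun.const[of I "- 1"] assms(2)]]
  by simp

lemma poly_closed_flag_forms: "poly_closed (pencil_index n) (flag_forms n p q)"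
  unfolding poly_closed_def
proof (intro exI conjI)
  let ?F = "(\<lambda>(b, i, j) x. x (b, i, j) - x (b, j, i)) ` (UNIV \<times> {..<n} \<times> {..<n}) \<union>
    (\<lambda>(b, i, j) x. x (b, i, j)) ` (UNIV \<times> {..<min n p} \<times> {..<min n q})"
  show "\<forall>f\<in>?F. polynomial_fun (pencil_index n) f"
    by (auto simp: pencil_index_def intro!: polynomial_fun_diff polynomial_fun.coord)
  show "flag_forms n p q = {x. \<forall>f\<in>?F. f x = 0}"
    unfolding flag_forms_def by (auto simp: ball_Un)
qed

text \<open>For upper triangular \<open>u\<close> the new entry at \<open>(j, j')\<close> involves
  only old entries at \<open>(i, i')\<close> with \<open>i \<le> j\<close> and
  \<open>i' \<le> j'\<close>, so a block of zeros in the corner persists.\<close>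

lemma upper_stable_flag_forms: "upper_stable n (flag_forms n p q)"
  unfolding upper_stable_def
proof (intro ballI allI impI)
  fix x u assume x: "x \<in> flag_forms n p q" and u: "upper n u"
  have sym: "x (b, i, j) = x (b, j, i)" if "i < n" "j < n" for b i j
    using x that unfolding flag_forms_def by blast
  have zero: "x (b, i, j) = 0" if "i < n" "j < n" "i < p" "j < q" for b i j
    using x that unfolding flag_forms_def by blast
  have "act n u x (b, j, j') = act n u x (b, j', j)" if "j < n" "j' < n" for b j j'
  proof -
    have "act n u x (b, j, j') = (\<Sum>i<n. \<Sum>i'<n. u i j * x (b, i, i') * u i' j')"
      using that by (simp add: act_def bil_def)
    also have "\<dots> = (\<Sum>i'<n. \<Sum>i<n. u i j * x (b, i, i') * u i' j')" by (rule sum.swap)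
    also have "\<dots> = (\<Sum>i'<n. \<Sum>i<n. u i' j' * x (b, i', i) * u i j)"
      using sym by (intro sum.cong refl) (simp add: mult_ac)
    finally show ?thesis using that by (simp add: act_def bil_def)
  qed
  moreover have "act n u x (b, j, j') = 0" if "j < n" "j' < n" "j < p" "j' < q" for b j j'
  proof -
    have "u i j * x (b, i, i') * u i' j' = 0" if "i < n" "i' < n" for i i'
    proof (cases "i \<le> j \<and> i' \<le> j'")
      case True
      then have "x (b, i, i') = 0" using that \<open>j < p\<close> \<open>j' < q\<close> by (intro zero) auto
      then show ?thesis by simp
    next
      case False
      then have "u i j = 0 \<or> u i' j' = 0" using u that by (auto simp: upper_def)
      then show ?thesis by auto
    qed
    then have "(\<Sum>i<n. \<Sum>i'<n. u i j * x (b, i, i') * u i' j') = 0" by (intro sum.neutral ballI) simp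
    then show ?thesis using that by (simp add: act_def bil_def)
  qed
  ultimately show "act n u x \<in> flag_forms n p q" by (simp add: flag_forms_def)
qed

definition flag_orbit :: "nat \<Rightarrow> nat \<Rightarrow> nat \<Rightarrow> coords set" where
  "flag_orbit n p q = saturation n (word (n - 1)) (flag_forms n p q)"

lemma flag_orbit_closed: "0 < n \<Longrightarrow> poly_closed (pencil_index n) (flag_orbit n p q)"
proof -
  assume "0 < n"
  then have "\<forall>k\<in>set (word (n - 1)). Suc k < n" using set_word[of _ "n - 1"] by fastforce
  from saturation_props[OF poly_closed_flag_forms upper_stable_flag_forms this]
  show ?thesis unfolding flag_orbit_def by (rule conjunct1)
qed

lemma act_flag_orbit: "0 < n \<Longrightarrow> x \<in> flag_forms n p q \<Longrightarrow> act n M x \<in> flag_orbit n p q"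
  unfolding flag_orbit_def by (rule act_saturation[OF upper_stable_flag_forms]) auto

lemma flag_orbit_obtain:
  assumes "0 < n" "y \<in> flag_orbit n p q"
  obtains M V where "inverse_on {..<n} {..<n} M V" "act n M y \<in> flag_forms n p q"
proof -
  have "\<forall>k\<in>set (word (n - 1)). Suc k < n" using set_word[of _ "n - 1"] assms(1) by fastforce
  moreover have "x' \<in> flag_forms n p q"
    if "x \<in> flag_forms n p q" "\<And>b i j. i < n \<Longrightarrow> j < n \<Longrightarrow> x (b, i, j) = x' (b, i, j)" for x x'
    using that by (simp add: flag_forms_def)
  ultimately show thesis
    using saturation_obtain[of "word (n - 1)" n y "flag_forms n p q"] assms(2) that
    unfolding flag_orbit_def by blast
qed

lemma polynomial_fun_cong: "polynomial_fun I f \<Longrightarrow> (\<And>i. i \<in> I \<Longrightarrow> x i = y i) \<Longrightarrow> f x = f y"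
  by (induction rule: polynomial_fun.induct) auto

lemma polynomial_fun_line:
  assumes "polynomial_fun I f" "\<And>i. i \<in> I \<Longrightarrow> \<exists>P. \<forall>\<tau>. y \<tau> i = poly P \<tau>"
  shows "\<exists>P. \<forall>\<tau>. f (y \<tau>) = poly P \<tau>"
  using assms(1)
proof induction
  case (const c)
  show ?case by (rule exI[of _ "[:c:]"]) simp
next
  case (coord i)
  then show ?case using assms(2) by simp
next
  case (add p q)
  then obtain P Q where "\<forall>\<tau>. p (y \<tau>) = poly P \<tau>" "\<forall>\<tau>. q (y \<tau>) = poly Q \<tau>" by blast
  then show ?case by (intro exI[of _ "P + Q"]) simp
next
  case (mult p q)
  then obtain P Q where "\<forall>\<tau>. p (y \<tau>) = poly P \<tau>" "\<forall>\<tau>. q (y \<tau>) = poly Q \<tau>" by blast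
  then show ?case by (intro exI[of _ "P * Q"]) simp
qed

lemma flag_orbit_act_obtain:
  assumes n: "0 < n" and y: "y \<in> flag_orbit n p q"
  obtains M x where "x \<in> flag_forms n p q" "\<And>b i j. i < n \<Longrightarrow> j < n \<Longrightarrow> y (b, i, j) = act n M x (b, i, j)"
proof -
  obtain M V where M: "inverse_on {..<n} {..<n} M V" "act n M y \<in> flag_forms n p q"
    using flag_orbit_obtain[OF n y] by blast
  have "y (b, i, j) = act n V (act n M y) (b, i, j)" if "i < n" "j < n" for b i j
  proof -
    have "act n V (act n M y) = act n (\<lambda>i j. if i = j then 1 else 0) y"
      unfolding act_mmul[symmetric] using M(1)
      by (intro act_cong) (auto simp: inverse_on_def mmul_def)
    moreover have "act n (\<lambda>i j. if i = j then 1 else 0) y (b, i, j) = y (b, i, j)"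
      using bil_unit[of "{..<n}" i j "\<lambda>i j. y (b, i, j)"] that by (simp add: act_def)
    ultimately show ?thesis by simp
  qed
  then show thesis using that[OF M(2)] by blast
qed

text \<open>The forms and the matrices of the two points are joined by straight lines; intermediate
  matrices may be singular, which \<open>act_flag_orbit\<close> allows. Along the resulting curve
  \<open>f\<close> and \<open>g\<close> are polynomials in one variable with product 0, so one of
  them is 0.\<close>

lemma flag_orbit_irreducible:
  assumes n: "0 < n" and f: "polynomial_fun (pencil_index n) f" and g: "polynomial_fun (pencil_index n) g"
    and z: "\<And>x. x \<in> flag_orbit n p q \<Longrightarrow> f x * g x = 0"
    and y: "y1 \<in> flag_orbit n p q" "f y1 \<noteq> 0" "y2 \<in> flag_orbit n p q"
  shows "g y2 = 0"
proof -
  obtain M1 x1 where 1: "x1 \<in> flag_forms n p q" "\<And>b i j. i < n \<Longrightarrow> j < n \<Longrightarrow> y1 (b, i, j) = act n M1 x1 (b, i, j)"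
    by (rule flag_orbit_act_obtain[OF n y(1)]) (rule that; assumption)
  obtain M2 x2 where 2: "x2 \<in> flag_forms n p q" "\<And>b i j. i < n \<Longrightarrow> j < n \<Longrightarrow> y2 (b, i, j) = act n M2 x2 (b, i, j)"
    by (rule flag_orbit_act_obtain[OF n y(3)]) (rule that; assumption)
  define X where "X \<tau> = (\<lambda>k. x1 k + \<tau> * (x2 k - x1 k))" for \<tau>
  define M where "M \<tau> = (\<lambda>i j. M1 i j + \<tau> * (M2 i j - M1 i j))" for \<tau>
  define Y where "Y \<tau> = act n (M \<tau>) (X \<tau>)" for \<tau>
  have "X \<tau> \<in> flag_forms n p q" for \<tau>
    using 1(1) 2(1) by (auto simp: flag_forms_def X_def)
  then have Y: "Y \<tau> \<in> flag_orbit n p q" for \<tau> unfolding Y_def by (intro act_flag_orbit n)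
  have line: "\<exists>P. \<forall>\<tau>. Y \<tau> k = poly P \<tau>" if k: "k \<in> pencil_index n" for k
  proof -
    obtain b j j' where k': "k = (b, j, j')" "j < n" "j' < n" using k by (auto simp: pencil_index_def)
    let ?m = "\<lambda>i j. [:M1 i j, M2 i j - M1 i j:]"
    let ?P = "\<Sum>i<n. \<Sum>i'<n. ?m i j * [:x1 (b, i, i'), x2 (b, i, i') - x1 (b, i, i'):] * ?m i' j'"
    have "Y \<tau> k = poly ?P \<tau>" for \<tau>
      using k' by (simp add: Y_def act_def bil_def M_def X_def poly_sum)
        (intro sum.cong refl, simp add: algebra_simps)
    then show ?thesis by (intro exI allI)
  qed
  obtain P where P: "\<And>\<tau>. f (Y \<tau>) = poly P \<tau>" using polynomial_fun_line[where y = Y, OF f line] by blast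
  obtain Q where Q: "\<And>\<tau>. g (Y \<tau>) = poly Q \<tau>" using polynomial_fun_line[where y = Y, OF g line] by blast
  have "f y1 = f (Y 0)"
    by (rule polynomial_fun_cong[OF f]) (auto simp: pencil_index_def Y_def M_def X_def 1(2))
  then have P0: "P \<noteq> 0" using P[of 0] y(2) by auto
  have "poly (P * Q) \<tau> = poly 0 \<tau>" for \<tau> using z[OF Y[of \<tau>]] P Q by simp
  then have "P * Q = 0" using poly_eq_poly_eq_iff by blast
  then have "Q = 0" using P0 by simp
  moreover have "g y2 = g (Y 1)"
    by (rule polynomial_fun_cong[OF g]) (auto simp: pencil_index_def Y_def M_def X_def 2(2))
  ultimately show ?thesis using Q[of 1] by simp
qed

section \<open>Pencils vanishing on a flag\<close>

definition form :: "pencil \<Rightarrow> bool \<Rightarrow> nat \<Rightarrow> nat \<Rightarrow> complex" where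
  "form P b i j = (if b then fst P else snd P) $$ (i, j)"

lemma pencil_coords_form: "i < n \<Longrightarrow> j < n \<Longrightarrow> pencil_coords n P (b, i, j) = form P b i j"
  by (simp add: pencil_coords_def form_def pencil_index_def)

lemma congruence_entry:
  assumes "W \<in> carrier_mat n n" "A \<in> carrier_mat n n" "j < n" "j' < n"
  shows "(transpose_mat W * A * W) $$ (j, j') =
    bil {..<n} (\<lambda>i i'. A $$ (i, i')) (\<lambda>i. W $$ (i, j)) (\<lambda>i. W $$ (i, j'))"
proof -
  have "transpose_mat W * A * W = transpose_mat W * (A * W)"
    using assms by (intro assoc_mult_mat[of _ n n _ n _ n]) auto
  also have "\<dots> $$ (j, j') = (\<Sum>i<n. W $$ (i, j) * (\<Sum>i'<n. A $$ (i, i') * W $$ (i', j')))"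
    using assms by (auto simp: scalar_prod_def atLeast0LessThan intro!: sum.cong)
  finally show ?thesis unfolding bil_def by (simp add: sum_distrib_left mult.assoc)
qed

lemma invertible_mat_inverse_on:
  assumes "W \<in> carrier_mat n n"
  shows "invertible_mat W \<longleftrightarrow> (\<exists>V. inverse_on {..<n} {..<n} (\<lambda>i j. W $$ (i, j)) V)"
proof
  assume "invertible_mat W"
  then obtain V where V: "W * V = 1\<^sub>m n" "V * W = 1\<^sub>m (dim_row V)"
    using assms unfolding invertible_mat_def inverts_mat_def by auto
  have "dim_col (W * V) = n" "dim_col (V * W) = dim_row V" unfolding V by simp_all
  then have V': "V \<in> carrier_mat n n" using assms by auto
  then have "V * W = 1\<^sub>m n" using V by simp
  have "inverse_on {..<n} {..<n} (\<lambda>i j. W $$ (i, j)) (\<lambda>i j. V $$ (i, j))"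
    unfolding inverse_on_def
  proof (intro conjI ballI)
    fix i j assume ij: "i \<in> {..<n}" "j \<in> {..<n}"
    have "(W * V) $$ (i, j) = (\<Sum>k<n. W $$ (i, k) * V $$ (k, j))"
      "(V * W) $$ (i, j) = (\<Sum>k<n. V $$ (i, k) * W $$ (k, j))"
      using ij assms V' by (auto simp: scalar_prod_def atLeast0LessThan intro!: sum.cong)
    then show "(\<Sum>k<n. W $$ (i, k) * V $$ (k, j)) = (if i = j then 1 else 0)"
      "(\<Sum>k<n. V $$ (i, k) * W $$ (k, j)) = (if i = j then 1 else 0)"
      using ij V(1) \<open>V * W = 1\<^sub>m n\<close> by auto
  qed
  then show "\<exists>V. inverse_on {..<n} {..<n} (\<lambda>i j. W $$ (i, j)) V" by blast
next
  assume "\<exists>V. inverse_on {..<n} {..<n} (\<lambda>i j. W $$ (i, j)) V"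
  then obtain V where V: "inverse_on {..<n} {..<n} (\<lambda>i j. W $$ (i, j)) V" ..
  let ?V = "mat n n (\<lambda>(i, j). V i j)"
  have "W * ?V = 1\<^sub>m n" "?V * W = 1\<^sub>m n"
    using V assms by (auto simp: inverse_on_def scalar_prod_def atLeast0LessThan intro!: eq_matI)
  then show "invertible_mat W"
    using assms unfolding invertible_mat_def inverts_mat_def square_mat.simps
    by (intro conjI exI[of _ ?V]) auto
qed

lemma congruence_orbit_iff:
  assumes P: "P \<in> pencils n" and Q: "Q \<in> pencils n"
  shows "P \<in> congruence_orbit Q \<longleftrightarrow> form_congruent {..<n} (form Q) {..<n} (form P)"
proof -
  obtain A B where PAB: "P = (A, B)" "A \<in> carrier_mat n n" "B \<in> carrier_mat n n"
    using P by (auto simp: pencils_def)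
  obtain A' B' where QAB: "Q = (A', B')" "A' \<in> carrier_mat n n" "B' \<in> carrier_mat n n"
    using Q by (auto simp: pencils_def)
  show ?thesis
  proof
    assume "P \<in> congruence_orbit Q"
    then obtain W where W0: "P = (transpose_mat W * fst Q * W, transpose_mat W * snd Q * W)"
      "W \<in> carrier_mat (dim_row (fst Q)) (dim_row (fst Q))" "invertible_mat W"
      unfolding congruence_orbit_def mem_Collect_eq by (elim exE conjE) (rule that)
    have W: "W \<in> carrier_mat n n" "invertible_mat W"
      "A = transpose_mat W * A' * W" "B = transpose_mat W * B' * W"
      using W0 PAB(1) QAB by simp_all
    obtain V where V: "inverse_on {..<n} {..<n} (\<lambda>i j. W $$ (i, j)) V"
      using invertible_mat_inverse_on[OF W(1)] W(2) by auto
    have "form P b j j' = bil {..<n} (form Q b) (\<lambda>i. W $$ (i, j)) (\<lambda>i. W $$ (i, j'))" if "j < n" "j' < n" for b j j'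
      using congruence_entry[OF W(1) QAB(2) that] congruence_entry[OF W(1) QAB(3) that] W(3,4)
      by (cases b) (simp_all add: form_def[abs_def] PAB(1) QAB(1))
    then show "form_congruent {..<n} (form Q) {..<n} (form P)"
      unfolding form_congruent_def using V by (intro exI[of _ "\<lambda>i j. W $$ (i, j)"] exI[of _ V]) auto
  next
    assume "form_congruent {..<n} (form Q) {..<n} (form P)"
    then obtain W V where W: "inverse_on {..<n} {..<n} W V"
      "\<forall>b. \<forall>j\<in>{..<n}. \<forall>j'\<in>{..<n}. form P b j j' = bil {..<n} (form Q b) (\<lambda>i. W i j) (\<lambda>i. W i j')"
      unfolding form_congruent_def by (elim exE conjE) (rule that)
    let ?W = "mat n n (\<lambda>(i, j). W i j)"
    have Wc: "?W \<in> carrier_mat n n" by simp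
    have "inverse_on {..<n} {..<n} (\<lambda>i j. ?W $$ (i, j)) V"
      using W(1) by (auto simp: inverse_on_def)
    then have inv: "invertible_mat ?W" using invertible_mat_inverse_on[OF Wc] by auto
    have e: "form P b j j' = bil {..<n} (form Q b) (\<lambda>i. ?W $$ (i, j)) (\<lambda>i. ?W $$ (i, j'))" if "j < n" "j' < n" for b j j'
      using W(2) that by (auto intro!: bil_cong)
    have "A = transpose_mat ?W * A' * ?W"
    proof (rule eq_matI)
      fix i j assume "i < dim_row (transpose_mat ?W * A' * ?W)" "j < dim_col (transpose_mat ?W * A' * ?W)"
      then have ij: "i < n" "j < n" by auto
      show "A $$ (i, j) = (transpose_mat ?W * A' * ?W) $$ (i, j)"
        unfolding congruence_entry[OF Wc QAB(2) ij] using e[OF ij, of True] by (simp add: form_def[abs_def] PAB(1) QAB(1))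
    qed (use PAB in auto)
    moreover have "B = transpose_mat ?W * B' * ?W"
    proof (rule eq_matI)
      fix i j assume "i < dim_row (transpose_mat ?W * B' * ?W)" "j < dim_col (transpose_mat ?W * B' * ?W)"
      then have ij: "i < n" "j < n" by auto
      show "B $$ (i, j) = (transpose_mat ?W * B' * ?W) $$ (i, j)"
        unfolding congruence_entry[OF Wc QAB(3) ij] using e[OF ij, of False] by (simp add: form_def[abs_def] PAB(1) QAB(1))
    qed (use PAB in auto)
    moreover have "?W \<in> carrier_mat (dim_row (fst Q)) (dim_row (fst Q))" using QAB by simp
    ultimately show "P \<in> congruence_orbit Q"
      unfolding congruence_orbit_def PAB(1) using inv QAB(1) by (intro CollectI exI[of _ ?W]) auto
  qed
qed

definition flag_pencils :: "nat \<Rightarrow> nat \<Rightarrow> nat \<Rightarrow> pencil set" where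
  "flag_pencils n p q = {P \<in> symmetric_pencils n. isotropic_flag {..<n} (form P) p q}"

lemma symmetric_pencils_iff:
  "P \<in> symmetric_pencils n \<longleftrightarrow> P \<in> pencils n \<and> (\<forall>b. \<forall>i<n. \<forall>j<n. form P b i j = form P b j i)"
proof -
  obtain A B where P: "P = (A, B)" by (cases P)
  have *: "transpose_mat A = A \<longleftrightarrow> (\<forall>i<n. \<forall>j<n. A $$ (i, j) = A $$ (j, i))" if "A \<in> carrier_mat n n" for A :: "complex mat"
    using that by (auto simp: mat_eq_iff)
  show ?thesis
    unfolding P by (auto simp: symmetric_pencils_def pencils_def * form_def all_bool_eq)
qed

lemma isotropic_flag_supported:
  assumes "finite I" "JV \<subseteq> JN" "JN \<subseteq> I" "\<And>b i j. i \<in> JV \<Longrightarrow> j \<in> JN \<Longrightarrow> Q b i j = 0"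
  shows "isotropic_flag I Q (card JV) (card JN)"
  unfolding isotropic_flag_def
proof (intro exI conjI allI ballI)
  have fin: "finite JV" "finite JN" using assms by (meson finite_subset)+
  show "fv.subspace (supported JV)" "fv.subspace (supported JN)" by (rule subspace_supported)+
  show "supported JV \<subseteq> supported JN" "supported JN \<subseteq> supported I" using assms by (auto simp: supported_def)
  show "fv.dim (supported JV) = card JV" "fv.dim (supported JN) = card JN" using fin dim_supported by auto
  fix b x y assume xy: "x \<in> supported JV" "y \<in> supported JN"
  have "x i * Q b i j * y j = 0" for i j
    using assms(4)[of i j b] supportedD[OF xy(1), of i] supportedD[OF xy(2), of j] by (cases "i \<in> JV"; cases "j \<in> JN") auto
  then show "bil I (Q b) x y = 0" unfolding bil_def by (intro sum.neutral ballI)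
qed

text \<open>A change of basis moves any flag to the one spanned by the first \<open>p\<close> and
  the first \<open>q\<close> unit vectors, where the pencil has its zeros in the corner described by
  \<open>flag_forms\<close>.\<close>

lemma flag_pencils_iff:
  assumes n: "0 < n" and pq: "p \<le> q" "q \<le> n"
  shows "P \<in> flag_pencils n p q \<longleftrightarrow> P \<in> pencils n \<and> pencil_coords n P \<in> flag_orbit n p q"
proof
  assume P: "P \<in> flag_pencils n p q"
  then have Pp: "P \<in> pencils n" and sym: "\<And>b i j. i < n \<Longrightarrow> j < n \<Longrightarrow> form P b i j = form P b j i"
    and fl: "isotropic_flag {..<n} (form P) p q"
    by (auto simp: flag_pencils_def symmetric_pencils_iff)
  obtain Q where Q: "form_congruent {..<n} (form P) {..<n} Q" "\<forall>b. \<forall>i\<in>{..<p}. \<forall>j\<in>{..<q}. Q b i j = 0"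
    using isotropic_flag_basis[OF _ _ _ fl, of "{..<n}" "{..<p}" "{..<q}"] pq by auto
  have Qsym: "Q b i j = Q b j i" if "i < n" "j < n" for b i j
    by (rule form_congruent_symmetric[OF Q(1)]) (use sym that in auto)
  obtain W V where W: "\<forall>b. \<forall>j\<in>{..<n}. \<forall>j'\<in>{..<n}. form P b j j' = bil {..<n} (Q b) (\<lambda>i. W i j) (\<lambda>i. W i j')"
    using form_congruent_sym[OF _ _ Q(1)] unfolding form_congruent_def by auto
  define x :: coords where "x = (\<lambda>(b, i, j). Q b i j)"
  have "x \<in> flag_forms n p q"
    using Qsym Q(2) unfolding flag_forms_def x_def by simp
  then have "act n W x \<in> flag_orbit n p q" by (rule act_flag_orbit[OF n])
  moreover obtain F where F: "\<forall>f\<in>F. polynomial_fun (pencil_index n) f" "flag_orbit n p q = {x. \<forall>f\<in>F. f x = 0}"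
    using flag_orbit_closed[OF n, of p q] unfolding poly_closed_def by blast
  \<comment> \<open>The two points may differ outside \<open>pencil_index n\<close>, where the first
    is undefined and the second 0; polynomial functions do not see this.\<close>
  moreover have "\<forall>f\<in>F. f (pencil_coords n P) = f (act n W x)"
  proof
    fix f assume "f \<in> F"
    then have "polynomial_fun (pencil_index n) f" using F by blast
    then show "f (pencil_coords n P) = f (act n W x)"
    proof (rule polynomial_fun_cong)
      fix k assume "k \<in> pencil_index n"
      then obtain b i j where k: "k = (b, i, j)" "i < n" "j < n" by (auto simp: pencil_index_def)
      then show "pencil_coords n P k = act n W x k"
        using W by (simp add: pencil_coords_form act_def x_def)
    qed
  qed
  ultimately have "\<forall>f\<in>F. f (pencil_coords n P) = 0" using F(2) by (metis (mono_tags, lifting) mem_Collect_eq)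
  then show "P \<in> pencils n \<and> pencil_coords n P \<in> flag_orbit n p q" using Pp F(2) by simp
next
  assume P: "P \<in> pencils n \<and> pencil_coords n P \<in> flag_orbit n p q"
  obtain M V where M: "inverse_on {..<n} {..<n} M V" "act n M (pencil_coords n P) \<in> flag_forms n p q"
    using flag_orbit_obtain[OF n] P by blast
  let ?Q = "\<lambda>b i j. act n M (pencil_coords n P) (b, i, j)"
  have "\<forall>b. \<forall>j\<in>{..<n}. \<forall>j'\<in>{..<n}. ?Q b j j' = bil {..<n} (form P b) (\<lambda>i. M i j) (\<lambda>i. M i j')"
    by (auto simp: act_def pencil_coords_form intro!: bil_cong)
  then have cong: "form_congruent {..<n} (form P) {..<n} ?Q"
    unfolding form_congruent_def using M(1) by (intro exI conjI) auto
  have Q: "?Q b i j = ?Q b j i" "i < p \<Longrightarrow> j < q \<Longrightarrow> ?Q b i j = 0" if "i < n" "j < n" for b i j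
    using M(2) that unfolding flag_forms_def by blast+
  have "form P b i j = form P b j i" if "i < n" "j < n" for b i j
    by (rule form_congruent_symmetric[OF form_congruent_sym[OF _ _ cong]]) (use Q(1) that in auto)
  moreover have "isotropic_flag {..<n} ?Q p q"
    using isotropic_flag_supported[of "{..<n}" "{..<p}" "{..<q}" ?Q] pq Q(2) by auto
  then have "isotropic_flag {..<n} (form P) p q"
    by (rule isotropic_flag_congruent[OF _ _ cong, rotated 2]) auto
  ultimately show "P \<in> flag_pencils n p q" using P by (simp add: flag_pencils_def symmetric_pencils_iff)
qed

section \<open>Closed and irreducible sets of pencils\<close>

lemma closedin_pullback:
  assumes "closedin T C" "f ` A \<subseteq> topspace T"
  shows "closedin (pullback_topology A f T) {x \<in> A. f x \<in> C}"
proof -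
  have "openin (pullback_topology A f T) (f -` (topspace T - C) \<inter> A)"
    using assms(1) unfolding openin_pullback_topology closedin_def by blast
  moreover have "f -` (topspace T - C) \<inter> A = A - {x \<in> A. f x \<in> C}" using assms(2) by auto
  moreover have "topspace (pullback_topology A f T) = A"
    using assms(2) by (auto simp: topspace_pullback_topology)
  ultimately show ?thesis unfolding closedin_def by auto
qed

lemma pencil_coords_range: "pencil_coords n ` pencils n \<subseteq> pencil_index n \<rightarrow>\<^sub>E UNIV"
  using pencil_coords_bij by (simp add: bij_betw_def)

lemma closedin_pencil_zariski:
  "closedin (pencil_zariski n) C \<longleftrightarrow>
    (\<exists>F. (\<forall>f\<in>F. polynomial_fun (pencil_index n) f) \<and> C = {P \<in> pencils n. \<forall>f\<in>F. f (pencil_coords n P) = 0})"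
proof
  assume "closedin (pencil_zariski n) C"
  then have C: "C \<subseteq> pencils n" "openin (pencil_zariski n) (pencils n - C)" by (auto simp: closedin_def)
  then obtain F where F: "\<forall>f\<in>F. polynomial_fun (pencil_index n) f"
    and e: "pencils n - C = pencil_coords n -` ((pencil_index n \<rightarrow>\<^sub>E UNIV) - zero_locus (pencil_index n) F) \<inter> pencils n"
    unfolding pencil_zariski_def openin_pullback_topology openin_zariski by auto
  have "C = {P \<in> pencils n. \<forall>f\<in>F. f (pencil_coords n P) = 0}"
  proof (rule Set.set_eqI)
    fix P
    have "P \<in> pencils n - C \<longleftrightarrow> P \<in> pencils n \<and> \<not> (\<forall>f\<in>F. f (pencil_coords n P) = 0)"
      unfolding e using pencil_coords_range[of n] by (auto simp: zero_locus_def)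
    then show "P \<in> C \<longleftrightarrow> P \<in> {P \<in> pencils n. \<forall>f\<in>F. f (pencil_coords n P) = 0}" using C(1) by blast
  qed
  then show "\<exists>F. (\<forall>f\<in>F. polynomial_fun (pencil_index n) f) \<and> C = {P \<in> pencils n. \<forall>f\<in>F. f (pencil_coords n P) = 0}"
    using F by blast
next
  assume "\<exists>F. (\<forall>f\<in>F. polynomial_fun (pencil_index n) f) \<and> C = {P \<in> pencils n. \<forall>f\<in>F. f (pencil_coords n P) = 0}"
  then obtain F where F: "\<forall>f\<in>F. polynomial_fun (pencil_index n) f"
    and C: "C = {P \<in> pencils n. \<forall>f\<in>F. f (pencil_coords n P) = 0}" by auto
  have "closedin (zariski_topology (pencil_index n)) (zero_locus (pencil_index n) F)"
    unfolding closedin_zariski using F by blast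
  then have "closedin (pencil_zariski n) {P \<in> pencils n. pencil_coords n P \<in> zero_locus (pencil_index n) F}"
    unfolding pencil_zariski_def by (rule closedin_pullback) (simp add: pencil_coords_range)
  moreover have "{P \<in> pencils n. pencil_coords n P \<in> zero_locus (pencil_index n) F} = C"
    unfolding C zero_locus_def using pencil_coords_range[of n] by auto
  ultimately show "closedin (pencil_zariski n) C" by simp
qed

lemma closedin_flag_pencils:
  assumes "0 < n" "p \<le> q" "q \<le> n"
  shows "closedin (pencil_zariski n) (flag_pencils n p q)"
proof -
  obtain F where F: "\<forall>f\<in>F. polynomial_fun (pencil_index n) f" "flag_orbit n p q = {x. \<forall>f\<in>F. f x = 0}"
    using flag_orbit_closed[OF assms(1), of p q] unfolding poly_closed_def by blast
  have "flag_pencils n p q = {P \<in> pencils n. \<forall>f\<in>F. f (pencil_coords n P) = 0}"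
    using flag_pencils_iff[OF assms] F(2) by auto
  then show ?thesis unfolding closedin_pencil_zariski using F(1) by blast
qed

lemma irreducible_flag_pencils:
  assumes "0 < n" "p \<le> q" "q \<le> n"
  shows "irreducible_set_in (pencil_zariski n) (flag_pencils n p q)"
  unfolding irreducible_set_in_def
proof (intro conjI allI impI)
  have sub: "flag_pencils n p q \<subseteq> pencils n" using flag_pencils_iff[OF assms] by auto
  then show "flag_pencils n p q \<subseteq> topspace (pencil_zariski n)" by simp
  \<comment> \<open>A point of \<open>flag_orbit\<close> may fail to be extensional; its restriction
    to the index set is the coordinate vector of a pencil.\<close>
  have surj: "\<exists>P\<in>flag_pencils n p q. \<forall>k\<in>pencil_index n. pencil_coords n P k = x k" if x: "x \<in> flag_orbit n p q" for x
  proof -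
    have "restrict x (pencil_index n) \<in> pencil_index n \<rightarrow>\<^sub>E UNIV" by auto
    then have "restrict x (pencil_index n) \<in> pencil_coords n ` pencils n"
      using pencil_coords_bij[of n] by (simp add: bij_betw_def)
    then obtain P where P: "P \<in> pencils n" "pencil_coords n P = restrict x (pencil_index n)" by force
    obtain F where F: "\<forall>f\<in>F. polynomial_fun (pencil_index n) f" "flag_orbit n p q = {x. \<forall>f\<in>F. f x = 0}"
      using flag_orbit_closed[OF assms(1), of p q] unfolding poly_closed_def by blast
    have "\<forall>f\<in>F. f (pencil_coords n P) = f x"
    proof
      fix f assume "f \<in> F"
      then have "polynomial_fun (pencil_index n) f" using F(1) by blast
      then show "f (pencil_coords n P) = f x" by (rule polynomial_fun_cong) (simp add: P(2))
    qed
    moreover have "\<forall>f\<in>F. f x = 0" using x F(2) by simp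
    ultimately have "\<forall>f\<in>F. f (pencil_coords n P) = 0" by metis
    then have "P \<in> flag_pencils n p q" using flag_pencils_iff[OF assms] P(1) F(2) by simp
    moreover have "\<forall>k\<in>pencil_index n. pencil_coords n P k = x k" unfolding P(2) by simp
    ultimately show ?thesis ..
  qed
  have "(\<lambda>_. 0) \<in> flag_forms n p q" by (simp add: flag_forms_def)
  then have "act n (\<lambda>_ _. 0) (\<lambda>_. 0) \<in> flag_orbit n p q" by (rule act_flag_orbit[OF assms(1)])
  then show "flag_pencils n p q \<noteq> {}" using surj by blast
  fix C D assume CD: "closedin (pencil_zariski n) C \<and> closedin (pencil_zariski n) D \<and> flag_pencils n p q \<subseteq> C \<union> D"
  obtain F where F: "\<forall>f\<in>F. polynomial_fun (pencil_index n) f" "C = {P \<in> pencils n. \<forall>f\<in>F. f (pencil_coords n P) = 0}"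
    using CD unfolding closedin_pencil_zariski by auto
  obtain G where G: "\<forall>f\<in>G. polynomial_fun (pencil_index n) f" "D = {P \<in> pencils n. \<forall>f\<in>G. f (pencil_coords n P) = 0}"
    using CD unfolding closedin_pencil_zariski by auto
  show "flag_pencils n p q \<subseteq> C \<or> flag_pencils n p q \<subseteq> D"
  proof (rule ccontr)
    assume "\<not> (flag_pencils n p q \<subseteq> C \<or> flag_pencils n p q \<subseteq> D)"
    then obtain P1 P2 where P: "P1 \<in> flag_pencils n p q" "P1 \<notin> C" "P2 \<in> flag_pencils n p q" "P2 \<notin> D" by auto
    obtain f where f: "f \<in> F" "f (pencil_coords n P1) \<noteq> 0" using P(1,2) sub F(2) by auto
    obtain g where g: "g \<in> G" "g (pencil_coords n P2) \<noteq> 0" using P(3,4) sub G(2) by auto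
    have pf: "polynomial_fun (pencil_index n) f" "polynomial_fun (pencil_index n) g" using F(1) G(1) f g by auto
    have "g (pencil_coords n P2) = 0"
    proof (rule flag_orbit_irreducible[OF assms(1) pf])
      show "pencil_coords n P1 \<in> flag_orbit n p q" "pencil_coords n P2 \<in> flag_orbit n p q"
        using P flag_pencils_iff[OF assms] by auto
      show "f (pencil_coords n P1) \<noteq> 0" by (rule f(2))
      fix x assume "x \<in> flag_orbit n p q"
      then obtain R where R: "R \<in> flag_pencils n p q" "\<forall>k\<in>pencil_index n. pencil_coords n R k = x k"
        using surj by blast
      have "f (pencil_coords n R) = f x" "g (pencil_coords n R) = g x"
        using R(2) polynomial_fun_cong[OF pf(1), of "pencil_coords n R" x]
          polynomial_fun_cong[OF pf(2), of "pencil_coords n R" x] by auto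
      moreover have "R \<in> C \<or> R \<in> D" using R(1) CD by blast
      ultimately show "f x * g x = 0" using F(2) G(2) f(1) g(1) by auto
    qed
    then show False using g(2) by simp
  qed
qed

section \<open>Rank and isotropic flags\<close>

text \<open>Bilinear and not Hermitian, in accordance with the transpose in congruence; a subspace
  may therefore meet its orthogonal complement.\<close>

definition pair :: "'i set \<Rightarrow> ('i \<Rightarrow> complex) \<Rightarrow> ('i \<Rightarrow> complex) \<Rightarrow> complex" where
  "pair I x y = (\<Sum>i\<in>I. x i * y i)"

lemma pair_linear:
  "pair I (x + y) z = pair I x z + pair I y z" "pair I (fscale c x) z = c * pair I x z" "pair I 0 z = 0"
  "pair I z (x + y) = pair I z x + pair I z y" "pair I z (fscale c x) = c * pair I z x" "pair I z 0 = 0"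
  by (simp_all add: pair_def sum.distrib[symmetric] sum_distrib_left algebra_simps)

lemma bil_linear:
  "bil I Q (x + y) z = bil I Q x z + bil I Q y z" "bil I Q (fscale c x) z = c * bil I Q x z" "bil I Q 0 z = 0"
  "bil I Q z (x + y) = bil I Q z x + bil I Q z y" "bil I Q z (fscale c x) = c * bil I Q z x" "bil I Q z 0 = 0"
  by (simp_all add: bil_def sum.distrib[symmetric] sum_distrib_left algebra_simps)

lemma inverse_on_transpose: "inverse_on I J W V \<Longrightarrow> inverse_on J I (\<lambda>j i. W i j) (\<lambda>i j. V j i)"
  unfolding inverse_on_def by (auto simp: mult.commute[of "W _ _"])

lemma lin_map_inverse:
  assumes "finite I" "inverse_on I J W V" "x \<in> supported I"
  shows "lin_map I J W (lin_map J I V x) = x"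
proof
  fix i
  show "lin_map I J W (lin_map J I V x) i = x i"
    using inverse_onD[OF assms(1,2), of i x] supportedD[OF assms(3), of i] by (simp add: lin_map_def)
qed

lemma dim_perp:
  assumes I: "finite I" and N: "fv.subspace N" "N \<subseteq> supported I"
  shows "fv.dim {x \<in> supported I. \<forall>y\<in>N. pair I x y = 0} = card I - fv.dim N"
proof -
  have fd: "fin_dim (supported I)" by (rule fin_dim_supported[OF I order_refl])
  have fdN: "fin_dim N" by (rule fin_dim_supported[OF I N(2)])
  obtain BN where BN: "BN \<subseteq> N" "fv.independent BN" "N \<subseteq> fv.span BN" "card BN = fv.dim N"
    using fv.basis_exists by blast
  have "BN \<subseteq> supported I" using BN(1) N(2) by blast
  from fin_dim_extend_basis[OF fd this BN(2)] obtain B where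
    B: "BN \<subseteq> B" "B \<subseteq> supported I" "fv.independent B" "supported I \<subseteq> fv.span B" "finite B" "card B = card I"
    unfolding dim_supported[OF I] by blast
  have "\<exists>V. inverse_on I B (\<lambda>i b. b i) V"
  proof (rule inverse_onI[OF I B(5) B(6)[symmetric]])
    fix u assume u: "\<forall>i\<in>I. (\<Sum>b\<in>B. b i * u b) = 0"
    have z: "(\<Sum>b\<in>B. fscale (u b) b) = 0"
    proof
      fix i
      show "(\<Sum>b\<in>B. fscale (u b) b) i = 0 i"
      proof (cases "i \<in> I")
        case True then show ?thesis using u by (simp add: sum_apply mult.commute)
      next
        case False
        have "b i = 0" if "b \<in> B" for b using supportedD[OF subsetD[OF B(2) that] False] .
        then have "(\<Sum>b\<in>B. u b * b i) = 0" by (intro sum.neutral ballI) simp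
        then show ?thesis by (simp add: sum_apply)
      qed
    qed
    show "\<forall>b\<in>B. u b = 0"
      using fv.independentD[where u = u, OF B(3,5) subset_refl z] by blast
  qed
  then obtain V where V: "inverse_on I B (\<lambda>i b. b i) V" ..
  note V' = inverse_on_transpose[OF V]
  let ?\<Phi> = "lin_map B I (\<lambda>b i. b i)" and ?\<Psi> = "lin_map I B (\<lambda>i b. V b i)"
  have \<Phi>: "?\<Phi> x b = pair I x b" if "b \<in> B" for x b using that by (simp add: lin_map_def pair_def mult.commute)
  let ?N = "{x \<in> supported I. \<forall>y\<in>N. pair I x y = 0}"
  have subN: "fv.subspace ?N"
    using subspace_supported[of I] unfolding fv.subspace_def by (auto simp: pair_linear)
  have im: "?\<Phi> ` ?N = supported (B - BN)"
  proof (intro equalityI subsetI)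
    fix u assume "u \<in> ?\<Phi> ` ?N"
    then obtain x where x: "x \<in> ?N" "u = ?\<Phi> x" by (rule imageE)
    have "u b = 0" if "b \<notin> B - BN" for b
    proof (cases "b \<in> B")
      case True
      then have "b \<in> N" using that BN(1) by blast
      then show ?thesis using \<Phi>[OF True] x by simp
    next
      case False then show ?thesis using x(2) by (simp add: lin_map_def)
    qed
    then show "u \<in> supported (B - BN)" by (simp add: supported_def)
  next
    fix u assume u: "u \<in> supported (B - BN)"
    then have uB: "u \<in> supported B" by (auto simp: supported_def)
    have e: "?\<Phi> (?\<Psi> u) = u" by (rule lin_map_inverse[OF B(5) V' uB])
    have "N \<subseteq> {y. pair I (?\<Psi> u) y = 0}"
    proof (rule order_trans[OF BN(3)], rule fv.span_minimal)
      show "fv.subspace {y. pair I (?\<Psi> u) y = 0}" unfolding fv.subspace_def by (simp add: pair_linear)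
      show "BN \<subseteq> {y. pair I (?\<Psi> u) y = 0}"
      proof
        fix b assume b: "b \<in> BN"
        then have "b \<in> B" using B(1) by blast
        then have "pair I (?\<Psi> u) b = u b" using \<Phi>[of b "?\<Psi> u"] e by simp
        then show "b \<in> {y. pair I (?\<Psi> u) y = 0}" using supportedD[OF u, of b] b by simp
      qed
    qed
    then have "?\<Psi> u \<in> ?N" using lin_map_supported[of I B "\<lambda>i b. V b i" u] by auto
    then show "u \<in> ?\<Phi> ` ?N" using e by (metis (no_types, lifting) image_eqI)
  qed
  have "fv.dim (?\<Phi> ` ?N) = fv.dim ?N"
  proof (rule dim_image_inj[OF subN _ linear_lin_map])
    show "fin_dim ?N" by (rule fin_dim_supported[OF I]) auto
    fix x assume x: "x \<in> ?N" "?\<Phi> x = 0"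
    have "?\<Psi> (?\<Phi> x) = x" by (rule lin_map_inverse[OF I inverse_on_sym[OF V']]) (use x in simp)
    then show "x = 0" unfolding x(2) using fvp.linear_0[OF linear_lin_map] by metis
  qed
  then have "fv.dim ?N = card (B - BN)" unfolding im using dim_supported[of "B - BN"] B(5) by simp
  also have "\<dots> = card I - fv.dim N"
    using B BN finite_subset[OF B(1,5)] by (simp add: card_Diff_subset)
  finally show ?thesis .
qed

lemma bil_pair:
  assumes "\<And>i j. i \<in> I \<Longrightarrow> j \<in> I \<Longrightarrow> Q i j = Q j i"
  shows "bil I Q x y = pair I (lin_map I I Q x) y"
proof -
  have "bil I Q x y = (\<Sum>j\<in>I. \<Sum>i\<in>I. x i * Q i j * y j)" unfolding bil_def by (rule sum.swap)
  also have "\<dots> = (\<Sum>j\<in>I. (\<Sum>i\<in>I. Q j i * x i) * y j)"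
    using assms by (intro sum.cong refl) (simp add: sum_distrib_left sum_distrib_right mult_ac)
  finally show ?thesis by (simp add: pair_def lin_map_def)
qed

section \<open>Kernels at the values of the variable\<close>

definition pmul :: "'i set \<Rightarrow> (bool \<Rightarrow> 'i \<Rightarrow> 'i \<Rightarrow> complex) \<Rightarrow> complex \<Rightarrow> ('i \<Rightarrow> complex) \<Rightarrow> 'i \<Rightarrow> complex" where
  "pmul I Q \<zeta> = lin_map I I (\<lambda>i j. \<zeta> * Q True i j + Q False i j)"

definition pker :: "'i set \<Rightarrow> (bool \<Rightarrow> 'i \<Rightarrow> 'i \<Rightarrow> complex) \<Rightarrow> complex \<Rightarrow> ('i \<Rightarrow> complex) set" where
  "pker I Q \<zeta> = {x \<in> supported I. pmul I Q \<zeta> x = 0}"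

lemma pmul_expand: "pmul I Q \<zeta> x = fscale \<zeta> (lin_map I I (Q True) x) + lin_map I I (Q False) x"
  by (auto simp: pmul_def lin_map_def fun_eq_iff algebra_simps sum.distrib sum_distrib_left)

lemma linear_pmul: "Vector_Spaces.linear fscale fscale (pmul I Q \<zeta>)"
  unfolding pmul_def by (rule linear_lin_map)

lemma subspace_kernel:
  assumes "fv.subspace S" "Vector_Spaces.linear fscale fscale f"
  shows "fv.subspace {x \<in> S. f x = 0}"
proof -
  interpret Vector_Spaces.linear fscale fscale f by fact
  show ?thesis using assms(1) by (auto simp: fv.subspace_def add scale zero)
qed

lemma subspace_preimage:
  assumes "fv.subspace T" "Vector_Spaces.linear fscale fscale f"
  shows "fv.subspace {x. f x \<in> T}"
proof -
  interpret Vector_Spaces.linear fscale fscale f by fact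
  show ?thesis using assms(1) by (simp add: fv.subspace_def add scale zero)
qed

lemma subspace_pker: "fv.subspace (pker I Q \<zeta>)"
  unfolding pker_def by (rule subspace_kernel[OF subspace_supported linear_pmul])

lemma pair_pmul:
  assumes "\<And>b i j. i \<in> I \<Longrightarrow> j \<in> I \<Longrightarrow> Q b i j = Q b j i"
  shows "pair I (pmul I Q \<zeta> x) y = \<zeta> * bil I (Q True) x y + bil I (Q False) x y"
  unfolding pmul_expand pair_linear by (simp add: bil_pair assms)

text \<open>The map \<open>\<zeta>A + B\<close> sends \<open>V\<close> into the orthogonal
  complement of \<open>N\<close>, and rank-nullity does the rest.\<close>

lemma dim_pker_ge:
  assumes I: "finite I" and sym: "\<And>b i j. i \<in> I \<Longrightarrow> j \<in> I \<Longrightarrow> Q b i j = Q b j i"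
    and V: "fv.subspace V" "fv.subspace N" "V \<subseteq> supported I" "N \<subseteq> supported I"
    and z: "\<And>b x y. x \<in> V \<Longrightarrow> y \<in> N \<Longrightarrow> bil I (Q b) x y = 0"
  shows "fv.dim V + fv.dim N \<le> card I + fv.dim {x \<in> V. pmul I Q \<zeta> x = 0}"
proof -
  have fd: "fin_dim V" by (rule fin_dim_supported[OF I V(3)])
  let ?N = "{x \<in> supported I. \<forall>y\<in>N. pair I x y = 0}"
  have "pmul I Q \<zeta> ` V \<subseteq> ?N"
  proof
    fix w assume "w \<in> pmul I Q \<zeta> ` V"
    then obtain x where x: "x \<in> V" "w = pmul I Q \<zeta> x" by auto
    have "pair I w y = 0" if "y \<in> N" for y
      using z[OF x(1) that] unfolding x(2) by (subst pair_pmul) (auto simp: sym)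
    moreover have "w \<in> supported I" unfolding x(2) pmul_def by (rule lin_map_supported)
    ultimately show "w \<in> ?N" by simp
  qed
  moreover have "fin_dim ?N" by (rule fin_dim_supported[OF I]) auto
  ultimately have "fv.dim (pmul I Q \<zeta> ` V) \<le> fv.dim ?N" by (intro fin_dim_mono)
  also have "fv.dim ?N = card I - fv.dim N" by (rule dim_perp[OF I V(2,4)])
  finally have 1: "fv.dim (pmul I Q \<zeta> ` V) \<le> card I - fv.dim N" .
  have "fv.dim N \<le> fv.dim (supported I)"
    by (rule fin_dim_mono[OF fin_dim_supported[OF I order_refl] V(4)])
  then have 2: "fv.dim N \<le> card I" using dim_supported[OF I] by metis
  show ?thesis using rank_nullity[OF V(1) fd linear_pmul[of I Q \<zeta>]] 1 2 by linarith
qed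

text \<open>For \<open>p = n - r + a\<close> and \<open>q = n - a\<close> this is a kernel of
  dimension at least \<open>n - r\<close>, whatever \<open>a\<close> is.\<close>

lemma isotropic_flag_dim_pker:
  assumes I: "finite I" and sym: "\<And>b i j. i \<in> I \<Longrightarrow> j \<in> I \<Longrightarrow> Q b i j = Q b j i"
    and fl: "isotropic_flag I Q p q"
  shows "p + q \<le> card I + fv.dim (pker I Q \<zeta>)"
proof -
  obtain V N where V: "fv.subspace V" "fv.subspace N" "V \<subseteq> N" "N \<subseteq> supported I" "fv.dim V = p" "fv.dim N = q"
    "\<And>b x y. x \<in> V \<Longrightarrow> y \<in> N \<Longrightarrow> bil I (Q b) x y = 0"
    using fl unfolding isotropic_flag_def by blast
  have "p + q \<le> card I + fv.dim {x \<in> V. pmul I Q \<zeta> x = 0}"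
    using dim_pker_ge[OF I sym V(1,2) _ V(4,7), where \<zeta> = \<zeta>] V by auto
  moreover have "fv.dim {x \<in> V. pmul I Q \<zeta> x = 0} \<le> fv.dim (pker I Q \<zeta>)"
    using V(3,4) by (intro fin_dim_mono fin_dim_supported[OF I]) (auto simp: pker_def)
  ultimately show ?thesis by linarith
qed

lemma intermediate_subspace:
  assumes V: "fv.subspace V" and N: "fv.subspace N" "fin_dim N" and "V \<subseteq> N" "fv.dim V \<le> k" "k \<le> fv.dim N"
  obtains S where "fv.subspace S" "V \<subseteq> S" "S \<subseteq> N" "fv.dim S = k"
proof -
  obtain B where B: "B \<subseteq> V" "fv.independent B" "V \<subseteq> fv.span B" "card B = fv.dim V"
    using fv.basis_exists by blast
  have "B \<subseteq> N" using B(1) assms(4) by blast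
  from fin_dim_extend_basis[OF N(2) this B(2)] obtain C where
    C: "B \<subseteq> C" "C \<subseteq> N" "fv.independent C" "N \<subseteq> fv.span C" "finite C" "card C = fv.dim N" by blast
  have finB: "finite B" using C finite_subset by blast
  obtain D where D: "D \<subseteq> C - B" "card D = k - card B"
    using obtain_subset_with_card_n[of "k - card B" "C - B"] assms(5,6) B(4) C finB
    by (metis card_Diff_subset diff_le_mono)
  have fD: "finite D" using D C(5) finite_subset by blast
  have "card (B \<union> D) = k"
    using D finB fD assms(5) B(4) by (subst card_Un_disjoint) auto
  moreover have "fv.independent (B \<union> D)" using fv.independent_mono[OF C(3)] C(1) D(1) by blast
  ultimately have "fv.dim (fv.span (B \<union> D)) = k" by (simp add: fv.dim_eq_card_independent)
  moreover have "fv.span (B \<union> D) \<subseteq> N" by (rule fv.span_minimal[OF _ N(1)]) (use C D in blast)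
  moreover have "V \<subseteq> fv.span (B \<union> D)" using B(3) fv.span_mono[of B "B \<union> D"] by blast
  ultimately show thesis using that fv.subspace_span by blast
qed

lemma fin_dim_subspace_dim_le:
  "fin_dim T \<Longrightarrow> S \<subseteq> T \<Longrightarrow> fv.subspace S \<Longrightarrow> fv.subspace T \<Longrightarrow> fv.dim T \<le> fv.dim S \<Longrightarrow> T \<subseteq> S"
  using fin_dim_subspace_eq by blast

text \<open>With \<open>V\<close> the minimal span of kernels, \<open>A\<close> and \<open>B\<close>
  both map \<open>V\<close> into \<open>U = A V\<close>. A single \<open>\<zeta>A + B\<close>
  already maps \<open>V\<close> onto \<open>U\<close>, with a kernel of dimension at least
  \<open>m\<close>, so \<open>dim U \<le> dim V - m\<close>. The orthogonal complement of
  \<open>U\<close> contains \<open>V\<close>, is annihilated by \<open>V\<close> under both forms,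
  and has room for the second member of the flag. If \<open>V\<close> is too large for this, both
  members are found inside \<open>V\<close>.\<close>

theorem isotropic_flag_exists:
  assumes I: "finite I" and sym: "\<And>b i j. i \<in> I \<Longrightarrow> j \<in> I \<Longrightarrow> Q b i j = Q b j i"
    and m: "m \<le> card I" "\<And>\<zeta>. m \<le> fv.dim (pker I Q \<zeta>)"
  shows "\<exists>a. 2 * a \<le> card I - m \<and> isotropic_flag I Q (m + a) (card I - a)"
proof -
  let ?n = "card I"
  define K where "K \<Lambda> = fv.span (\<Union>\<zeta>\<in>\<Lambda>. pker I Q \<zeta>)" for \<Lambda>
  have K_base: "pker I Q \<zeta> \<subseteq> K \<Lambda>" if "\<zeta> \<in> \<Lambda>" for \<zeta> \<Lambda>
    unfolding K_def using that fv.span_superset by blast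
  have K_sup: "K \<Lambda> \<subseteq> supported I" for \<Lambda>
    unfolding K_def by (rule fv.span_minimal[OF _ subspace_supported]) (auto simp: pker_def)
  have K_sub: "fv.subspace (K \<Lambda>)" for \<Lambda> unfolding K_def by (rule fv.subspace_span)
  have K_min: "K \<Lambda> \<subseteq> S" if "fv.subspace S" "\<And>\<zeta>. \<zeta> \<in> \<Lambda> \<Longrightarrow> pker I Q \<zeta> \<subseteq> S" for \<Lambda> S
    unfolding K_def using that by (intro fv.span_minimal) auto
  have fd: "fin_dim S" if "S \<subseteq> supported I" for S by (rule fin_dim_supported[OF I that])
  obtain \<Lambda> where \<Lambda>: "infinite \<Lambda>" "\<And>\<Lambda>'. infinite \<Lambda>' \<Longrightarrow> fv.dim (K \<Lambda>) \<le> fv.dim (K \<Lambda>')"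
  proof -
    have "infinite (UNIV :: complex set)" by (rule infinite_UNIV_char_0)
    from ex_has_least_nat[of infinite, OF this, of "\<lambda>\<Lambda>. fv.dim (K \<Lambda>)"] show thesis using that by blast
  qed
  define V where "V = K \<Lambda>"
  have V: "fv.subspace V" "V \<subseteq> supported I" "fin_dim V"
    unfolding V_def by (rule K_sub, rule K_sup, rule fd[OF K_sup])
  \<comment> \<open>The remaining set of values is still infinite, so by minimality its span is not
    smaller.\<close>
  have remove: "V \<subseteq> K (\<Lambda> - {\<zeta>})" for \<zeta>
  proof (rule fin_dim_subspace_dim_le[OF V(3) _ K_sub V(1)])
    show "K (\<Lambda> - {\<zeta>}) \<subseteq> V" unfolding V_def by (rule K_min[OF K_sub]) (use K_base in blast)
    show "fv.dim V \<le> fv.dim (K (\<Lambda> - {\<zeta>}))" unfolding V_def by (rule \<Lambda>(2)) (use \<Lambda>(1) in simp)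
  qed
  have kerD: "bil I (Q False) x y = - \<zeta> * bil I (Q True) x y" if "x \<in> pker I Q \<zeta>" for x y \<zeta>
  proof -
    have "pair I (pmul I Q \<zeta> x) y = 0" using that by (simp add: pker_def pair_linear)
    moreover have "pair I (pmul I Q \<zeta> x) y = \<zeta> * bil I (Q True) x y + bil I (Q False) x y"
      by (rule pair_pmul) (rule sym)
    ultimately show ?thesis by (simp add: add_eq_0_iff)
  qed
  have bsym: "bil I (Q b) x y = bil I (Q b) y x" for b x y
    unfolding bil_def by (subst sum.swap) (intro sum.cong, auto simp: sym mult_ac)
  have iso: "bil I (Q b) x y = 0" if "x \<in> V" "y \<in> V" for b x y
  proof -
    \<comment> \<open>A kernel vector at \<open>\<zeta>\<close> is compared only with kernels at
      other values, and these span \<open>V\<close>.\<close>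
    have 1: "bil I (Q b) x y = 0" if x: "x \<in> pker I Q \<zeta>" and l: "\<zeta> \<in> \<Lambda>" and y: "y \<in> V" for \<zeta> x y
    proof -
      have "K (\<Lambda> - {\<zeta>}) \<subseteq> {y. bil I (Q b) x y = 0}"
      proof (rule K_min)
        show "fv.subspace {y. bil I (Q b) x y = 0}" unfolding fv.subspace_def by (simp add: bil_linear)
        fix \<mu> assume \<mu>: "\<mu> \<in> \<Lambda> - {\<zeta>}"
        show "pker I Q \<mu> \<subseteq> {y. bil I (Q b) x y = 0}"
        proof
          fix y assume y: "y \<in> pker I Q \<mu>"
          have "- \<zeta> * bil I (Q True) x y = - \<mu> * bil I (Q True) x y"
            unfolding kerD[OF x, of y, symmetric] bsym[of False x y] kerD[OF y, of x] bsym[of True y x] ..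
          then have "(\<zeta> - \<mu>) * bil I (Q True) x y = 0" by (simp add: left_diff_distrib)
          then have "bil I (Q True) x y = 0" using \<mu> by auto
          then show "y \<in> {y. bil I (Q b) x y = 0}" using kerD[OF x, of y] by (cases b) simp_all
        qed
      qed
      then show ?thesis using remove[of \<zeta>] y by blast
    qed
    have "V \<subseteq> {x. \<forall>y\<in>V. bil I (Q b) x y = 0}"
      unfolding V_def
    proof (rule K_min)
      show "fv.subspace {x. \<forall>y\<in>K \<Lambda>. bil I (Q b) x y = 0}" unfolding fv.subspace_def by (simp add: bil_linear)
      show "pker I Q \<zeta> \<subseteq> {x. \<forall>y\<in>K \<Lambda>. bil I (Q b) x y = 0}" if "\<zeta> \<in> \<Lambda>" for \<zeta>
        using 1[OF _ that] unfolding V_def by blast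
    qed
    then show ?thesis using that by blast
  qed
  let ?A = "lin_map I I (Q True)" and ?B = "lin_map I I (Q False)"
  have linA: "Vector_Spaces.linear fscale fscale ?A" and linB: "Vector_Spaces.linear fscale fscale ?B"
    by (rule linear_lin_map)+
  define U where "U = ?A ` V"
  have U: "fv.subspace U" "U \<subseteq> supported I"
    unfolding U_def using subspace_image_lin_map[OF V(1)] by (auto simp: lin_map_supported)
  have ker_B: "?B x = fscale (- \<zeta>) (?A x)" if "x \<in> pker I Q \<zeta>" for x \<zeta>
  proof -
    have "fscale \<zeta> (?A x) + ?B x = 0" using that unfolding pker_def pmul_expand by simp
    then show ?thesis by (simp add: fv.scale_minus_left add_eq_0_iff)
  qed
  have BU: "?B x \<in> U" if "x \<in> V" for x
  proof -
    have "V \<subseteq> {x. ?B x \<in> U}"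
      unfolding V_def
    proof (rule K_min)
      show "fv.subspace {x. ?B x \<in> U}" by (rule subspace_preimage[OF U(1) linB])
      fix \<zeta> assume l: "\<zeta> \<in> \<Lambda>"
      show "pker I Q \<zeta> \<subseteq> {x. ?B x \<in> U}"
      proof
        fix x assume x: "x \<in> pker I Q \<zeta>"
        then have "x \<in> V" using K_base[OF l] unfolding V_def by blast
        then have "?A x \<in> U" unfolding U_def by (rule imageI)
        then have "fscale (- \<zeta>) (?A x) \<in> U" by (rule fv.subspace_scale[OF U(1)])
        then show "x \<in> {x. ?B x \<in> U}" by (simp only: mem_Collect_eq ker_B[OF x])
      qed
    qed
    then show ?thesis using that by blast
  qed
  obtain \<zeta>0 where \<zeta>0: "\<zeta>0 \<in> \<Lambda>" using \<Lambda>(1) by (metis finite.emptyI ex_in_conv)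
  \<comment> \<open>On the kernel at \<open>\<mu>\<close>, the map \<open>\<zeta>0 A + B\<close> is
    \<open>(\<zeta>0 - \<mu>) A\<close>; the kernels at \<open>\<mu> \<noteq> \<zeta>0\<close> span
    \<open>V\<close>.\<close>
  have "U \<subseteq> pmul I Q \<zeta>0 ` V"
  proof -
    have sp: "fv.subspace (pmul I Q \<zeta>0 ` V)" unfolding pmul_def by (rule subspace_image_lin_map[OF V(1)])
    have "K (\<Lambda> - {\<zeta>0}) \<subseteq> {x. ?A x \<in> pmul I Q \<zeta>0 ` V}"
    proof (rule K_min)
      show "fv.subspace {x. ?A x \<in> pmul I Q \<zeta>0 ` V}"
        by (rule subspace_preimage[OF sp linA])
      fix \<mu> assume \<mu>: "\<mu> \<in> \<Lambda> - {\<zeta>0}"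
      show "pker I Q \<mu> \<subseteq> {x. ?A x \<in> pmul I Q \<zeta>0 ` V}"
      proof
        fix x assume x: "x \<in> pker I Q \<mu>"
        have "pmul I Q \<zeta>0 x = fscale (\<zeta>0 - \<mu>) (?A x)"
          unfolding pmul_expand ker_B[OF x] by (simp add: fv.scale_left_diff_distrib fv.scale_minus_left)
        then have "?A x = fscale (1 / (\<zeta>0 - \<mu>)) (pmul I Q \<zeta>0 x)" using \<mu> by (auto simp: fun_eq_iff)
        moreover have "x \<in> V" using x \<mu> K_base[of \<mu> \<Lambda>] unfolding V_def by blast
        ultimately show "x \<in> {x. ?A x \<in> pmul I Q \<zeta>0 ` V}"
          using fv.subspace_scale[OF sp] by simp
      qed
    qed
    then show ?thesis using remove[of \<zeta>0] unfolding U_def by blast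
  qed
  then have "fv.dim U \<le> fv.dim (pmul I Q \<zeta>0 ` V)"
    by (rule fin_dim_mono[rotated]) (rule fd, auto simp: pmul_def lin_map_supported)
  moreover have "fv.dim (pker I Q \<zeta>0) \<le> fv.dim {x \<in> V. pmul I Q \<zeta>0 x = 0}"
    using K_base[OF \<zeta>0] V(2) unfolding V_def[symmetric]
    by (intro fin_dim_mono fd) (auto simp: pker_def)
  ultimately have dimVU: "fv.dim U + m \<le> fv.dim V"
    using rank_nullity[OF V(1,3) linear_pmul[of I Q \<zeta>0]] m(2)[of \<zeta>0] by linarith
  let ?N = "{x \<in> supported I. \<forall>y\<in>U. pair I x y = 0}"
  have N: "fv.subspace ?N"
    using subspace_supported[of I] unfolding fv.subspace_def by (auto simp: pair_linear)
  have dimN: "fv.dim ?N = ?n - fv.dim U" by (rule dim_perp[OF I U])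
  have pc: "pair I x y = pair I y x" for x y unfolding pair_def by (simp add: mult.commute)
  have VN0: "bil I (Q b) x y = 0" if "x \<in> V" "y \<in> ?N" for b x y
  proof -
    have "lin_map I I (Q b) x \<in> U" using BU[OF that(1)] that(1) unfolding U_def by (cases b) auto
    then have "pair I (lin_map I I (Q b) x) y = 0" using that(2) pc by auto
    then show ?thesis by (simp add: bil_pair sym)
  qed
  have VN: "V \<subseteq> ?N"
  proof
    fix x assume x: "x \<in> V"
    have "pair I x y = 0" if y: "y \<in> U" for y
    proof -
      obtain z where z: "z \<in> V" "y = ?A z" using y unfolding U_def by auto
      have "pair I (?A z) x = 0" using iso[OF z(1) x, of True] by (simp add: bil_pair sym)
      then show ?thesis using pc z by simp
    qed
    then show "x \<in> ?N" using x V(2) by auto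
  qed
  have dimV: "fv.dim V \<le> ?n"
    using fin_dim_mono[OF fd[OF order_refl] V(2)] dim_supported[OF I] by metis
  define a0 where "a0 = fv.dim V - m"
  have a0: "fv.dim V = m + a0" using dimVU unfolding a0_def by simp
  show ?thesis
  proof (cases "2 * a0 \<le> ?n - m")
    case True
    \<comment> \<open>The second bound rests on \<open>dim U \<le> a0\<close>.\<close>
    have "fv.dim V \<le> ?n - a0" "?n - a0 \<le> fv.dim ?N" using True a0 dimVU dimN m(1) by simp_all
    from intermediate_subspace[OF V(1) N fd VN this] obtain S where
      S: "fv.subspace S" "V \<subseteq> S" "S \<subseteq> ?N" "fv.dim S = ?n - a0" by blast
    have "isotropic_flag I Q (m + a0) (?n - a0)"
      unfolding isotropic_flag_def
    proof (rule exI[of _ V], rule exI[of _ S], intro conjI allI ballI)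
      show "bil I (Q b) x y = 0" if "x \<in> V" "y \<in> S" for b x y using VN0 that S(3) by blast
    qed (use V S a0 in auto)
    then show ?thesis using True by blast
  next
    case False
    let ?a = "(?n - m) div 2"
    have le: "m + ?a \<le> ?n - ?a" "?n - ?a \<le> fv.dim V" using False a0 m(1) by linarith+
    have z: "fv.subspace {0 :: _ \<Rightarrow> complex}" by (rule fv.subspace_single_0)
    from intermediate_subspace[OF z V(1,3), of "?n - ?a"] le fv.subspace_0[OF V(1)] obtain S where
      S: "fv.subspace S" "S \<subseteq> V" "fv.dim S = ?n - ?a" by (auto simp: dim_zero)
    have "fin_dim S" using fin_dim_subset[OF V(3) S(2)] .
    from intermediate_subspace[OF z S(1) this, of "m + ?a"] le S(3) fv.subspace_0[OF S(1)] obtain T where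
      T: "fv.subspace T" "T \<subseteq> S" "fv.dim T = m + ?a" by (auto simp: dim_zero)
    have "isotropic_flag I Q (m + ?a) (?n - ?a)"
      unfolding isotropic_flag_def
    proof (rule exI[of _ T], rule exI[of _ S], intro conjI allI ballI)
      show "bil I (Q b) x y = 0" if "x \<in> T" "y \<in> S" for b x y using iso that S(2) T(2) by blast
    qed (use V S T in auto)
    moreover have "2 * ?a \<le> ?n - m" by simp
    ultimately show ?thesis by blast
  qed
qed

lemma dim_0_subspace:
  assumes "fv.subspace S" "fin_dim S" "fv.dim S = 0" shows "S = {0}"
  using fin_dim_subspace_eq[OF assms(2), of "{0}"] assms fv.subspace_0[OF assms(1)] fv.subspace_single_0
  by (auto simp: dim_zero)

section \<open>Minors and the rank of a pencil\<close>

text \<open>The images of the unit vectors in \<open>J\<close> form a maximal independent family,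
  that is, a basis of the column space.\<close>

lemma linear_injective_support:
  fixes f :: "('i \<Rightarrow> complex) \<Rightarrow> 'j \<Rightarrow> complex"
  assumes I: "finite I" and f: "Vector_Spaces.linear fscale fscale f"
  obtains J where "J \<subseteq> I" "card J = fv.dim (f ` supported I)" "f ` supported J = f ` supported I"
    "\<And>x. x \<in> supported J \<Longrightarrow> f x = 0 \<Longrightarrow> x = 0"
proof -
  let ?g = "\<lambda>i. f (unit_fun i)"
  have span: "f ` supported J = fv.span (?g ` J)" if "finite J" for J
    using fvp.linear_span_image[OF f, of "unit_fun ` J"] span_unit_fun[OF that] by (simp add: image_image)
  obtain B where B: "B \<subseteq> ?g ` I" "fv.independent B" "?g ` I \<subseteq> fv.span B"
    using fv.maximal_independent_subset[of "?g ` I"] by blast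
  obtain J where J: "J \<subseteq> I" "inj_on ?g J" "B = ?g ` J"
    using B(1) by (auto simp: subset_image_inj)
  have fJ: "finite J" using J(1) I finite_subset by blast
  have "fv.span B = fv.span (?g ` I)"
    using fv.span_minimal[OF B(3) fv.subspace_span] fv.span_mono[OF B(1)] by blast
  then have im: "f ` supported J = f ` supported I" using span[OF fJ] span[OF I] J(3) by simp
  have card: "card J = fv.dim (f ` supported J)"
    unfolding span[OF fJ] using J(2,3) B(2) by (simp add: fv.dim_eq_card_independent card_image)
  let ?K = "{x \<in> supported J. f x = 0}"
  have fd: "fin_dim (supported J)" by (rule fin_dim_supported[OF fJ order_refl])
  have "fv.dim ?K = 0"
    using rank_nullity[OF subspace_supported fd f] card dim_supported[OF fJ] by simp
  then have "?K = {0}"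
    by (intro dim_0_subspace subspace_kernel[OF subspace_supported f] fin_dim_subset[OF fd]) auto
  then show thesis using that[OF J(1)] card im by auto
qed

text \<open>Independent columns \<open>C\<close> are chosen first. The transpose restricted to them
  is onto \<open>supported C\<close>, because a vector orthogonal to its image lies in the kernel of
  \<open>M\<close> on \<open>C\<close>. The same selection, applied to the transpose, gives the rows
  \<open>R\<close>.\<close>

lemma ex_nonsingular_submatrix:
  fixes M :: "'i \<Rightarrow> 'j \<Rightarrow> complex"
  assumes I: "finite I" and J: "finite J" and k: "k \<le> fv.dim (lin_map I J M ` supported J)"
  obtains R C where "R \<subseteq> I" "C \<subseteq> J" "card R = k" "card C = k"
    "\<And>x. x \<in> supported C \<Longrightarrow> (\<And>i. i \<in> R \<Longrightarrow> (\<Sum>j\<in>C. M i j * x j) = 0) \<Longrightarrow> x = 0"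
proof -
  obtain C0 where C0: "C0 \<subseteq> J" "card C0 = fv.dim (lin_map I J M ` supported J)"
    "\<And>x. x \<in> supported C0 \<Longrightarrow> lin_map I J M x = 0 \<Longrightarrow> x = 0"
    by (rule linear_injective_support[OF J linear_lin_map[of I J M]]) (rule that)
  obtain C where C: "C \<subseteq> C0" "card C = k" "finite C" using obtain_subset_with_card_n[of k C0] k C0(2) by metis
  have CJ: "C \<subseteq> J" using C C0 by blast
  have inj: "x = 0" if x: "x \<in> supported C" and z: "\<And>i. i \<in> I \<Longrightarrow> (\<Sum>j\<in>C. M i j * x j) = 0" for x
  proof (rule C0(3))
    show "x \<in> supported C0" using x C(1) by (auto simp: supported_def)
    have "(\<Sum>j\<in>J. M i j * x j) = (\<Sum>j\<in>C. M i j * x j)" for i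
      using CJ J x by (intro sum.mono_neutral_right) (auto simp: supported_def)
    then show "lin_map I J M x = 0" using z by (auto simp: lin_map_def)
  qed
  let ?g = "lin_map C I (\<lambda>j i. M i j)"
  have pg: "pair C x (?g y) = (\<Sum>i\<in>I. y i * (\<Sum>j\<in>C. M i j * x j))" for x y
  proof -
    have "pair C x (?g y) = (\<Sum>j\<in>C. \<Sum>i\<in>I. y i * (M i j * x j))"
      unfolding pair_def lin_map_def by (intro sum.cong refl) (simp add: sum_distrib_left mult_ac)
    also have "\<dots> = (\<Sum>i\<in>I. \<Sum>j\<in>C. y i * (M i j * x j))" by (rule sum.swap)
    finally show ?thesis by (simp add: sum_distrib_left)
  qed
  have g: "fv.subspace (?g ` supported I)" "?g ` supported I \<subseteq> supported C"
    using subspace_image_lin_map[OF subspace_supported] by (auto simp: lin_map_supported)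
  have "{x \<in> supported C. \<forall>w\<in>?g ` supported I. pair C x w = 0} = {0}"
  proof -
    have "x = 0" if x: "x \<in> supported C" and p: "\<forall>w\<in>?g ` supported I. pair C x w = 0" for x
    proof (rule inj[OF x])
      fix i assume i: "i \<in> I"
      have "pair C x (?g (unit_fun i)) = 0" using p unit_fun_supported[OF i] by blast
      moreover have "(\<Sum>k\<in>I. unit_fun i k * (\<Sum>j\<in>C. M k j * x j)) = (\<Sum>j\<in>C. M i j * x j)"
        unfolding unit_fun_def by (rule sum_delta_mult(2)[OF I i])
      ultimately show "(\<Sum>j\<in>C. M i j * x j) = 0" unfolding pg by simp
    qed
    then show ?thesis using fv.subspace_0[OF subspace_supported[of C]] by (auto simp: pair_linear)
  qed
  then have "card C - fv.dim (?g ` supported I) = 0" using dim_perp[OF C(3) g] by (simp add: dim_zero)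
  then have "fv.dim (supported C) \<le> fv.dim (?g ` supported I)" using dim_supported[OF C(3)] by simp
  then have surj: "?g ` supported I = supported C"
    by (rule fin_dim_subspace_eq[OF fin_dim_supported[OF C(3) order_refl] g(2,1) subspace_supported])
  obtain R where R: "R \<subseteq> I" "card R = fv.dim (?g ` supported I)" "?g ` supported R = ?g ` supported I"
    by (rule linear_injective_support[OF I linear_lin_map[of C I "\<lambda>j i. M i j"]]) (rule that)
  have "card R = k" unfolding R(2) surj using dim_supported[OF C(3)] C(2) by simp
  moreover have "x = 0" if x: "x \<in> supported C" and z: "\<And>i. i \<in> R \<Longrightarrow> (\<Sum>j\<in>C. M i j * x j) = 0" for x
  proof
    fix j
    show "x j = 0 j"
    proof (cases "j \<in> C")
      case True
      have "unit_fun j \<in> ?g ` supported R" unfolding R(3) surj by (rule unit_fun_supported[OF True])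
      then obtain y where y: "y \<in> supported R" "unit_fun j = ?g y" by (rule imageE) (rule that)
      have "pair C x (unit_fun j) = 0"
        unfolding y(2) pg using z supportedD[OF y(1)] by (intro sum.neutral) (metis mult_eq_0_iff)
      then show ?thesis
        unfolding pair_def unit_fun_def using sum_delta_mult(4)[OF C(3) True] by simp
    qed (use supportedD[OF x] in simp)
  qed
  ultimately show thesis using that[OF R(1) CJ] C(2) by blast
qed

lemma bij_betw_pick: "finite S \<Longrightarrow> bij_betw (pick S) {..<card S} S"
proof -
  assume S: "finite S"
  have "inj_on (pick S) {..<card S}"
  proof (rule inj_onI)
    fix x y assume "x \<in> {..<card S}" "y \<in> {..<card S}" "pick S x = pick S y"
    then show "x = y" using pick_mono_le[of x S y] pick_mono_le[of y S x] by (metis lessThan_iff nat_neq_iff)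
  qed
  moreover have "pick S ` {..<card S} \<subseteq> S" using pick_in_set_le by auto
  ultimately show ?thesis
    using S by (simp add: bij_betw_def card_image card_subset_eq)
qed

lemma det_submatrix_zero_iff:
  fixes A :: "complex mat"
  assumes A: "A \<in> carrier_mat n n'" and R: "R \<subseteq> {..<n}" and C: "C \<subseteq> {..<n'}" and k: "card R = card C"
  shows "det (submatrix A R C) = 0 \<longleftrightarrow>
    (\<exists>x\<in>supported C. x \<noteq> 0 \<and> (\<forall>i\<in>R. (\<Sum>j\<in>C. A $$ (i, j) * x j) = 0))"
proof -
  let ?k = "card C"
  have fin: "finite R" "finite C" using R C finite_subset by blast+
  have "{i. i < n \<and> i \<in> R} = R" "{i. i < n' \<and> i \<in> C} = C" using R C by auto
  then have S: "submatrix A R C \<in> carrier_mat ?k ?k"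
    "\<And>i j. i < ?k \<Longrightarrow> j < ?k \<Longrightarrow> submatrix A R C $$ (i, j) = A $$ (pick R i, pick C j)"
    using A k by (auto simp: submatrix_def)
  note bR = bij_betw_pick[OF fin(1)] and bC = bij_betw_pick[OF fin(2)]
  have row: "(submatrix A R C *\<^sub>v v) $ i = (\<Sum>j<?k. A $$ (pick R i, pick C j) * v $ j)"
    if "i < ?k" "v \<in> carrier_vec ?k" for i v
    using S that by (auto simp: scalar_prod_def atLeast0LessThan intro!: sum.cong)
  show ?thesis
  proof
    assume "det (submatrix A R C) = 0"
    then obtain v where v: "v \<in> carrier_vec ?k" "v \<noteq> 0\<^sub>v ?k" "submatrix A R C *\<^sub>v v = 0\<^sub>v ?k"
      using det_0_iff_vec_prod_zero[OF S(1)] by blast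
    define g where "g = the_inv_into {..<?k} (pick C)"
    define x where "x = (\<lambda>j. if j \<in> C then v $ g j else 0)"
    have g: "g (pick C j) = j" if "j < ?k" for j
      unfolding g_def using bC that by (auto simp: bij_betw_def the_inv_into_f_f)
    have pC: "pick C j \<in> C" if "j < ?k" for j using bC that by (auto simp: bij_betw_def)
    obtain j where "j < ?k" "v $ j \<noteq> 0" using v(1,2) by (metis carrier_vecD eq_vecI index_zero_vec)
    then have "x (pick C j) \<noteq> 0" using g pC by (simp add: x_def)
    then have "x \<noteq> 0" by auto
    moreover have "x \<in> supported C" by (simp add: x_def supported_def)
    moreover have "(\<Sum>j\<in>C. A $$ (i, j) * x j) = 0" if iR: "i \<in> R" for i
    proof -
      obtain l where l: "l < ?k" "i = pick R l" using bR iR k by (auto simp: bij_betw_def)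
      have "(\<Sum>j\<in>C. A $$ (i, j) * x j) = (\<Sum>j<?k. A $$ (i, pick C j) * x (pick C j))"
        by (rule sum.reindex_bij_betw[OF bC, symmetric])
      also have "\<dots> = (submatrix A R C *\<^sub>v v) $ l"
        unfolding row[OF l(1) v(1)] l(2) using g pC by (intro sum.cong) (auto simp: x_def)
      finally show ?thesis unfolding v(3) using l by simp
    qed
    ultimately show "\<exists>x\<in>supported C. x \<noteq> 0 \<and> (\<forall>i\<in>R. (\<Sum>j\<in>C. A $$ (i, j) * x j) = 0)" by blast
  next
    assume "\<exists>x\<in>supported C. x \<noteq> 0 \<and> (\<forall>i\<in>R. (\<Sum>j\<in>C. A $$ (i, j) * x j) = 0)"
    then obtain x where x: "x \<in> supported C" "x \<noteq> 0" "\<forall>i\<in>R. (\<Sum>j\<in>C. A $$ (i, j) * x j) = 0" by blast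
    define v where "v = vec ?k (\<lambda>j. x (pick C j))"
    have v: "v \<in> carrier_vec ?k" by (simp add: v_def)
    have "\<exists>j. x j \<noteq> 0" using x(2) by (auto simp: fun_eq_iff)
    then obtain j where j: "j \<in> C" "x j \<noteq> 0" using supportedD[OF x(1)] by blast
    then obtain l where "l < ?k" "j = pick C l" using bC by (auto simp: bij_betw_def)
    then have "v $ l \<noteq> 0\<^sub>v ?k $ l" using j by (simp add: v_def)
    then have "v \<noteq> 0\<^sub>v ?k" by auto
    moreover have "submatrix A R C *\<^sub>v v = 0\<^sub>v ?k"
    proof (rule eq_vecI)
      fix l assume "l < dim_vec (0\<^sub>v ?k :: complex vec)"
      then have l: "l < ?k" by simp
      have "(submatrix A R C *\<^sub>v v) $ l = (\<Sum>j<?k. A $$ (pick R l, pick C j) * x (pick C j))"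
        unfolding row[OF l v] by (simp add: v_def)
      also have "\<dots> = (\<Sum>j\<in>C. A $$ (pick R l, j) * x j)" by (rule sum.reindex_bij_betw[OF bC])
      also have "\<dots> = 0" using x(3) bR l k by (auto simp: bij_betw_def)
      finally show "(submatrix A R C *\<^sub>v v) $ l = 0\<^sub>v ?k $ l" using l by simp
    qed (use S in simp)
    ultimately show "det (submatrix A R C) = 0" using det_0_iff_vec_prod_zero[OF S(1)] v by blast
  qed
qed

lemma comm_ring_hom_poly_eval: "comm_ring_hom (\<lambda>p :: complex poly. poly p \<zeta>)"
  by unfold_locales auto

definition pencil_eval :: "nat \<Rightarrow> pencil \<Rightarrow> complex \<Rightarrow> complex mat" where
  "pencil_eval n P \<zeta> = mat n n (\<lambda>(i, j). \<zeta> * form P True i j + form P False i j)"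

text \<open>Evaluation is a ring homomorphism and thus commutes with determinants.\<close>

lemma poly_det_submatrix_pencil:
  assumes "P \<in> pencils n"
  shows "poly (det (submatrix (pencil_poly_mat P) R C)) \<zeta> = det (submatrix (pencil_eval n P \<zeta>) R C)"
proof -
  note h = comm_ring_hom.hom_det[OF comm_ring_hom_poly_eval[of \<zeta>]]
  have PM: "pencil_poly_mat P \<in> carrier_mat n n"
    "\<And>i j. i < n \<Longrightarrow> j < n \<Longrightarrow> poly (pencil_poly_mat P $$ (i, j)) \<zeta> = pencil_eval n P \<zeta> $$ (i, j)"
    using assms by (auto simp: pencils_def pencil_poly_mat_def pencil_eval_def form_def)
  have "map_mat (\<lambda>p. poly p \<zeta>) (submatrix (pencil_poly_mat P) R C) = submatrix (pencil_eval n P \<zeta>) R C"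
  proof (rule eq_matI)
    fix i j assume "i < dim_row (submatrix (pencil_eval n P \<zeta>) R C)" "j < dim_col (submatrix (pencil_eval n P \<zeta>) R C)"
    then have ij: "i < card {i. i < n \<and> i \<in> R}" "j < card {j. j < n \<and> j \<in> C}"
      by (auto simp: dim_submatrix pencil_eval_def)
    then have "pick R i < n" "pick C j < n" using pick_le by blast+
    then show "map_mat (\<lambda>p. poly p \<zeta>) (submatrix (pencil_poly_mat P) R C) $$ (i, j) = submatrix (pencil_eval n P \<zeta>) R C $$ (i, j)"
      using ij PM by (simp add: submatrix_def pencil_eval_def)
  qed (use PM in \<open>auto simp: dim_submatrix pencil_eval_def\<close>)
  then show ?thesis by (metis h)
qed

definition minor_cards :: "pencil \<Rightarrow> nat set" where
  "minor_cards P = {card I |I J. I \<subseteq> {..<dim_row (pencil_poly_mat P)} \<and>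
     J \<subseteq> {..<dim_col (pencil_poly_mat P)} \<and> card I = card J \<and>
     det (submatrix (pencil_poly_mat P) I J) \<noteq> 0}"

lemma finite_minor_cards: "finite (minor_cards P)" and minor_cards_nonempty: "minor_cards P \<noteq> {}"
proof -
  have "minor_cards P \<subseteq> {..card {..<dim_row (pencil_poly_mat P)}}"
    unfolding minor_cards_def using card_mono[OF finite_lessThan] by blast
  then show "finite (minor_cards P)" using finite_subset by blast
  have "det (submatrix (pencil_poly_mat P) {} {}) = 1"
    by (simp add: submatrix_def det_def)
  then have "card {} \<in> minor_cards P"
    unfolding minor_cards_def by (intro CollectI exI[of _ "{}"]) auto
  then show "minor_cards P \<noteq> {}" by blast
qed

text \<open>A minor is a nonzero polynomial exactly if it is nonzero at some \<open>\<zeta>\<close>,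
  so the rank of the pencil is the largest rank of the matrices \<open>\<zeta>A + B\<close>.\<close>

lemma pencil_rank_le_iff:
  assumes P: "P \<in> pencils n" and r: "r \<le> n"
  shows "pencil_rank P \<le> r \<longleftrightarrow> (\<forall>\<zeta>. n - r \<le> fv.dim (pker {..<n} (form P) \<zeta>))"
proof -
  have dims: "dim_row (pencil_poly_mat P) = n" "dim_col (pencil_poly_mat P) = n"
    using P by (auto simp: pencils_def pencil_poly_mat_def)
  let ?I = "{..<n}"
  have E: "pencil_eval n P \<zeta> \<in> carrier_mat n n" for \<zeta> by (simp add: pencil_eval_def)
  have fd: "fin_dim S" if "S \<subseteq> supported ?I" for S by (rule fin_dim_supported[OF _ that]) simp
  have dimI: "fv.dim (supported ?I) = n" using dim_supported[of ?I] by simp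
  have iff: "pencil_rank P \<le> r \<longleftrightarrow> (\<forall>R C. R \<subseteq> ?I \<longrightarrow> C \<subseteq> ?I \<longrightarrow> card R = card C \<longrightarrow>
      det (submatrix (pencil_poly_mat P) R C) \<noteq> 0 \<longrightarrow> card R \<le> r)"
  proof -
    have "pencil_rank P \<le> r \<longleftrightarrow> (\<forall>k\<in>minor_cards P. k \<le> r)"
      unfolding pencil_rank_def minor_cards_def[symmetric]
      by (rule Max_le_iff[OF finite_minor_cards minor_cards_nonempty])
    then show ?thesis unfolding minor_cards_def dims by blast
  qed
  show ?thesis
  proof
    assume le: "pencil_rank P \<le> r"
    show "\<forall>\<zeta>. n - r \<le> fv.dim (pker ?I (form P) \<zeta>)"
    proof (rule allI, rule ccontr)
      fix \<zeta> assume "\<not> n - r \<le> fv.dim (pker ?I (form P) \<zeta>)"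
      then have "Suc r \<le> fv.dim (pmul ?I (form P) \<zeta> ` supported ?I)"
        using rank_nullity[OF subspace_supported fd[OF order_refl] linear_pmul[of ?I "form P" \<zeta>]]
        by (simp add: dimI pker_def)
      then obtain R C where RC: "R \<subseteq> ?I" "C \<subseteq> ?I" "card R = Suc r" "card C = Suc r"
        "\<And>x. x \<in> supported C \<Longrightarrow> (\<And>i. i \<in> R \<Longrightarrow> (\<Sum>j\<in>C. (\<zeta> * form P True i j + form P False i j) * x j) = 0) \<Longrightarrow> x = 0"
      proof (unfold pmul_def, elim ex_nonsingular_submatrix[OF finite_lessThan finite_lessThan, where k = "Suc r"])
        fix R C assume 1: "R \<subseteq> ?I" "C \<subseteq> ?I" "card R = Suc r" "card C = Suc r"
          "\<And>x. x \<in> supported C \<Longrightarrow> (\<And>i. i \<in> R \<Longrightarrow> (\<Sum>j\<in>C. (\<zeta> * form P True i j + form P False i j) * x j) = 0) \<Longrightarrow> x = 0"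
        show thesis by (rule that[OF 1])
      qed
      have "det (submatrix (pencil_eval n P \<zeta>) R C) \<noteq> 0"
      proof
        assume "det (submatrix (pencil_eval n P \<zeta>) R C) = 0"
        then obtain x where x: "x \<in> supported C" "x \<noteq> 0"
          "\<forall>i\<in>R. (\<Sum>j\<in>C. pencil_eval n P \<zeta> $$ (i, j) * x j) = 0"
          using det_submatrix_zero_iff[OF E RC(1,2)] RC(3,4) by auto
        have "(\<Sum>j\<in>C. (\<zeta> * form P True i j + form P False i j) * x j) = 0" if "i \<in> R" for i
        proof -
          have "(\<Sum>j\<in>C. pencil_eval n P \<zeta> $$ (i, j) * x j) = (\<Sum>j\<in>C. (\<zeta> * form P True i j + form P False i j) * x j)"
            using that RC(1,2) by (intro sum.cong refl) (auto simp: pencil_eval_def subset_iff)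
          then show ?thesis using x(3) that by auto
        qed
        then show False using RC(5)[OF x(1)] x(2) by blast
      qed
      then have "det (submatrix (pencil_poly_mat P) R C) \<noteq> 0"
        unfolding poly_det_submatrix_pencil[OF P, symmetric] by auto
      then have "card R \<le> r" using iff[THEN iffD1, OF le, rule_format, OF RC(1,2)] RC(3,4) by simp
      then show False using RC(3) by simp
    qed
  next
    assume ge: "\<forall>\<zeta>. n - r \<le> fv.dim (pker ?I (form P) \<zeta>)"
    show "pencil_rank P \<le> r"
      unfolding iff
    proof (intro allI impI, rule ccontr)
      fix R C assume R: "R \<subseteq> ?I" and C: "C \<subseteq> ?I" and RC: "card R = card C"
        and d: "det (submatrix (pencil_poly_mat P) R C) \<noteq> 0" and gt: "\<not> card R \<le> r"
      have "\<exists>\<zeta>. poly (det (submatrix (pencil_poly_mat P) R C)) \<zeta> \<noteq> 0" using d poly_all_0_iff_0 by blast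
      then obtain \<zeta> where \<zeta>: "det (submatrix (pencil_eval n P \<zeta>) R C) \<noteq> 0"
        unfolding poly_det_submatrix_pencil[OF P] ..
      let ?K = "pker ?I (form P) \<zeta>"
      \<comment> \<open>Projection to the coordinates outside \<open>C\<close>. By dimension it
        annihilates a nonzero kernel vector, which is then supported on \<open>C\<close> and makes
        the minor vanish.\<close>
      let ?f = "lin_map (?I - C) ?I (\<lambda>i j. if i = j then 1 else 0)"
      have fK: "?f x i = (if i \<in> ?I - C then x i else 0)" for x i
        by (auto simp: lin_map_def sum_delta_mult)
      have KI: "?K \<subseteq> supported ?I" by (auto simp: pker_def)
      have "fv.dim (?f ` ?K) \<le> fv.dim (supported (?I - C))"
        by (rule fin_dim_mono[OF fin_dim_supported[OF _ order_refl]]) (auto simp: lin_map_supported)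
      also have "\<dots> = n - card C" using dim_supported[of "?I - C"] C finite_subset[OF C] by (simp add: card_Diff_subset)
      finally have "fv.dim {x \<in> ?K. ?f x = 0} > 0"
        using rank_nullity[OF subspace_pker fd[OF KI] linear_lin_map[of "?I - C" ?I "\<lambda>i j. if i = j then 1 else 0"]]
          ge[rule_format, of \<zeta>] gt RC card_mono[OF _ C] r by simp
      then have "{x \<in> ?K. ?f x = 0} \<noteq> {0}" using dim_zero by (metis less_irrefl)
      moreover have "0 \<in> {x \<in> ?K. ?f x = 0}"
        using fv.subspace_0[OF subspace_pker[of ?I "form P" \<zeta>]] by (auto simp: fK fun_eq_iff)
      ultimately obtain x where x: "x \<in> ?K" "?f x = 0" "x \<noteq> 0" by blast
      have xC: "x \<in> supported C"
      proof -
        have "x i = 0" if "i \<notin> C" for i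
          using fun_cong[OF x(2), of i] that KI x(1) by (auto simp: fK supported_def split: if_splits)
        then show ?thesis by (simp add: supported_def)
      qed
      have "(\<Sum>j\<in>C. pencil_eval n P \<zeta> $$ (i, j) * x j) = 0" if "i \<in> R" for i
      proof -
        have i: "i < n" using that R by auto
        have "(\<Sum>j\<in>C. pencil_eval n P \<zeta> $$ (i, j) * x j) = (\<Sum>j<n. (\<zeta> * form P True i j + form P False i j) * x j)"
          using C i supportedD[OF xC] by (intro sum.mono_neutral_cong_left) (auto simp: pencil_eval_def)
        also have "\<dots> = pmul ?I (form P) \<zeta> x i" using i by (simp add: pmul_def lin_map_def)
        also have "\<dots> = 0" using x(1) by (simp add: pker_def)
        finally show ?thesis .
      qed
      then have "det (submatrix (pencil_eval n P \<zeta>) R C) = 0"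
        using det_submatrix_zero_iff[OF E R C RC] xC x(3) by blast
      then show False using \<zeta> by simp
    qed
  qed
qed

theorem symmetric_pencils_rank_le_eq:
  assumes "r \<le> n"
  shows "symmetric_pencils_rank_le n r = (\<Union>a\<in>{0..r div 2}. flag_pencils n (n - r + a) (n - a))"
proof (rule Set.set_eqI)
  fix P
  show "P \<in> symmetric_pencils_rank_le n r \<longleftrightarrow> P \<in> (\<Union>a\<in>{0..r div 2}. flag_pencils n (n - r + a) (n - a))"
  proof (cases "P \<in> symmetric_pencils n")
    case True
    then have P: "P \<in> pencils n" and sym: "\<And>b i j. i \<in> {..<n} \<Longrightarrow> j \<in> {..<n} \<Longrightarrow> form P b i j = form P b j i"
      by (auto simp: symmetric_pencils_iff)
    show ?thesis
    proof
      assume "P \<in> symmetric_pencils_rank_le n r"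
      then have "\<And>\<zeta>. n - r \<le> fv.dim (pker {..<n} (form P) \<zeta>)"
        using pencil_rank_le_iff[OF P assms] by (simp add: symmetric_pencils_rank_le_def)
      then have "\<exists>a. 2 * a \<le> card {..<n} - (n - r) \<and> isotropic_flag {..<n} (form P) (n - r + a) (card {..<n} - a)"
        by (intro isotropic_flag_exists) (use sym in auto)
      then obtain a where a: "2 * a \<le> r" "isotropic_flag {..<n} (form P) (n - r + a) (n - a)"
        using assms by auto
      then have "a \<in> {0..r div 2}" "P \<in> flag_pencils n (n - r + a) (n - a)" using True by (auto simp: flag_pencils_def)
      then show "P \<in> (\<Union>a\<in>{0..r div 2}. flag_pencils n (n - r + a) (n - a))" by blast
    next
      assume "P \<in> (\<Union>a\<in>{0..r div 2}. flag_pencils n (n - r + a) (n - a))"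
      then obtain a where "a \<le> r div 2" and a2: "isotropic_flag {..<n} (form P) (n - r + a) (n - a)"
        by (auto simp: flag_pencils_def)
      then have a: "2 * a \<le> r" "isotropic_flag {..<n} (form P) (n - r + a) (n - a)" by simp_all
      have "n - r \<le> fv.dim (pker {..<n} (form P) \<zeta>)" for \<zeta>
        using isotropic_flag_dim_pker[OF _ sym a(2), of \<zeta>] a(1) assms by simp
      then show "P \<in> symmetric_pencils_rank_le n r"
        using True pencil_rank_le_iff[OF P assms] by (simp add: symmetric_pencils_rank_le_def)
    qed
  qed (auto simp: symmetric_pencils_rank_le_def flag_pencils_def)
qed

section \<open>Canonical blocks\<close>

text \<open>Pairs of a block number and a position inside the block; they avoid the offsets of a
  block diagonal matrix.\<close>

definition bindex :: "'e block list \<Rightarrow> (nat \<times> nat) set" where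
  "bindex bs = Sigma {..<length bs} (\<lambda>l. {..<block_size (bs ! l)})"

definition bform :: "eigval block list \<Rightarrow> bool \<Rightarrow> nat \<times> nat \<Rightarrow> nat \<times> nat \<Rightarrow> complex" where
  "bform bs b p q = (if fst p = fst q then form (block_pencil (bs ! fst p)) b (snd p) (snd q) else 0)"

lemma finite_bindex [simp]: "finite (bindex bs)"
  by (simp add: bindex_def)

lemma blocks_pencil_pencils: "blocks_pencil bs \<in> pencils (\<Sum>b\<leftarrow>bs. block_size b)"
  using blocks_pencil_symmetric[of bs] by (simp add: symmetric_pencils_def case_prod_beta)

lemma block_pencil_pencils: "block_pencil b \<in> pencils (block_size b)"
  using block_pencil_symmetric[of b] by (simp add: symmetric_pencils_def case_prod_beta)

lemma blocks_pencil_bij: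
  "\<exists>\<pi>. bij_betw \<pi> {..<\<Sum>b\<leftarrow>bs. block_size b} (bindex bs) \<and>
    (\<forall>b. \<forall>i<\<Sum>b\<leftarrow>bs. block_size b. \<forall>j<\<Sum>b\<leftarrow>bs. block_size b.
      form (blocks_pencil bs) b i j = bform bs b (\<pi> i) (\<pi> j))"
proof (induction bs)
  case Nil
  show ?case by (intro exI[of _ "\<lambda>_. (0, 0)"]) (simp add: bindex_def bij_betw_def)
next
  case (Cons c bs)
  let ?N = "\<Sum>b\<leftarrow>bs. block_size b" let ?k = "block_size c"
  obtain \<pi> where \<pi>: "bij_betw \<pi> {..<?N} (bindex bs)"
    "\<forall>b. \<forall>i<?N. \<forall>j<?N. form (blocks_pencil bs) b i j = bform bs b (\<pi> i) (\<pi> j)"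
    using Cons.IH by auto
  let ?p = "\<lambda>i. if i < ?k then (0, i) else (Suc (fst (\<pi> (i - ?k))), snd (\<pi> (i - ?k)))"
  have inj: "inj_on \<pi> {..<?N}" and im: "\<pi> ` {..<?N} = bindex bs" using \<pi>(1) by (auto simp: bij_betw_def)
  have bi: "bindex (c # bs) = Pair 0 ` {..<?k} \<union> (\<lambda>q. (Suc (fst q), snd q)) ` bindex bs"
  proof (intro equalityI subsetI)
    fix q assume "q \<in> bindex (c # bs)"
    then obtain l i where q: "q = (l, i)" "l < Suc (length bs)" "i < block_size ((c # bs) ! l)"
      by (auto simp: bindex_def)
    show "q \<in> Pair 0 ` {..<?k} \<union> (\<lambda>q. (Suc (fst q), snd q)) ` bindex bs"
    proof (cases l)
      case 0 then show ?thesis using q by auto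
    next
      case (Suc l')
      then have "(l', i) \<in> bindex bs" using q by (simp add: bindex_def)
      then show ?thesis using q Suc by (intro UnI2 image_eqI[of _ _ "(l', i)"]) auto
    qed
  qed (auto simp: bindex_def)
  have "bij_betw ?p {..<?k + ?N} (bindex (c # bs))"
    unfolding bij_betw_def
  proof
    show "inj_on ?p {..<?k + ?N}"
    proof (rule inj_onI)
      fix x y assume xy: "x \<in> {..<?k + ?N}" "y \<in> {..<?k + ?N}" "?p x = ?p y"
      show "x = y"
      proof (cases "x < ?k"; cases "y < ?k")
        assume k: "\<not> x < ?k" "\<not> y < ?k"
        then have "\<pi> (x - ?k) = \<pi> (y - ?k)" using xy(3) by (simp add: prod_eq_iff)
        moreover have "x - ?k \<in> {..<?N}" "y - ?k \<in> {..<?N}" using xy k by auto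
        ultimately have "x - ?k = y - ?k" using inj by (simp add: inj_on_def)
        then show ?thesis using k by simp
      qed (use xy in auto)
    qed
    have "{..<?k + ?N} = {..<?k} \<union> (\<lambda>i. i + ?k) ` {..<?N}"
      by (auto simp: image_iff) (metis add.commute le_add_diff_inverse2 less_diff_conv2 not_less lessThan_iff)
    then have "?p ` {..<?k + ?N} = ?p ` {..<?k} \<union> ?p ` (\<lambda>i. i + ?k) ` {..<?N}" by (simp only: image_Un)
    also have "?p ` {..<?k} = Pair 0 ` {..<?k}" by (intro image_cong) auto
    also have "?p ` (\<lambda>i. i + ?k) ` {..<?N} = (\<lambda>i. (Suc (fst (\<pi> i)), snd (\<pi> i))) ` {..<?N}"
      unfolding image_image by (intro image_cong) auto
    also have "(\<lambda>i. (Suc (fst (\<pi> i)), snd (\<pi> i))) ` {..<?N} = (\<lambda>q. (Suc (fst q), snd q)) ` bindex bs"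
      unfolding im[symmetric] by (simp add: image_image)
    finally show "?p ` {..<?k + ?N} = bindex (c # bs)" unfolding bi .
  qed
  moreover have "form (blocks_pencil (c # bs)) b i j = bform (c # bs) b (?p i) (?p j)"
    if ij: "i < ?k + ?N" "j < ?k + ?N" for b i j
  proof -
    have C: "fst (block_pencil c) \<in> carrier_mat ?k ?k" "snd (block_pencil c) \<in> carrier_mat ?k ?k"
      using block_pencil_pencils[of c] by (auto simp: pencils_def)
    have D: "fst (blocks_pencil bs) \<in> carrier_mat ?N ?N" "snd (blocks_pencil bs) \<in> carrier_mat ?N ?N"
      using blocks_pencil_pencils[of bs] by (auto simp: pencils_def)
    have e: "blocks_pencil (c # bs) =
      (four_block_mat (fst (block_pencil c)) (0\<^sub>m ?k ?N) (0\<^sub>m ?N ?k) (fst (blocks_pencil bs)),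
       four_block_mat (snd (block_pencil c)) (0\<^sub>m ?k ?N) (0\<^sub>m ?N ?k) (snd (blocks_pencil bs)))"
      using C D by (simp add: blocks_pencil_def diag_pencil_def Let_def)
    have "form (blocks_pencil (c # bs)) b i j = (if i < ?k then if j < ?k then form (block_pencil c) b i j else 0
      else if j < ?k then 0 else form (blocks_pencil bs) b (i - ?k) (j - ?k))"
      unfolding e form_def using C D ij by (cases b) auto
    also have "\<dots> = bform (c # bs) b (?p i) (?p j)"
      using \<pi>(2) ij by (auto simp: bform_def)
    finally show ?thesis .
  qed
  ultimately show ?case by (intro exI[of _ ?p]) auto
qed

lemma card_bindex: "card (bindex bs) = (\<Sum>b\<leftarrow>bs. block_size b)"
  by (simp add: bindex_def sum_list_sum_nth atLeast0LessThan)

lemma blocks_pencil_congruent: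
  "form_congruent (bindex bs) (bform bs) {..<\<Sum>b\<leftarrow>bs. block_size b} (form (blocks_pencil bs))"
proof -
  obtain \<pi> where \<pi>: "bij_betw \<pi> {..<\<Sum>b\<leftarrow>bs. block_size b} (bindex bs)"
    "\<forall>b. \<forall>i<\<Sum>b\<leftarrow>bs. block_size b. \<forall>j<\<Sum>b\<leftarrow>bs. block_size b.
      form (blocks_pencil bs) b i j = bform bs b (\<pi> i) (\<pi> j)"
    using blocks_pencil_bij[of bs] by (elim exE conjE) (rule that)
  show ?thesis by (rule form_congruent_bij[OF _ _ \<pi>(1)]) (use \<pi>(2) in auto)
qed

lemma bform_sym: "p \<in> bindex bs \<Longrightarrow> q \<in> bindex bs \<Longrightarrow> bform bs b p q = bform bs b q p"
  using block_pencil_symmetric[of "bs ! fst q"]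
  by (auto simp: bform_def bindex_def symmetric_pencils_iff)

lemma form_M_pencil:
  assumes "i < 2 * d + 1" "j < 2 * d + 1"
  shows "form (M_pencil d) b i j =
    (if i \<le> d \<and> d < j then if i = j - (d + 1) + (if b then 0 else 1) then 1 else 0
     else if d < i \<and> j \<le> d then if j = i - (d + 1) + (if b then 0 else 1) then 1 else 0 else 0)"
  using assms by (cases b) (auto simp: form_def M_pencil_def off_diag_sym_def G_mat_def F_mat_def)

lemma form_J_pencil:
  assumes "i < k" "j < k"
  shows "form (J_pencil k (Fin \<mu>)) b i j = (if i + j + 1 = k then if b then 1 else - \<mu>
      else if i + j + 2 = k then if b then 0 else 1 else 0)"
    "form (J_pencil k Infty) b i j = (if i + j + 1 = k then if b then 0 else 1
      else if i + j + 2 = k then if b then 1 else 0 else 0)"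
  using assms by (cases b; simp add: form_def)+

section \<open>The flag given by the singular blocks\<close>

definition mpos :: "'e block list \<Rightarrow> nat set" where
  "mpos bs = {l. l < length bs \<and> (\<exists>d. bs ! l = M_block d)}"

definition dval :: "'e block list \<Rightarrow> nat \<Rightarrow> nat" where
  "dval bs l = (case bs ! l of M_block d \<Rightarrow> d | J_block k e \<Rightarrow> 0)"

text \<open>For a block \<open>M\<^sub>d\<close>, these are the first \<open>d + 1\<close> and the last \<open>d\<close> of the basis vectors.\<close>

definition vindex :: "'e block list \<Rightarrow> (nat \<times> nat) set" where
  "vindex bs = Sigma (mpos bs) (\<lambda>l. {..dval bs l})"

definition uindex :: "'e block list \<Rightarrow> (nat \<times> nat) set" where
  "uindex bs = Sigma (mpos bs) (\<lambda>l. {dval bs l<..2 * dval bs l})"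

lemma finite_mpos [simp]: "finite (mpos bs)"
  by (simp add: mpos_def)

lemma vindex_sub: "vindex bs \<subseteq> bindex bs" and uindex_sub: "uindex bs \<subseteq> bindex bs"
  by (auto simp: vindex_def uindex_def bindex_def mpos_def dval_def)

lemma card_vindex: "card (vindex bs) = card (mpos bs) + (\<Sum>l\<in>mpos bs. dval bs l)"
  by (simp add: vindex_def sum_Suc)

lemma card_uindex: "card (uindex bs) = (\<Sum>l\<in>mpos bs. dval bs l)"
  by (simp add: uindex_def)

lemma mpos_map [simp]: "mpos (map (map_block f) bs) = mpos bs"
proof -
  have *: "(\<exists>d. map_block f c = M_block d) \<longleftrightarrow> (\<exists>d. c = M_block d)" for c by (cases c) auto
  have "l \<in> mpos (map (map_block f) bs) \<longleftrightarrow> l \<in> mpos bs" for l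
    using *[of "bs ! l"] by (cases "l < length bs") (simp_all add: mpos_def)
  then show ?thesis by blast
qed

lemma dval_map: "l \<in> mpos bs \<Longrightarrow> dval (map (map_block f) bs) l = dval bs l"
  by (auto simp: mpos_def dval_def)

lemma block_size_map [simp]: "block_size (map_block f c) = block_size c"
  by (cases c) auto

text \<open>A basis vector in \<open>vindex\<close> pairs only with vectors of \<open>uindex\<close>
  in its own block. For \<open>K_pencil\<close> the dimensions are \<open>n - r + a\<close> and
  \<open>n - a\<close>.\<close>

lemma isotropic_flag_blocks:
  "isotropic_flag (bindex bs) (bform bs) (card (vindex bs)) (card (bindex bs) - card (uindex bs))"
proof -
  have "vindex bs \<inter> uindex bs = {}" by (auto simp: vindex_def uindex_def)
  then have sub: "vindex bs \<subseteq> bindex bs - uindex bs" using vindex_sub[of bs] by blast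
  have *: "bform bs b p q = 0" if pv: "p \<in> vindex bs" and qv: "q \<in> bindex bs - uindex bs" for b p q
  proof (cases "fst p = fst q")
    case True
    obtain l d where l: "l < length bs" "bs ! l = M_block d" "fst p = l" "snd p \<le> d"
      using pv by (auto simp: vindex_def mpos_def dval_def)
    then have "snd q < 2 * d + 1" "snd q \<le> d"
      using qv True by (cases q; auto simp: bindex_def uindex_def mpos_def dval_def not_less)+
    then show ?thesis using l True by (simp add: bform_def form_M_pencil)
  qed (simp add: bform_def)
  have "isotropic_flag (bindex bs) (bform bs) (card (vindex bs)) (card (bindex bs - uindex bs))"
    by (rule isotropic_flag_supported[OF finite_bindex sub Diff_subset]) (rule *)
  then show ?thesis
    by (simp only: card_Diff_subset[OF finite_subset[OF uindex_sub finite_bindex] uindex_sub])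
qed

lemma sum_bform:
  assumes "(l, i) \<in> bindex bs"
  shows "(\<Sum>q\<in>bindex bs. (\<zeta> * bform bs True (l, i) q + bform bs False (l, i) q) * x q) =
    (\<Sum>j<block_size (bs ! l). (\<zeta> * form (block_pencil (bs ! l)) True i j + form (block_pencil (bs ! l)) False i j) * x (l, j))"
proof -
  have "(\<Sum>q\<in>bindex bs. (\<zeta> * bform bs True (l, i) q + bform bs False (l, i) q) * x q) =
      (\<Sum>q\<in>Pair l ` {..<block_size (bs ! l)}. (\<zeta> * bform bs True (l, i) q + bform bs False (l, i) q) * x q)"
    using assms by (intro sum.mono_neutral_right) (auto simp: bindex_def bform_def)
  also have "\<dots> = (\<Sum>j<block_size (bs ! l). (\<zeta> * bform bs True (l, i) (l, j) + bform bs False (l, i) (l, j)) * x (l, j))"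
    by (subst sum.reindex) (auto simp: inj_on_def)
  finally show ?thesis by (simp add: bform_def)
qed

section \<open>Kernels of the blocks\<close>

text \<open>Row \<open>k - 1 - j\<close> involves only \<open>x j\<close> and
  \<open>x (j - 1)\<close>, so the coordinates vanish one after another. Blocks with a finite
  eigenvalue have \<open>a = \<zeta> - \<mu>\<close> and \<open>b = 1\<close>, those at infinity
  \<open>a = 1\<close> and \<open>b = \<zeta>\<close>.\<close>

lemma antitriangular_kernel:
  fixes x :: "nat \<Rightarrow> complex"
  assumes a: "a \<noteq> 0"
    and z: "\<And>i. i < k \<Longrightarrow> (\<Sum>j<k. (if i + j + 1 = k then a else if i + j + 2 = k then b else 0) * x j) = 0"
  shows "j < k \<Longrightarrow> x j = 0"
proof (induction j)
  case 0
  have "(\<Sum>j<k. (if k - 1 + j + 1 = k then a else if k - 1 + j + 2 = k then b else 0) * x j)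
      = (\<Sum>j<k. if j = 0 then a * x 0 else 0)"
    using 0 by (intro sum.cong) auto
  then show ?case using z[of "k - 1"] 0 a by simp
next
  case (Suc j)
  let ?i = "k - 1 - Suc j"
  have "(\<Sum>l<k. (if ?i + l + 1 = k then a else if ?i + l + 2 = k then b else 0) * x l)
      = (\<Sum>l<k. if l = Suc j then a * x (Suc j) else 0)"
  proof (rule sum.cong)
    fix l assume "l \<in> {..<k}"
    have "?i + l + 1 = k \<longleftrightarrow> l = Suc j" "?i + l + 2 = k \<longleftrightarrow> l = j" using Suc.prems by auto
    then show "(if ?i + l + 1 = k then a else if ?i + l + 2 = k then b else 0) * x l =
        (if l = Suc j then a * x (Suc j) else 0)"
      using Suc by simp
  qed simp
  then show ?case using z[of ?i] Suc.prems a by simp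
qed

text \<open>The last \<open>d\<close> rows give the recursion
  \<open>x (r + 1) = - \<zeta> * x r\<close> for the first \<open>d + 1\<close> coordinates. The
  rows \<open>1\<close> to \<open>d\<close> determine the last \<open>d\<close> coordinates from the
  end backwards, and the last of them is 0.\<close>

lemma M_kernel:
  fixes x :: "nat \<Rightarrow> complex"
  assumes z: "\<And>i. i < 2 * d + 1 \<Longrightarrow>
    (\<Sum>j<2 * d + 1. (\<zeta> * form (M_pencil d) True i j + form (M_pencil d) False i j) * x j) = 0"
  shows "i \<le> d \<Longrightarrow> x i = (- \<zeta>) ^ i * x 0" "d < i \<Longrightarrow> i < 2 * d + 1 \<Longrightarrow> x i = 0"
proof -
  have "x (Suc r) = - \<zeta> * x r" if r: "r < d" for r
  proof -
    have "(\<Sum>j<2 * d + 1. (\<zeta> * form (M_pencil d) True (d + 1 + r) j + form (M_pencil d) False (d + 1 + r) j) * x j)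
        = (\<Sum>j<2 * d + 1. (if j = r then \<zeta> * x r else 0) + (if j = Suc r then x (Suc r) else 0))"
      using r by (intro sum.cong refl) (auto simp: form_M_pencil)
    also have "\<dots> = \<zeta> * x r + x (Suc r)" using r by (simp add: sum.distrib)
    finally show ?thesis using z[of "d + 1 + r"] r by (simp add: add_eq_0_iff)
  qed
  note up = this
  show "i \<le> d \<Longrightarrow> x i = (- \<zeta>) ^ i * x 0"
    by (induction i) (auto simp: up)
  have dn: "x (d + 1 + r) = 0" if "r < d" for r
    using that
  proof (induction "d - r" arbitrary: r rule: less_induct)
    case less
    have "(\<Sum>j<2 * d + 1. (\<zeta> * form (M_pencil d) True (Suc r) j + form (M_pencil d) False (Suc r) j) * x j)
        = (\<Sum>j<2 * d + 1. (if j = d + 1 + Suc r then \<zeta> * x (d + 1 + Suc r) else 0)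
            + (if j = d + 1 + r then x (d + 1 + r) else 0))"
      using less.prems by (intro sum.cong refl) (auto simp: form_M_pencil)
    also have "\<dots> = (if Suc r < d then \<zeta> * x (d + 1 + Suc r) else 0) + x (d + 1 + r)"
      using less.prems by (simp add: sum.distrib)
    also have "(if Suc r < d then \<zeta> * x (d + 1 + Suc r) else 0) = 0"
      using less.hyps[of "Suc r"] by auto
    finally show ?case using z[of "Suc r"] less.prems by simp
  qed
  show "d < i \<Longrightarrow> i < 2 * d + 1 \<Longrightarrow> x i = 0"
    using dn[of "i - (d + 1)"] by simp
qed

text \<open>The vector \<open>(1, -\<zeta>, \<zeta>\<^sup>2, \<dots>)\<close> spans the kernel of \<open>M\<^sub>d(\<zeta>)\<close>.\<close>

definition zvec :: "'e block list \<Rightarrow> complex \<Rightarrow> nat \<Rightarrow> nat \<times> nat \<Rightarrow> complex" where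
  "zvec bs \<zeta> l = (\<lambda>(l', i). if l' = l \<and> i \<le> dval bs l then (- \<zeta>) ^ i else 0)"

text \<open>Away from the eigenvalues the blocks \<open>J\<close> have trivial kernel, and each
  block \<open>M\<close> contributes one line.\<close>

lemma pker_bform:
  assumes proper: "\<forall>c\<in>set bs. proper_block c"
    and \<zeta>: "\<And>k. J_block k (Fin \<zeta>) \<notin> set bs"
  shows "pker (bindex bs) (bform bs) \<zeta> \<subseteq> fv.span (zvec bs \<zeta> ` mpos bs)"
proof
  fix x assume x: "x \<in> pker (bindex bs) (bform bs) \<zeta>"
  have row: "(\<Sum>j<block_size (bs ! l). (\<zeta> * form (block_pencil (bs ! l)) True i j + form (block_pencil (bs ! l)) False i j) * x (l, j)) = 0"
    if "(l, i) \<in> bindex bs" for l i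
  proof -
    have "pmul (bindex bs) (bform bs) \<zeta> x (l, i) = 0" using x by (simp add: pker_def)
    then show ?thesis using that sum_bform[OF that, of \<zeta> x] by (simp add: pmul_def lin_map_def)
  qed
  have xs: "x \<in> supported (bindex bs)" using x by (simp add: pker_def)
  have supp: "x q = 0" if "q \<notin> bindex bs" for q by (rule supportedD[OF xs that])
  have J: "x (l, j) = 0" if l: "l < length bs" "bs ! l = J_block k e" "j < k" for l k e j
  proof (cases e)
    case (Fin \<mu>)
    have "\<zeta> - \<mu> \<noteq> 0" using \<zeta>[of k] l nth_mem[OF l(1)] Fin by auto
    then show ?thesis
    proof (rule antitriangular_kernel[where x = "\<lambda>j. x (l, j)"])
      fix i assume i: "i < k"
      have "(\<Sum>j<k. (if i + j + 1 = k then \<zeta> - \<mu> else if i + j + 2 = k then 1 else 0) * x (l, j)) =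
          (\<Sum>j<k. (\<zeta> * form (J_pencil k (Fin \<mu>)) True i j + form (J_pencil k (Fin \<mu>)) False i j) * x (l, j))"
        using i by (intro sum.cong refl) (simp add: form_J_pencil del: J_pencil.simps)
      also have "\<dots> = 0" using row[of l i] l i Fin by (simp add: bindex_def)
      finally show "(\<Sum>j<k. (if i + j + 1 = k then \<zeta> - \<mu> else if i + j + 2 = k then 1 else 0) * x (l, j)) = 0" .
    qed (rule l(3))
  next
    case Infty
    show ?thesis
    proof (rule antitriangular_kernel[where x = "\<lambda>j. x (l, j)" and a = 1])
      fix i assume i: "i < k"
      have "(\<Sum>j<k. (if i + j + 1 = k then 1 else if i + j + 2 = k then \<zeta> else 0) * x (l, j)) =
          (\<Sum>j<k. (\<zeta> * form (J_pencil k Infty) True i j + form (J_pencil k Infty) False i j) * x (l, j))"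
        using i by (intro sum.cong refl) (simp add: form_J_pencil del: J_pencil.simps)
      also have "\<dots> = 0" using row[of l i] l i Infty by (simp add: bindex_def)
      finally show "(\<Sum>j<k. (if i + j + 1 = k then 1 else if i + j + 2 = k then \<zeta> else 0) * x (l, j)) = 0" .
    qed (use l(3) in simp_all)
  qed
  have M: "i \<le> d \<Longrightarrow> x (l, i) = (- \<zeta>) ^ i * x (l, 0)" "d < i \<Longrightarrow> i < 2 * d + 1 \<Longrightarrow> x (l, i) = 0"
    if l: "l < length bs" "bs ! l = M_block d" for l d i
  proof -
    have "(\<Sum>j<2 * d + 1. (\<zeta> * form (M_pencil d) True i j + form (M_pencil d) False i j) * x (l, j)) = 0"
      if "i < 2 * d + 1" for i
      using row[of l i] l that by (simp add: bindex_def)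
    from M_kernel[of d \<zeta> "\<lambda>j. x (l, j)", OF this]
    show "i \<le> d \<Longrightarrow> x (l, i) = (- \<zeta>) ^ i * x (l, 0)" "d < i \<Longrightarrow> i < 2 * d + 1 \<Longrightarrow> x (l, i) = 0"
      by blast+
  qed
  have "x = (\<Sum>l\<in>mpos bs. fscale (x (l, 0)) (zvec bs \<zeta> l))"
  proof
    fix q :: "nat \<times> nat"
    obtain l i where q: "q = (l, i)" by (cases q)
    have s: "(\<Sum>l\<in>mpos bs. fscale (x (l, 0)) (zvec bs \<zeta> l)) q =
        (\<Sum>l'\<in>mpos bs. if l' = l then (if i \<le> dval bs l then x (l, 0) * (- \<zeta>) ^ i else 0) else 0)"
      unfolding sum_apply q by (intro sum.cong) (auto simp: zvec_def)
    show "x q = (\<Sum>l\<in>mpos bs. fscale (x (l, 0)) (zvec bs \<zeta> l)) q"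
    proof (cases "l \<in> mpos bs")
      case True
      then obtain d where d: "l < length bs" "bs ! l = M_block d" by (auto simp: mpos_def)
      then have "dval bs l = d" by (simp add: dval_def)
      then show ?thesis
        unfolding s using True M[OF d, of i] supp[of "(l, i)"] d q
        by (cases "i < 2 * d + 1") (auto simp: bindex_def)
    next
      case False
      have "x (l, i) = 0"
      proof (cases "(l, i) \<in> bindex bs")
        case True
        then have "l < length bs" "i < block_size (bs ! l)" by (auto simp: bindex_def)
        then show ?thesis using False J[of l] by (cases "bs ! l") (auto simp: mpos_def)
      qed (rule supp)
      then show ?thesis unfolding s using False q by simp
    qed
  qed
  also have "\<dots> \<in> fv.span (zvec bs \<zeta> ` mpos bs)"
    by (intro fv.span_sum fv.span_scale fv.span_base) auto
  finally show "x \<in> fv.span (zvec bs \<zeta> ` mpos bs)" .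
qed

lemma perp_perp:
  assumes I: "finite I" and V: "fv.subspace V" "V \<subseteq> supported I"
    and x: "x \<in> supported I" "\<And>y. y \<in> supported I \<Longrightarrow> (\<forall>v\<in>V. pair I y v = 0) \<Longrightarrow> pair I x y = 0"
  shows "x \<in> V"
proof -
  let ?P = "{y \<in> supported I. \<forall>v\<in>V. pair I y v = 0}"
  let ?PP = "{x \<in> supported I. \<forall>y\<in>?P. pair I x y = 0}"
  have sub: "fv.subspace {x \<in> supported I. \<forall>y\<in>S. pair I x y = 0}" for S
    using subspace_supported[of I] unfolding fv.subspace_def by (auto simp: pair_linear)
  have le: "fv.dim V \<le> card I"
    using fin_dim_mono[OF fin_dim_supported[OF I order_refl] V(2)] dim_supported[OF I] by metis
  have "fv.dim ?P = card I - fv.dim V" by (rule dim_perp[OF I V])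
  then have "fv.dim ?PP = fv.dim V"
    using dim_perp[OF I sub[of V]] le by auto
  moreover have "V \<subseteq> ?PP" using V(2) by (auto simp: pair_def mult.commute)
  moreover have "fin_dim ?PP" by (rule fin_dim_supported[OF I]) auto
  ultimately have "V = ?PP" by (intro fin_dim_subspace_eq[OF _ _ V(1) sub]) auto
  moreover have "x \<in> ?PP" using x by blast
  ultimately show ?thesis by blast
qed

text \<open>Paired with a vector orthogonal to \<open>V\<close>, the curve becomes a polynomial in
  \<open>\<zeta>\<close> with infinitely many zeros. So each coefficient lies in the double
  orthogonal complement of \<open>V\<close>, which is \<open>V\<close>.\<close>

lemma polynomial_curve_in_subspace:
  assumes I: "finite I" and V: "fv.subspace V" "V \<subseteq> supported I" and v: "\<And>i. i \<le> d \<Longrightarrow> v i \<in> supported I"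
    and L: "infinite \<Lambda>" "\<And>\<zeta>. \<zeta> \<in> \<Lambda> \<Longrightarrow> (\<Sum>i\<le>d. fscale (\<zeta> ^ i) (v i)) \<in> V" and i: "i \<le> d"
  shows "v i \<in> V"
proof (rule perp_perp[OF I V v[OF i]])
  fix y assume y: "\<forall>w\<in>V. pair I y w = 0"
  have psum: "pair I y (\<Sum>i\<in>A. f i) = (\<Sum>i\<in>A. pair I y (f i))" if "finite A" for A and f :: "nat \<Rightarrow> 'a \<Rightarrow> complex"
    using that
  proof induction
    case empty
    show ?case by (simp only: sum.empty pair_linear)
  next
    case (insert i A)
    then show ?case by (simp only: sum.insert pair_linear not_False_eq_True if_True)
  qed
  let ?p = "\<Sum>i\<le>d. monom (pair I y (v i)) i"
  have "poly ?p \<zeta> = 0" if "\<zeta> \<in> \<Lambda>" for \<zeta>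
  proof -
    have "pair I y (\<Sum>i\<le>d. fscale (\<zeta> ^ i) (v i)) = 0" using y L(2)[OF that] by blast
    then show ?thesis by (simp add: psum pair_linear poly_sum poly_monom mult.commute)
  qed
  then have "infinite {\<zeta>. poly ?p \<zeta> = 0}" using infinite_super[OF _ L(1), of "{\<zeta>. poly ?p \<zeta> = 0}"] by blast
  then have "?p = 0" by (rule contrapos_np) (rule poly_roots_finite)
  moreover have "coeff ?p i = pair I y (v i)" using i by (simp add: coeff_sum)
  ultimately have "pair I y (v i) = 0" by simp
  then show "pair I (v i) y = 0" by (simp add: pair_def mult.commute)
qed

text \<open>At all but finitely many \<open>\<zeta>\<close> the kernel has at most as many
  dimensions as there are blocks \<open>M\<close>; \<open>dim_pker_ge\<close> turns this into the
  bound. In the case of equality \<open>V\<close> contains these kernels, hence the curves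
  \<open>zvec\<close>, hence their coefficients, which are the unit vectors in \<open>vindex\<close>
  up to sign.\<close>

lemma flag_contains_vindex:
  assumes proper: "\<forall>c\<in>set bs. proper_block c"
    and V: "fv.subspace V" "fv.subspace N" "V \<subseteq> supported (bindex bs)" "N \<subseteq> supported (bindex bs)"
    and z: "\<And>b x y. x \<in> V \<Longrightarrow> y \<in> N \<Longrightarrow> bil (bindex bs) (bform bs b) x y = 0"
  shows "fv.dim V + fv.dim N \<le> card (bindex bs) + card (mpos bs)"
    and "fv.dim V + fv.dim N = card (bindex bs) + card (mpos bs) \<Longrightarrow> supported (vindex bs) \<subseteq> V"
proof -
  let ?I = "bindex bs"
  let ?E = "{\<zeta>. \<exists>k. J_block k (Fin \<zeta>) \<in> set bs}"
  have "?E \<subseteq> (\<lambda>c. case c of J_block k (Fin \<mu>) \<Rightarrow> \<mu> | _ \<Rightarrow> 0) ` set bs"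
    by (force intro: image_eqI[rotated])
  then have finE: "finite ?E" by (rule finite_subset) simp
  let ?S = "\<lambda>\<zeta>. {x \<in> V. pmul ?I (bform bs) \<zeta> x = 0}"
  let ?Z = "\<lambda>\<zeta>. fv.span (zvec bs \<zeta> ` mpos bs)"
  have dZ: "fv.dim (?Z \<zeta>) \<le> card (mpos bs)" for \<zeta>
    using fv.dim_le_card[OF order_refl, of "zvec bs \<zeta> ` mpos bs"] card_image_le[of "mpos bs" "zvec bs \<zeta>"] by simp
  have fdZ: "fin_dim (?Z \<zeta>)" for \<zeta> unfolding fin_dim_def by (rule exI[of _ "zvec bs \<zeta> ` mpos bs"]) simp
  have SZ: "?S \<zeta> \<subseteq> ?Z \<zeta>" if "\<zeta> \<notin> ?E" for \<zeta>
    using pker_bform[OF proper, of \<zeta>] that V(3) by (auto simp: pker_def)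
  have dim: "fv.dim V + fv.dim N \<le> card ?I + fv.dim (?S \<zeta>)" for \<zeta>
    by (rule dim_pker_ge[OF finite_bindex bform_sym V z])
  obtain \<zeta>0 where \<zeta>0: "\<zeta>0 \<notin> ?E" using ex_new_if_finite[OF infinite_UNIV_char_0 finE] by blast
  have "fv.dim (?S \<zeta>0) \<le> card (mpos bs)"
    using fin_dim_mono[OF fdZ SZ[OF \<zeta>0]] dZ[of \<zeta>0] by linarith
  then show "fv.dim V + fv.dim N \<le> card ?I + card (mpos bs)" using dim[of \<zeta>0] by linarith
  assume eq: "fv.dim V + fv.dim N = card ?I + card (mpos bs)"
  have zV: "zvec bs \<zeta> l \<in> V" if "\<zeta> \<notin> ?E" "l \<in> mpos bs" for \<zeta> l
  proof -
    have "fv.dim (?Z \<zeta>) \<le> fv.dim (?S \<zeta>)" using dim[of \<zeta>] eq dZ[of \<zeta>] by linarith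
    then have "?S \<zeta> = ?Z \<zeta>"
      by (intro fin_dim_subspace_eq[OF fdZ SZ[OF that(1)]] subspace_kernel[OF V(1) linear_pmul] fv.subspace_span)
    then show ?thesis using fv.span_base[of "zvec bs \<zeta> l" "zvec bs \<zeta> ` mpos bs"] that(2) by blast
  qed
  have unit: "unit_fun q \<in> V" if q: "q \<in> vindex bs" for q
  proof -
    obtain l i where li: "q = (l, i)" "l \<in> mpos bs" "i \<le> dval bs l" using q by (auto simp: vindex_def)
    \<comment> \<open>The sign turns \<open>(- \<zeta>) ^ i\<close> into a power of
      \<open>\<zeta>\<close> times a fixed vector.\<close>
    let ?v = "\<lambda>i. fscale ((- 1) ^ i) (unit_fun (l, i))"
    have "?v i \<in> V"
    proof (rule polynomial_curve_in_subspace[OF finite_bindex V(1,3) _ _ _ li(3)])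
      fix j assume "j \<le> dval bs l"
      then have "(l, j) \<in> bindex bs" using li(2) vindex_sub[of bs] by (auto simp: vindex_def)
      then show "?v j \<in> supported ?I"
        by (intro fv.subspace_scale[OF subspace_supported] unit_fun_supported)
    next
      show "infinite (- ?E)" using finE by (simp add: finite_compl infinite_UNIV_char_0)
      fix \<zeta> assume "\<zeta> \<in> - ?E"
      then have "zvec bs \<zeta> l \<in> V" using zV li(2) by simp
      moreover have "zvec bs \<zeta> l = (\<Sum>i\<le>dval bs l. fscale (\<zeta> ^ i) (?v i))"
      proof
        fix q :: "nat \<times> nat"
        obtain l' j where q: "q = (l', j)" by (cases q)
        have "(\<Sum>i\<le>dval bs l. fscale (\<zeta> ^ i) (?v i)) q =
            (\<Sum>i\<le>dval bs l. if i = j then (if l' = l then (- \<zeta>) ^ j else 0) else 0)"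
          unfolding sum_apply by (intro sum.cong refl)
            (auto simp: q unit_fun_def power_mult_distrib[symmetric])
        also have "\<dots> = zvec bs \<zeta> l q" by (simp add: zvec_def q)
        finally show "zvec bs \<zeta> l q = (\<Sum>i\<le>dval bs l. fscale (\<zeta> ^ i) (?v i)) q" by simp
      qed
      ultimately show "(\<Sum>i\<le>dval bs l. fscale (\<zeta> ^ i) (?v i)) \<in> V" by simp
    qed
    then have "fscale ((- 1) ^ i) (?v i) \<in> V" by (rule fv.subspace_scale[OF V(1)])
    then show ?thesis using li(1) by (simp add: power_mult_distrib[symmetric])
  qed
  have "finite (vindex bs)" by (rule finite_subset[OF vindex_sub finite_bindex])
  moreover have "unit_fun ` vindex bs \<subseteq> V" using unit by blast
  then have "fv.span (unit_fun ` vindex bs) \<subseteq> V" by (rule fv.span_minimal[OF _ V(1)])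
  ultimately show "supported (vindex bs) \<subseteq> V" by (simp only: span_unit_fun)
qed

lemma isotropic_flag_blocks_bound:
  assumes "\<forall>c\<in>set bs. proper_block c" "isotropic_flag (bindex bs) (bform bs) p q"
  shows "p + q \<le> card (bindex bs) + card (mpos bs)"
    "p + q = card (bindex bs) + card (mpos bs) \<Longrightarrow> card (vindex bs) \<le> p"
proof -
  obtain V N where V: "fv.subspace V" "fv.subspace N" "V \<subseteq> N" "N \<subseteq> supported (bindex bs)" "fv.dim V = p" "fv.dim N = q"
    "\<And>b x y. x \<in> V \<Longrightarrow> y \<in> N \<Longrightarrow> bil (bindex bs) (bform bs b) x y = 0"
    using assms(2) unfolding isotropic_flag_def by blast
  have VI: "V \<subseteq> supported (bindex bs)" using V by blast
  note F = flag_contains_vindex[OF assms(1) V(1,2) VI V(4,7)]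
  show "p + q \<le> card (bindex bs) + card (mpos bs)" using F(1) V(5,6) by simp
  assume "p + q = card (bindex bs) + card (mpos bs)"
  then have "supported (vindex bs) \<subseteq> V" using F(2) V(5,6) by simp
  from fin_dim_mono[OF fin_dim_supported[OF finite_bindex VI] this]
  show "card (vindex bs) \<le> p"
    using dim_supported[OF finite_subset[OF vindex_sub finite_bindex], of bs] V(5) by simp
qed

lemma bil_unit_left:
  assumes "finite I" "p \<in> I"
  shows "bil I Q (unit_fun p) y = (\<Sum>q\<in>I. Q p q * y q)"
proof -
  have "bil I Q (unit_fun p) y = (\<Sum>p'\<in>I. if p' = p then (\<Sum>q\<in>I. Q p q * y q) else 0)"
    unfolding bil_def unit_fun_def by (intro sum.cong refl) auto
  then show ?thesis using assms by simp
qed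

text \<open>Modulo the forced part \<open>vindex\<close>, the flag lives in the eigenvalue
  coordinates, where \<open>A\<close> is the identity and \<open>B\<close> is diagonal. There
  \<open>V\<close> is the complement of \<open>N\<close> and is stable under multiplication by the
  eigenvalues. As these are distinct, a nonzero \<open>V\<close> contains a vector with a single
  nonzero coordinate, which is not isotropic for \<open>A\<close>.\<close>

lemma isotropic_flag_distinct_eigenvalues:
  fixes bs :: "eigval block list" and ev :: "nat \<Rightarrow> complex"
  assumes J: "\<And>l. l < length bs \<Longrightarrow> l \<notin> mpos bs \<Longrightarrow> bs ! l = J_block 1 (Fin (ev l))"
    and ev: "inj_on ev ({..<length bs} - mpos bs)"
    and fl: "isotropic_flag (bindex bs) (bform bs) p q"
    and pq: "p + q = card (bindex bs) + card (mpos bs)"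
  shows "p \<le> card (vindex bs)"
proof (rule ccontr)
  assume gt: "\<not> p \<le> card (vindex bs)"
  let ?I = "bindex bs"
  define W where "W = {..<length bs} - mpos bs"
  define widx where "widx = (\<lambda>l. (l, 0 :: nat)) ` W"
  have finw: "finite widx" by (simp add: widx_def W_def)
  have finv: "finite (vindex bs)" and finu: "finite (uindex bs)"
    using finite_subset[OF vindex_sub finite_bindex] finite_subset[OF uindex_sub finite_bindex] by auto
  have proper: "\<forall>c\<in>set bs. proper_block c"
  proof
    fix c assume "c \<in> set bs"
    then obtain l where l: "l < length bs" "c = bs ! l" by (auto simp: in_set_conv_nth)
    show "proper_block c"
    proof (cases "l \<in> mpos bs")
      case True
      then obtain d where "bs ! l = M_block d" by (auto simp: mpos_def)
      then show ?thesis by (simp add: l(2))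
    next
      case False
      then show ?thesis by (simp add: l(2) J[OF l(1)])
    qed
  qed
  have I: "?I = vindex bs \<union> uindex bs \<union> widx"
  proof (intro equalityI subsetI)
    fix x assume "x \<in> ?I"
    then obtain l i where x: "x = (l, i)" "l < length bs" "i < block_size (bs ! l)" by (auto simp: bindex_def)
    show "x \<in> vindex bs \<union> uindex bs \<union> widx"
    proof (cases "l \<in> mpos bs")
      case True
      then obtain d where "bs ! l = M_block d" by (auto simp: mpos_def)
      then show ?thesis using x True by (auto simp: vindex_def uindex_def dval_def)
    next
      case False
      then show ?thesis using x J[of l] by (auto simp: widx_def W_def)
    qed
  next
    fix x assume x: "x \<in> vindex bs \<union> uindex bs \<union> widx"
    have "widx \<subseteq> ?I" using J by (auto simp: widx_def W_def bindex_def)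
    then show "x \<in> ?I" using x vindex_sub[of bs] uindex_sub[of bs] by blast
  qed
  have disj: "vindex bs \<inter> uindex bs = {}" "(vindex bs \<union> uindex bs) \<inter> widx = {}"
    by (auto simp: vindex_def uindex_def widx_def W_def)
  have cardI: "card ?I = card (vindex bs) + card (uindex bs) + card widx"
    unfolding I using disj finv finu finw by (simp add: card_Un_disjoint)
  obtain V N where V: "fv.subspace V" "fv.subspace N" "V \<subseteq> N" "N \<subseteq> supported ?I" "fv.dim V = p" "fv.dim N = q"
    "\<And>b x y. x \<in> V \<Longrightarrow> y \<in> N \<Longrightarrow> bil ?I (bform bs b) x y = 0"
    using fl unfolding isotropic_flag_def by blast
  have VI: "V \<subseteq> supported ?I" using V by blast
  have vV: "supported (vindex bs) \<subseteq> V"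
    using flag_contains_vindex(2)[OF proper V(1,2) VI V(4,7)] V(5,6) pq by simp
  \<comment> \<open>The matrix \<open>A\<close> pairs the basis vector \<open>u\<close> with a
    single other one, which belongs to \<open>vindex\<close> and so to \<open>V\<close>.\<close>
  have N0: "y u = 0" if y: "y \<in> N" and u: "u \<in> uindex bs" for y u
  proof -
    obtain l i where li: "u = (l, i)" "l \<in> mpos bs" "dval bs l < i" "i \<le> 2 * dval bs l"
      using u by (auto simp: uindex_def)
    obtain d where d: "l < length bs" "bs ! l = M_block d" using li(2) by (auto simp: mpos_def)
    then have dv: "dval bs l = d" by (simp add: dval_def)
    let ?r = "i - (d + 1)"
    have r: "(l, ?r) \<in> vindex bs" using li dv by (auto simp: vindex_def)
    have rI: "(l, ?r) \<in> ?I" using r vindex_sub by blast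
    have uI: "u \<in> ?I" using u uindex_sub by blast
    have "unit_fun (l, ?r) \<in> V" using vV unit_fun_supported[OF r] by blast
    then have "bil ?I (bform bs True) (unit_fun (l, ?r)) y = 0" using V(7) y by blast
    moreover have "bil ?I (bform bs True) (unit_fun (l, ?r)) y = (\<Sum>x\<in>?I. if x = u then y u else 0)"
      unfolding bil_unit_left[OF finite_bindex rI]
    proof (rule sum.cong)
      fix x assume x: "x \<in> ?I"
      show "bform bs True (l, ?r) x * y x = (if x = u then y u else 0)"
      proof (cases "fst x = l")
        case True
        then have sx: "snd x < 2 * d + 1" using x d(2) by (auto simp: bindex_def)
        have r': "?r < 2 * d + 1" "?r \<le> d" "d < i" "i = ?r + (d + 1)" using li dv by simp_all
        have "form (M_pencil d) True ?r (snd x) = (if snd x = i then 1 else 0)"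
          unfolding form_M_pencil[OF r'(1) sx] using r'(2-4) by auto
        moreover have "x = u \<longleftrightarrow> snd x = i" using True li(1) by (simp add: prod_eq_iff)
        ultimately show ?thesis using True d(2) by (auto simp: bform_def)
      next
        case False
        then show ?thesis using li by (auto simp: bform_def)
      qed
    qed simp
    ultimately show ?thesis using uI by simp
  qed
  define cf where "cf b l = (if b then 1 else - ev l)" for b l
  \<comment> \<open>On \<open>N\<close> only the eigenvalue coordinates contribute, and there both
    matrices are diagonal.\<close>
  have bilW: "bil ?I (bform bs b) x y = (\<Sum>w\<in>widx. cf b (fst w) * x w * y w)" if "x \<in> N" "y \<in> N" for b x y
  proof -
    have t: "x p * bform bs b p q * y q = (if p \<in> widx \<and> q = p then cf b (fst p) * x p * y p else 0)"
      if pI: "p \<in> ?I" and qI: "q \<in> ?I" for p q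
    proof (cases "p \<in> uindex bs \<or> q \<in> uindex bs")
      case True
      then have "x p = 0 \<or> y q = 0" using N0 \<open>x \<in> N\<close> \<open>y \<in> N\<close> by blast
      moreover have "p \<notin> widx \<or> q \<noteq> p \<or> x p = 0 \<or> y p = 0" using True disj by blast
      ultimately show ?thesis by auto
    next
      case False
      then have pq: "p \<in> vindex bs \<union> widx" "q \<in> vindex bs \<union> widx" using pI qI I by auto
      show ?thesis
      proof (cases "p \<in> widx")
        case True
        then obtain l where l: "p = (l, 0)" "l \<in> W" by (auto simp: widx_def)
        then have bl: "bs ! l = J_block 1 (Fin (ev l))" using J by (simp add: W_def)
        show ?thesis
        proof (cases "q = p")
          case True
          have "bform bs b p p = cf b l"
            using l(1) bl by (simp add: bform_def form_J_pencil cf_def del: J_pencil.simps)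
          then show ?thesis using True \<open>p \<in> widx\<close> l by simp
        next
          case False
          then have "fst q \<noteq> l" using pq(2) l by (auto simp: widx_def vindex_def W_def)
          then show ?thesis using False l by (simp add: bform_def)
        qed
      next
        case False
        then obtain l i where l: "p = (l, i)" "l \<in> mpos bs" "i \<le> dval bs l" using pq(1) by (auto simp: vindex_def)
        then obtain d where d: "bs ! l = M_block d" "dval bs l = d" by (auto simp: mpos_def dval_def)
        have "bform bs b p q = 0"
        proof (cases "fst q = l")
          case True
          then have "snd q \<le> d" using pq(2) l d by (auto simp: widx_def vindex_def W_def)
          then show ?thesis using True l d by (simp add: bform_def form_M_pencil)
        qed (use l in \<open>simp add: bform_def\<close>)
        then show ?thesis using False by simp
      qed
    qed
    have "bil ?I (bform bs b) x y = (\<Sum>p\<in>?I. \<Sum>q\<in>?I. if q = p then (if p \<in> widx then cf b (fst p) * x p * y p else 0) else 0)"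
      unfolding bil_def using t by (intro sum.cong refl) auto
    also have "\<dots> = (\<Sum>p\<in>?I. if p \<in> widx then cf b (fst p) * x p * y p else 0)"
      by (intro sum.cong refl) simp
    also have "\<dots> = (\<Sum>p\<in>widx. cf b (fst p) * x p * y p)"
      by (intro sum.mono_neutral_cong_right[OF finite_bindex]) (auto simp: I)
    finally show ?thesis .
  qed
  \<comment> \<open>Projection to the coordinates in \<open>vindex\<close>; its kernel on a member
    of the flag is the part in the eigenvalue coordinates.\<close>
  let ?f = "lin_map (vindex bs) ?I (\<lambda>i j. if i = j then 1 else 0)"
  have f: "?f x i = (if i \<in> vindex bs then x i else 0)" for x i
    using vindex_sub[of bs] by (auto simp: lin_map_def sum_delta_mult)
  have split: "fv.dim S = card (vindex bs) + fv.dim (S \<inter> supported widx)" and subS: "fv.subspace (S \<inter> supported widx)"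
    if S: "fv.subspace S" "supported (vindex bs) \<subseteq> S" "S \<subseteq> N" for S
  proof -
    have SI: "S \<subseteq> supported ?I" using S V by blast
    have "?f ` S = supported (vindex bs)"
    proof (intro equalityI subsetI)
      fix x assume x: "x \<in> supported (vindex bs)"
      then have "?f x = x" by (auto simp: f fun_eq_iff supported_def)
      moreover have "x \<in> S" using S(2) x by (rule subsetD)
      ultimately show "x \<in> ?f ` S" by (rule image_eqI[OF sym])
    qed (auto simp: lin_map_supported)
    moreover have "{x \<in> S. ?f x = 0} = S \<inter> supported widx"
    proof (intro equalityI subsetI)
      fix x assume x: "x \<in> {x \<in> S. ?f x = 0}"
      have "x i = 0" if i: "i \<notin> widx" for i
      proof (cases "i \<in> vindex bs")
        case True then show ?thesis using f[of x i] x by simp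
      next
        case False
        show ?thesis
        proof (cases "i \<in> uindex bs")
          case True then show ?thesis using N0 x S(3) by blast
        next
          case False
          then have "i \<notin> ?I" using i \<open>i \<notin> vindex bs\<close> I by blast
          moreover have "x \<in> supported ?I" using x SI by blast
          ultimately show ?thesis by (intro supportedD)
        qed
      qed
      then show "x \<in> S \<inter> supported widx" using x by (simp add: supported_def)
    next
      fix x assume x: "x \<in> S \<inter> supported widx"
      have "?f x = 0" using x disj(2) by (auto simp: f fun_eq_iff supported_def)
      then show "x \<in> {x \<in> S. ?f x = 0}" using x by simp
    qed
    ultimately show "fv.dim S = card (vindex bs) + fv.dim (S \<inter> supported widx)"
      using rank_nullity[OF S(1) fin_dim_supported[OF finite_bindex SI] linear_lin_map[of "vindex bs" ?I "\<lambda>i j. if i = j then 1 else 0"]]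
        dim_supported[OF finv] by simp
    show "fv.subspace (S \<inter> supported widx)" by (intro fv.subspace_inter S subspace_supported)
  qed
  have vN: "supported (vindex bs) \<subseteq> N" using vV V(3) by blast
  let ?V = "V \<inter> supported widx" and ?N = "N \<inter> supported widx"
  let ?T = "{x \<in> supported widx. \<forall>y\<in>?N. pair widx x y = 0}"
  have dV: "p = card (vindex bs) + fv.dim ?V" using split(1)[OF V(1) vV V(3)] V(5) by simp
  have dN: "q = card (vindex bs) + fv.dim ?N" using split(1)[OF V(2) vN order_refl] V(6) by simp
  have "fv.dim ?T = card widx - fv.dim ?N"
    by (rule dim_perp[OF finw]) (use subS[OF V(2) vN order_refl] in auto)
  \<comment> \<open>By \<open>pq\<close> the two members of the flag have complementary dimensions
    in the eigenvalue coordinates.\<close>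
  moreover have "card widx - fv.dim ?N = fv.dim ?V"
    using dV dN pq cardI card_vindex[of bs] card_uindex[of bs] by linarith
  ultimately have dT: "fv.dim ?T = fv.dim ?V" by simp
  have "?V \<subseteq> ?T"
  proof
    fix x assume x: "x \<in> ?V"
    have "pair widx x y = 0" if "y \<in> ?N" for y
    proof -
      have "bil ?I (bform bs True) x y = 0" using V(7) x that by blast
      moreover have "bil ?I (bform bs True) x y = pair widx x y"
        using bilW[of x y True] x that V(3) by (auto simp: cf_def pair_def)
      ultimately show ?thesis by simp
    qed
    then show "x \<in> ?T" using x by blast
  qed
  moreover have "fv.subspace ?T"
    using subspace_supported[of widx] unfolding fv.subspace_def by (auto simp: pair_linear)
  moreover have "fin_dim ?T" by (rule fin_dim_supported[OF finw]) auto
  ultimately have VT: "?V = ?T"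
    using dT subS[OF V(1) vV V(3)] by (intro fin_dim_subspace_eq) auto
  \<comment> \<open>Orthogonality under \<open>B\<close> to \<open>?N\<close> says that
    multiplication by the eigenvalues leads back into the complement of \<open>?N\<close>, which is
    \<open>?V\<close>.\<close>
  have D: "(\<lambda>w. ev (fst w) * x w) \<in> ?V" if x: "x \<in> ?V" for x
  proof -
    have "pair widx (\<lambda>w. ev (fst w) * x w) y = 0" if y: "y \<in> ?N" for y
    proof -
      have "bil ?I (bform bs False) x y = 0" using V(7) x y by blast
      moreover have "bil ?I (bform bs False) x y = - pair widx (\<lambda>w. ev (fst w) * x w) y"
        using bilW[of x y False] x y V(3) by (auto simp: cf_def pair_def sum_negf)
      ultimately show ?thesis by simp
    qed
    moreover have "(\<lambda>w. ev (fst w) * x w) \<in> supported widx" using x by (auto simp: supported_def)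
    ultimately show ?thesis unfolding VT by blast
  qed
  have "?V \<noteq> {0}"
  proof
    assume "?V = {0}"
    then have "fv.dim ?V = 0" by (simp add: dim_zero)
    then show False using gt dV by simp
  qed
  moreover have "0 \<in> ?V" using subS[OF V(1) vV V(3)] by (rule fv.subspace_0)
  ultimately have "\<exists>x. x \<in> ?V \<and> x \<noteq> 0" by blast
  from ex_has_least_nat[of "\<lambda>x. x \<in> ?V \<and> x \<noteq> 0", OF this[THEN someI_ex], of "\<lambda>x. card {w \<in> widx. x w \<noteq> 0}"]
  obtain x where x: "x \<in> ?V" "x \<noteq> 0"
    "\<And>y. y \<in> ?V \<Longrightarrow> y \<noteq> 0 \<Longrightarrow> card {w \<in> widx. x w \<noteq> 0} \<le> card {w \<in> widx. y w \<noteq> 0}" by blast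
  have xs: "x \<in> supported widx" using x(1) by blast
  obtain w0 where w0: "x w0 \<noteq> 0" using x(2) by (auto simp: fun_eq_iff)
  then have w0W: "w0 \<in> widx" using supportedD[OF xs] by blast
  \<comment> \<open>The coordinate \<open>w0\<close> cancels, so \<open>y\<close> has smaller
    support than \<open>x\<close>, whose support is minimal.\<close>
  define y where "y = (\<lambda>w. ev (fst w) * x w) - fscale (ev (fst w0)) x"
  have yw: "y w = (ev (fst w) - ev (fst w0)) * x w" for w by (simp add: y_def algebra_simps)
  have yV: "y \<in> ?V"
    unfolding y_def using subS[OF V(1) vV V(3)] D[OF x(1)] x(1) by (intro fv.subspace_diff fv.subspace_scale)
  have "{w \<in> widx. y w \<noteq> 0} \<subset> {w \<in> widx. x w \<noteq> 0}" using w0 w0W by (auto simp: yw)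
  then have "card {w \<in> widx. y w \<noteq> 0} < card {w \<in> widx. x w \<noteq> 0}" using finw by (intro psubset_card_mono) auto
  then have "y = 0" using x(3)[OF yV] by linarith
  then have y0: "(ev (fst w) - ev (fst w0)) * x w = 0" for w using yw[of w] by simp
  have only: "x w = 0" if "w \<in> widx" "w \<noteq> w0" for w
  proof -
    have "ev (fst w) \<noteq> ev (fst w0)"
      using ev that w0W unfolding W_def[symmetric] by (auto simp: widx_def inj_on_def)
    then show ?thesis using y0[of w] by simp
  qed
  have "bil ?I (bform bs True) x x = (\<Sum>w\<in>widx. if w = w0 then x w0 * x w0 else 0)"
  proof -
    have "x \<in> N" using x(1) V(3) by blast
    then have "bil ?I (bform bs True) x x = (\<Sum>w\<in>widx. x w * x w)" using bilW[of x x True] by (simp add: cf_def)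
    also have "\<dots> = (\<Sum>w\<in>widx. if w = w0 then x w0 * x w0 else 0)"
    proof (rule sum.cong)
      fix w assume "w \<in> widx"
      then show "x w * x w = (if w = w0 then x w0 * x w0 else 0)" using only[of w] by (cases "w = w0") simp_all
    qed simp
    finally show ?thesis .
  qed
  also have "\<dots> \<noteq> 0" using w0 w0W finw by simp
  finally show False using V(7)[of x x True] x(1) V(3) by blast
qed

text \<open>Each list of blocks imposes its flag on the other, and
  \<open>isotropic_flag_blocks_bound\<close> compares the counts in both directions. They fix the
  dimensions of the flag, so all canonical forms of a pencil yield flags of the same type.\<close>

lemma blocks_congruent_counts:
  assumes "\<forall>c\<in>set bs. proper_block c" "\<forall>c\<in>set bs'. proper_block c"
    and c: "form_congruent (bindex bs) (bform bs) (bindex bs') (bform bs')"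
    and card: "card (bindex bs) = card (bindex bs')"
  shows "card (mpos bs) = card (mpos bs')" "card (vindex bs) = card (vindex bs')"
proof -
  have le: "card (mpos bs') \<le> card (mpos bs) \<and> (card (mpos bs') = card (mpos bs) \<longrightarrow> card (vindex bs) \<le> card (vindex bs'))"
    if pr: "\<forall>c\<in>set bs. proper_block c"
      and c: "form_congruent (bindex bs) (bform bs) (bindex bs') (bform bs')"
      and card: "card (bindex bs) = card (bindex bs')" for bs bs'
  proof -
    have fl: "isotropic_flag (bindex bs) (bform bs) (card (vindex bs')) (card (bindex bs') - card (uindex bs'))"
      by (rule isotropic_flag_congruent[OF _ _ c isotropic_flag_blocks]) simp_all
    have "card (uindex bs') \<le> card (bindex bs')" by (rule card_mono[OF finite_bindex uindex_sub])
    then have "card (vindex bs') + (card (bindex bs') - card (uindex bs')) = card (bindex bs) + card (mpos bs')"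
      using card card_vindex[of bs'] card_uindex[of bs'] by simp
    then show ?thesis using isotropic_flag_blocks_bound[OF pr fl] by auto
  qed
  have c': "form_congruent (bindex bs') (bform bs') (bindex bs) (bform bs)"
    by (rule form_congruent_sym[OF _ _ c]) simp_all
  show "card (mpos bs) = card (mpos bs')" "card (vindex bs) = card (vindex bs')"
    using le[OF assms(1) c card] le[OF assms(2) c' card[symmetric]] by auto
qed

section \<open>The blocks of the generic pencils\<close>

definition kblocks :: "nat \<Rightarrow> nat \<Rightarrow> nat \<Rightarrow> complex list \<Rightarrow> eigval block list" where
  "kblocks n r a \<mu>s = replicate (a mod (n - r)) (M_block (a div (n - r) + 1)) @
     replicate (n - r - a mod (n - r)) (M_block (a div (n - r))) @ map (\<lambda>\<mu>. J_block 1 (Fin \<mu>)) \<mu>s"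

lemma K_pencil_kblocks: "K_pencil n r a \<mu>s = blocks_pencil (kblocks n r a \<mu>s)"
  by (simp add: K_pencil_def kblocks_def Let_def)

lemma kblocks_nth:
  assumes "r < n"
  shows "length (kblocks n r a \<mu>s) = n - r + length \<mu>s"
    "l < n - r \<Longrightarrow> kblocks n r a \<mu>s ! l = M_block (a div (n - r) + (if l < a mod (n - r) then 1 else 0))"
    "n - r \<le> l \<Longrightarrow> l < n - r + length \<mu>s \<Longrightarrow> kblocks n r a \<mu>s ! l = J_block 1 (Fin (\<mu>s ! (l - (n - r))))"
proof -
  have s: "a mod (n - r) < n - r" using assms by simp
  show "length (kblocks n r a \<mu>s) = n - r + length \<mu>s" using s by (simp add: kblocks_def)
  show "l < n - r \<Longrightarrow> kblocks n r a \<mu>s ! l = M_block (a div (n - r) + (if l < a mod (n - r) then 1 else 0))"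
    using s by (auto simp: kblocks_def nth_append)
  show "n - r \<le> l \<Longrightarrow> l < n - r + length \<mu>s \<Longrightarrow> kblocks n r a \<mu>s ! l = J_block 1 (Fin (\<mu>s ! (l - (n - r))))"
    using s by (auto simp: kblocks_def nth_append)
qed

lemma mpos_kblocks: "r < n \<Longrightarrow> mpos (kblocks n r a \<mu>s) = {..<n - r}"
proof -
  assume r: "r < n"
  have "l \<in> mpos (kblocks n r a \<mu>s) \<longleftrightarrow> l < n - r" for l
    using kblocks_nth[OF r, where a = a and \<mu>s = \<mu>s] by (cases "l < n - r") (auto simp: mpos_def not_less)
  then show ?thesis by auto
qed

lemma dval_kblocks: "r < n \<Longrightarrow> l < n - r \<Longrightarrow>
    dval (kblocks n r a \<mu>s) l = a div (n - r) + (if l < a mod (n - r) then 1 else 0)"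
  by (simp add: dval_def kblocks_nth)

text \<open>The indices of the singular blocks add up to
  \<open>(n - r) * (a div (n - r)) + a mod (n - r)\<close>.\<close>

lemma card_uindex_kblocks: "r < n \<Longrightarrow> card (uindex (kblocks n r a \<mu>s)) = a"
proof -
  assume r: "r < n"
  let ?m = "n - r"
  have s: "a mod ?m < ?m" using r by simp
  have "card (uindex (kblocks n r a \<mu>s)) = (\<Sum>l<?m. a div ?m + (if l < a mod ?m then 1 else 0))"
    unfolding card_uindex mpos_kblocks[OF r] using r by (intro sum.cong) (auto simp: dval_kblocks)
  also have "\<dots> = ?m * (a div ?m) + (\<Sum>l<?m. if l < a mod ?m then 1 else 0)" by (simp add: sum.distrib)
  also have "(\<Sum>l<?m. if l < a mod ?m then 1 else 0) = (\<Sum>l<a mod ?m. 1 :: nat)"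
    using s by (intro sum.mono_neutral_cong_right) auto
  finally show ?thesis by simp
qed

lemma card_vindex_kblocks: "r < n \<Longrightarrow> card (vindex (kblocks n r a \<mu>s)) = n - r + a"
  using card_vindex[of "kblocks n r a \<mu>s"] card_uindex[of "kblocks n r a \<mu>s"]
  by (simp add: card_uindex_kblocks mpos_kblocks)

lemma pencils_unique: "P \<in> pencils n \<Longrightarrow> P \<in> pencils n' \<Longrightarrow> n = n'"
  by (auto simp: pencils_def)

lemma K_pencil_pencils:
  assumes "r < n" "2 * a \<le> r" "length \<mu>s = r - 2 * a"
  shows "K_pencil n r a \<mu>s \<in> pencils n"
  using K_pencil_symmetric[OF assms] by (simp add: symmetric_pencils_def case_prod_beta)

lemma sum_block_size_kblocks:
  assumes "r < n" "2 * a \<le> r" "length \<mu>s = r - 2 * a"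
  shows "(\<Sum>b\<leftarrow>kblocks n r a \<mu>s. block_size b) = n"
  using pencils_unique[OF K_pencil_pencils[OF assms], of "\<Sum>b\<leftarrow>kblocks n r a \<mu>s. block_size b"]
    blocks_pencil_pencils[of "kblocks n r a \<mu>s"] by (simp add: K_pencil_kblocks)

lemma proper_kblocks: "\<forall>c\<in>set (kblocks n r a \<mu>s). proper_block c"
  by (auto simp: kblocks_def)

lemma K_pencil_congruent:
  assumes "r < n" "2 * a \<le> r" "length \<mu>s = r - 2 * a"
  shows "form_congruent (bindex (kblocks n r a \<mu>s)) (bform (kblocks n r a \<mu>s)) {..<n} (form (K_pencil n r a \<mu>s))"
  using blocks_pencil_congruent[of "kblocks n r a \<mu>s"] sum_block_size_kblocks[OF assms]
  by (simp add: K_pencil_kblocks)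

lemma congruence_orbit_pencils:
  assumes "P \<in> congruence_orbit Q" "Q \<in> pencils n" shows "P \<in> pencils n"
  using assms by (auto simp: congruence_orbit_def pencils_def)

text \<open>Replacing the eigenvalues in a canonical form touches no block \<open>M\<close>, and the
  flag of \<open>isotropic_flag_blocks\<close> depends on these blocks only.\<close>

theorem congruence_bundle_subset_flag:
  assumes r: "r < n" "2 * a \<le> r" "length \<mu>s = r - 2 * a"
  shows "congruence_bundle (K_pencil n r a \<mu>s) \<subseteq> flag_pencils n (n - r + a) (n - a)"
proof
  fix P assume "P \<in> congruence_bundle (K_pencil n r a \<mu>s)"
  then obtain bs f where P: "P \<in> congruence_orbit (blocks_pencil (map (map_block f) bs))"
    and can: "is_canonical_form bs (K_pencil n r a \<mu>s)"
    unfolding congruence_bundle_def by blast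
  let ?K = "K_pencil n r a \<mu>s" and ?kb = "kblocks n r a \<mu>s" and ?bs = "map (map_block f) bs"
  have pr: "\<forall>c\<in>set bs. proper_block c" and K: "?K \<in> congruence_orbit (blocks_pencil bs)"
    using can by (auto simp: is_canonical_form_def)
  have N: "(\<Sum>b\<leftarrow>bs. block_size b) = n"
    using congruence_orbit_pencils[OF K blocks_pencil_pencils] K_pencil_pencils[OF r] pencils_unique by blast
  have N': "(\<Sum>b\<leftarrow>?bs. block_size b) = n" using N by (simp add: comp_def)
  have fin: "finite {..<n}" by simp
  have bsn: "blocks_pencil bs \<in> pencils n" using blocks_pencil_pencils[of bs] N by simp
  have c1: "form_congruent {..<n} (form (blocks_pencil bs)) {..<n} (form ?K)"
    using congruence_orbit_iff[OF K_pencil_pencils[OF r] bsn] K by simp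
  have c2: "form_congruent (bindex bs) (bform bs) {..<n} (form (blocks_pencil bs))"
    using blocks_pencil_congruent[of bs] N by simp
  have "form_congruent (bindex bs) (bform bs) {..<n} (form ?K)"
    by (rule form_congruent_trans[OF finite_bindex fin fin c2 c1])
  moreover have "form_congruent {..<n} (form ?K) (bindex ?kb) (bform ?kb)"
    by (rule form_congruent_sym[OF finite_bindex fin K_pencil_congruent[OF r]])
  ultimately have c: "form_congruent (bindex bs) (bform bs) (bindex ?kb) (bform ?kb)"
    by (rule form_congruent_trans[OF finite_bindex fin finite_bindex])
  have cardI: "card (bindex bs) = n" "card (bindex ?kb) = n" "card (bindex ?bs) = n"
    using N N' sum_block_size_kblocks[OF r] by (simp_all only: card_bindex)
  have cnt: "card (mpos bs) = n - r" "card (vindex bs) = n - r + a"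
    using blocks_congruent_counts[OF pr proper_kblocks c] cardI card_vindex_kblocks[OF r(1), of a \<mu>s] mpos_kblocks[OF r(1), of a \<mu>s]
    by simp_all
  have "(\<Sum>l\<in>mpos bs. dval ?bs l) = (\<Sum>l\<in>mpos bs. dval bs l)" by (intro sum.cong) (simp_all add: dval_map)
  then have cnt': "card (vindex ?bs) = n - r + a" "card (uindex ?bs) = a"
    using cnt card_vindex[of bs] card_vindex[of ?bs] card_uindex[of ?bs] by simp_all
  have Pn: "P \<in> pencils n" using congruence_orbit_pencils[OF P] blocks_pencil_pencils[of ?bs] N' by simp
  have bsn': "blocks_pencil ?bs \<in> pencils n" using blocks_pencil_pencils[of ?bs] unfolding N' .
  have c3: "form_congruent {..<n} (form (blocks_pencil ?bs)) {..<n} (form P)"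
    using congruence_orbit_iff[OF Pn bsn'] P by simp
  have c4: "form_congruent (bindex ?bs) (bform ?bs) {..<n} (form (blocks_pencil ?bs))"
    using blocks_pencil_congruent[of ?bs] unfolding N' .
  have c': "form_congruent (bindex ?bs) (bform ?bs) {..<n} (form P)"
    by (rule form_congruent_trans[OF finite_bindex fin fin c4 c3])
  have "form P b i j = form P b j i" if "i < n" "j < n" for b i j
    by (rule form_congruent_symmetric[OF c' bform_sym]) (use that in auto)
  moreover have "isotropic_flag {..<n} (form P) (n - r + a) (n - a)"
    using isotropic_flag_congruent[OF fin finite_bindex form_congruent_sym[OF finite_bindex fin c'] isotropic_flag_blocks]
    by (simp add: cnt' cardI)
  ultimately show "P \<in> flag_pencils n (n - r + a) (n - a)"
    using Pn by (simp add: flag_pencils_def symmetric_pencils_iff)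
qed

text \<open>The bound \<open>a \<le> b\<close> comes from the forced part \<open>vindex\<close>, the
  bound \<open>b \<le> a\<close> from the distinctness of the eigenvalues. This is what prevents
  inclusions between the components.\<close>

lemma K_pencil_flag:
  assumes r: "r < n" "2 * a \<le> r" "length \<mu>s = r - 2 * a" "distinct \<mu>s" and b: "2 * b \<le> r"
  shows "K_pencil n r a \<mu>s \<in> flag_pencils n (n - r + b) (n - b) \<longleftrightarrow> b = a"
proof -
  let ?K = "K_pencil n r a \<mu>s" and ?kb = "kblocks n r a \<mu>s"
  have fin: "finite {..<n}" by simp
  note c = K_pencil_congruent[OF r(1-3)]
  note c' = form_congruent_sym[OF finite_bindex fin c]
  have cardI: "card (bindex ?kb) = n" using sum_block_size_kblocks[OF r(1-3)] by (simp only: card_bindex)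
  have "?K \<in> flag_pencils n (n - r + b) (n - b) \<longleftrightarrow> isotropic_flag (bindex ?kb) (bform ?kb) (n - r + b) (n - b)"
    using isotropic_flag_congruent[OF fin finite_bindex c'] isotropic_flag_congruent[OF finite_bindex fin c]
      K_pencil_symmetric[OF r(1-3)] by (auto simp: flag_pencils_def)
  also have "\<dots> \<longleftrightarrow> b = a"
  proof
    assume fl: "isotropic_flag (bindex ?kb) (bform ?kb) (n - r + b) (n - b)"
    have eq: "n - r + b + (n - b) = card (bindex ?kb) + card (mpos ?kb)"
      using r b cardI by (simp add: mpos_kblocks)
    have "a \<le> b" using isotropic_flag_blocks_bound(2)[OF proper_kblocks fl eq] r by (simp add: card_vindex_kblocks)
    moreover have "n - r + b \<le> card (vindex ?kb)"
    proof (rule isotropic_flag_distinct_eigenvalues[OF _ _ fl eq, of "\<lambda>l. \<mu>s ! (l - (n - r))"])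
      fix l assume "l < length ?kb" "l \<notin> mpos ?kb"
      then show "?kb ! l = J_block 1 (Fin (\<mu>s ! (l - (n - r))))"
        using r by (simp add: mpos_kblocks kblocks_nth)
    next
      show "inj_on (\<lambda>l. \<mu>s ! (l - (n - r))) ({..<length ?kb} - mpos ?kb)"
      proof (rule inj_onI)
        fix x y assume "x \<in> {..<length ?kb} - mpos ?kb" "y \<in> {..<length ?kb} - mpos ?kb"
          "\<mu>s ! (x - (n - r)) = \<mu>s ! (y - (n - r))"
        moreover from this have "x - (n - r) < length \<mu>s" "y - (n - r) < length \<mu>s" "n - r \<le> x" "n - r \<le> y"
          using r by (auto simp: mpos_kblocks kblocks_nth)
        ultimately have "x - (n - r) = y - (n - r)" using nth_eq_iff_index_eq[OF r(4)] by blast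
        then show "x = y" using \<open>n - r \<le> x\<close> \<open>n - r \<le> y\<close> by simp
      qed
    qed
    then have "b \<le> a" using r by (simp add: card_vindex_kblocks)
    ultimately show "b = a" by simp
  next
    assume "b = a"
    then show "isotropic_flag (bindex ?kb) (bform ?kb) (n - r + b) (n - b)"
      using isotropic_flag_blocks[of ?kb] r by (simp add: card_vindex_kblocks card_uindex_kblocks cardI)
  qed
  finally show ?thesis .
qed

section \<open>Changes of basis and perturbations\<close>

definition symmetric_on :: "'i set \<Rightarrow> (bool \<Rightarrow> 'i \<Rightarrow> 'i \<Rightarrow> complex) \<Rightarrow> bool" where
  "symmetric_on I Q \<longleftrightarrow> (\<forall>b. \<forall>p\<in>I. \<forall>q\<in>I. Q b p q = Q b q p)"

lemma symmetric_on_congruent: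
  "form_congruent I Q J Q' \<Longrightarrow> symmetric_on I Q \<Longrightarrow> symmetric_on J Q'"
  unfolding symmetric_on_def
proof (intro allI ballI)
  fix b p q assume c: "form_congruent I Q J Q'" and s: "\<forall>b. \<forall>p\<in>I. \<forall>q\<in>I. Q b p q = Q b q p"
    and pq: "p \<in> J" "q \<in> J"
  show "Q' b p q = Q' b q p" by (rule form_congruent_symmetric[OF c _ pq]) (use s in blast)
qed

lemma form_congruent_family:
  assumes "inverse_on I J (\<lambda>i j. E j i) V" "\<And>b p q. p \<in> J \<Longrightarrow> q \<in> J \<Longrightarrow> Q' b p q = bil I (Q b) (E p) (E q)"
  shows "form_congruent I Q J Q'"
  unfolding form_congruent_def using assms by (intro exI[of _ "\<lambda>i j. E j i"] exI[of _ V]) auto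

lemma bil_sum:
  assumes "finite A"
  shows "bil I Q (\<Sum>l\<in>A. f l) y = (\<Sum>l\<in>A. bil I Q (f l) y)" "bil I Q y (\<Sum>l\<in>A. f l) = (\<Sum>l\<in>A. bil I Q y (f l))"
proof -
  show "bil I Q (\<Sum>l\<in>A. f l) y = (\<Sum>l\<in>A. bil I Q (f l) y)" using assms
  proof induction
    case empty show ?case by (simp only: sum.empty bil_linear)
  next
    case (insert i A)
    then show ?case by (simp only: sum.insert bil_linear not_False_eq_True if_True)
  qed
  show "bil I Q y (\<Sum>l\<in>A. f l) = (\<Sum>l\<in>A. bil I Q y (f l))" using assms
  proof induction
    case empty show ?case by (simp only: sum.empty bil_linear)
  next
    case (insert i A)
    then show ?case by (simp only: sum.insert bil_linear not_False_eq_True if_True)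
  qed
qed

lemma bil_unit_fun:
  assumes "finite I" "i \<in> I" "j \<in> I" shows "bil I Q (unit_fun i) (unit_fun j) = Q i j"
  unfolding unit_fun_def by (rule bil_unit[OF assms])

text \<open>The form in the basis obtained by adding \<open>\<Sum>l<h. c l p \<sigma>\<^sub>l\<close> to each basis vector \<open>p\<close>; the coefficients
  of the vectors \<open>\<sigma>\<^sub>l\<close> themselves have to vanish.\<close>

definition shear :: "nat \<Rightarrow> (nat \<Rightarrow> 'i) \<Rightarrow> (nat \<Rightarrow> 'i \<Rightarrow> complex) \<Rightarrow> (bool \<Rightarrow> 'i \<Rightarrow> 'i \<Rightarrow> complex) \<Rightarrow> bool \<Rightarrow> 'i \<Rightarrow> 'i \<Rightarrow> complex" where
  "shear h \<sigma> c Q b p q = Q b p q + (\<Sum>l<h. c l p * Q b (\<sigma> l) q) + (\<Sum>l<h. c l q * Q b p (\<sigma> l))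
     + (\<Sum>l<h. \<Sum>l'<h. c l p * c l' q * Q b (\<sigma> l) (\<sigma> l'))"

text \<open>If the square of \<open>N\<close> is 0, the product of \<open>1 + N\<close> and
  \<open>1 - N\<close> is 1.\<close>

lemma inverse_on_unipotent:
  assumes I: "finite I" and N: "\<And>i k. i \<in> I \<Longrightarrow> k \<in> I \<Longrightarrow> (\<Sum>j\<in>I. N i j * N j k) = 0"
  shows "inverse_on I I (\<lambda>i j. (if i = j then 1 else 0) + N i j) (\<lambda>i j. (if i = j then 1 else 0) - N i j)"
proof -
  have "(\<Sum>j\<in>I. ((if i = j then 1 else 0) + N i j) * ((if j = k then 1 else 0) - N j k)) = (if i = k then 1 else 0)"
    "(\<Sum>j\<in>I. ((if i = j then 1 else 0) - N i j) * ((if j = k then 1 else 0) + N j k)) = (if i = k then 1 else 0)"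
    if "i \<in> I" "k \<in> I" for i k
    using N[OF that] sum_delta_mult(1)[OF I that(1), of "\<lambda>j. N j k"] sum_delta_mult(4)[OF I that(2), of "N i"]
      sum_delta_mult(1)[OF I that(1), of "\<lambda>j. if j = k then 1 else 0"]
    by (simp_all add: algebra_simps sum.distrib sum_subtractf)
  then show ?thesis by (simp add: inverse_on_def)
qed

lemma form_congruent_shear:
  assumes I: "finite I" and \<sigma>: "\<And>l. l < h \<Longrightarrow> \<sigma> l \<in> I"
    and c: "\<And>l l'. l < h \<Longrightarrow> l' < h \<Longrightarrow> c l (\<sigma> l') = 0"
  shows "form_congruent I Q I (shear h \<sigma> c Q)"
proof (rule form_congruent_family)
  let ?E = "\<lambda>p. unit_fun p + (\<Sum>l<h. fscale (c l p) (unit_fun (\<sigma> l)))"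
  let ?N = "\<lambda>i p. \<Sum>l<h. c l p * (if i = \<sigma> l then 1 else 0)"
  \<comment> \<open>The correction has square 0, as the vectors \<open>\<sigma> l\<close> that it
    adds are themselves left unchanged.\<close>
  have "(\<Sum>j\<in>I. ?N i j * ?N j k) = 0" for i k
  proof (rule sum.neutral, rule ballI)
    fix j assume "j \<in> I"
    show "?N i j * ?N j k = 0"
    proof (cases "\<exists>l<h. j = \<sigma> l")
      case True
      then have "?N i j = 0" using c by (intro sum.neutral) auto
      then show ?thesis by simp
    next
      case False
      then have "?N j k = 0" by (intro sum.neutral) auto
      then show ?thesis by simp
    qed
  qed
  then have "inverse_on I I (\<lambda>i p. (if i = p then 1 else 0) + ?N i p) (\<lambda>i p. (if i = p then 1 else 0) - ?N i p)"
    by (intro inverse_on_unipotent[OF I])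
  moreover have "(\<lambda>i p. (if i = p then 1 else 0) + ?N i p) = (\<lambda>i p. ?E p i)"
    by (auto simp: fun_eq_iff unit_fun_def sum_apply)
  ultimately show "inverse_on I I (\<lambda>i p. ?E p i) (\<lambda>i p. (if i = p then 1 else 0) - ?N i p)" by simp
  fix b p q assume pq: "p \<in> I" "q \<in> I"
  show "shear h \<sigma> c Q b p q = bil I (Q b) (?E p) (?E q)"
  proof -
    have u: "bil I (Q b) (unit_fun (\<sigma> l)) (unit_fun (\<sigma> l')) = Q b (\<sigma> l) (\<sigma> l')"
      "bil I (Q b) (unit_fun p) (unit_fun (\<sigma> l)) = Q b p (\<sigma> l)"
      "bil I (Q b) (unit_fun (\<sigma> l)) (unit_fun q) = Q b (\<sigma> l) q"
      "bil I (Q b) (unit_fun p) (unit_fun q) = Q b p q" if "l < h" "l' < h" for l l'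
      using pq \<sigma> that by (simp_all add: bil_unit_fun[OF I])
    have u': "bil I (Q b) (unit_fun p) (unit_fun q) = Q b p q" using pq by (simp add: bil_unit_fun[OF I])
    have "bil I (Q b) (?E p) (?E q) = Q b p q + (\<Sum>l<h. c l p * Q b (\<sigma> l) q) + ((\<Sum>l<h. c l q * Q b p (\<sigma> l))
        + (\<Sum>l'<h. \<Sum>l<h. c l p * c l' q * Q b (\<sigma> l) (\<sigma> l')))"
      unfolding bil_linear bil_sum[OF finite_lessThan] u'
      by (simp add: u sum_distrib_left distrib_left sum.distrib mult.assoc mult.left_commute)
    also have "(\<Sum>l'<h. \<Sum>l<h. c l p * c l' q * Q b (\<sigma> l) (\<sigma> l')) = (\<Sum>l<h. \<Sum>l'<h. c l p * c l' q * Q b (\<sigma> l) (\<sigma> l'))"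
      by (rule sum.swap)
    finally show ?thesis unfolding shear_def by (simp only: add.assoc)
  qed
qed

text \<open>A change of basis confined to \<open>T\<close>. For symmetric \<open>Q\<close> the
  entries on \<open>(I - T) \<times> T\<close> follow by symmetry.\<close>

lemma bchange_set:
  assumes I: "finite I" and T: "T \<subseteq> I" and R: "inverse_on T T R V"
  obtains Q' where "form_congruent I Q I Q'"
    "\<And>b p q. p \<in> I - T \<Longrightarrow> q \<in> I - T \<Longrightarrow> Q' b p q = Q b p q"
    "\<And>b p q. p \<in> T \<Longrightarrow> q \<in> I - T \<Longrightarrow> Q' b p q = (\<Sum>i\<in>T. R i p * Q b i q)"
    "\<And>b p q. p \<in> T \<Longrightarrow> q \<in> T \<Longrightarrow> Q' b p q = bil T (Q b) (\<lambda>i. R i p) (\<lambda>i. R i q)"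
proof -
  have fT: "finite T" using I T finite_subset by blast
  let ?E = "\<lambda>p. if p \<in> T then (\<lambda>i. if i \<in> T then R i p else 0) else unit_fun p"
  let ?F = "\<lambda>p i. if p \<in> T \<and> i \<in> T then V p i else if p = i then 1 else 0"
  let ?Q = "\<lambda>b p q. bil I (Q b) (?E p) (?E q)"
  have inv: "inverse_on I I (\<lambda>i p. ?E p i) ?F"
    unfolding inverse_on_def
  proof (intro conjI ballI)
    fix i i' assume i: "i \<in> I" "i' \<in> I"
    have "(\<Sum>j\<in>I. ?E j i * ?F j i') = (\<Sum>j\<in>T. ?E j i * ?F j i') + (\<Sum>j\<in>I - T. ?E j i * ?F j i')"
      using sum.subset_diff[OF T I, of "\<lambda>j. ?E j i * ?F j i'"] by (simp add: add.commute)
    also have "(\<Sum>j\<in>T. ?E j i * ?F j i') = (if i \<in> T \<and> i' \<in> T then (if i = i' then 1 else 0) else 0)"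
    proof (cases "i \<in> T \<and> i' \<in> T")
      case True
      then have "(\<Sum>j\<in>T. ?E j i * ?F j i') = (\<Sum>j\<in>T. R i j * V j i')" by (intro sum.cong) auto
      then show ?thesis using True R by (simp add: inverse_on_def)
    next
      case False
      then show ?thesis by (intro sum.neutral[THEN trans]) auto
    qed
    also have "(\<Sum>j\<in>I - T. ?E j i * ?F j i') = (\<Sum>j\<in>I - T. if j = i then (if i = i' then 1 else 0) else 0)"
      by (intro sum.cong) (auto simp: unit_fun_def)
    also have "\<dots> = (if i \<in> I - T then (if i = i' then 1 else 0) else 0)" using I by simp
    finally show "(\<Sum>j\<in>I. ?E j i * ?F j i') = (if i = i' then 1 else 0)" using i by auto
    have "(\<Sum>j\<in>I. ?F i j * ?E i' j) = (\<Sum>j\<in>T. ?F i j * ?E i' j) + (\<Sum>j\<in>I - T. ?F i j * ?E i' j)"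
      using sum.subset_diff[OF T I, of "\<lambda>j. ?F i j * ?E i' j"] by (simp add: add.commute)
    also have "(\<Sum>j\<in>T. ?F i j * ?E i' j) = (if i \<in> T \<and> i' \<in> T then (if i = i' then 1 else 0) else 0)"
    proof (cases "i \<in> T \<and> i' \<in> T")
      case True
      then have "(\<Sum>j\<in>T. ?F i j * ?E i' j) = (\<Sum>j\<in>T. V i j * R j i')" by (intro sum.cong) auto
      then show ?thesis using True R by (simp add: inverse_on_def)
    next
      case False
      then show ?thesis by (intro sum.neutral[THEN trans]) (auto simp: unit_fun_def)
    qed
    also have "(\<Sum>j\<in>I - T. ?F i j * ?E i' j) = (\<Sum>j\<in>I - T. if j = i then (if i = i' then 1 else 0) else 0)"
      by (intro sum.cong) (auto simp: unit_fun_def)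
    also have "\<dots> = (if i \<in> I - T then (if i = i' then 1 else 0) else 0)" using I by simp
    finally show "(\<Sum>j\<in>I. ?F i j * ?E i' j) = (if i = i' then 1 else 0)" using i by auto
  qed
  have ET: "bil I (Q b) (?E p) y = (\<Sum>i\<in>T. R i p * (\<Sum>j\<in>I. Q b i j * y j))" if "p \<in> T" for b p y
  proof -
    have "bil I (Q b) (?E p) y = (\<Sum>i\<in>I. if i \<in> T then R i p * (\<Sum>j\<in>I. Q b i j * y j) else 0)"
      unfolding bil_def using that by (intro sum.cong refl) (auto simp: sum_distrib_left mult.assoc)
    also have "\<dots> = (\<Sum>i\<in>T. R i p * (\<Sum>j\<in>I. Q b i j * y j))"
      using T by (intro sum.mono_neutral_cong_right[OF I]) auto
    finally show ?thesis .
  qed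
  show thesis
  proof (rule that)
    show "form_congruent I Q I ?Q" by (rule form_congruent_family[OF inv]) simp
    fix b p q
    show "?Q b p q = Q b p q" if "p \<in> I - T" "q \<in> I - T" using that by (simp add: bil_unit_fun[OF I])
    show "?Q b p q = (\<Sum>i\<in>T. R i p * Q b i q)" if "p \<in> T" "q \<in> I - T"
    proof -
      have "(\<Sum>j\<in>I. Q b i j * unit_fun q j) = Q b i q" for i
        unfolding unit_fun_def using that by (intro sum_delta_mult(4)[OF I]) auto
      then show ?thesis using that ET[OF that(1)] by simp
    qed
    show "?Q b p q = bil T (Q b) (\<lambda>i. R i p) (\<lambda>i. R i q)" if "p \<in> T" "q \<in> T"
    proof -
      have "(\<Sum>j\<in>I. Q b i j * ?E q j) = (\<Sum>j\<in>T. Q b i j * R j q)" for i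
        using T that by (intro sum.mono_neutral_cong_right[OF I]) auto
      then show ?thesis using ET[OF that(1), of b "?E q"] that
        by (simp add: bil_def sum_distrib_left mult.assoc)
    qed
  qed
qed

lemma bchange:
  assumes I: "finite I" and \<sigma>: "inj_on \<sigma> {..<h}" "\<sigma> ` {..<h} \<subseteq> I" and R: "inverse_on {..<h} {..<h} R V"
  obtains Q' where "form_congruent I Q I Q'"
    "\<And>b p q. p \<in> I - \<sigma> ` {..<h} \<Longrightarrow> q \<in> I - \<sigma> ` {..<h} \<Longrightarrow> Q' b p q = Q b p q"
    "\<And>b l q. l < h \<Longrightarrow> q \<in> I - \<sigma> ` {..<h} \<Longrightarrow> Q' b (\<sigma> l) q = (\<Sum>i<h. R i l * Q b (\<sigma> i) q)"
    "\<And>b l k. l < h \<Longrightarrow> k < h \<Longrightarrow> Q' b (\<sigma> l) (\<sigma> k) = (\<Sum>i<h. \<Sum>j<h. R i l * Q b (\<sigma> i) (\<sigma> j) * R j k)"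
proof -
  let ?g = "the_inv_into {..<h} \<sigma>"
  have g: "?g (\<sigma> l) = l" if "l < h" for l using the_inv_into_f_f[OF \<sigma>(1)] that by simp
  let ?T = "\<sigma> ` {..<h}"
  have re: "(\<Sum>i\<in>?T. f i) = (\<Sum>l<h. f (\<sigma> l))" for f :: "_ \<Rightarrow> complex" by (simp add: sum.reindex[OF \<sigma>(1)])
  have inj: "\<sigma> l = \<sigma> k \<longleftrightarrow> l = k" if "l < h" "k < h" for l k using \<sigma>(1) that by (auto simp: inj_on_def)
  have inv: "inverse_on ?T ?T (\<lambda>i p. R (?g i) (?g p)) (\<lambda>i p. V (?g i) (?g p))"
    unfolding inverse_on_def re
  proof (intro conjI ballI)
    fix i j assume "i \<in> ?T" "j \<in> ?T"
    then obtain l k where lk: "i = \<sigma> l" "j = \<sigma> k" "l < h" "k < h" by auto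
    have "(\<Sum>m<h. R (?g i) (?g (\<sigma> m)) * V (?g (\<sigma> m)) (?g j)) = (\<Sum>m<h. R l m * V m k)"
      "(\<Sum>m<h. V (?g i) (?g (\<sigma> m)) * R (?g (\<sigma> m)) (?g j)) = (\<Sum>m<h. V l m * R m k)"
      using lk g by (auto intro!: sum.cong)
    then show "(\<Sum>m<h. R (?g i) (?g (\<sigma> m)) * V (?g (\<sigma> m)) (?g j)) = (if i = j then 1 else 0)"
      "(\<Sum>m<h. V (?g i) (?g (\<sigma> m)) * R (?g (\<sigma> m)) (?g j)) = (if i = j then 1 else 0)"
      using R lk inj by (simp_all add: inverse_on_def)
  qed
  show thesis
  proof (rule bchange_set[OF I \<sigma>(2) inv, of Q])
    fix Q' assume Q': "form_congruent I Q I Q'"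
      "\<And>b p q. p \<in> I - ?T \<Longrightarrow> q \<in> I - ?T \<Longrightarrow> Q' b p q = Q b p q"
      "\<And>b p q. p \<in> ?T \<Longrightarrow> q \<in> I - ?T \<Longrightarrow> Q' b p q = (\<Sum>i\<in>?T. R (?g i) (?g p) * Q b i q)"
      "\<And>b p q. p \<in> ?T \<Longrightarrow> q \<in> ?T \<Longrightarrow> Q' b p q = bil ?T (Q b) (\<lambda>i. R (?g i) (?g p)) (\<lambda>i. R (?g i) (?g q))"
    show thesis
    proof (rule that[OF Q'(1,2)])
      fix b l k q assume l: "l < h"
      show "Q' b (\<sigma> l) q = (\<Sum>i<h. R i l * Q b (\<sigma> i) q)" if "q \<in> I - ?T"
        using Q'(3)[of "\<sigma> l" q b] l that g by (simp add: re)
      show "Q' b (\<sigma> l) (\<sigma> k) = (\<Sum>i<h. \<Sum>j<h. R i l * Q b (\<sigma> i) (\<sigma> j) * R j k)" if "k < h"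
        using Q'(4)[of "\<sigma> l" "\<sigma> k" b] l that g by (simp add: bil_def re)
    qed
  qed
qed

section \<open>Approximation\<close>

definition close_on :: "'i set \<Rightarrow> real \<Rightarrow> (bool \<Rightarrow> 'i \<Rightarrow> 'i \<Rightarrow> complex) \<Rightarrow> (bool \<Rightarrow> 'i \<Rightarrow> 'i \<Rightarrow> complex) \<Rightarrow> bool" where
  "close_on I \<epsilon> Q Q' \<longleftrightarrow> (\<forall>b. \<forall>p\<in>I. \<forall>q\<in>I. cmod (Q b p q - Q' b p q) < \<epsilon>)"

definition approximable :: "'i set \<Rightarrow> ((bool \<Rightarrow> 'i \<Rightarrow> 'i \<Rightarrow> complex) \<Rightarrow> bool) \<Rightarrow> (bool \<Rightarrow> 'i \<Rightarrow> 'i \<Rightarrow> complex) \<Rightarrow> bool" where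
  "approximable I good Q \<longleftrightarrow> (\<forall>\<epsilon>>0. \<exists>Q'. good Q' \<and> close_on I \<epsilon> Q Q')"

lemma approximable_good: "good Q \<Longrightarrow> approximable I good Q"
  unfolding approximable_def close_on_def by (intro allI impI exI[of _ Q]) simp

text \<open>Halving \<open>\<epsilon>\<close> lets perturbations be composed, so that the reduction
  can alternate between small perturbations and changes of basis.\<close>

lemma approximable_closure:
  assumes "\<And>\<epsilon>. 0 < \<epsilon> \<Longrightarrow> \<exists>Q'. close_on I \<epsilon> Q Q' \<and> approximable I good Q'"
  shows "approximable I good Q"
  unfolding approximable_def
proof (intro allI impI)
  fix \<epsilon> :: real assume e: "0 < \<epsilon>"
  obtain Q' where Q': "close_on I (\<epsilon> / 2) Q Q'" "approximable I good Q'" using assms[of "\<epsilon> / 2"] e by auto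
  obtain Q'' where Q'': "good Q''" "close_on I (\<epsilon> / 2) Q' Q''" using Q'(2) e unfolding approximable_def by (metis half_gt_zero)
  have "close_on I \<epsilon> Q Q''"
    unfolding close_on_def
  proof (intro allI ballI)
    fix b p q assume "p \<in> I" "q \<in> I"
    then have "cmod (Q b p q - Q' b p q) < \<epsilon> / 2" "cmod (Q' b p q - Q'' b p q) < \<epsilon> / 2"
      using Q'(1) Q''(2) by (simp_all add: close_on_def)
    then show "cmod (Q b p q - Q'' b p q) < \<epsilon>"
      using norm_triangle_ineq[of "Q b p q - Q' b p q" "Q' b p q - Q'' b p q"] by simp
  qed
  then show "\<exists>Q'. good Q' \<and> close_on I \<epsilon> Q Q'" using Q''(1) by blast
qed

text \<open>Congruence by a fixed matrix is continuous: an error grows at most by the factor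
  \<open>B * B\<close>.\<close>

lemma approximable_congruent:
  assumes I: "finite I" "finite J" and c: "form_congruent I Q J Q1" and a: "approximable J good Q1"
    and good: "\<And>Q' Q''. good Q' \<Longrightarrow> form_congruent J Q' I Q'' \<Longrightarrow> good' Q''"
  shows "approximable I good' Q"
  unfolding approximable_def
proof (intro allI impI)
  fix \<epsilon> :: real assume e: "0 < \<epsilon>"
  obtain W V where W: "inverse_on J I W V"
    "\<forall>b. \<forall>p\<in>I. \<forall>q\<in>I. Q b p q = bil J (Q1 b) (\<lambda>i. W i p) (\<lambda>i. W i q)"
    using form_congruent_sym[OF I c] unfolding form_congruent_def by (elim exE conjE) (rule that)
  define B where "B = (\<Sum>p\<in>I. \<Sum>i\<in>J. cmod (W i p))"
  have B0: "0 \<le> B" unfolding B_def by (intro sum_nonneg) auto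
  have WB: "(\<Sum>i\<in>J. cmod (W i p)) \<le> B" if "p \<in> I" for p
    unfolding B_def using that I(1) by (intro member_le_sum) (auto intro: sum_nonneg)
  \<comment> \<open>The summand 1 keeps the denominator positive when \<open>B = 0\<close>.\<close>
  define \<delta> where "\<delta> = \<epsilon> / (B * B + 1)"
  have \<delta>: "0 < \<delta>" using e B0 by (simp add: \<delta>_def add_nonneg_pos)
  obtain Q1' where Q1': "good Q1'" "close_on J \<delta> Q1 Q1'" using a \<delta> unfolding approximable_def by blast
  let ?Q = "\<lambda>b p q. bil J (Q1' b) (\<lambda>i. W i p) (\<lambda>i. W i q)"
  have "form_congruent J Q1' I ?Q" unfolding form_congruent_def using W(1) by blast
  then have "good' ?Q" by (rule good[OF Q1'(1)])
  moreover have "close_on I \<epsilon> Q ?Q"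
    unfolding close_on_def
  proof (intro allI ballI)
    fix b p q assume pq: "p \<in> I" "q \<in> I"
    have "Q b p q - ?Q b p q = (\<Sum>i\<in>J. \<Sum>j\<in>J. W i p * (Q1 b i j - Q1' b i j) * W j q)"
      using W(2) pq by (simp add: bil_def sum_subtractf[symmetric] algebra_simps)
    also have "cmod \<dots> \<le> (\<Sum>i\<in>J. \<Sum>j\<in>J. cmod (W i p) * \<delta> * cmod (W j q))"
    proof (intro order_trans[OF norm_sum] sum_mono)
      fix i j assume "i \<in> J" "j \<in> J"
      then have "cmod (Q1 b i j - Q1' b i j) \<le> \<delta>" using Q1'(2) by (simp add: close_on_def less_imp_le)
      then show "cmod (W i p * (Q1 b i j - Q1' b i j) * W j q) \<le> cmod (W i p) * \<delta> * cmod (W j q)"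
        by (simp add: norm_mult mult_left_mono mult_right_mono)
    qed
    also have "\<dots> = \<delta> * ((\<Sum>i\<in>J. cmod (W i p)) * (\<Sum>j\<in>J. cmod (W j q)))" (is "?l = ?r")
    proof -
      have "?r = \<delta> * (\<Sum>i\<in>J. \<Sum>j\<in>J. cmod (W i p) * cmod (W j q))" by (simp only: sum_product)
      also have "\<dots> = ?l" by (simp add: sum_distrib_left mult_ac)
      finally show ?thesis by (rule sym)
    qed
    also have "\<dots> \<le> \<delta> * (B * B)"
      using \<delta> WB[OF pq(1)] WB[OF pq(2)] B0 by (intro mult_left_mono mult_mono) (auto intro: sum_nonneg)
    also have "\<dots> < \<epsilon>"
    proof -
      have "0 < B * B + 1" using B0 by (simp add: add_nonneg_pos)
      moreover have "\<epsilon> * (B * B) < \<epsilon> * (B * B + 1)" using e by (simp add: distrib_left)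
      ultimately show ?thesis unfolding \<delta>_def by (simp add: pos_divide_less_eq)
    qed
    finally show "cmod (Q b p q - ?Q b p q) < \<epsilon>" .
  qed
  ultimately show "\<exists>Q'. good' Q' \<and> close_on I \<epsilon> Q Q'" by blast
qed

section \<open>Eigenvalues and small perturbations\<close>

text \<open>The values \<open>t\<close> in question are the roots of the characteristic polynomial,
  which has degree \<open>h\<close>.\<close>

lemma finite_eigenvalues:
  fixes D :: "nat \<Rightarrow> nat \<Rightarrow> complex"
  shows "finite {t. \<exists>u. (\<exists>j<h. u j \<noteq> 0) \<and> (\<forall>i<h. (\<Sum>j<h. D i j * u j) = t * u i)}"
    and "0 < h \<Longrightarrow> \<exists>t u. (\<exists>j<h. u j \<noteq> 0) \<and> (\<forall>i<h. (\<Sum>j<h. D i j * u j) = t * u i)"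
proof -
  let ?A = "mat h h (\<lambda>(i, j). D i j)"
  have A: "?A \<in> carrier_mat h h" by simp
  have iff: "(\<exists>u. (\<exists>j<h. u j \<noteq> 0) \<and> (\<forall>i<h. (\<Sum>j<h. D i j * u j) = t * u i)) \<longleftrightarrow> poly (char_poly ?A) t = 0" for t
  proof -
    have "(\<exists>u. (\<exists>j<h. u j \<noteq> 0) \<and> (\<forall>i<h. (\<Sum>j<h. D i j * u j) = t * u i)) \<longleftrightarrow> eigenvalue ?A t"
    proof
      assume "\<exists>u. (\<exists>j<h. u j \<noteq> 0) \<and> (\<forall>i<h. (\<Sum>j<h. D i j * u j) = t * u i)"
      then obtain u j where u: "j < h" "u j \<noteq> 0" "\<forall>i<h. (\<Sum>j<h. D i j * u j) = t * u i" by auto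
      have "eigenvector ?A (vec h u) t"
        unfolding eigenvector_def
      proof (intro conjI)
        have "vec h u $ j \<noteq> 0\<^sub>v h $ j" using u by simp
        then show "vec h u \<noteq> 0\<^sub>v (dim_row ?A)" by auto
        show "?A *\<^sub>v vec h u = t \<cdot>\<^sub>v vec h u"
          using u(3) by (intro eq_vecI) (auto simp: scalar_prod_def atLeast0LessThan)
      qed simp
      then show "eigenvalue ?A t" unfolding eigenvalue_def by blast
    next
      assume "eigenvalue ?A t"
      then obtain v where v: "v \<in> carrier_vec h" "v \<noteq> 0\<^sub>v h" "?A *\<^sub>v v = t \<cdot>\<^sub>v v"
        unfolding eigenvalue_def eigenvector_def by auto
      obtain j where j: "j < h" "v $ j \<noteq> 0" using v(1,2) by (metis carrier_vecD eq_vecI index_zero_vec)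
      have "(\<Sum>j<h. D i j * v $ j) = t * v $ i" if "i < h" for i
      proof -
        have "(?A *\<^sub>v v) $ i = (\<Sum>j<h. D i j * v $ j)"
          using that v(1) by (auto simp: scalar_prod_def atLeast0LessThan)
        then show ?thesis using v(1,3) that by simp
      qed
      then show "\<exists>u. (\<exists>j<h. u j \<noteq> 0) \<and> (\<forall>i<h. (\<Sum>j<h. D i j * u j) = t * u i)"
        using j by (intro exI[of _ "\<lambda>i. v $ i"]) auto
    qed
    then show ?thesis using eigenvalue_root_char_poly[OF A] by simp
  qed
  have deg: "degree (char_poly ?A) = h" and "monic (char_poly ?A)" using degree_monic_char_poly[OF A] by auto
  then have "char_poly ?A \<noteq> 0" by auto
  then show "finite {t. \<exists>u. (\<exists>j<h. u j \<noteq> 0) \<and> (\<forall>i<h. (\<Sum>j<h. D i j * u j) = t * u i)}"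
    unfolding iff by (rule poly_roots_finite)
  show "\<exists>t u. (\<exists>j<h. u j \<noteq> 0) \<and> (\<forall>i<h. (\<Sum>j<h. D i j * u j) = t * u i)" if "0 < h"
    unfolding iff using fundamental_theorem_of_algebra[of "char_poly ?A"] deg that by (auto simp: constant_degree)
qed

lemma finite_avoid_small:
  assumes "finite (E :: complex set)" "0 < \<epsilon>"
  shows "\<exists>t. t \<notin> E \<and> cmod t < \<epsilon>"
proof -
  let ?f = "\<lambda>k :: nat. complex_of_real (\<epsilon> / real (k + 2))"
  have "inj ?f"
  proof (rule injI)
    fix x y assume "?f x = ?f y"
    then have "\<epsilon> / real (x + 2) = \<epsilon> / real (y + 2)" using of_real_eq_iff by blast
    then show "x = y" using assms(2) by (simp add: field_simps)
  qed
  then have "infinite (range ?f)" using finite_imageD infinite_UNIV_nat by blast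
  then have "\<not> range ?f \<subseteq> E" using assms(1) finite_subset by blast
  then obtain k where k: "?f k \<notin> E" by blast
  have "cmod (?f k) = \<epsilon> / real (k + 2)" unfolding norm_of_real using assms(2) by simp
  also have "\<dots> < \<epsilon>" using assms(2) by (simp add: pos_divide_less_eq)
  finally show ?thesis using k by blast
qed

text \<open>The sum is singular only if \<open>t\<close> is one of the finitely many eigenvalues of
  \<open>- D\<close>.\<close>

lemma perturb_invertible:
  fixes D :: "nat \<Rightarrow> nat \<Rightarrow> complex"
  assumes "0 < \<epsilon>"
  shows "\<exists>t V. cmod t < \<epsilon> \<and> inverse_on {..<h} {..<h} (\<lambda>i j. D i j + (if i = j then t else 0)) V"
proof -
  let ?E = "{t. \<exists>u. (\<exists>j<h. u j \<noteq> 0) \<and> (\<forall>i<h. (\<Sum>j<h. - D i j * u j) = t * u i)}"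
  have "finite ?E" by (rule finite_eigenvalues(1)[of h "\<lambda>i j. - D i j"])
  from finite_avoid_small[OF this assms] obtain t where t: "t \<notin> ?E" "cmod t < \<epsilon>" by (elim exE conjE) (rule that)
  have "\<exists>V. inverse_on {..<h} {..<h} (\<lambda>i j. D i j + (if i = j then t else 0)) V"
  proof (rule inverse_onI)
    fix u assume u: "\<forall>i\<in>{..<h}. (\<Sum>j\<in>{..<h}. (D i j + (if i = j then t else 0)) * u j) = 0"
    have "(\<Sum>j<h. - D i j * u j) = t * u i" if "i < h" for i
    proof -
      have "(\<Sum>j<h. (D i j + (if i = j then t else 0)) * u j) = (\<Sum>j<h. D i j * u j) + t * u i"
        using that by (simp add: distrib_right sum.distrib if_distrib[of "\<lambda>x. x * _"] cong: if_cong)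
      then show ?thesis using bspec[OF u, of i] that by (simp add: sum_negf add_eq_0_iff)
    qed
    then have "\<not> (\<exists>j<h. u j \<noteq> 0)" using t(1) unfolding mem_Collect_eq by (metis (no_types))
    then show "\<forall>j\<in>{..<h}. u j = 0" by auto
  qed simp_all
  then show ?thesis using t(2) by blast
qed

section \<open>Density of the generic pencils\<close>

text \<open>The basis vectors \<open>Gi\<close> span \<open>V\<close>, the vectors \<open>Wi\<close> extend them to a basis of \<open>N\<close>, and \<open>Ui\<close> to a basis of
  the whole space. Here \<open>m = n - r\<close> and \<open>c = r - 2 a\<close>.\<close>

datatype idx = Gi nat | Ui nat | Wi nat

definition iset :: "nat \<Rightarrow> nat \<Rightarrow> nat \<Rightarrow> idx set" where
  "iset m a c = Gi ` {..<a + m} \<union> Ui ` {..<a} \<union> Wi ` {..<c}"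

lemma iset_simps [simp]:
  "Gi i \<in> iset m a c \<longleftrightarrow> i < a + m" "Ui i \<in> iset m a c \<longleftrightarrow> i < a" "Wi i \<in> iset m a c \<longleftrightarrow> i < c"
  by (auto simp: iset_def)

lemma finite_iset [simp]: "finite (iset m a c)"
  by (simp add: iset_def)

text \<open>This is \<^const>\<open>K_pencil\<close> with the \<open>m\<close> singular blocks interleaved: the vector number \<open>i\<close> of the block \<open>l\<close> is
  number \<open>l + m i\<close>. A uniform description results, independent of the Euclidean division of \<open>a\<close> by \<open>m\<close>.\<close>

fun shift_form :: "nat \<Rightarrow> (nat \<Rightarrow> complex) \<Rightarrow> bool \<Rightarrow> idx \<Rightarrow> idx \<Rightarrow> complex" where
  "shift_form m \<mu> b (Gi i) (Ui j) = (if i = j + (if b then 0 else m) then 1 else 0)"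
| "shift_form m \<mu> b (Ui j) (Gi i) = (if i = j + (if b then 0 else m) then 1 else 0)"
| "shift_form m \<mu> b (Wi i) (Wi j) = (if i = j then if b then 1 else - \<mu> i else 0)"
| "shift_form m \<mu> b _ _ = 0"

lemma symmetric_onD: "symmetric_on I Q \<Longrightarrow> p \<in> I \<Longrightarrow> q \<in> I \<Longrightarrow> Q b p q = Q b q p"
  by (simp add: symmetric_on_def)

lemma sum_pick:
  assumes "\<And>l. l < (h :: nat) \<Longrightarrow> f l = (if l = k then v else 0)"
  shows "(\<Sum>l<h. f l) = (if k < h then v else (0 :: complex))"
proof -
  have "(\<Sum>l<h. f l) = (\<Sum>l<h. if l = k then v else 0)" using assms by (intro sum.cong) auto
  then show ?thesis by simp
qed

lemma sum_zero: "(\<And>l. l < (h :: nat) \<Longrightarrow> f l = 0) \<Longrightarrow> (\<Sum>l<h. f l) = (0 :: complex)"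
  by (intro sum.neutral) auto

section \<open>The case without eigenvalues\<close>

text \<open>Four shears remove what the preceding normalizations leave over. The last
  \<open>h\<close> vectors \<open>Gi\<close> are in the kernel of \<open>A\<close> and are paired by
  \<open>B\<close> with the last \<open>h\<close> vectors \<open>Ui\<close>, so adding them corrects
  \<open>B\<close> without changing \<open>A\<close>. The condition
  \<open>h = m \<or> a' = 0\<close> keeps the second shear from spoiling the part normalized
  before.\<close>

lemma shift_form_reduction:
  fixes Q :: "bool \<Rightarrow> idx \<Rightarrow> idx \<Rightarrow> complex"
  assumes hm: "h \<le> m" "h = m \<or> a' = 0"
    and sym: "symmetric_on (iset m (a' + h) 0) Q"
    and GG: "\<And>b i j. i < a' + h + m \<Longrightarrow> j < a' + h + m \<Longrightarrow> Q b (Gi i) (Gi j) = 0"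
    and K1: "\<And>i j. a' + m \<le> i \<Longrightarrow> i < a' + h + m \<Longrightarrow> j < a' + h \<Longrightarrow> Q True (Gi i) (Ui j) = 0"
    and K2: "\<And>i j. a' + m \<le> i \<Longrightarrow> i < a' + h + m \<Longrightarrow> j < a' + h \<Longrightarrow>
      Q False (Gi i) (Ui j) = (if i = j + m then 1 else 0)"
    and GU: "\<And>b i j. i < a' + m \<Longrightarrow> j < a' \<Longrightarrow> Q b (Gi i) (Ui j) = (if i = j + (if b then 0 else m) then 1 else 0)"
    and UU: "\<And>b i j. i < a' \<Longrightarrow> j < a' \<Longrightarrow> Q b (Ui i) (Ui j) = 0"
    and D: "\<And>l l'. l < h \<Longrightarrow> l' < h \<Longrightarrow> Q True (Gi (a' + l)) (Ui (a' + l')) = (if l = l' then 1 else 0)"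
  shows "form_congruent (iset m (a' + h) 0) Q (iset m (a' + h) 0) (shift_form m \<mu>)"
proof -
  let ?I = "iset m (a' + h) 0"
  \<comment> \<open>Clears \<open>A\<close> between the first \<open>a'\<close> vectors
    \<open>Gi\<close> and the last \<open>h\<close> vectors \<open>Ui\<close>.\<close>
  define c1 where "c1 l p = (case p of Ui j \<Rightarrow> if a' \<le> j then - Q True (Gi l) (Ui j) else 0 | _ \<Rightarrow> 0)" for l p
  define Q1 where "Q1 = shear a' Ui c1 Q"
  have cong1: "form_congruent ?I Q ?I Q1"
    unfolding Q1_def by (rule form_congruent_shear) (auto simp: c1_def)
  have sym1: "symmetric_on ?I Q1" by (rule symmetric_on_congruent[OF cong1 sym])
  have GG1: "Q1 b (Gi i) (Gi j) = 0" if "i < a' + h + m" "j < a' + h + m" for b i j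
    using GG[OF that] by (simp add: Q1_def shear_def c1_def)
  have GU1: "Q1 b (Gi i) (Ui j) = Q b (Gi i) (Ui j) + (\<Sum>l<a'. c1 l (Ui j) * Q b (Gi i) (Ui l))" for b i j
    by (simp add: Q1_def shear_def c1_def)
  have U1: "Q1 b (Gi i) (Ui j) = (if i = j + (if b then 0 else m) then 1 else 0)" if "i < a' + m" "j < a'" for b i j
    using GU[OF that] that by (simp add: GU1 c1_def)
  have UU1: "Q1 b (Ui i) (Ui j) = 0" if "i < a'" "j < a'" for b i j
    using UU[OF that] that by (simp add: Q1_def shear_def c1_def)
  have K11: "Q1 b (Gi i) (Ui j) = (if b then 0 else if i = j + m then 1 else 0)"
    if i: "a' + m \<le> i" "i < a' + h + m" "j < a' + h" for b i j
  proof -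
    have "Q b (Gi i) (Ui l) = 0" if "l < a'" for l
      using K1[OF i(1,2), of l] K2[OF i(1,2), of l] that i(1) by (cases b) auto
    then have "(\<Sum>l<a'. c1 l (Ui j) * Q b (Gi i) (Ui l)) = 0" by (intro sum_zero) simp
    then show ?thesis unfolding GU1 using K1[OF i] K2[OF i] by (cases b) simp_all
  qed
  have D1: "Q1 True (Gi i) (Ui j) = (if i < a' then 0 else Q True (Gi i) (Ui j))"
    if ij: "i < a' + m" "a' \<le> j" for i j
  proof -
    have "(\<Sum>l<a'. c1 l (Ui j) * Q True (Gi i) (Ui l)) = (if i < a' then - Q True (Gi i) (Ui j) else 0)"
    proof (rule sum_pick)
      fix l assume "l < a'"
      then show "c1 l (Ui j) * Q True (Gi i) (Ui l) = (if l = i then - Q True (Gi i) (Ui j) else 0)"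
        using GU[OF ij(1), of l True] ij(2) by (simp add: c1_def)
    qed
    then show ?thesis unfolding GU1 by simp
  qed
  \<comment> \<open>Clears \<open>A\<close> between the last \<open>h\<close> vectors
    \<open>Ui\<close> and the \<open>Gi i\<close> with \<open>a' + h \<le> i\<close> and
    \<open>i < a' + m\<close>. Such \<open>i\<close> exist only for \<open>h < m\<close>, where
    \<open>a' = 0\<close>.\<close>
  define c2 where "c2 l p = (case p of Gi i \<Rightarrow> if a' + h \<le> i \<and> i < a' + m then - Q1 True (Gi i) (Ui (a' + l)) else 0 | _ \<Rightarrow> 0)" for l p
  define Q2 where "Q2 = shear h (\<lambda>l. Gi (a' + l)) c2 Q1"
  have cong2: "form_congruent ?I Q1 ?I Q2"
    unfolding Q2_def by (rule form_congruent_shear) (auto simp: c2_def)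
  have sym2: "symmetric_on ?I Q2" by (rule symmetric_on_congruent[OF cong2 sym1])
  have GG2: "Q2 b (Gi i) (Gi j) = 0" if "i < a' + h + m" "j < a' + h + m" for b i j
  proof -
    have "Q1 b (Gi (a' + l)) (Gi k) = 0" "Q1 b (Gi k) (Gi (a' + l)) = 0" if "l < h" "k < a' + h + m" for l k
      using that by (auto intro!: GG1)
    then show ?thesis using GG1[OF that] that by (simp add: Q2_def shear_def)
  qed
  have GU2: "Q2 b (Gi i) (Ui j) = Q1 b (Gi i) (Ui j) + (\<Sum>l<h. c2 l (Gi i) * Q1 b (Gi (a' + l)) (Ui j))" for b i j
    by (simp add: Q2_def shear_def c2_def)
  have UU2: "Q2 b (Ui i) (Ui j) = Q1 b (Ui i) (Ui j)" for b i j
    by (simp add: Q2_def shear_def c2_def)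
  have U2: "Q2 b (Gi i) (Ui j) = (if i = j + (if b then 0 else m) then 1 else 0)" if "i < a' + m" "j < a'" for b i j
  proof -
    have "c2 l (Gi i) = 0" for l using that hm by (auto simp: c2_def)
    then show ?thesis unfolding GU2 using U1[OF that] by simp
  qed
  have K12: "Q2 b (Gi i) (Ui j) = (if b then 0 else if i = j + m then 1 else 0)"
    if i: "a' + m \<le> i" "i < a' + h + m" "j < a' + h" for b i j
    unfolding GU2 using K11[OF i] i by (simp add: c2_def)
  have A2: "Q2 True (Gi i) (Ui j) = (if i = j then 1 else 0)" if ij: "i < a' + h + m" "j < a' + h" for i j
  proof (cases "j < a' \<or> a' + m \<le> i")
    case True
    then show ?thesis
    proof
      assume j: "j < a'"
      show ?thesis
      proof (cases "i < a' + m")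
        case True
        then show ?thesis using U2[OF True j, of True] by simp
      next
        case False
        then show ?thesis using K12[of i j True] ij j by auto
      qed
    next
      assume "a' + m \<le> i"
      then show ?thesis using K12[of i j True] ij hm(1) by auto
    qed
  next
    case False
    then have j: "a' \<le> j" and i: "i < a' + m" by auto
    have Dk: "Q1 True (Gi (a' + l)) (Ui (a' + k)) = (if l = k then 1 else 0)" if "l < h" "k < h" for l k
      using D1[of "a' + l" "a' + k"] D[OF that] that hm(1) by simp
    show ?thesis
    proof (cases "a' + h \<le> i")
      case True
      have "(\<Sum>l<h. c2 l (Gi i) * Q1 True (Gi (a' + l)) (Ui j)) = (if j - a' < h then - Q1 True (Gi i) (Ui j) else 0)"
      proof (rule sum_pick)
        fix l assume l: "l < h"
        have "Q1 True (Gi (a' + l)) (Ui j) = (if l = j - a' then 1 else 0)"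
          using Dk[OF l, of "j - a'"] j ij(2) by simp
        then show "c2 l (Gi i) * Q1 True (Gi (a' + l)) (Ui j) = (if l = j - a' then - Q1 True (Gi i) (Ui j) else 0)"
          using True i j by (simp add: c2_def)
      qed
      moreover have "j - a' < h" using j ij(2) by linarith
      ultimately show ?thesis unfolding GU2 using True ij(2) by simp
    next
      case False
      then have "Q2 True (Gi i) (Ui j) = Q1 True (Gi i) (Ui j)" unfolding GU2 by (simp add: c2_def)
      then show ?thesis
        using D1[OF i j] Dk[of "i - a'" "j - a'"] False i j ij(2) by (cases "i < a'") auto
    qed
  qed
  \<comment> \<open>Clears \<open>A\<close> on the vectors \<open>Ui\<close>. When both arguments
    are among the last \<open>h\<close>, each of the two symmetric contributions takes one
    half.\<close>
  define c3 where "c3 l p = (case p of Ui j \<Rightarrow> if a' \<le> j then if l < a' then - Q2 True (Ui l) (Ui j)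
      else - Q2 True (Ui l) (Ui j) / 2 else 0 | _ \<Rightarrow> 0)" for l p
  define Q3 where "Q3 = shear (a' + h) Gi c3 Q2"
  have cong3: "form_congruent ?I Q2 ?I Q3"
    unfolding Q3_def by (rule form_congruent_shear) (auto simp: c3_def)
  have sym3: "symmetric_on ?I Q3" by (rule symmetric_on_congruent[OF cong3 sym2])
  have GG3: "Q3 b (Gi i) (Gi j) = 0" if "i < a' + h + m" "j < a' + h + m" for b i j
    using GG2[OF that] by (simp add: Q3_def shear_def c3_def)
  have GU3: "Q3 b (Gi i) (Ui j) = Q2 b (Gi i) (Ui j)" if "i < a' + h + m" for b i j
  proof -
    have "(\<Sum>l<a' + h. c3 l (Ui j) * Q2 b (Gi i) (Gi l)) = 0" using GG2[OF that] by (intro sum_zero) simp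
    then show ?thesis by (simp add: Q3_def shear_def c3_def)
  qed
  have UU3: "Q3 b (Ui i) (Ui j) = 0" if "i < a'" "j < a'" for b i j
    using UU1[OF that, of b] that by (simp add: Q3_def shear_def c3_def UU2)
  have A3: "Q3 True (Ui i) (Ui j) = 0" if ij: "i < a' + h" "j < a' + h" for i j
  proof -
    have s1: "(\<Sum>l<a' + h. c3 l (Ui i) * Q2 True (Gi l) (Ui j)) = (if j < a' + h then c3 j (Ui i) else 0)"
      by (rule sum_pick) (use A2 ij in auto)
    have s2: "(\<Sum>l<a' + h. c3 l (Ui j) * Q2 True (Ui i) (Gi l)) = (if i < a' + h then c3 i (Ui j) else 0)"
    proof (rule sum_pick)
      fix l assume l: "l < a' + h"
      have "Q2 True (Ui i) (Gi l) = Q2 True (Gi l) (Ui i)" using l ij by (intro symmetric_onD[OF sym2]) auto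
      then show "c3 l (Ui j) * Q2 True (Ui i) (Gi l) = (if l = i then c3 i (Ui j) else 0)"
        using A2[of l i] l ij by auto
    qed
    have s3: "(\<Sum>l<a' + h. \<Sum>l'<a' + h. c3 l (Ui i) * c3 l' (Ui j) * Q2 True (Gi l) (Gi l')) = 0"
      using GG2 by (intro sum_zero) simp
    have "Q2 True (Ui i) (Ui j) = Q2 True (Ui j) (Ui i)" using ij by (intro symmetric_onD[OF sym2]) auto
    then show ?thesis
      unfolding Q3_def shear_def s1 s2 s3 using ij UU1[of i j True] by (auto simp: c3_def UU2)
  qed
  \<comment> \<open>Clears the remaining entries of \<open>B\<close> by means of the kernel vectors
    of \<open>A\<close>, again with halves where both arguments contribute.\<close>
  define c4 where "c4 l p = (case p of Gi i \<Rightarrow> if i < a' + m then - Q3 False (Gi i) (Ui (a' + l)) else 0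
     | Ui j \<Rightarrow> if j < a' then - Q3 False (Ui j) (Ui (a' + l)) else - Q3 False (Ui j) (Ui (a' + l)) / 2 | _ \<Rightarrow> 0)" for l p
  let ?\<sigma> = "\<lambda>l. Gi (a' + m + l)"
  define Q4 where "Q4 = shear h ?\<sigma> c4 Q3"
  have cong4: "form_congruent ?I Q3 ?I Q4"
    unfolding Q4_def by (rule form_congruent_shear) (auto simp: c4_def)
  have sym4: "symmetric_on ?I Q4" by (rule symmetric_on_congruent[OF cong4 sym3])
  have kU: "Q3 b (?\<sigma> l) (Ui j) = (if b then 0 else if j = a' + l then 1 else 0)" if "l < h" "j < a' + h" for b l j
    using GU3[of "a' + m + l" b j] K12[of "a' + m + l" j b] that by auto
  have kG: "Q3 b (?\<sigma> l) (Gi j) = 0" "Q3 b (Gi j) (?\<sigma> l) = 0" if "l < h" "j < a' + h + m" for b l j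
    using that by (auto intro!: GG3)
  have uk: "Q3 b (Ui j) (?\<sigma> l) = Q3 b (?\<sigma> l) (Ui j)" if "l < h" "j < a' + h" for b l j
    using that by (intro symmetric_onD[OF sym3]) auto
  have kk: "(\<Sum>l<h. \<Sum>l'<h. c4 l p * c4 l' q * Q3 b (?\<sigma> l) (?\<sigma> l')) = 0" for b p q
    using kG by (intro sum_zero) simp
  have GG4: "Q4 b (Gi i) (Gi j) = 0" if "i < a' + h + m" "j < a' + h + m" for b i j
  proof -
    have "(\<Sum>l<h. c4 l (Gi i) * Q3 b (?\<sigma> l) (Gi j)) = 0" "(\<Sum>l<h. c4 l (Gi j) * Q3 b (Gi i) (?\<sigma> l)) = 0"
      using kG that by (auto intro!: sum_zero)
    then show ?thesis unfolding Q4_def shear_def kk using GG3[OF that] by simp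
  qed
  have GU4: "Q4 b (Gi i) (Ui j) = (if i = j + (if b then 0 else m) then 1 else 0)"
    if ij: "i < a' + h + m" "j < a' + h" for b i j
  proof -
    have s2: "(\<Sum>l<h. c4 l (Ui j) * Q3 b (Gi i) (?\<sigma> l)) = 0" using kG ij by (auto intro!: sum_zero)
    show ?thesis
    proof (cases b)
      case True
      then have "(\<Sum>l<h. c4 l (Gi i) * Q3 b (?\<sigma> l) (Ui j)) = 0" using kU ij by (auto intro!: sum_zero)
      then show ?thesis unfolding Q4_def shear_def kk s2 using True GU3[OF ij(1)] A2[OF ij] by simp
    next
      case b: False
      have s1: "(\<Sum>l<h. c4 l (Gi i) * Q3 b (?\<sigma> l) (Ui j)) = (if a' \<le> j then c4 (j - a') (Gi i) else 0)"
      proof (cases "a' \<le> j")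
        case True
        have "(\<Sum>l<h. c4 l (Gi i) * Q3 b (?\<sigma> l) (Ui j)) = (if j - a' < h then c4 (j - a') (Gi i) else 0)"
          by (rule sum_pick) (use kU[of _ j b] ij b True in auto)
        then show ?thesis using True ij by simp
      next
        case False
        then show ?thesis using kU[of _ j b] ij b by (auto intro!: sum_zero)
      qed
      show ?thesis
      proof (cases "i < a' + m")
        case True
        then show ?thesis unfolding Q4_def shear_def kk s1 s2
          using b GU3[OF ij(1), of False j] U2[of i j False] by (auto simp: c4_def)
      next
        case False
        then show ?thesis unfolding Q4_def shear_def kk s1 s2
          using b GU3[OF ij(1), of False j] K12[of i j False] ij by (auto simp: c4_def)
      qed
    qed
  qed
  have UU4: "Q4 b (Ui i) (Ui j) = 0" if ij: "i < a' + h" "j < a' + h" for b i j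
  proof (cases b)
    case True
    then have "(\<Sum>l<h. c4 l (Ui i) * Q3 b (?\<sigma> l) (Ui j)) = 0" "(\<Sum>l<h. c4 l (Ui j) * Q3 b (Ui i) (?\<sigma> l)) = 0"
      using kU uk ij by (auto intro!: sum_zero)
    then show ?thesis unfolding Q4_def shear_def kk using True A3[OF ij] by simp
  next
    case b: False
    have s: "(\<Sum>l<h. c4 l (Ui i) * Q3 b (?\<sigma> l) (Ui j)) = (if a' \<le> j then c4 (j - a') (Ui i) else 0)"
      if ij: "i < a' + h" "j < a' + h" for i j
    proof (cases "a' \<le> j")
      case True
      have "(\<Sum>l<h. c4 l (Ui i) * Q3 b (?\<sigma> l) (Ui j)) = (if j - a' < h then c4 (j - a') (Ui i) else 0)"
        by (rule sum_pick) (use kU[of _ j b] ij b True in auto)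
      then show ?thesis using True ij by simp
    next
      case False
      then show ?thesis using kU[of _ j b] ij b by (auto intro!: sum_zero)
    qed
    have s2: "(\<Sum>l<h. c4 l (Ui j) * Q3 b (Ui i) (?\<sigma> l)) = (if a' \<le> i then c4 (i - a') (Ui j) else 0)"
    proof -
      have "(\<Sum>l<h. c4 l (Ui j) * Q3 b (Ui i) (?\<sigma> l)) = (\<Sum>l<h. c4 l (Ui j) * Q3 b (?\<sigma> l) (Ui i))"
        using uk ij by (intro sum.cong) auto
      then show ?thesis using s[OF ij(2,1)] by simp
    qed
    have "Q3 False (Ui i) (Ui j) = Q3 False (Ui j) (Ui i)" using ij by (intro symmetric_onD[OF sym3]) auto
    then show ?thesis
      unfolding Q4_def shear_def kk s[OF ij] s2 using b UU3[of i j False] by (auto simp: c4_def)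
  qed
  have final: "shift_form m \<mu> b p q = Q4 b p q" if "p \<in> ?I" "q \<in> ?I" for b p q
  proof (cases p; cases q)
    fix i j assume "p = Ui i" "q = Gi j"
    moreover from this have "Q4 b (Ui i) (Gi j) = Q4 b (Gi j) (Ui i)"
      using that by (intro symmetric_onD[OF sym4]) auto
    ultimately show ?thesis using GU4[of j i b] that by simp
  qed (use that GG4 GU4 UU4 in auto)
  have fin: "finite ?I" by simp
  have "form_congruent ?I Q4 ?I (shift_form m \<mu>)" by (rule form_congruent_cong[OF fin final])
  from form_congruent_trans[OF fin fin fin cong4 this]
  have "form_congruent ?I Q3 ?I (shift_form m \<mu>)" .
  from form_congruent_trans[OF fin fin fin cong3 this]
  have "form_congruent ?I Q2 ?I (shift_form m \<mu>)" .
  from form_congruent_trans[OF fin fin fin cong2 this]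
  have "form_congruent ?I Q1 ?I (shift_form m \<mu>)" .
  from form_congruent_trans[OF fin fin fin cong1 this] show ?thesis .
qed

text \<open>The vectors of \<open>S\<close> come last, where the kernel vectors of \<open>A\<close>
  and the eigenvector \<open>Wi c\<close> have their place.\<close>

lemma subspace_basis:
  assumes S: "fv.subspace S" "S \<subseteq> supported {..<N}" "h \<le> fv.dim S"
  obtains R V where "inverse_on {..<N} {..<N :: nat} R V" "\<And>l. N - h \<le> l \<Longrightarrow> l < N \<Longrightarrow> (\<lambda>i. R i l) \<in> S"
proof -
  have fd: "fin_dim S" by (rule fin_dim_supported[OF _ S(2)]) simp
  have "fv.dim S \<le> fv.dim (supported {..<N})"
    by (rule fin_dim_mono[OF fin_dim_supported[OF _ order_refl] S(2)]) simp
  then have hN: "h \<le> N" using S(3) dim_supported[of "{..<N}"] by simp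
  have z: "{0} \<subseteq> S" using fv.subspace_0[OF S(1)] by simp
  obtain S' where S': "fv.subspace S'" "S' \<subseteq> S" "fv.dim S' = h"
    by (rule intermediate_subspace[OF fv.subspace_single_0 S(1) fd z _ S(3)]) (simp_all add: dim_zero)
  have c: "card {N - h..<N} = fv.dim S'" using hN S'(3) by simp
  obtain R V where R: "inverse_on {..<N} {..<N} R V" "\<forall>j\<in>{N - h..<N}. (\<lambda>i. R i j) \<in> S'"
    by (rule adapted_basis[OF finite_lessThan finite_lessThan refl S'(1) S'(1) order_refl order_trans[OF S'(2) S(2)] order_refl _ c c])
      (auto intro: that)
  show thesis
  proof (rule that[OF R(1)])
    fix l assume "N - h \<le> l" "l < N"
    then have "(\<lambda>i. R i l) \<in> S'" using R(2) by simp
    then show "(\<lambda>i. R i l) \<in> S" using S'(2) by blast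
  qed
qed

lemma left_kernel:
  fixes M :: "nat \<Rightarrow> nat \<Rightarrow> complex" and N a :: nat
  defines "S \<equiv> {x \<in> supported {..<N}. \<forall>j<a. (\<Sum>i<N. x i * M i j) = 0}"
  shows "fv.subspace S" "N \<le> fv.dim S + a"
proof -
  let ?f = "lin_map {..<a} {..<N} (\<lambda>j i. M i j)"
  have eq: "S = {x \<in> supported {..<N}. ?f x = 0}"
    by (auto simp: S_def lin_map_def fun_eq_iff mult.commute)
  have fd: "fin_dim (supported {..<N})" by (rule fin_dim_supported[OF _ order_refl]) simp
  show "fv.subspace S" unfolding eq by (rule subspace_kernel[OF subspace_supported linear_lin_map])
  have "fv.dim (supported {..<N}) = fv.dim (?f ` supported {..<N}) + fv.dim S"
    unfolding eq by (rule rank_nullity[OF subspace_supported fd linear_lin_map])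
  moreover have "fv.dim (?f ` supported {..<N}) \<le> fv.dim (supported {..<a})"
  proof (rule fin_dim_mono[OF fin_dim_supported[OF _ order_refl]])
    show "?f ` supported {..<N} \<subseteq> supported {..<a}" by (auto simp: lin_map_supported)
  qed simp
  ultimately show "N \<le> fv.dim S + a" using dim_supported[of "{..<N}"] dim_supported[of "{..<a}"] by simp
qed

definition perturb :: "bool \<Rightarrow> ('i \<Rightarrow> 'i \<Rightarrow> bool) \<Rightarrow> complex \<Rightarrow> (bool \<Rightarrow> 'i \<Rightarrow> 'i \<Rightarrow> complex) \<Rightarrow> bool \<Rightarrow> 'i \<Rightarrow> 'i \<Rightarrow> complex" where
  "perturb b0 E t Q b p q = Q b p q + (if b = b0 \<and> (E p q \<or> E q p) then t else 0)"

lemma symmetric_on_perturb: "symmetric_on I Q \<Longrightarrow> symmetric_on I (perturb b0 E t Q)"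
  by (auto simp: symmetric_on_def perturb_def)

lemma close_on_perturb: "cmod t < \<epsilon> \<Longrightarrow> close_on I \<epsilon> Q (perturb b0 E t Q)"
  using le_less_trans[OF norm_ge_zero[of t]] by (auto simp: close_on_def perturb_def)

definition flagform :: "nat \<Rightarrow> nat \<Rightarrow> nat \<Rightarrow> (bool \<Rightarrow> idx \<Rightarrow> idx \<Rightarrow> complex) \<Rightarrow> bool" where
  "flagform m a c Q \<longleftrightarrow> symmetric_on (iset m a c) Q \<and>
     (\<forall>b. \<forall>i<a + m. (\<forall>j<a + m. Q b (Gi i) (Gi j) = 0) \<and> (\<forall>j<c. Q b (Gi i) (Wi j) = 0))"

text \<open>By \<open>kblocks_shift_form\<close> this is congruence to \<open>K_pencil\<close> with
  distinct eigenvalues, which may depend on the form.\<close>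

definition generic_form :: "nat \<Rightarrow> nat \<Rightarrow> nat \<Rightarrow> (bool \<Rightarrow> idx \<Rightarrow> idx \<Rightarrow> complex) \<Rightarrow> bool" where
  "generic_form m a c Q \<longleftrightarrow> (\<exists>\<mu>. inj_on \<mu> {..<c} \<and> form_congruent (iset m a c) (shift_form m \<mu>) (iset m a c) Q)"

lemma generic_form_congruent:
  assumes "generic_form m a c Q" "form_congruent (iset m a c) Q (iset m a c) Q'"
  shows "generic_form m a c Q'"
proof -
  obtain \<mu> where \<mu>: "inj_on \<mu> {..<c}" "form_congruent (iset m a c) (shift_form m \<mu>) (iset m a c) Q"
    using assms(1) unfolding generic_form_def by blast
  show ?thesis unfolding generic_form_def
    by (rule exI[of _ \<mu>], rule conjI[OF \<mu>(1)])
      (rule form_congruent_trans[OF finite_iset finite_iset finite_iset \<mu>(2) assms(2)])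
qed

lemma generic_formI:
  assumes "inj_on \<mu> {..<c}" "form_congruent (iset m a c) Q (iset m a c) (shift_form m \<mu>)"
  shows "generic_form m a c Q"
  unfolding generic_form_def
  by (rule exI[of _ \<mu>], rule conjI[OF assms(1)]) (rule form_congruent_sym[OF finite_iset finite_iset assms(2)])

lemma approximable_generic_congruent:
  assumes "form_congruent (iset m a c) Q (iset m a c) Q'" "approximable (iset m a c) (generic_form m a c) Q'"
  shows "approximable (iset m a c) (generic_form m a c) Q"
  by (rule approximable_congruent[OF finite_iset finite_iset assms]) (rule generic_form_congruent)

lemma symmetric_shift_form: "symmetric_on I (shift_form m \<mu>)"
proof -
  have "shift_form m \<mu> b p q = shift_form m \<mu> b q p" for b p q by (cases p; cases q) auto
  then show ?thesis by (simp add: symmetric_on_def)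
qed

lemma generic_form_symmetric: "generic_form m a c Q \<Longrightarrow> symmetric_on (iset m a c) Q"
  unfolding generic_form_def using symmetric_on_congruent[OF _ symmetric_shift_form] by blast

text \<open>Changing the last \<open>h\<close> vectors \<open>Ui\<close> by the inverse of the
  pairing in \<open>D\<close> makes this pairing the identity but spoils the pairing with the kernel
  vectors; a change of these by \<open>D\<close> compensates.\<close>

lemma normalized_step:
  fixes Q :: "bool \<Rightarrow> idx \<Rightarrow> idx \<Rightarrow> complex"
  assumes hm: "h \<le> m" "h = m \<or> a' = 0"
    and sym: "symmetric_on (iset m (a' + h) 0) Q"
    and GG: "\<And>b i j. i < a' + h + m \<Longrightarrow> j < a' + h + m \<Longrightarrow> Q b (Gi i) (Gi j) = 0"
    and K: "\<And>b i j. a' + m \<le> i \<Longrightarrow> i < a' + h + m \<Longrightarrow> j < a' + h \<Longrightarrow>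
      Q b (Gi i) (Ui j) = (if \<not> b \<and> i = j + m then 1 else 0)"
    and GU: "\<And>b i j. i < a' + m \<Longrightarrow> j < a' \<Longrightarrow> Q b (Gi i) (Ui j) = (if i = j + (if b then 0 else m) then 1 else 0)"
    and UU: "\<And>b i j. i < a' \<Longrightarrow> j < a' \<Longrightarrow> Q b (Ui i) (Ui j) = 0"
    and D: "inverse_on {..<h} {..<h} (\<lambda>l l'. Q True (Gi (a' + l)) (Ui (a' + l'))) V"
  shows "form_congruent (iset m (a' + h) 0) Q (iset m (a' + h) 0) (shift_form m \<mu>)"
proof -
  let ?I = "iset m (a' + h) 0" and ?\<sigma> = "\<lambda>l. Ui (a' + l)" and ?\<tau> = "\<lambda>l. Gi (a' + m + l)"
  let ?D = "\<lambda>l l'. Q True (Gi (a' + l)) (Ui (a' + l'))"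
  have inj: "inj_on ?\<sigma> {..<h}" "inj_on ?\<tau> {..<h}" by (auto simp: inj_on_def)
  have sub: "?\<sigma> ` {..<h} \<subseteq> ?I" "?\<tau> ` {..<h} \<subseteq> ?I" by auto
  have Gn: "Gi i \<in> ?I - ?\<sigma> ` {..<h}" if "i < a' + h + m" for i using that by auto
  have Un: "Ui i \<in> ?I - ?\<sigma> ` {..<h}" if "i < a'" for i using that by auto
  obtain Q1 where Q1: "form_congruent ?I Q ?I Q1"
    "\<And>b p q. p \<in> ?I - ?\<sigma> ` {..<h} \<Longrightarrow> q \<in> ?I - ?\<sigma> ` {..<h} \<Longrightarrow> Q1 b p q = Q b p q"
    "\<And>b l q. l < h \<Longrightarrow> q \<in> ?I - ?\<sigma> ` {..<h} \<Longrightarrow> Q1 b (?\<sigma> l) q = (\<Sum>i<h. V i l * Q b (?\<sigma> i) q)"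
    "\<And>b l k. l < h \<Longrightarrow> k < h \<Longrightarrow> Q1 b (?\<sigma> l) (?\<sigma> k) = (\<Sum>i<h. \<Sum>j<h. V i l * Q b (?\<sigma> i) (?\<sigma> j) * V j k)"
    by (rule bchange[OF finite_iset inj(1) sub(1) inverse_on_sym[OF D], of Q]) (rule that)
  have sym1: "symmetric_on ?I Q1" by (rule symmetric_on_congruent[OF Q1(1) sym])
  have GU1: "Q1 b (Gi i) (?\<sigma> l) = (\<Sum>k<h. V k l * Q b (Gi i) (?\<sigma> k))" if "i < a' + h + m" "l < h" for b i l
  proof -
    have "Q1 b (Gi i) (?\<sigma> l) = Q1 b (?\<sigma> l) (Gi i)" using that by (intro symmetric_onD[OF sym1]) auto
    also have "\<dots> = (\<Sum>k<h. V k l * Q b (?\<sigma> k) (Gi i))" by (rule Q1(3)[OF that(2) Gn[OF that(1)]])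
    also have "\<dots> = (\<Sum>k<h. V k l * Q b (Gi i) (?\<sigma> k))"
      using that symmetric_onD[OF sym] by (intro sum.cong) auto
    finally show ?thesis .
  qed
  have K1: "Q1 b (?\<tau> k) (?\<sigma> l) = (if b then 0 else V k l)" if "k < h" "l < h" for b k l
  proof -
    have "Q b (?\<tau> k) (?\<sigma> i) = (if \<not> b \<and> i = k then 1 else 0)" if "i < h" for i
      using K[of "a' + m + k" "a' + i" b] that \<open>k < h\<close> by auto
    then have "(\<Sum>i<h. V i l * Q b (?\<tau> k) (?\<sigma> i)) = (if k < h then if b then 0 else V k l else 0)"
      by (intro sum_pick) auto
    moreover have "Q1 b (?\<tau> k) (?\<sigma> l) = (\<Sum>i<h. V i l * Q b (?\<tau> k) (?\<sigma> i))" using that by (intro GU1) auto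
    ultimately show ?thesis using that by simp
  qed
  have D1: "Q1 True (Gi (a' + k)) (?\<sigma> l) = (if k = l then 1 else 0)" if "k < h" "l < h" for k l
    using D that hm(1) by (subst GU1) (auto simp: inverse_on_def mult.commute)
  have inv: "inverse_on {..<h} {..<h} (\<lambda>k l. ?D l k) (\<lambda>k l. V l k)"
    using D by (auto simp: inverse_on_def mult.commute)
  have Kn: "p \<in> ?I - ?\<tau> ` {..<h}" if "p \<in> ?I" "\<And>i. p = Gi i \<Longrightarrow> i < a' + m" for p
    using that by fastforce
  obtain Q2 where Q2: "form_congruent ?I Q1 ?I Q2"
    "\<And>b p q. p \<in> ?I - ?\<tau> ` {..<h} \<Longrightarrow> q \<in> ?I - ?\<tau> ` {..<h} \<Longrightarrow> Q2 b p q = Q1 b p q"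
    "\<And>b l q. l < h \<Longrightarrow> q \<in> ?I - ?\<tau> ` {..<h} \<Longrightarrow> Q2 b (?\<tau> l) q = (\<Sum>i<h. ?D l i * Q1 b (?\<tau> i) q)"
    "\<And>b l k. l < h \<Longrightarrow> k < h \<Longrightarrow> Q2 b (?\<tau> l) (?\<tau> k) = (\<Sum>i<h. \<Sum>j<h. ?D l i * Q1 b (?\<tau> i) (?\<tau> j) * ?D k j)"
    by (rule bchange[OF finite_iset inj(2) sub(2) inv, of Q1]) (rule that)
  have sym2: "symmetric_on ?I Q2" by (rule symmetric_on_congruent[OF Q2(1) sym1])
  have GG1: "Q1 b (Gi i) (Gi j) = 0" if "i < a' + h + m" "j < a' + h + m" for b i j
    using Q1(2)[OF Gn Gn] GG that by simp
  have GG2': "Q2 b (Gi i) (Gi j) = 0" if "a' + m \<le> i" "i < a' + h + m" "j < a' + h + m" for b i j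
  proof -
    define l where "l = i - (a' + m)"
    have l: "l < h" "i = a' + m + l" using that by (auto simp: l_def)
    show ?thesis
    proof (cases "j < a' + m")
      case True
      then have "Q2 b (?\<tau> l) (Gi j) = (\<Sum>i<h. ?D l i * Q1 b (?\<tau> i) (Gi j))" by (intro Q2(3)[OF l(1)] Kn) auto
      also have "\<dots> = 0" using True by (intro sum_zero) (simp add: GG1)
      finally show ?thesis using l by simp
    next
      case False
      define k where "k = j - (a' + m)"
      have k: "k < h" "j = a' + m + k" using that False by (auto simp: k_def)
      have "Q2 b (?\<tau> l) (?\<tau> k) = 0" unfolding Q2(4)[OF l(1) k(1)] by (intro sum_zero) (simp add: GG1)
      then show ?thesis using l k by simp
    qed
  qed
  have GG2: "Q2 b (Gi i) (Gi j) = 0" if ij: "i < a' + h + m" "j < a' + h + m" for b i j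
  proof (cases "i < a' + m \<and> j < a' + m")
    case True
    then have "Q2 b (Gi i) (Gi j) = Q1 b (Gi i) (Gi j)" by (intro Q2(2) Kn) auto
    then show ?thesis using GG1 ij by simp
  next
    case False
    have "Q2 b (Gi i) (Gi j) = Q2 b (Gi j) (Gi i)" using ij by (intro symmetric_onD[OF sym2]) auto
    then show ?thesis using GG2'[of i j b] GG2'[of j i b] ij False by (cases "i < a' + m") auto
  qed
  have K2: "Q2 b (Gi i) (Ui j) = (if \<not> b \<and> i = j + m then 1 else 0)"
    if ij: "a' + m \<le> i" "i < a' + h + m" "j < a' + h" for b i j
  proof -
    define l where "l = i - (a' + m)"
    have l: "l < h" "i = a' + m + l" using that by (auto simp: l_def)
    have e: "Q2 b (?\<tau> l) (Ui j) = (\<Sum>i<h. ?D l i * Q1 b (?\<tau> i) (Ui j))" using ij by (intro Q2(3)[OF l(1)] Kn) auto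
    show ?thesis
    proof (cases "j < a'")
      case True
      have "Q1 b (?\<tau> i) (Ui j) = 0" if "i < h" for i
        using Q1(2)[OF Gn Un, of "a' + m + i" j b] K[of "a' + m + i" j b] that True by auto
      then have "(\<Sum>i<h. ?D l i * Q1 b (?\<tau> i) (Ui j)) = 0" by (intro sum_zero) simp
      then show ?thesis using e l True by simp
    next
      case False
      define k where "k = j - a'"
      have k: "k < h" "j = a' + k" using that False by (auto simp: k_def)
      have "(\<Sum>i<h. ?D l i * Q1 b (?\<tau> i) (?\<sigma> k)) = (\<Sum>i<h. if b then 0 else ?D l i * V i k)"
        using K1 k by (intro sum.cong) auto
      also have "\<dots> = (if \<not> b \<and> l = k then 1 else 0)" using D l k by (cases b) (auto simp: inverse_on_def)
      finally show ?thesis using e l k by simp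
    qed
  qed
  have un: "Q2 b p q = Q1 b p q" if "p \<in> ?I" "q \<in> ?I" "\<And>i. p = Gi i \<Longrightarrow> i < a' + m" "\<And>i. q = Gi i \<Longrightarrow> i < a' + m" for b p q
    using that by (intro Q2(2) Kn) auto
  have "form_congruent ?I Q2 ?I (shift_form m \<mu>)"
  proof (rule shift_form_reduction[OF hm sym2 GG2])
    fix i j assume "a' + m \<le> i" "i < a' + h + m" "j < a' + h"
    from K2[OF this] show "Q2 True (Gi i) (Ui j) = 0" "Q2 False (Gi i) (Ui j) = (if i = j + m then 1 else 0)"
      by simp_all
  next
    fix b i j assume ij: "i < a' + m" "j < a'"
    then have "Q2 b (Gi i) (Ui j) = Q1 b (Gi i) (Ui j)" by (intro un) auto
    also have "\<dots> = Q b (Gi i) (Ui j)" using ij by (intro Q1(2) Gn Un) auto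
    finally show "Q2 b (Gi i) (Ui j) = (if i = j + (if b then 0 else m) then 1 else 0)" using GU[OF ij] by simp
  next
    fix b i j assume ij: "i < a'" "j < a'"
    then have "Q2 b (Ui i) (Ui j) = Q1 b (Ui i) (Ui j)" by (intro un) auto
    also have "\<dots> = Q b (Ui i) (Ui j)" using ij by (intro Q1(2) Un) auto
    finally show "Q2 b (Ui i) (Ui j) = 0" using UU[OF ij] by simp
  next
    fix l l' assume l: "l < h" "l' < h"
    then have "Q2 True (Gi (a' + l)) (?\<sigma> l') = Q1 True (Gi (a' + l)) (?\<sigma> l')" using hm(1) by (intro un) auto
    then show "Q2 True (Gi (a' + l)) (?\<sigma> l') = (if l = l' then 1 else 0)" using D1 l by simp
  qed auto
  then have "form_congruent ?I Q1 ?I (shift_form m \<mu>)"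
    by (rule form_congruent_trans[OF finite_iset finite_iset finite_iset Q2(1)])
  then show ?thesis by (rule form_congruent_trans[OF finite_iset finite_iset finite_iset Q1(1)])
qed

lemma flagformD:
  assumes "flagform m a c Q"
  shows "symmetric_on (iset m a c) Q" "i < a + m \<Longrightarrow> j < a + m \<Longrightarrow> Q b (Gi i) (Gi j) = 0"
    "i < a + m \<Longrightarrow> j < c \<Longrightarrow> Q b (Gi i) (Wi j) = 0"
  using assms by (auto simp: flagform_def)

lemma inverse_on_cong:
  assumes "inverse_on I J W V" "\<And>i j. i \<in> I \<Longrightarrow> j \<in> J \<Longrightarrow> W' i j = W i j"
  shows "inverse_on I J W' V"
  using assms(1) unfolding inverse_on_def by (simp add: assms(2) cong: sum.cong)

text \<open>A small multiple of the identity makes the pairing of \<open>Gi (a' + l)\<close> and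
  \<open>Ui (a' + l')\<close> by \<open>A\<close> invertible. The perturbed positions are disjoint
  from the normalized ones because \<open>h \<le> m\<close>.\<close>

lemma generic_dense_normalized:
  fixes Q :: "bool \<Rightarrow> idx \<Rightarrow> idx \<Rightarrow> complex"
  assumes hm: "h \<le> m" "h = m \<or> a' = 0"
    and flag: "flagform m (a' + h) 0 Q"
    and K: "\<And>b i j. a' + m \<le> i \<Longrightarrow> i < a' + h + m \<Longrightarrow> j < a' + h \<Longrightarrow>
      Q b (Gi i) (Ui j) = (if \<not> b \<and> i = j + m then 1 else 0)"
    and GU: "\<And>b i j. i < a' + m \<Longrightarrow> j < a' \<Longrightarrow> Q b (Gi i) (Ui j) = (if i = j + (if b then 0 else m) then 1 else 0)"
    and UU: "\<And>b i j. i < a' \<Longrightarrow> j < a' \<Longrightarrow> Q b (Ui i) (Ui j) = 0"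
  shows "approximable (iset m (a' + h) 0) (generic_form m (a' + h) 0) Q"
proof (rule approximable_closure)
  fix \<epsilon> :: real assume "0 < \<epsilon>"
  from perturb_invertible[OF this, of h "\<lambda>l l'. Q True (Gi (a' + l)) (Ui (a' + l'))"]
  obtain t V where t: "cmod t < \<epsilon>"
    "inverse_on {..<h} {..<h} (\<lambda>l l'. Q True (Gi (a' + l)) (Ui (a' + l')) + (if l = l' then t else 0)) V"
    by (elim exE conjE) (rule that)
  let ?E = "\<lambda>p q. \<exists>l<h. p = Gi (a' + l) \<and> q = Ui (a' + l)"
  let ?Q = "perturb True ?E t Q"
  have "form_congruent (iset m (a' + h) 0) ?Q (iset m (a' + h) 0) (shift_form m (\<lambda>_. 0))"
  proof (rule normalized_step[OF hm symmetric_on_perturb[OF flagformD(1)[OF flag]]])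
    show "?Q b (Gi i) (Gi j) = 0" if "i < a' + h + m" "j < a' + h + m" for b i j
      using flagformD(2)[OF flag that, of b] by (simp add: perturb_def)
    show "?Q b (Gi i) (Ui j) = (if \<not> b \<and> i = j + m then 1 else 0)"
      if "a' + m \<le> i" "i < a' + h + m" "j < a' + h" for b i j
      using K[OF that, of b] that hm(1) by (auto simp: perturb_def)
    show "?Q b (Gi i) (Ui j) = (if i = j + (if b then 0 else m) then 1 else 0)" if "i < a' + m" "j < a'" for b i j
      using GU[OF that, of b] that by (auto simp: perturb_def)
    show "?Q b (Ui i) (Ui j) = 0" if "i < a'" "j < a'" for b i j
      using UU[OF that, of b] by (auto simp: perturb_def)
    show "inverse_on {..<h} {..<h} (\<lambda>l l'. ?Q True (Gi (a' + l)) (Ui (a' + l'))) V"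
      by (rule inverse_on_cong[OF t(2)]) (auto simp: perturb_def)
  qed
  then have "generic_form m (a' + h) 0 ?Q" by (intro generic_formI[of "\<lambda>_. 0"]) simp_all
  then show "\<exists>Q'. close_on (iset m (a' + h) 0) \<epsilon> Q Q' \<and> approximable (iset m (a' + h) 0) (generic_form m (a' + h) 0) Q'"
    by (intro exI[of _ ?Q] conjI close_on_perturb[OF t(1)] approximable_good)
qed

text \<open>The induction hypothesis perturbs the restriction to \<open>iset m a' 0\<close>, and the
  change of basis that normalizes it is extended by the identity. The pairing of the kernel vectors
  survives, since they are orthogonal to all of \<open>iset m a' 0\<close>.\<close>

lemma generic_dense_kernel_normalized:
  fixes Q :: "bool \<Rightarrow> idx \<Rightarrow> idx \<Rightarrow> complex"
  assumes IH: "\<And>Q. flagform m a' 0 Q \<Longrightarrow> approximable (iset m a' 0) (generic_form m a' 0) Q"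
    and hm: "h \<le> m" "h = m \<or> a' = 0"
    and flag: "flagform m (a' + h) 0 Q"
    and K: "\<And>b i j. a' + m \<le> i \<Longrightarrow> i < a' + h + m \<Longrightarrow> j < a' + h \<Longrightarrow>
      Q b (Gi i) (Ui j) = (if \<not> b \<and> i = j + m then 1 else 0)"
  shows "approximable (iset m (a' + h) 0) (generic_form m (a' + h) 0) Q"
proof (rule approximable_closure)
  let ?I = "iset m (a' + h) 0" and ?T = "iset m a' 0"
  fix \<epsilon> :: real assume e: "0 < \<epsilon>"
  have TI: "?T \<subseteq> ?I" by (auto simp: iset_def)
  have sym: "symmetric_on ?I Q" by (rule flagformD(1)[OF flag])
  have "flagform m a' 0 Q"
    unfolding flagform_def
  proof (intro conjI allI impI)
    show "symmetric_on ?T Q" using sym TI unfolding symmetric_on_def by blast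
    show "Q b (Gi i) (Gi j) = 0" if "i < a' + m" "j < a' + m" for b i j
      using that by (intro flagformD(2)[OF flag]) auto
  qed simp
  from IH[OF this] e obtain P where P: "generic_form m a' 0 P" "close_on ?T \<epsilon> Q P"
    unfolding approximable_def by blast
  let ?Q = "\<lambda>b p q. if p \<in> ?T \<and> q \<in> ?T then P b p q else Q b p q"
  have close: "close_on ?I \<epsilon> Q ?Q" using P(2) e by (auto simp: close_on_def)
  have symQ: "symmetric_on ?I ?Q"
    using sym generic_form_symmetric[OF P(1)] by (simp add: symmetric_on_def)
  obtain \<mu> where \<mu>: "form_congruent ?T (shift_form m \<mu>) ?T P"
    using P(1) unfolding generic_form_def by blast
  obtain R V where R: "inverse_on ?T ?T R V"
    "\<forall>b. \<forall>j\<in>?T. \<forall>j'\<in>?T. shift_form m \<mu> b j j' = bil ?T (P b) (\<lambda>i. R i j) (\<lambda>i. R i j')"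
    using form_congruent_sym[OF finite_iset finite_iset \<mu>] unfolding form_congruent_def
    by (elim exE conjE) (rule that)
  obtain Q1 where Q1: "form_congruent ?I ?Q ?I Q1"
    "\<And>b p q. p \<in> ?I - ?T \<Longrightarrow> q \<in> ?I - ?T \<Longrightarrow> Q1 b p q = ?Q b p q"
    "\<And>b p q. p \<in> ?T \<Longrightarrow> q \<in> ?I - ?T \<Longrightarrow> Q1 b p q = (\<Sum>i\<in>?T. R i p * ?Q b i q)"
    "\<And>b p q. p \<in> ?T \<Longrightarrow> q \<in> ?T \<Longrightarrow> Q1 b p q = bil ?T (?Q b) (\<lambda>i. R i p) (\<lambda>i. R i q)"
    by (rule bchange_set[OF finite_iset TI R(1), of ?Q]) (rule that)
  have sym1: "symmetric_on ?I Q1" by (rule symmetric_on_congruent[OF Q1(1) symQ])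
  have T1: "Q1 b p q = shift_form m \<mu> b p q" if "p \<in> ?T" "q \<in> ?T" for b p q
  proof -
    have "Q1 b p q = bil ?T (P b) (\<lambda>i. R i p) (\<lambda>i. R i q)"
      unfolding Q1(4)[OF that] by (rule bil_cong) simp
    then show ?thesis using R(2) that by simp
  qed
  have KT: "Q1 b p (Gi i) = 0" if "p \<in> ?T" "a' + m \<le> i" "i < a' + h + m" for b p i
  proof -
    have "Q1 b p (Gi i) = (\<Sum>k\<in>?T. R k p * ?Q b k (Gi i))" using that by (intro Q1(3)) auto
    also have "\<dots> = (\<Sum>k\<in>?T. 0)"
    proof (rule sum.cong[OF refl])
      fix k assume k: "k \<in> ?T"
      have "Q b k (Gi i) = Q b (Gi i) k" using k TI that by (intro symmetric_onD[OF sym]) auto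
      also have "\<dots> = 0"
      proof (cases k)
        case (Gi l)
        then show ?thesis using k that flagformD(2)[OF flag] by simp
      next
        case (Ui l)
        then show ?thesis using k that K[of i l b] by simp
      next
        case (Wi l)
        then show ?thesis using k by simp
      qed
      finally show "R k p * ?Q b k (Gi i) = 0" using that by simp
    qed
    finally show ?thesis by simp
  qed
  have GG1: "Q1 b (Gi i) (Gi j) = 0" if ij: "i < a' + h + m" "j < a' + h + m" for b i j
  proof -
    have s: "Q1 b (Gi i) (Gi j) = Q1 b (Gi j) (Gi i)" using that by (intro symmetric_onD[OF sym1]) auto
    consider "i < a' + m" "j < a' + m" | "i < a' + m" "a' + m \<le> j" | "a' + m \<le> i" "j < a' + m" | "a' + m \<le> i" "a' + m \<le> j"
      by linarith
    then show ?thesis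
    proof cases
      case 1 then show ?thesis using T1[of "Gi i" "Gi j" b] by simp
    next
      case 2 then show ?thesis using KT[of "Gi i" j b] ij by simp
    next
      case 3 then show ?thesis using KT[of "Gi j" i b] ij s by simp
    next
      case 4 then show ?thesis using Q1(2)[of "Gi i" "Gi j" b] ij flagformD(2)[OF flag ij, of b] by simp
    qed
  qed
  have "approximable ?I (generic_form m (a' + h) 0) Q1"
  proof (rule generic_dense_normalized[OF hm])
    show "flagform m (a' + h) 0 Q1" using sym1 GG1 by (simp add: flagform_def)
    show "Q1 b (Gi i) (Ui j) = (if \<not> b \<and> i = j + m then 1 else 0)"
      if ij: "a' + m \<le> i" "i < a' + h + m" "j < a' + h" for b i j
    proof (cases "j < a'")
      case True
      have "Q1 b (Gi i) (Ui j) = Q1 b (Ui j) (Gi i)" using ij by (intro symmetric_onD[OF sym1]) auto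
      then show ?thesis using True KT[of "Ui j" i b] ij by auto
    next
      case False
      then show ?thesis using Q1(2)[of "Gi i" "Ui j" b] K[OF ij, of b] ij by simp
    qed
    show "Q1 b (Gi i) (Ui j) = (if i = j + (if b then 0 else m) then 1 else 0)" if "i < a' + m" "j < a'" for b i j
      using T1[of "Gi i" "Ui j" b] that by simp
    show "Q1 b (Ui i) (Ui j) = 0" if "i < a'" "j < a'" for b i j
      using T1[of "Ui i" "Ui j" b] that by simp
  qed
  then show "\<exists>Q'. close_on ?I \<epsilon> Q Q' \<and> approximable ?I (generic_form m (a' + h) 0) Q'"
    by (intro exI[of _ ?Q] conjI close approximable_generic_congruent[OF Q1(1)])
qed

text \<open>The last \<open>h\<close> vectors \<open>Ui\<close> are changed so that \<open>B\<close>
  pairs them with the kernel vectors by the identity. Adding multiples of them to the other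
  \<open>Ui\<close> clears the rest of this pairing; the pairing by \<open>A\<close> stays
  0.\<close>

lemma generic_dense_kernel:
  fixes Q :: "bool \<Rightarrow> idx \<Rightarrow> idx \<Rightarrow> complex"
  assumes IH: "\<And>Q. flagform m a' 0 Q \<Longrightarrow> approximable (iset m a' 0) (generic_form m a' 0) Q"
    and hm: "h \<le> m" "h = m \<or> a' = 0"
    and flag: "flagform m (a' + h) 0 Q"
    and K: "\<And>i j. a' + m \<le> i \<Longrightarrow> i < a' + h + m \<Longrightarrow> j < a' + h \<Longrightarrow> Q True (Gi i) (Ui j) = 0"
    and E: "inverse_on {..<h} {..<h} (\<lambda>l l'. Q False (Gi (a' + m + l)) (Ui (a' + l'))) V"
  shows "approximable (iset m (a' + h) 0) (generic_form m (a' + h) 0) Q"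
proof -
  let ?I = "iset m (a' + h) 0" and ?\<sigma> = "\<lambda>l. Ui (a' + l)" and ?\<tau> = "\<lambda>l. Gi (a' + m + l)"
  have inj: "inj_on ?\<sigma> {..<h}" by (auto simp: inj_on_def)
  have sub: "?\<sigma> ` {..<h} \<subseteq> ?I" by auto
  have sym: "symmetric_on ?I Q" by (rule flagformD(1)[OF flag])
  obtain Q1 where Q1: "form_congruent ?I Q ?I Q1"
    "\<And>b p q. p \<in> ?I - ?\<sigma> ` {..<h} \<Longrightarrow> q \<in> ?I - ?\<sigma> ` {..<h} \<Longrightarrow> Q1 b p q = Q b p q"
    "\<And>b l q. l < h \<Longrightarrow> q \<in> ?I - ?\<sigma> ` {..<h} \<Longrightarrow> Q1 b (?\<sigma> l) q = (\<Sum>i<h. V i l * Q b (?\<sigma> i) q)"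
    "\<And>b l k. l < h \<Longrightarrow> k < h \<Longrightarrow> Q1 b (?\<sigma> l) (?\<sigma> k) = (\<Sum>i<h. \<Sum>j<h. V i l * Q b (?\<sigma> i) (?\<sigma> j) * V j k)"
    by (rule bchange[OF finite_iset inj sub inverse_on_sym[OF E], of Q]) (rule that)
  have sym1: "symmetric_on ?I Q1" by (rule symmetric_on_congruent[OF Q1(1) sym])
  have GG1: "Q1 b (Gi i) (Gi j) = 0" if "i < a' + h + m" "j < a' + h + m" for b i j
  proof -
    have "Q1 b (Gi i) (Gi j) = Q b (Gi i) (Gi j)" using that by (intro Q1(2)) auto
    then show ?thesis using flagformD(2)[OF flag that] by simp
  qed
  have K1: "Q1 b (?\<tau> k) (?\<sigma> l) = (if \<not> b \<and> k = l then 1 else 0)" if kl: "k < h" "l < h" for b k l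
  proof -
    have "Q1 b (?\<tau> k) (?\<sigma> l) = Q1 b (?\<sigma> l) (?\<tau> k)" using that by (intro symmetric_onD[OF sym1]) auto
    also have "\<dots> = (\<Sum>i<h. V i l * Q b (?\<sigma> i) (?\<tau> k))" using that by (intro Q1(3)) auto
    also have "\<dots> = (\<Sum>i<h. Q b (?\<tau> k) (?\<sigma> i) * V i l)"
    proof (intro sum.cong refl)
      fix i assume "i \<in> {..<h}"
      then have "Q b (?\<sigma> i) (?\<tau> k) = Q b (?\<tau> k) (?\<sigma> i)" using that by (intro symmetric_onD[OF sym]) auto
      then show "V i l * Q b (?\<sigma> i) (?\<tau> k) = Q b (?\<tau> k) (?\<sigma> i) * V i l" by simp
    qed
    also have "\<dots> = (if \<not> b \<and> k = l then 1 else 0)"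
    proof (cases b)
      case True
      have "(\<Sum>i<h. Q b (?\<tau> k) (?\<sigma> i) * V i l) = 0" using K kl True by (intro sum_zero) simp
      then show ?thesis using True by simp
    next
      case False
      then show ?thesis using E kl by (simp add: inverse_on_def)
    qed
    finally show ?thesis .
  qed
  have K1': "Q1 True (?\<tau> k) (Ui j) = 0" if "k < h" "j < a'" for k j
  proof -
    have "Q1 True (?\<tau> k) (Ui j) = Q True (?\<tau> k) (Ui j)" using that by (intro Q1(2)) auto
    then show ?thesis using K that by simp
  qed
  define c where "c l p = (case p of Ui j \<Rightarrow> if j < a' then - Q1 False (?\<tau> l) (Ui j) else 0 | _ \<Rightarrow> 0)" for l p
  define Q2 where "Q2 = shear h ?\<sigma> c Q1"
  have cong2: "form_congruent ?I Q1 ?I Q2"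
    unfolding Q2_def by (rule form_congruent_shear) (auto simp: c_def)
  have sym2: "symmetric_on ?I Q2" by (rule symmetric_on_congruent[OF cong2 sym1])
  have "approximable ?I (generic_form m (a' + h) 0) Q2"
  proof (rule generic_dense_kernel_normalized[OF IH hm])
    show "flagform m (a' + h) 0 Q2"
      using sym2 GG1 by (simp add: flagform_def Q2_def shear_def c_def)
    fix b i j assume ij: "a' + m \<le> i" "i < a' + h + m" "j < a' + h"
    define k where "k = i - (a' + m)"
    have k: "k < h" "i = a' + m + k" using ij by (auto simp: k_def)
    have e: "Q2 b (?\<tau> k) (Ui j) = Q1 b (?\<tau> k) (Ui j) + (\<Sum>l<h. c l (Ui j) * Q1 b (?\<tau> k) (?\<sigma> l))"
      by (simp add: Q2_def shear_def c_def)
    have "(\<Sum>l<h. c l (Ui j) * Q1 b (?\<tau> k) (?\<sigma> l)) = (if k < h then if b then 0 else c k (Ui j) else 0)"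
      by (rule sum_pick) (use K1 k in auto)
    then have e': "Q2 b (?\<tau> k) (Ui j) = Q1 b (?\<tau> k) (Ui j) + (if b then 0 else c k (Ui j))" using e k by simp
    show "Q2 b (Gi i) (Ui j) = (if \<not> b \<and> i = j + m then 1 else 0)"
    proof (cases "j < a'")
      case True
      then show ?thesis using e' k K1'[OF k(1) True] by (cases b) (auto simp: c_def)
    next
      case False
      define l where "l = j - a'"
      have l: "l < h" "j = a' + l" using ij False by (auto simp: l_def)
      show ?thesis using e' k l K1[OF k(1) l(1), of b] by (simp add: c_def)
    qed
  qed
  then show ?thesis by (intro approximable_generic_congruent[OF Q1(1)] approximable_generic_congruent[OF cong2])
qed

text \<open>The last \<open>h\<close> of the vectors \<open>Gi\<close> are chosen in the kernel of \<open>A\<close>, and \<open>B\<close> is perturbed so that it pairs them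
  perfectly with the last \<open>h\<close> of the vectors \<open>Ui\<close>. The induction hypothesis applies to the remaining vectors.\<close>

lemma generic_dense_step:
  fixes Q :: "bool \<Rightarrow> idx \<Rightarrow> idx \<Rightarrow> complex"
  assumes IH: "\<And>Q. flagform m a' 0 Q \<Longrightarrow> approximable (iset m a' 0) (generic_form m a' 0) Q"
    and hm: "h \<le> m" "h = m \<or> a' = 0"
    and flag: "flagform m (a' + h) 0 Q"
  shows "approximable (iset m (a' + h) 0) (generic_form m (a' + h) 0) Q"
proof -
  let ?I = "iset m (a' + h) 0" and ?N = "a' + h + m" and ?a = "a' + h"
  have sym: "symmetric_on ?I Q" by (rule flagformD(1)[OF flag])
  let ?M = "\<lambda>i j. Q True (Gi i) (Ui j)"
  let ?S = "{x \<in> supported {..<?N}. \<forall>j<?a. (\<Sum>i<?N. x i * ?M i j) = 0}"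
  \<comment> \<open>There are \<open>m\<close> more vectors \<open>Gi\<close> than
    \<open>Ui\<close>, so this left kernel has dimension at least \<open>m\<close>, hence at least
    \<open>h\<close>.\<close>
  have S: "fv.subspace ?S" "h \<le> fv.dim ?S" using left_kernel[of ?N ?a ?M] hm(1) by simp_all
  have "?S \<subseteq> supported {..<?N}" by simp
  then obtain R V where R: "inverse_on {..<?N} {..<?N} R V"
    "\<And>l. ?N - h \<le> l \<Longrightarrow> l < ?N \<Longrightarrow> (\<lambda>i. R i l) \<in> ?S" by (rule subspace_basis[OF S(1) _ S(2)]) (rule that)
  have inj: "inj_on Gi {..<?N}" by (simp add: inj_on_def)
  have sub: "Gi ` {..<?N} \<subseteq> ?I" by auto
  obtain Q1 where Q1: "form_congruent ?I Q ?I Q1"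
    "\<And>b p q. p \<in> ?I - Gi ` {..<?N} \<Longrightarrow> q \<in> ?I - Gi ` {..<?N} \<Longrightarrow> Q1 b p q = Q b p q"
    "\<And>b l q. l < ?N \<Longrightarrow> q \<in> ?I - Gi ` {..<?N} \<Longrightarrow> Q1 b (Gi l) q = (\<Sum>i<?N. R i l * Q b (Gi i) q)"
    "\<And>b l k. l < ?N \<Longrightarrow> k < ?N \<Longrightarrow> Q1 b (Gi l) (Gi k) = (\<Sum>i<?N. \<Sum>j<?N. R i l * Q b (Gi i) (Gi j) * R j k)"
    by (rule bchange[OF finite_iset inj sub R(1), of Q]) (rule that)
  have sym1: "symmetric_on ?I Q1" by (rule symmetric_on_congruent[OF Q1(1) sym])
  have GG1: "Q1 b (Gi i) (Gi j) = 0" if "i < ?N" "j < ?N" for b i j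
    unfolding Q1(4)[OF that] by (intro sum_zero) (simp add: flagformD(2)[OF flag])
  have K1: "Q1 True (Gi i) (Ui j) = 0" if ij: "a' + m \<le> i" "i < ?N" "j < ?a" for i j
  proof -
    have "Q1 True (Gi i) (Ui j) = (\<Sum>k<?N. R k i * Q True (Gi k) (Ui j))" using ij by (intro Q1(3)) auto
    also have "\<dots> = 0" using R(2)[of i] ij by simp
    finally show ?thesis .
  qed
  have "approximable ?I (generic_form m ?a 0) Q1"
  proof (rule approximable_closure)
    fix \<epsilon> :: real assume "0 < \<epsilon>"
    from perturb_invertible[OF this, of h "\<lambda>l l'. Q1 False (Gi (a' + m + l)) (Ui (a' + l'))"]
    obtain t V where t: "cmod t < \<epsilon>"
      "inverse_on {..<h} {..<h} (\<lambda>l l'. Q1 False (Gi (a' + m + l)) (Ui (a' + l')) + (if l = l' then t else 0)) V"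
      by (elim exE conjE) (rule that)
    let ?E = "\<lambda>p q. \<exists>l<h. p = Gi (a' + m + l) \<and> q = Ui (a' + l)"
    let ?Q = "perturb False ?E t Q1"
    have "approximable ?I (generic_form m ?a 0) ?Q"
    proof (rule generic_dense_kernel[OF IH hm])
      show "flagform m ?a 0 ?Q"
        unfolding flagform_def using symmetric_on_perturb[OF sym1] GG1 by (simp add: perturb_def)
      show "?Q True (Gi i) (Ui j) = 0" if "a' + m \<le> i" "i < ?N" "j < ?a" for i j
        using K1[OF that] by (simp add: perturb_def)
      show "inverse_on {..<h} {..<h} (\<lambda>l l'. ?Q False (Gi (a' + m + l)) (Ui (a' + l'))) V"
        by (rule inverse_on_cong[OF t(2)]) (auto simp: perturb_def)
    qed
    then show "\<exists>Q'. close_on ?I \<epsilon> Q1 Q' \<and> approximable ?I (generic_form m ?a 0) Q'"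
      by (intro exI[of _ ?Q] conjI close_on_perturb[OF t(1)])
  qed
  then show ?thesis by (rule approximable_generic_congruent[OF Q1(1)])
qed

text \<open>In \<open>shift_form\<close> a chain passes from \<open>Gi j\<close> to
  \<open>Gi (j + m)\<close> through \<open>Ui j\<close>, so \<open>m\<close> of the
  \<open>Ui\<close> are peeled off at a time. A smaller number is peeled off only when nothing else
  is left, which gives \<open>h = m \<or> a' = 0\<close>.\<close>

lemma generic_dense_0:
  assumes "0 < m" "flagform m a 0 Q"
  shows "approximable (iset m a 0) (generic_form m a 0) Q"
  using assms(2)
proof (induction a arbitrary: Q rule: less_induct)
  case (less a)
  show ?case
  proof (cases "a = 0")
    case True
    have "form_congruent (iset m a 0) Q (iset m a 0) (shift_form m (\<lambda>_. 0))"
    proof (rule form_congruent_cong[OF finite_iset])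
      fix b i j assume "i \<in> iset m a 0" "j \<in> iset m a 0"
      then obtain i' j' where "i = Gi i'" "j = Gi j'" "i' < a + m" "j' < a + m" using True by (auto simp: iset_def)
      then show "shift_form m (\<lambda>_. 0) b i j = Q b i j" using flagformD(2)[OF less.prems] by simp
    qed
    then have "generic_form m a 0 Q" by (intro generic_formI[of "\<lambda>_. 0"]) simp_all
    then show ?thesis by (rule approximable_good)
  next
    case False
    define h where "h = min a m"
    define a' where "a' = a - h"
    have h: "h \<le> m" "h = m \<or> a' = 0" "a = a' + h" "a' < a" using False assms(1) by (auto simp: h_def a'_def)
    have IH: "approximable (iset m a' 0) (generic_form m a' 0) Q" if "flagform m a' 0 Q" for Q
      by (rule less.IH[OF h(4) that])
    show ?thesis using generic_dense_step[OF IH h(1,2), of Q] less.prems h(3) by simp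
  qed
qed

section \<open>Splitting off eigenvalues\<close>

text \<open>The new vector is orthogonal to the old ones, so the change of basis that normalizes
  these leaves it alone.\<close>

lemma generic_extend:
  fixes Q :: "bool \<Rightarrow> idx \<Rightarrow> idx \<Rightarrow> complex"
  assumes gen: "generic_form m a c P"
    and P: "\<And>b p q. p \<in> iset m a c \<Longrightarrow> q \<in> iset m a c \<Longrightarrow> Q b p q = P b p q"
    and Z: "\<And>b p. p \<in> iset m a c \<Longrightarrow> Q b p (Wi c) = 0" "\<And>b p. p \<in> iset m a c \<Longrightarrow> Q b (Wi c) p = 0"
    and \<mu>: "inj_on \<mu> {..<Suc c}" "form_congruent (iset m a c) (shift_form m \<mu>) (iset m a c) P"
    and W: "Q True (Wi c) (Wi c) = 1" "Q False (Wi c) (Wi c) = - \<mu> c"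
  shows "generic_form m a (Suc c) Q"
proof -
  let ?I = "iset m a (Suc c)" and ?T = "iset m a c"
  have TI: "?T \<subseteq> ?I" "?I - ?T = {Wi c}" by (auto simp: iset_def)
  obtain R V where R: "inverse_on ?T ?T R V"
    "\<forall>b. \<forall>j\<in>?T. \<forall>j'\<in>?T. shift_form m \<mu> b j j' = bil ?T (P b) (\<lambda>i. R i j) (\<lambda>i. R i j')"
    using form_congruent_sym[OF finite_iset finite_iset \<mu>(2)] unfolding form_congruent_def
    by (elim exE conjE) (rule that)
  have fin: "finite ?I" by simp
  obtain Q1 where Q1: "form_congruent ?I Q ?I Q1"
    "\<And>b p q. p \<in> ?I - ?T \<Longrightarrow> q \<in> ?I - ?T \<Longrightarrow> Q1 b p q = Q b p q"
    "\<And>b p q. p \<in> ?T \<Longrightarrow> q \<in> ?I - ?T \<Longrightarrow> Q1 b p q = (\<Sum>i\<in>?T. R i p * Q b i q)"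
    "\<And>b p q. p \<in> ?T \<Longrightarrow> q \<in> ?T \<Longrightarrow> Q1 b p q = bil ?T (Q b) (\<lambda>i. R i p) (\<lambda>i. R i q)"
    by (rule bchange_set[OF fin TI(1) R(1), of Q]) (rule that)
  have symQ: "symmetric_on ?I Q"
    unfolding symmetric_on_def
  proof (intro allI ballI)
    fix b p q assume "p \<in> ?I" "q \<in> ?I"
    then have "p \<in> ?T \<or> p = Wi c" "q \<in> ?T \<or> q = Wi c" using TI(2) by auto
    then show "Q b p q = Q b q p"
      using P Z symmetric_onD[OF generic_form_symmetric[OF gen]] by auto
  qed
  have sym1: "symmetric_on ?I Q1" by (rule symmetric_on_congruent[OF Q1(1) symQ])
  have T1: "Q1 b p q = shift_form m \<mu> b p q" if "p \<in> ?T" "q \<in> ?T" for b p q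
  proof -
    have "Q1 b p q = bil ?T (P b) (\<lambda>i. R i p) (\<lambda>i. R i q)"
      unfolding Q1(4)[OF that] by (rule bil_cong) (simp add: P)
    then show ?thesis using R(2) that by simp
  qed
  have TW: "Q1 b p (Wi c) = 0" if "p \<in> ?T" for b p
  proof -
    have "Q1 b p (Wi c) = (\<Sum>i\<in>?T. R i p * Q b i (Wi c))" using that TI(2) by (intro Q1(3)) auto
    then show ?thesis using Z(1) by simp
  qed
  have WW: "Q1 b (Wi c) (Wi c) = Q b (Wi c) (Wi c)" for b using TI(2) by (intro Q1(2)) auto
  have SW: "shift_form m \<mu> b p (Wi c) = 0" "shift_form m \<mu> b (Wi c) p = 0" if "p \<in> ?T" for b p
    using that by (cases p; auto)+
  have "form_congruent ?I Q1 ?I (shift_form m \<mu>)"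
  proof (rule form_congruent_cong[OF fin])
    fix b p q assume pq: "p \<in> ?I" "q \<in> ?I"
    have s: "Q1 b p q = Q1 b q p" by (rule symmetric_onD[OF sym1 pq])
    have "p \<in> ?T \<or> p = Wi c" "q \<in> ?T \<or> q = Wi c" using TI(2) pq by auto
    then consider "p \<in> ?T" "q \<in> ?T" | "p \<in> ?T" "q = Wi c" | "p = Wi c" "q \<in> ?T" | "p = Wi c" "q = Wi c" by blast
    then show "shift_form m \<mu> b p q = Q1 b p q"
    proof cases
      case 1 then show ?thesis using T1 by simp
    next
      case 2 then show ?thesis using TW SW by simp
    next
      case 3 then show ?thesis using TW SW s by simp
    next
      case 4 then show ?thesis using WW W by (cases b) simp_all
    qed
  qed
  then show ?thesis
    by (intro generic_formI[OF \<mu>(1)] form_congruent_trans[OF fin fin fin Q1(1)])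
qed

text \<open>The restriction to \<open>iset m a c\<close> is approximated first. Its eigenvalues are
  then finitely many values to be avoided by a small change of the eigenvalue of
  \<open>Wi c\<close>.\<close>

lemma generic_dense_split:
  fixes Q :: "bool \<Rightarrow> idx \<Rightarrow> idx \<Rightarrow> complex"
  assumes IH: "approximable (iset m a c) (generic_form m a c) Q"
    and Z: "\<And>b p. p \<in> iset m a c \<Longrightarrow> Q b p (Wi c) = 0" "\<And>b p. p \<in> iset m a c \<Longrightarrow> Q b (Wi c) p = 0"
    and W: "Q True (Wi c) (Wi c) = 1"
  shows "approximable (iset m a (Suc c)) (generic_form m a (Suc c)) Q"
  unfolding approximable_def
proof (intro allI impI)
  let ?I = "iset m a (Suc c)" and ?T = "iset m a c"
  fix \<epsilon> :: real assume e: "0 < \<epsilon>"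
  obtain P where P: "generic_form m a c P" "close_on ?T \<epsilon> Q P" using IH e unfolding approximable_def by blast
  obtain \<mu> where \<mu>: "inj_on \<mu> {..<c}" "form_congruent ?T (shift_form m \<mu>) ?T P"
    using P(1) unfolding generic_form_def by blast
  define \<beta> where "\<beta> = Q False (Wi c) (Wi c)"
  have "finite ((\<lambda>k. - \<beta> - \<mu> k) ` {..<c})" by simp
  from finite_avoid_small[OF this e] obtain s where s: "s \<notin> (\<lambda>k. - \<beta> - \<mu> k) ` {..<c}" "cmod s < \<epsilon>"
    by (elim exE conjE) (rule that)
  \<comment> \<open>In \<open>shift_form\<close> the entry of \<open>B\<close> is minus the
    eigenvalue.\<close>
  define \<nu> where "\<nu> = \<mu>(c := - \<beta> - s)"
  have \<nu>: "inj_on \<nu> {..<Suc c}"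
  proof -
    have ne: "- \<beta> - s \<noteq> \<mu> k" if "k < c" for k
    proof
      assume "- \<beta> - s = \<mu> k"
      then have "s = - \<beta> - \<mu> k" by (simp add: algebra_simps)
      then show False using s(1) that by simp
    qed
    then have "\<nu> c \<notin> \<nu> ` ({..<c} - {c})" by (auto simp: \<nu>_def)
    moreover have "inj_on \<nu> {..<c}" using \<mu>(1) inj_on_cong[of "{..<c}" \<nu> \<mu>] by (simp add: \<nu>_def)
    ultimately show ?thesis unfolding lessThan_Suc inj_on_insert by simp
  qed
  let ?Q = "\<lambda>b p q. if p \<in> ?T \<and> q \<in> ?T then P b p q else if p = Wi c \<and> q = Wi c then if b then 1 else \<beta> + s else 0"
  have cong: "form_congruent ?T (shift_form m \<nu>) ?T P"
  proof (rule form_congruent_trans[OF finite_iset finite_iset finite_iset _ \<mu>(2)], rule form_congruent_cong[OF finite_iset])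
    fix b p q assume "p \<in> ?T" "q \<in> ?T"
    then show "shift_form m \<mu> b p q = shift_form m \<nu> b p q" by (cases p; cases q) (auto simp: \<nu>_def)
  qed
  have "generic_form m a (Suc c) ?Q"
    by (rule generic_extend[OF P(1) _ _ _ \<nu> cong]) (auto simp: \<nu>_def)
  moreover have "close_on ?I \<epsilon> Q ?Q"
    unfolding close_on_def
  proof (intro allI ballI)
    fix b p q assume pq: "p \<in> ?I" "q \<in> ?I"
    have "?I - ?T = {Wi c}" by (auto simp: iset_def)
    then have "p \<in> ?T \<or> p = Wi c" "q \<in> ?T \<or> q = Wi c" using pq by auto
    then consider "p \<in> ?T" "q \<in> ?T" | "p \<in> ?T" "q = Wi c" | "p = Wi c" "q \<in> ?T" | "p = Wi c" "q = Wi c" by blast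
    then show "cmod (Q b p q - ?Q b p q) < \<epsilon>"
    proof cases
      case 1 then show ?thesis using P(2) by (simp add: close_on_def)
    next
      case 2 then show ?thesis using Z e by auto
    next
      case 3 then show ?thesis using Z e by auto
    next
      case 4 then show ?thesis using W s(2) e by (cases b) (simp_all add: \<beta>_def)
    qed
  qed
  ultimately show "\<exists>Q'. generic_form m a (Suc c) Q' \<and> close_on ?I \<epsilon> Q Q'" by blast
qed

text \<open>The vector \<open>Wi c\<close> can be changed within the flag so that it lies in the kernel of \<open>\<zeta>A + B\<close>. Being
  non-isotropic for \<open>A\<close>, it then splits off as a block with eigenvalue \<open>\<zeta>\<close>.\<close>

lemma generic_dense_complement:
  fixes Q :: "bool \<Rightarrow> idx \<Rightarrow> idx \<Rightarrow> complex"
  assumes IH: "\<And>Q. flagform m a c Q \<Longrightarrow> approximable (iset m a c) (generic_form m a c) Q"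
    and flag: "flagform m a (Suc c) Q"
    and L: "\<And>l. l \<le> c \<Longrightarrow> \<zeta> * Q True (Wi l) (Wi c) + Q False (Wi l) (Wi c) = 0"
    and \<alpha>: "Q True (Wi c) (Wi c) \<noteq> 0"
    and E: "inverse_on {..<a} {..<a} (\<lambda>l j. \<zeta> * Q True (Gi l) (Ui j) + Q False (Gi l) (Ui j)) V"
  shows "approximable (iset m a (Suc c)) (generic_form m a (Suc c)) Q"
proof -
  let ?I = "iset m a (Suc c)" and ?T = "iset m a c" and ?w = "Wi c"
  have fin: "finite ?I" by simp
  have TI: "?T \<subseteq> ?I" "?w \<in> ?I" "?w \<notin> ?T" by (auto simp: iset_def)
  have IT: "?I - ?T = {?w}" by (auto simp: iset_def)
  have sym: "symmetric_on ?I Q" by (rule flagformD(1)[OF flag])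
  have GG: "Q b (Gi i) (Gi j) = 0" if "i < a + m" "j < a + m" for b i j by (rule flagformD(2)[OF flag that])
  have GW: "Q b (Gi i) (Wi j) = 0" if "i < a + m" "j < Suc c" for b i j by (rule flagformD(3)[OF flag that])
  have WG: "Q b (Wi j) (Gi i) = 0" if "i < a + m" "j < Suc c" for b i j
    using symmetric_onD[OF sym, of "Wi j" "Gi i" b] GW[OF that, of b] that by simp
  define L where "L Q p q = \<zeta> * Q True p q + Q False p q" for Q :: "bool \<Rightarrow> idx \<Rightarrow> idx \<Rightarrow> complex" and p q
  \<comment> \<open>The multiples of \<open>Gi l\<close> to be added to \<open>Wi c\<close> so that
    \<open>\<zeta>A + B\<close> vanishes between it and all \<open>Ui j\<close>; \<open>V\<close>
    inverts the pairing of the \<open>Gi l\<close> with the \<open>Ui j\<close>.\<close>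
  define t where "t l = - (\<Sum>j<a. L Q ?w (Ui j) * V j l)" for l
  define c1 where "c1 l p = (if p = ?w then t l else 0)" for l p
  define Q1 where "Q1 = shear a Gi c1 Q"
  have cong1: "form_congruent ?I Q ?I Q1"
    unfolding Q1_def by (rule form_congruent_shear) (auto simp: c1_def)
  have sym1: "symmetric_on ?I Q1" by (rule symmetric_on_congruent[OF cong1 sym])
  have T1: "Q1 b p q = Q b p q" if "p \<noteq> ?w" "q \<noteq> ?w" for b p q
    using that by (simp add: Q1_def shear_def c1_def)
  have WT1: "Q1 b ?w q = Q b ?w q + (\<Sum>l<a. t l * Q b (Gi l) q)" if "q \<noteq> ?w" for b q
    using that by (simp add: Q1_def shear_def c1_def)
  have WW1: "Q1 b ?w ?w = Q b ?w ?w" for b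
  proof -
    have "(\<Sum>l<a. c1 l ?w * Q b (Gi l) ?w) = 0" "(\<Sum>l<a. c1 l ?w * Q b ?w (Gi l)) = 0"
      "(\<Sum>l<a. \<Sum>l'<a. c1 l ?w * c1 l' ?w * Q b (Gi l) (Gi l')) = 0"
      by (intro sum_zero; simp add: GG GW WG)+
    then show ?thesis by (simp add: Q1_def shear_def)
  qed
  have L1: "L Q1 ?w p = 0" if p: "p \<in> ?I" for p
  proof (cases p)
    case (Gi i)
    have "Q1 b ?w p = 0" for b
    proof -
      have "(\<Sum>l<a. t l * Q b (Gi l) p) = 0" using p Gi by (intro sum_zero) (simp add: GG)
      then show ?thesis using WT1[of p b] p Gi WG by simp
    qed
    then show ?thesis by (simp add: L_def)
  next
    case (Ui j)
    have j: "j < a" using p Ui by simp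
    have "L Q1 ?w p = L Q ?w (Ui j) + (\<Sum>l<a. t l * L Q (Gi l) (Ui j))"
      unfolding L_def Ui using WT1[of "Ui j"] by (simp add: algebra_simps sum.distrib sum_distrib_left)
    also have "(\<Sum>l<a. t l * L Q (Gi l) (Ui j)) = - (\<Sum>l<a. \<Sum>k<a. L Q ?w (Ui k) * (V k l * L Q (Gi l) (Ui j)))"
      unfolding t_def by (simp add: sum_negf sum_distrib_right mult.assoc)
    also have "(\<Sum>l<a. \<Sum>k<a. L Q ?w (Ui k) * (V k l * L Q (Gi l) (Ui j)))
        = (\<Sum>k<a. \<Sum>l<a. L Q ?w (Ui k) * (V k l * L Q (Gi l) (Ui j)))" by (rule sum.swap)
    also have "\<dots> = (\<Sum>k<a. L Q ?w (Ui k) * (\<Sum>l<a. V k l * L Q (Gi l) (Ui j)))"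
      by (simp add: sum_distrib_left)
    also have "\<dots> = (if j < a then L Q ?w (Ui j) else 0)"
      by (rule sum_pick) (use E j in \<open>auto simp: inverse_on_def L_def\<close>)
    finally show ?thesis using j by simp
  next
    case (Wi l)
    have l: "l \<le> c" using p Wi by simp
    have "Q1 b ?w p = Q b ?w p" for b
    proof (cases "l = c")
      case True then show ?thesis using WW1 Wi by simp
    next
      case False
      have "(\<Sum>k<a. t k * Q b (Gi k) p) = 0" using p Wi by (intro sum_zero) (simp add: GW)
      then show ?thesis using WT1[of p b] False Wi by simp
    qed
    moreover have "Q b ?w p = Q b p ?w" for b using p TI by (intro symmetric_onD[OF sym]) auto
    ultimately show ?thesis using L[OF l] Wi by (simp add: L_def)
  qed
  let ?\<alpha> = "Q True ?w ?w"
  \<comment> \<open>Orthogonalization with respect to \<open>A\<close>. It is also one for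
    \<open>B\<close>, since \<open>Wi c\<close> is now in the kernel of
    \<open>\<zeta>A + B\<close>.\<close>
  define c2 where "c2 l p = (if p = ?w then 0 else - Q1 True ?w p / ?\<alpha>)" for l :: nat and p
  define Q2 where "Q2 = shear 1 (\<lambda>_. ?w) c2 Q1"
  have cong2: "form_congruent ?I Q1 ?I Q2"
    unfolding Q2_def by (rule form_congruent_shear) (auto simp: c2_def TI)
  have sym2: "symmetric_on ?I Q2" by (rule symmetric_on_congruent[OF cong2 sym1])
  have wp: "Q2 b ?w p = 0" if p: "p \<in> ?T" for b p
  proof -
    have pw: "p \<noteq> ?w" "p \<in> ?I" using p TI by auto
    have e: "Q2 b ?w p = Q1 b ?w p - Q1 True ?w p / ?\<alpha> * Q1 b ?w ?w" for b
      using pw by (simp add: Q2_def shear_def c2_def)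
    have A: "Q2 True ?w p = 0" unfolding e WW1 using \<alpha> by simp
    have "L Q2 ?w p = L Q1 ?w p - Q1 True ?w p / ?\<alpha> * L Q1 ?w ?w" unfolding L_def e by (simp add: algebra_simps)
    also have "\<dots> = 0" using L1[OF pw(2)] L1[OF TI(2)] by simp
    finally have "Q2 False ?w p = 0" using A by (simp add: L_def)
    then show ?thesis using A by (cases b) simp_all
  qed
  have pw: "Q2 b p ?w = 0" if "p \<in> ?T" for b p
    using wp[OF that, of b] symmetric_onD[OF sym2, of p ?w b] that TI by auto
  have WW2: "Q2 b ?w ?w = Q b ?w ?w" for b by (simp add: Q2_def shear_def c2_def WW1)
  have wG: "Q1 b ?w (Gi i) = 0" if "i < a + m" for b i
  proof -
    have "(\<Sum>l<a. t l * Q b (Gi l) (Gi i)) = 0" using that by (intro sum_zero) (simp add: GG)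
    then show ?thesis using WT1[of "Gi i" b] that WG by simp
  qed
  have Gw: "Q1 b (Gi i) ?w = 0" if "i < a + m" for b i
    using wG[OF that, of b] symmetric_onD[OF sym1, of "Gi i" ?w b] that TI by auto
  have flag2: "flagform m a c Q2"
    unfolding flagform_def
  proof (intro conjI allI impI)
    show "symmetric_on ?T Q2" using sym2 TI(1) unfolding symmetric_on_def by blast
    fix b i assume i: "i < a + m"
    show "Q2 b (Gi i) (Gi j) = 0" if "j < a + m" for j
      using i that by (simp add: Q2_def shear_def c2_def T1 GG wG)
    show "Q2 b (Gi i) (Wi j) = 0" if "j < c" for j
      using i that by (simp add: Q2_def shear_def c2_def T1 GW wG Gw)
  qed
  \<comment> \<open>Rescaling of \<open>Wi c\<close>, to make its diagonal entry in \<open>A\<close>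
    equal to 1.\<close>
  define \<rho> where "\<rho> = 1 / csqrt ?\<alpha>"
  have \<rho>: "\<rho> \<noteq> 0" "\<rho> * ?\<alpha> * \<rho> = 1"
  proof -
    have "csqrt ?\<alpha> * csqrt ?\<alpha> = ?\<alpha>" using power2_csqrt[of ?\<alpha>] by (simp only: power2_eq_square)
    then show "\<rho> \<noteq> 0" "\<rho> * ?\<alpha> * \<rho> = 1" using \<alpha> by (auto simp: \<rho>_def field_simps)
  qed
  have inv: "inverse_on {?w} {?w} (\<lambda>_ _. \<rho>) (\<lambda>_ _. 1 / \<rho>)" using \<rho>(1) by (simp add: inverse_on_def)
  have wI: "{?w} \<subseteq> ?I" using TI by simp
  obtain Q3 where Q3: "form_congruent ?I Q2 ?I Q3"
    "\<And>b p q. p \<in> ?I - {?w} \<Longrightarrow> q \<in> ?I - {?w} \<Longrightarrow> Q3 b p q = Q2 b p q"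
    "\<And>b p q. p \<in> {?w} \<Longrightarrow> q \<in> ?I - {?w} \<Longrightarrow> Q3 b p q = (\<Sum>i\<in>{?w}. \<rho> * Q2 b i q)"
    "\<And>b p q. p \<in> {?w} \<Longrightarrow> q \<in> {?w} \<Longrightarrow> Q3 b p q = bil {?w} (Q2 b) (\<lambda>i. \<rho>) (\<lambda>i. \<rho>)"
    by (rule bchange_set[OF fin wI inv, of Q2]) (rule that)
  have sym3: "symmetric_on ?I Q3" by (rule symmetric_on_congruent[OF Q3(1) sym2])
  have T3: "Q3 b p q = Q2 b p q" if "p \<in> ?T" "q \<in> ?T" for b p q using that TI by (intro Q3(2)) auto
  have wp3: "Q3 b ?w p = 0" if "p \<in> ?T" for b p
  proof -
    have "p \<noteq> ?w" "p \<in> ?I" using that TI by auto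
    then show ?thesis using Q3(3)[of ?w p b] wp[OF that, of b] by simp
  qed
  have "approximable ?T (generic_form m a c) Q3"
  proof (rule IH)
    have "symmetric_on ?T Q3" using sym3 TI(1) unfolding symmetric_on_def by blast
    then show "flagform m a c Q3" using T3 flag2 by (simp add: flagform_def)
  qed
  then have "approximable ?I (generic_form m a (Suc c)) Q3"
  proof (rule generic_dense_split)
    show "Q3 b ?w p = 0" if "p \<in> ?T" for b p by (rule wp3[OF that])
    show "Q3 b p ?w = 0" if "p \<in> ?T" for b p
      using wp3[OF that, of b] symmetric_onD[OF sym3, of p ?w b] that TI by auto
    show "Q3 True ?w ?w = 1" using Q3(4)[of ?w ?w True] \<rho>(2) by (simp add: bil_def WW2)
  qed
  then show ?thesis
    by (intro approximable_generic_congruent[OF cong1] approximable_generic_congruent[OF cong2]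
        approximable_generic_congruent[OF Q3(1)])
qed

text \<open>Two perturbations secure the conditions of \<open>generic_dense_complement\<close>. At
  \<open>Wi c\<close>, \<open>A\<close> changes by \<open>s\<close> and \<open>B\<close> by
  \<open>- \<zeta> * s\<close>, which leaves \<open>\<zeta>A + B\<close> unchanged there; between
  \<open>Gi l\<close> and \<open>Ui l\<close>, \<open>B\<close> changes by \<open>t\<close>.\<close>

lemma generic_dense_eigenvector:
  fixes Q :: "bool \<Rightarrow> idx \<Rightarrow> idx \<Rightarrow> complex"
  assumes IH: "\<And>Q. flagform m a c Q \<Longrightarrow> approximable (iset m a c) (generic_form m a c) Q"
    and flag: "flagform m a (Suc c) Q"
    and L: "\<And>l. l \<le> c \<Longrightarrow> \<zeta> * Q True (Wi l) (Wi c) + Q False (Wi l) (Wi c) = 0"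
  shows "approximable (iset m a (Suc c)) (generic_form m a (Suc c)) Q"
proof (rule approximable_closure)
  let ?I = "iset m a (Suc c)" and ?w = "Wi c"
  fix \<epsilon> :: real assume e: "0 < \<epsilon>"
  have sym: "symmetric_on ?I Q" by (rule flagformD(1)[OF flag])
  from perturb_invertible[OF e, of a "\<lambda>l j. \<zeta> * Q True (Gi l) (Ui j) + Q False (Gi l) (Ui j)"]
  obtain t V where t: "cmod t < \<epsilon>"
    "inverse_on {..<a} {..<a} (\<lambda>l j. \<zeta> * Q True (Gi l) (Ui j) + Q False (Gi l) (Ui j) + (if l = j then t else 0)) V"
    by (elim exE conjE) (rule that)
  have e': "0 < \<epsilon> / (1 + cmod \<zeta>)" using e by (simp add: add_pos_nonneg)
  \<comment> \<open>The bound makes both \<open>s\<close> and \<open>\<zeta> * s\<close> smaller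
    than \<open>\<epsilon>\<close>.\<close>
  obtain s where s: "s \<noteq> - Q True ?w ?w" "cmod s < \<epsilon> / (1 + cmod \<zeta>)"
    using finite_avoid_small[OF _ e', of "{- Q True ?w ?w}"] by auto
  have s1: "cmod s * (1 + cmod \<zeta>) < \<epsilon>" using s(2) by (simp add: pos_less_divide_eq add_pos_nonneg)
  have s2: "cmod s < \<epsilon>" "cmod (\<zeta> * s) < \<epsilon>"
  proof -
    have "cmod s + cmod \<zeta> * cmod s < \<epsilon>" using s1 by (simp add: algebra_simps)
    moreover have "0 \<le> cmod s" "0 \<le> cmod \<zeta> * cmod s" by simp_all
    ultimately show "cmod s < \<epsilon>" "cmod (\<zeta> * s) < \<epsilon>" unfolding norm_mult by linarith+
  qed
  define X where "X b p q = (if p = ?w \<and> q = ?w then if b then s else - \<zeta> * s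
    else if \<not> b \<and> (\<exists>l<a. p = Gi l \<and> q = Ui l \<or> p = Ui l \<and> q = Gi l) then t else 0)" for b p q
  have Xs: "X b p q = X b q p" for b p q unfolding X_def by auto
  have X: "cmod (X b p q) < \<epsilon>" for b p q
    unfolding X_def using s2 t(1) e by (auto simp: norm_minus_cancel)
  let ?Q = "\<lambda>b p q. Q b p q + X b p q"
  have close: "close_on ?I \<epsilon> Q ?Q" unfolding close_on_def using X by simp
  have "approximable ?I (generic_form m a (Suc c)) ?Q"
  proof (rule generic_dense_complement[OF IH, of _ \<zeta>])
    show "flagform m a (Suc c) ?Q"
      unfolding flagform_def
    proof (intro conjI allI impI)
      show "symmetric_on ?I ?Q"
        unfolding symmetric_on_def using Xs symmetric_onD[OF sym] by auto
    qed (use flagformD(2,3)[OF flag] in \<open>auto simp: X_def\<close>)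
    show "\<zeta> * ?Q True (Wi l) ?w + ?Q False (Wi l) ?w = 0" if "l \<le> c" for l
      using L[OF that] by (auto simp: X_def algebra_simps)
    show "?Q True ?w ?w \<noteq> 0" using s(1) by (simp add: X_def add_eq_0_iff)
    show "inverse_on {..<a} {..<a} (\<lambda>l j. \<zeta> * ?Q True (Gi l) (Ui j) + ?Q False (Gi l) (Ui j)) V"
      by (rule inverse_on_cong[OF t(2)]) (auto simp: X_def)
  qed
  then show "\<exists>Q'. close_on ?I \<epsilon> Q Q' \<and> approximable ?I (generic_form m a (Suc c)) Q'"
    by (intro exI[of _ ?Q] conjI close)
qed

text \<open>After a perturbation \<open>A\<close> is invertible on the vectors \<open>Wi\<close>, so
  \<open>A\<^sup>-\<^sup>1 B\<close> has an eigenvector there, with an eigenvalue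
  \<open>\<tau>\<close>. On these vectors it is in the kernel of \<open>\<zeta>A + B\<close> for
  \<open>\<zeta> = - \<tau>\<close>, and a change of basis makes a vector of this eigenspace the
  last one, \<open>Wi c\<close>.\<close>

lemma generic_dense_Suc:
  fixes Q :: "bool \<Rightarrow> idx \<Rightarrow> idx \<Rightarrow> complex"
  assumes IH: "\<And>Q. flagform m a c Q \<Longrightarrow> approximable (iset m a c) (generic_form m a c) Q"
    and flag: "flagform m a (Suc c) Q"
  shows "approximable (iset m a (Suc c)) (generic_form m a (Suc c)) Q"
proof (rule approximable_closure)
  let ?I = "iset m a (Suc c)" and ?N = "Suc c"
  fix \<epsilon> :: real assume "0 < \<epsilon>"
  from perturb_invertible[OF this, of ?N "\<lambda>l l'. Q True (Wi l) (Wi l')"]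
  obtain t V where t: "cmod t < \<epsilon>"
    "inverse_on {..<?N} {..<?N} (\<lambda>l l'. Q True (Wi l) (Wi l') + (if l = l' then t else 0)) V"
    by (elim exE conjE) (rule that)
  let ?E = "\<lambda>p q. \<exists>l<?N. p = Wi l \<and> q = Wi l"
  define P where "P = perturb True ?E t Q"
  have flagP: "flagform m a ?N P"
    unfolding flagform_def P_def
  proof (intro conjI allI impI)
    show "symmetric_on ?I (perturb True ?E t Q)" by (rule symmetric_on_perturb[OF flagformD(1)[OF flag]])
  qed (use flagformD(2,3)[OF flag] in \<open>auto simp: perturb_def\<close>)
  have inv: "inverse_on {..<?N} {..<?N} (\<lambda>l l'. P True (Wi l) (Wi l')) V"
    by (rule inverse_on_cong[OF t(2)]) (auto simp: P_def perturb_def)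
  have "0 < ?N" by simp
  from finite_eigenvalues(2)[OF this, of "\<lambda>i j. \<Sum>k<?N. V i k * P False (Wi k) (Wi j)"]
  obtain \<tau> u j where u: "j < ?N" "u j \<noteq> 0"
    "\<forall>i<?N. (\<Sum>j<?N. (\<Sum>k<?N. V i k * P False (Wi k) (Wi j)) * u j) = \<tau> * u i"
    by (elim exE conjE) (rule that)
  have Bu: "(\<Sum>j<?N. P False (Wi i) (Wi j) * u j) = \<tau> * (\<Sum>j<?N. P True (Wi i) (Wi j) * u j)" if i: "i < ?N" for i
  proof -
    have e: "(\<Sum>k<?N. V l k * (\<Sum>j<?N. P False (Wi k) (Wi j) * u j)) = \<tau> * u l" if "l < ?N" for l
    proof -
      have "(\<Sum>k<?N. V l k * (\<Sum>j<?N. P False (Wi k) (Wi j) * u j)) = (\<Sum>k<?N. \<Sum>j<?N. V l k * P False (Wi k) (Wi j) * u j)"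
        by (simp only: sum_distrib_left mult.assoc)
      also have "\<dots> = (\<Sum>j<?N. \<Sum>k<?N. V l k * P False (Wi k) (Wi j) * u j)" by (rule sum.swap)
      also have "\<dots> = \<tau> * u l" using u(3) that by (simp only: sum_distrib_right)
      finally show ?thesis .
    qed
    have "(\<Sum>j<?N. P False (Wi i) (Wi j) * u j) = (\<Sum>l<?N. P True (Wi i) (Wi l) * (\<Sum>k<?N. V l k * (\<Sum>j<?N. P False (Wi k) (Wi j) * u j)))"
      using inverse_onD[OF finite_lessThan inv, of i "\<lambda>k. \<Sum>j<?N. P False (Wi k) (Wi j) * u j"] i by simp
    also have "\<dots> = (\<Sum>l<?N. P True (Wi i) (Wi l) * (\<tau> * u l))" using e by (intro sum.cong) auto
    also have "\<dots> = \<tau> * (\<Sum>l<?N. P True (Wi i) (Wi l) * u l)" by (simp only: sum_distrib_left mult.left_commute)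
    finally show ?thesis .
  qed
  let ?S = "{x \<in> supported {..<?N}. lin_map {..<?N} {..<?N} (\<lambda>i j. - \<tau> * P True (Wi i) (Wi j) + P False (Wi i) (Wi j)) x = 0}"
  have S: "fv.subspace ?S" by (rule subspace_kernel[OF subspace_supported linear_lin_map])
  have fd: "fin_dim ?S" by (rule fin_dim_supported[of "{..<?N}"]) auto
  let ?u = "\<lambda>i. if i < ?N then u i else 0"
  have "?u \<in> ?S"
  proof -
    have "(\<Sum>j<?N. (- \<tau> * P True (Wi i) (Wi j) + P False (Wi i) (Wi j)) * ?u j) = 0" if "i < ?N" for i
    proof -
      have "(\<Sum>j<?N. (- \<tau> * P True (Wi i) (Wi j) + P False (Wi i) (Wi j)) * ?u j)
          = (\<Sum>j<?N. P False (Wi i) (Wi j) * u j - \<tau> * (P True (Wi i) (Wi j) * u j))"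
        by (intro sum.cong) (auto simp: algebra_simps)
      also have "\<dots> = 0" using Bu[OF that] by (simp only: sum_subtractf sum_distrib_left[symmetric] right_minus_eq)
      finally show ?thesis .
    qed
    then show ?thesis by (auto simp: supported_def lin_map_def fun_eq_iff)
  qed
  moreover have "?u \<noteq> 0" using u(1,2) by (auto simp: fun_eq_iff)
  ultimately have "?S \<noteq> {0}" by blast
  then have "fv.dim ?S \<noteq> 0" using dim_0_subspace[OF S fd] by blast
  then have d: "1 \<le> fv.dim ?S" by simp
  have "?S \<subseteq> supported {..<?N}" by blast
  then obtain R W where R: "inverse_on {..<?N} {..<?N} R W" "\<And>l. ?N - 1 \<le> l \<Longrightarrow> l < ?N \<Longrightarrow> (\<lambda>i. R i l) \<in> ?S"
    by (rule subspace_basis[OF S _ d]) (rule that)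
  have inj: "inj_on Wi {..<?N}" by (simp add: inj_on_def)
  have sub: "Wi ` {..<?N} \<subseteq> ?I" by auto
  have sym: "symmetric_on ?I P" by (rule flagformD(1)[OF flagP])
  have fin: "finite ?I" by simp
  obtain Q1 where Q1: "form_congruent ?I P ?I Q1"
    "\<And>b p q. p \<in> ?I - Wi ` {..<?N} \<Longrightarrow> q \<in> ?I - Wi ` {..<?N} \<Longrightarrow> Q1 b p q = P b p q"
    "\<And>b l q. l < ?N \<Longrightarrow> q \<in> ?I - Wi ` {..<?N} \<Longrightarrow> Q1 b (Wi l) q = (\<Sum>i<?N. R i l * P b (Wi i) q)"
    "\<And>b l k. l < ?N \<Longrightarrow> k < ?N \<Longrightarrow> Q1 b (Wi l) (Wi k) = (\<Sum>i<?N. \<Sum>j<?N. R i l * P b (Wi i) (Wi j) * R j k)"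
    by (rule bchange[OF fin inj sub R(1), of P]) (rule that)
  have sym1: "symmetric_on ?I Q1" by (rule symmetric_on_congruent[OF Q1(1) sym])
  have GG1: "Q1 b (Gi i) (Gi j) = 0" if ij: "i < a + m" "j < a + m" for b i j
  proof -
    have "Q1 b (Gi i) (Gi j) = P b (Gi i) (Gi j)" using ij by (intro Q1(2)) auto
    then show ?thesis using flagformD(2)[OF flagP ij] by simp
  qed
  have GW1: "Q1 b (Gi i) (Wi j) = 0" if ij: "i < a + m" "j < ?N" for b i j
  proof -
    have "Q1 b (Gi i) (Wi j) = Q1 b (Wi j) (Gi i)" using ij by (intro symmetric_onD[OF sym1]) auto
    also have "\<dots> = (\<Sum>k<?N. R k j * P b (Wi k) (Gi i))" using ij by (intro Q1(3)) auto
    also have "\<dots> = 0"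
    proof (rule sum_zero)
      fix k assume k: "k < ?N"
      have "P b (Wi k) (Gi i) = P b (Gi i) (Wi k)" using ij k by (intro symmetric_onD[OF sym]) auto
      then show "R k j * P b (Wi k) (Gi i) = 0" using flagformD(3)[OF flagP ij(1) k] by simp
    qed
    finally show ?thesis .
  qed
  have "approximable ?I (generic_form m a ?N) Q1"
  proof (rule generic_dense_eigenvector[OF IH])
    show "flagform m a ?N Q1" using sym1 GG1 GW1 by (simp add: flagform_def)
    fix l assume "l \<le> c"
    then have l: "l < ?N" by simp
    have c: "c < ?N" by simp
    have "(\<lambda>i. R i c) \<in> ?S" by (rule R(2)) simp_all
    then have Rz: "lin_map {..<?N} {..<?N} (\<lambda>i j. - \<tau> * P True (Wi i) (Wi j) + P False (Wi i) (Wi j)) (\<lambda>i. R i c) = 0"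
      by blast
    have Rc: "(\<Sum>j<?N. (- \<tau> * P True (Wi i) (Wi j) + P False (Wi i) (Wi j)) * R j c) = 0" if "i < ?N" for i
      using fun_cong[OF Rz, of i] that by (simp only: lin_map_def lessThan_iff if_True zero_fun_def)
    have "- \<tau> * Q1 True (Wi l) (Wi c) + Q1 False (Wi l) (Wi c)
      = (\<Sum>i<?N. R i l * (\<Sum>j<?N. (- \<tau> * P True (Wi i) (Wi j) + P False (Wi i) (Wi j)) * R j c))"
      unfolding Q1(4)[OF l c] sum_distrib_left sum.distrib[symmetric]
      by (intro sum.cong refl) (simp add: algebra_simps)
    also have "\<dots> = 0" by (rule sum_zero) (simp only: Rc mult_zero_right)
    finally show "- \<tau> * Q1 True (Wi l) (Wi c) + Q1 False (Wi l) (Wi c) = 0" .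
  qed
  then have "approximable ?I (generic_form m a ?N) P" by (rule approximable_generic_congruent[OF Q1(1)])
  then show "\<exists>Q'. close_on ?I \<epsilon> Q Q' \<and> approximable ?I (generic_form m a ?N) Q'"
    unfolding P_def by (intro exI[of _ "perturb True ?E t Q"] conjI close_on_perturb[OF t(1)])
qed

theorem generic_dense:
  assumes "0 < m" "flagform m a c Q"
  shows "approximable (iset m a c) (generic_form m a c) Q"
  using assms(2)
proof (induction c arbitrary: Q)
  case 0
  then show ?case by (rule generic_dense_0[OF assms(1)])
next
  case (Suc c)
  show ?case by (rule generic_dense_Suc[OF Suc.IH Suc.prems])
qed

section \<open>Irreducible components\<close>

text \<open>Division with remainder by \<open>m\<close> recovers \<open>l\<close> and
  \<open>i\<close> from \<open>l + m * i\<close>, so the relabelling \<open>\<pi>\<close> is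
  injective; it is onto by counting.\<close>

lemma kblocks_shift_form:
  fixes \<mu> :: "nat \<Rightarrow> complex" and n r a :: nat
  assumes r: "r < n" "2 * a \<le> r"
  defines "m \<equiv> n - r" and "c \<equiv> r - 2 * a"
  defines "kb \<equiv> kblocks n r a (map \<mu> [0..<c])"
  shows "form_congruent (iset m a c) (shift_form m \<mu>) (bindex kb) (bform kb)"
proof -
  define d where "d l = a div m + (if l < a mod m then 1 else 0)" for l
  define \<pi> where "\<pi> = (\<lambda>(l, i). if l < m then if i \<le> d l then Gi (l + m * i) else Ui (l + m * (i - (d l + 1))) else Wi (l - m))"
  have m: "0 < m" using r by (simp add: m_def)
  have len: "length kb = m + c" using kblocks_nth(1)[OF r(1)] by (simp add: kb_def m_def)
  have kM: "kb ! l = M_block (d l)" if "l < m" for l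
    using kblocks_nth(2)[OF r(1)] that by (simp add: kb_def m_def d_def)
  have kJ: "kb ! l = J_block 1 (Fin (\<mu> (l - m)))" if "m \<le> l" "l < m + c" for l
    using kblocks_nth(3)[OF r(1), of l "map \<mu> [0..<c]" a] that by (simp add: kb_def m_def)
  have mem: "(l, i) \<in> bindex kb \<longleftrightarrow> l < m \<and> i < 2 * d l + 1 \<or> m \<le> l \<and> l < m + c \<and> i = 0" for l i
    using kM[of l] kJ[of l] by (cases "l < m") (auto simp: bindex_def len)
  have am: "a = m * (a div m) + a mod m" by simp
  \<comment> \<open>Only the first \<open>a mod m\<close> blocks have the larger index, so the
    numbering stays below \<open>a + m\<close>.\<close>
  have bound: "l + m * d l < a + m" if "l < m" for l
  proof -
    have "m * d l = m * (a div m) + (if l < a mod m then m else 0)" by (simp add: d_def)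
    then show ?thesis using am that by (cases "l < a mod m") (simp only: if_True if_False; linarith)+
  qed
  have eq: "l + m * i = l' + m * i' \<longleftrightarrow> l = l' \<and> i = i'" if "l < m" "l' < m" for l l' i i'
  proof
    assume e: "l + m * i = l' + m * i'"
    have "(l + m * i) mod m = (l' + m * i') mod m" "(l + m * i) div m = (l' + m * i') div m" by (simp_all only: e)
    then show "l = l' \<and> i = i'" using that by simp
  qed simp
  have sub: "\<pi> ` bindex kb \<subseteq> iset m a c"
  proof
    fix p assume "p \<in> \<pi> ` bindex kb"
    then obtain l i where p: "p = \<pi> (l, i)" "(l, i) \<in> bindex kb" by auto
    show "p \<in> iset m a c"
    proof (cases "l < m")
      case True
      show ?thesis
      proof (cases "i \<le> d l")
        case Ti: True
        have "l + m * i < a + m" using bound[OF True] mult_le_mono2[OF Ti, of m] by linarith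
        then show ?thesis using p(1) True Ti by (simp add: \<pi>_def)
      next
        case False
        then have "i - (d l + 1) + 1 \<le> d l" using p(2) True unfolding mem by simp
        then have "m * (i - (d l + 1) + 1) \<le> m * d l" by (rule mult_le_mono2)
        then show ?thesis using bound[OF True] p(1) True False by (simp add: \<pi>_def)
      qed
    next
      case False
      then show ?thesis using p unfolding mem by (auto simp: \<pi>_def)
    qed
  qed
  have inj: "inj_on \<pi> (bindex kb)"
  proof (rule inj_onI)
    fix p q assume pq: "p \<in> bindex kb" "q \<in> bindex kb" and e: "\<pi> p = \<pi> q"
    obtain l i where p: "p = (l, i)" by (cases p)
    obtain l' i' where q: "q = (l', i')" by (cases q)
    have li: "l < m \<and> i < 2 * d l + 1 \<or> m \<le> l \<and> l < m + c \<and> i = 0" using pq(1) unfolding p mem .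
    have li': "l' < m \<and> i' < 2 * d l' + 1 \<or> m \<le> l' \<and> l' < m + c \<and> i' = 0" using pq(2) unfolding q mem .
    consider "l < m" "l' < m" | "m \<le> l" "m \<le> l'" | "l < m" "m \<le> l'" | "m \<le> l" "l' < m" by linarith
    then show "p = q"
    proof cases
      case 1
      then show ?thesis using e eq[OF 1] by (auto simp: p q \<pi>_def split: if_splits)
    next
      case 2
      then show ?thesis using e li li' by (auto simp: p q \<pi>_def)
    next
      case 3
      then show ?thesis using e by (auto simp: p q \<pi>_def split: if_splits)
    next
      case 4
      then show ?thesis using e by (auto simp: p q \<pi>_def split: if_splits)
    qed
  qed
  have "card (bindex kb) = n"
    using sum_block_size_kblocks[OF r, of "map \<mu> [0..<c]"] by (simp only: card_bindex kb_def c_def length_map length_upt diff_zero)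
  moreover have "card (iset m a c) = n"
  proof -
    have "card (iset m a c) = card (Gi ` {..<a + m} \<union> Ui ` {..<a}) + card (Wi ` {..<c})"
      unfolding iset_def by (rule card_Un_disjoint) auto
    also have "card (Gi ` {..<a + m} \<union> Ui ` {..<a}) = card (Gi ` {..<a + m}) + card (Ui ` {..<a})"
      by (rule card_Un_disjoint) auto
    finally have "card (iset m a c) = a + m + a + c" by (simp add: card_image inj_on_def)
    then show ?thesis using r by (simp add: m_def c_def)
  qed
  ultimately have "\<pi> ` bindex kb = iset m a c"
    using sub inj by (intro card_subset_eq) (simp_all add: card_image)
  then have bij: "bij_betw \<pi> (bindex kb) (iset m a c)" using inj by (simp add: bij_betw_def)
  show ?thesis
  proof (rule form_congruent_bij[OF finite_iset finite_bindex bij])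
    fix b p q assume pq: "p \<in> bindex kb" "q \<in> bindex kb"
    obtain l i where p: "p = (l, i)" by (cases p)
    obtain l' i' where q: "q = (l', i')" by (cases q)
    have li: "l < m \<and> i < 2 * d l + 1 \<or> m \<le> l \<and> l < m + c \<and> i = 0" using pq(1) unfolding p mem .
    have li': "l' < m \<and> i' < 2 * d l' + 1 \<or> m \<le> l' \<and> l' < m + c \<and> i' = 0" using pq(2) unfolding q mem .
    consider "l < m" "l' < m" | "m \<le> l" "m \<le> l'" | "l < m" "m \<le> l'" | "m \<le> l" "l' < m" by linarith
    then show "bform kb b p q = shift_form m \<mu> b (\<pi> p) (\<pi> q)"
    proof cases
      case 1
      have sh: "x = y + (if b then 0 else m) \<longleftrightarrow> x = y + m * (if b then 0 else 1)" for x y :: nat by simp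
      have e: "l + m * j = l' + m * j' + (if b then 0 else m) \<longleftrightarrow> l = l' \<and> j = j' + (if b then 0 else 1)"
        "l' + m * j = l + m * j' + (if b then 0 else m) \<longleftrightarrow> l = l' \<and> j = j' + (if b then 0 else 1)" for j j'
        using eq[OF 1, of j "j' + (if b then 0 else 1)"] eq[OF 1(2,1), of j "j' + (if b then 0 else 1)"]
        by (auto simp: distrib_left add.assoc)
      have e': "m * j = m * j' + m \<longleftrightarrow> j = Suc j'" for j j'
      proof -
        have "m * j' + m = m * Suc j'" by simp
        then show ?thesis using m by (simp only: mult_cancel1) simp
      qed
      show ?thesis
      proof (cases "l = l'")
        case True
        have "bform kb b p q = form (M_pencil (d l)) b i i'" using True kM[OF 1(1)] by (simp add: bform_def p q)
        also have "\<dots> = shift_form m \<mu> b (\<pi> p) (\<pi> q)"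
          using li li' 1 True by (subst form_M_pencil) (auto simp: p q \<pi>_def e' not_le)
        finally show ?thesis .
      next
        case False
        then show ?thesis using 1 e by (simp add: bform_def p q \<pi>_def)
      qed
    next
      case 2
      show ?thesis
      proof (cases "l = l'")
        case True
        have "bform kb b p q = form (J_pencil 1 (Fin (\<mu> (l - m)))) b 0 0"
          using True 2 li li' kJ[of l] by (simp add: bform_def p q del: J_pencil.simps)
        also have "\<dots> = shift_form m \<mu> b (\<pi> p) (\<pi> q)"
          using 2 True by (subst form_J_pencil) (simp_all add: p q \<pi>_def)
        finally show ?thesis .
      next
        case False
        then have "l - m \<noteq> l' - m" using 2 by simp
        then show ?thesis using 2 False by (simp add: bform_def p q \<pi>_def)
      qed
    next
      case 3
      then show ?thesis by (auto simp: bform_def p q \<pi>_def)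
    next
      case 4
      then show ?thesis by (auto simp: bform_def p q \<pi>_def)
    qed
  qed
qed

text \<open>Density produces \<open>K_pencil\<close> with eigenvalues that depend on the pencil to
  be approximated; \<open>f\<close> maps the prescribed eigenvalues to these.\<close>

lemma K_orbit_subset_bundle:
  assumes r: "r < n" "2 * a \<le> r" "length \<mu>s = r - 2 * a" "distinct \<mu>s" "length \<nu>s = r - 2 * a" "distinct \<nu>s"
  shows "congruence_orbit (K_pencil n r a \<nu>s) \<subseteq> congruence_bundle (K_pencil n r a \<mu>s)"
proof -
  let ?c = "r - 2 * a"
  let ?g = "the_inv_into {..<?c} ((!) \<mu>s)"
  define f where "f e = (case e of Fin x \<Rightarrow> Fin (\<nu>s ! ?g x) | Infty \<Rightarrow> Infty)" for e
  have inj: "inj_on ((!) \<mu>s) {..<?c}" using r(3,4) by (simp add: inj_on_nth)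
  have f: "f (Fin (\<mu>s ! k)) = Fin (\<nu>s ! k)" if "k < ?c" for k
    using the_inv_into_f_f[OF inj] that by (simp add: f_def)
  have ev: "eigenvalues_of_blocks (kblocks n r a \<mu>s) \<subseteq> Fin ` set \<mu>s"
    by (auto simp: eigenvalues_of_blocks_def kblocks_def)
  have inj_f: "inj_on f (eigenvalues_of_blocks (kblocks n r a \<mu>s))"
  proof (rule inj_on_subset[OF _ ev], rule inj_onI)
    fix x y assume "x \<in> Fin ` set \<mu>s" "y \<in> Fin ` set \<mu>s" and e: "f x = f y"
    then obtain k k' where k: "x = Fin (\<mu>s ! k)" "y = Fin (\<mu>s ! k')" "k < ?c" "k' < ?c"
      using r(3) by (auto simp: in_set_conv_nth)
    then have "\<nu>s ! k = \<nu>s ! k'" using e f by simp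
    then have "k = k'" using r(5,6) k by (simp add: nth_eq_iff_index_eq)
    then show "x = y" using k by simp
  qed
  have "map (map_block f) (map (\<lambda>\<mu>. J_block 1 (Fin \<mu>)) \<mu>s) = map (\<lambda>\<mu>. J_block 1 (Fin \<mu>)) \<nu>s"
    by (rule nth_equalityI) (use r f in auto)
  then have "map (map_block f) (kblocks n r a \<mu>s) = kblocks n r a \<nu>s"
    by (simp add: kblocks_def)
  then have e: "K_pencil n r a \<nu>s = blocks_pencil (map (map_block f) (kblocks n r a \<mu>s))"
    by (simp add: K_pencil_kblocks)
  have K: "K_pencil n r a \<mu>s \<in> pencils n" by (rule K_pencil_pencils[OF r(1-3)])
  have "K_pencil n r a \<mu>s \<in> congruence_orbit (K_pencil n r a \<mu>s)"
    unfolding congruence_orbit_iff[OF K K] by (rule form_congruent_refl) simp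
  then have "is_canonical_form (kblocks n r a \<mu>s) (K_pencil n r a \<mu>s)"
    using proper_kblocks[of n r a \<mu>s] unfolding is_canonical_form_def K_pencil_kblocks by blast
  then show ?thesis unfolding congruence_bundle_def e using inj_f by blast
qed

section \<open>Comparison of the two topologies\<close>

lemma closedin_zariski_euclidean:
  assumes "closedin (pencil_zariski n) C"
  shows "closedin (pencil_euclidean n) C"
proof -
  obtain F where F: "\<forall>f\<in>F. polynomial_fun (pencil_index n) f" "C = {P \<in> pencils n. \<forall>f\<in>F. f (pencil_coords n P) = 0}"
    using assms unfolding closedin_pencil_zariski by blast
  let ?X = "euclidean_topology_on (pencil_index n)"
  have cont: "(f \<longlongrightarrow> f x) (atin ?X x)" if "polynomial_fun (pencil_index n) f" "x \<in> topspace ?X" for f x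
    using that(1)
  proof induction
    case (const c) show ?case by simp
  next
    case (coord i)
    have "continuous_map ?X euclidean (\<lambda>x. x i)"
      unfolding euclidean_topology_on_def by (rule continuous_map_product_projection[OF coord])
    then show ?case using that(2) unfolding continuous_map_atin by (simp add: limitin_canonical_iff)
  next
    case (add p q) then show ?case by (intro tendsto_add)
  next
    case (mult p q) then show ?case by (intro tendsto_mult)
  qed
  have op: "openin ?X {x \<in> topspace ?X. f x \<noteq> 0}" if "f \<in> F" for f
  proof -
    have "continuous_map ?X euclidean f"
      unfolding continuous_map_atin limitin_canonical_iff using cont F(1) that by blast
    then have "openin ?X {x \<in> topspace ?X. f x \<in> - {0}}" by (rule openin_continuous_map_preimage) (simp add: open_Compl)
    then show ?thesis by simp
  qed
  have top: "topspace ?X = pencil_index n \<rightarrow>\<^sub>E UNIV" by (simp add: euclidean_topology_on_def)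
  have "pencils n - C = pencil_coords n -` (\<Union>f\<in>F. {x \<in> topspace ?X. f x \<noteq> 0}) \<inter> pencils n"
    using pencil_coords_range[of n] unfolding top F(2) by blast
  moreover have "openin ?X (\<Union>f\<in>F. {x \<in> topspace ?X. f x \<noteq> 0})" using op by (intro openin_Union) blast
  ultimately have "openin (pencil_euclidean n) (pencils n - C)"
    unfolding pencil_euclidean_def openin_pullback_topology by blast
  moreover have "C \<subseteq> pencils n" using F(2) by blast
  ultimately show ?thesis unfolding closedin_def by simp
qed

lemma in_euclidean_closure:
  assumes P: "P \<in> pencils n" and approx: "\<And>\<epsilon>. 0 < \<epsilon> \<Longrightarrow> \<exists>P'\<in>S. P' \<in> pencils n \<and> close_on {..<n} \<epsilon> (form P) (form P')"
  shows "P \<in> pencil_euclidean n closure_of S"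
  unfolding in_closure_of
proof (intro conjI allI impI)
  show "P \<in> topspace (pencil_euclidean n)" using P by simp
  fix T assume T: "P \<in> T \<and> openin (pencil_euclidean n) T"
  let ?I = "pencil_index n"
  obtain U where U: "openin (product_topology (\<lambda>_. euclidean) ?I) U" "T = pencil_coords n -` U \<inter> pencils n"
    using T unfolding pencil_euclidean_def openin_pullback_topology euclidean_topology_on_def by blast
  have PU: "pencil_coords n P \<in> U" using T U(2) by blast
  obtain X where X: "pencil_coords n P \<in> Pi\<^sub>E ?I X" "\<And>i. open (X i)" "Pi\<^sub>E ?I X \<subseteq> U"
    using product_topology_open_contains_basis[OF U(1) PU] by auto
  have fin: "finite ?I" by (simp add: pencil_index_def)
  have "\<forall>k\<in>?I. \<exists>e>0. \<forall>y. dist y (pencil_coords n P k) < e \<longrightarrow> y \<in> X k"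
  proof
    fix k assume "k \<in> ?I"
    then have "pencil_coords n P k \<in> X k" using X(1) by (auto simp: PiE_iff)
    then show "\<exists>e>0. \<forall>y. dist y (pencil_coords n P k) < e \<longrightarrow> y \<in> X k" using X(2)[of k] unfolding open_dist by blast
  qed
  from bchoice[OF this] obtain e where e: "\<forall>k\<in>?I. 0 < e k \<and> (\<forall>y. dist y (pencil_coords n P k) < e k \<longrightarrow> y \<in> X k)" by (rule exE)
  \<comment> \<open>There are finitely many coordinates, so one bound serves for all; the element 1
    keeps the set nonempty.\<close>
  define \<epsilon> where "\<epsilon> = Min (insert 1 (e ` ?I))"
  have "0 < \<epsilon>" unfolding \<epsilon>_def using fin e by (subst Min_gr_iff) auto
  from approx[OF this] obtain P' where P': "P' \<in> S" "P' \<in> pencils n" "close_on {..<n} \<epsilon> (form P) (form P')" by blast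
  have "pencil_coords n P' k \<in> X k" if k: "k \<in> ?I" for k
  proof -
    obtain b i j where bij: "k = (b, i, j)" by (cases k)
    then have ij: "i < n" "j < n" using k by (auto simp: pencil_index_def)
    have "dist (pencil_coords n P' k) (pencil_coords n P k) < \<epsilon>"
      using P'(3) ij by (simp add: close_on_def bij pencil_coords_form dist_norm norm_minus_commute)
    also have "\<epsilon> \<le> e k" unfolding \<epsilon>_def using fin k by (intro Min_le) auto
    finally show ?thesis using e k by auto
  qed
  moreover have "pencil_coords n P' \<in> ?I \<rightarrow>\<^sub>E UNIV" using pencil_coords_range[of n] P'(2) by blast
  ultimately have "pencil_coords n P' \<in> Pi\<^sub>E ?I X" by (auto simp: PiE_iff)
  then have "P' \<in> T" using X(3) U(2) P'(2) by blast
  then show "\<exists>y. y \<in> S \<and> y \<in> T" using P'(1) by blast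
qed

lemma flag_pencils_subset_euclidean_closure:
  assumes r: "r < n" "2 * a \<le> r" "length \<mu>s = r - 2 * a" "distinct \<mu>s"
  shows "flag_pencils n (n - r + a) (n - a) \<subseteq> pencil_euclidean n closure_of congruence_bundle (K_pencil n r a \<mu>s)"
proof
  fix P assume P: "P \<in> flag_pencils n (n - r + a) (n - a)"
  define m c where "m = n - r" and "c = r - 2 * a"
  let ?I = "iset m a c" and ?G = "Gi ` {..<a + m}" and ?W = "Wi ` {..<c}"
  have Pn: "P \<in> pencils n" and Ps: "\<forall>b. \<forall>i<n. \<forall>j<n. form P b i j = form P b j i"
    and flag: "isotropic_flag {..<n} (form P) (n - r + a) (n - a)"
    using P unfolding flag_pencils_def symmetric_pencils_iff by auto
  have sym: "symmetric_on {..<n} (form P)" using Ps by (simp add: symmetric_on_def)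
  have cG: "card ?G = n - r + a" by (simp add: card_image inj_on_def m_def)
  have cGW: "card (?G \<union> ?W) = n - a"
    using r by (subst card_Un_disjoint) (auto simp: card_image inj_on_def m_def c_def)
  have card: "card {..<n} = card ?I"
  proof -
    have "?I = (?G \<union> ?W) \<union> Ui ` {..<a}" by (auto simp: iset_def)
    also have "card \<dots> = card (?G \<union> ?W) + card (Ui ` {..<a})" by (rule card_Un_disjoint) auto
    finally have "card ?I = n" unfolding cGW using r by (simp add: card_image inj_on_def)
    then show ?thesis by simp
  qed
  have sub: "?G \<subseteq> ?G \<union> ?W" "?G \<union> ?W \<subseteq> ?I" by (auto simp: iset_def)
  from isotropic_flag_basis[OF finite_lessThan finite_iset card flag sub cG cGW]
  obtain Q where Q: "form_congruent {..<n} (form P) ?I Q" "\<forall>b. \<forall>i\<in>?G. \<forall>j\<in>?G \<union> ?W. Q b i j = 0"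
    by (elim exE conjE) (rule that)
  have "flagform m a c Q"
    unfolding flagform_def using symmetric_on_congruent[OF Q(1) sym] Q(2) by auto
  moreover have "0 < m" using r by (simp add: m_def)
  ultimately have ap: "approximable ?I (generic_form m a c) Q" by (intro generic_dense)
  define good where "good Q' \<longleftrightarrow> (\<exists>\<mu>. inj_on \<mu> {..<c} \<and> form_congruent ?I (shift_form m \<mu>) {..<n} Q')" for Q'
  have "approximable {..<n} good (form P)"
  proof (rule approximable_congruent[OF finite_lessThan finite_iset Q(1) ap])
    fix Q' Q'' assume g: "generic_form m a c Q'" and c': "form_congruent ?I Q' {..<n} Q''"
    obtain \<mu> where \<mu>: "inj_on \<mu> {..<c}" "form_congruent ?I (shift_form m \<mu>) ?I Q'"
      using g unfolding generic_form_def by blast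
    show "good Q''" unfolding good_def
      by (rule exI[of _ \<mu>], rule conjI[OF \<mu>(1)])
        (rule form_congruent_trans[OF finite_iset finite_iset finite_lessThan \<mu>(2) c'])
  qed
  show "P \<in> pencil_euclidean n closure_of congruence_bundle (K_pencil n r a \<mu>s)"
  proof (rule in_euclidean_closure[OF Pn])
    fix \<epsilon> :: real assume "0 < \<epsilon>"
    then obtain Q' where Q': "good Q'" "close_on {..<n} \<epsilon> (form P) Q'"
      using \<open>approximable {..<n} good (form P)\<close> unfolding approximable_def by blast
    obtain \<mu> where \<mu>: "inj_on \<mu> {..<c}" "form_congruent ?I (shift_form m \<mu>) {..<n} Q'"
      using Q'(1) unfolding good_def by blast
    let ?P = "(mat n n (\<lambda>(i, j). Q' True i j), mat n n (\<lambda>(i, j). Q' False i j))"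
    let ?\<nu> = "map \<mu> [0..<c]"
    let ?kb = "kblocks n r a ?\<nu>" and ?K = "K_pencil n r a ?\<nu>"
    have fP: "form ?P b i j = Q' b i j" if "i \<in> {..<n}" "j \<in> {..<n}" for b i j
      using that by (simp add: form_def)
    have P': "?P \<in> pencils n" by (simp add: pencils_def)
    have len: "length ?\<nu> = r - 2 * a" by (simp add: c_def)
    have K: "?K \<in> pencils n" by (rule K_pencil_pencils[OF r(1,2) len])
    have "form_congruent {..<n} (form ?K) (bindex ?kb) (bform ?kb)"
      by (rule form_congruent_sym[OF finite_bindex finite_lessThan K_pencil_congruent[OF r(1,2) len]])
    moreover have "form_congruent (bindex ?kb) (bform ?kb) ?I (shift_form m \<mu>)"
      unfolding m_def c_def by (rule form_congruent_sym[OF finite_iset finite_bindex kblocks_shift_form[OF r(1,2)]])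
    ultimately have "form_congruent {..<n} (form ?K) ?I (shift_form m \<mu>)"
      by (rule form_congruent_trans[OF finite_lessThan finite_bindex finite_iset])
    then have "form_congruent {..<n} (form ?K) {..<n} Q'"
      by (rule form_congruent_trans[OF finite_lessThan finite_iset finite_lessThan _ \<mu>(2)])
    then have "form_congruent {..<n} (form ?K) {..<n} (form ?P)"
      by (rule form_congruent_trans[OF finite_lessThan finite_lessThan finite_lessThan _ form_congruent_cong[OF finite_lessThan fP]])
    then have "?P \<in> congruence_orbit ?K" unfolding congruence_orbit_iff[OF P' K] .
    moreover have "distinct ?\<nu>" using \<mu>(1) by (simp add: distinct_map atLeast0LessThan)
    ultimately have "?P \<in> congruence_bundle (K_pencil n r a \<mu>s)"
      using K_orbit_subset_bundle[OF r len] by blast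
    moreover have "close_on {..<n} \<epsilon> (form P) (form ?P)" using Q'(2) fP by (simp add: close_on_def)
    ultimately show "\<exists>P'\<in>congruence_bundle (K_pencil n r a \<mu>s). P' \<in> pencils n \<and> close_on {..<n} \<epsilon> (form P) (form P')"
      using P' by blast
  qed
qed

text \<open>By density \<open>?Z\<close> lies in the Euclidean closure, which lies in the Zariski
  closure, which lies in the Zariski closed set \<open>?Z\<close>; so all three coincide.\<close>

lemma closure_congruence_bundle:
  assumes r: "r < n" "2 * a \<le> r" "length \<mu>s = r - 2 * a" "distinct \<mu>s"
  shows "pencil_euclidean n closure_of congruence_bundle (K_pencil n r a \<mu>s) = flag_pencils n (n - r + a) (n - a)"
    "pencil_zariski n closure_of congruence_bundle (K_pencil n r a \<mu>s) = flag_pencils n (n - r + a) (n - a)"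
proof -
  let ?B = "congruence_bundle (K_pencil n r a \<mu>s)" and ?Z = "flag_pencils n (n - r + a) (n - a)"
  have BZ: "?B \<subseteq> ?Z" by (rule congruence_bundle_subset_flag[OF r(1-3)])
  have closed: "closedin (pencil_zariski n) ?Z" using r by (intro closedin_flag_pencils) auto
  have Zn: "?Z \<subseteq> pencils n" using closedin_subset[OF closed] by simp
  have ZE: "?Z \<subseteq> pencil_euclidean n closure_of ?B" by (rule flag_pencils_subset_euclidean_closure[OF r])
  have "pencil_euclidean n closure_of ?B \<subseteq> pencil_zariski n closure_of ?B"
  proof (rule closure_of_minimal)
    show "?B \<subseteq> pencil_zariski n closure_of ?B" using BZ Zn by (intro closure_of_subset) simp
    show "closedin (pencil_euclidean n) (pencil_zariski n closure_of ?B)"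
      by (rule closedin_zariski_euclidean[OF closedin_closure_of])
  qed
  moreover have "pencil_zariski n closure_of ?B \<subseteq> ?Z" by (rule closure_of_minimal[OF BZ closed])
  ultimately show "pencil_euclidean n closure_of ?B = ?Z" "pencil_zariski n closure_of ?B = ?Z" using ZE by blast+
qed

section \<open>Components of a finite union\<close>

lemma irreducible_subset_finite_union:
  assumes "finite A" "irreducible_set_in T S" "\<And>a. a \<in> A \<Longrightarrow> closedin T (Z a)" "S \<subseteq> (\<Union>a\<in>A. Z a)"
  shows "\<exists>a\<in>A. S \<subseteq> Z a"
  using assms(1,3,4)
proof (induction A rule: finite_induct)
  case empty
  then show ?case using assms(2) by (simp add: irreducible_set_in_def)
next
  case (insert a A)
  have "closedin T (Z a)" "closedin T (\<Union>a\<in>A. Z a)"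
    using insert by (auto intro: closedin_Union)
  moreover have "S \<subseteq> Z a \<union> (\<Union>a\<in>A. Z a)" using insert.prems(2) by simp
  ultimately have "S \<subseteq> Z a \<or> S \<subseteq> (\<Union>a\<in>A. Z a)" using assms(2) unfolding irreducible_set_in_def by blast
  then show ?case using insert.IH insert.prems(1) by blast
qed

text \<open>An irreducible subset of the union lies in one member. As no member is contained in
  another, the maximal irreducible subsets are the members.\<close>

lemma irreducible_components_finite_union:
  assumes A: "finite A" and Z: "\<And>a. a \<in> A \<Longrightarrow> closedin T (Z a)" "\<And>a. a \<in> A \<Longrightarrow> irreducible_set_in T (Z a)"
    and ne: "\<And>a b. a \<in> A \<Longrightarrow> b \<in> A \<Longrightarrow> Z a \<subseteq> Z b \<Longrightarrow> a = b"
  shows "irreducible_components T (\<Union>a\<in>A. Z a) = Z ` A"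
proof (intro equalityI subsetI)
  fix S assume S: "S \<in> irreducible_components T (\<Union>a\<in>A. Z a)"
  then have S1: "S \<subseteq> (\<Union>a\<in>A. Z a)" "irreducible_set_in T S"
    and S2: "\<And>S'. S' \<subseteq> (\<Union>a\<in>A. Z a) \<Longrightarrow> irreducible_set_in T S' \<Longrightarrow> S \<subseteq> S' \<Longrightarrow> S' = S"
    unfolding irreducible_components_def by auto
  obtain a where a: "a \<in> A" "S \<subseteq> Z a" using irreducible_subset_finite_union[OF A S1(2) Z(1) S1(1)] by blast
  have "Z a = S" using a by (intro S2 Z(2)) auto
  then show "S \<in> Z ` A" using a(1) by blast
next
  fix S assume "S \<in> Z ` A"
  then obtain a where a: "a \<in> A" "S = Z a" by blast
  have "S' = Z a" if S': "S' \<subseteq> (\<Union>a\<in>A. Z a)" "irreducible_set_in T S'" "Z a \<subseteq> S'" for S'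
  proof -
    obtain b where b: "b \<in> A" "S' \<subseteq> Z b" using irreducible_subset_finite_union[OF A S'(2) Z(1) S'(1)] by blast
    have "Z a \<subseteq> Z b" using S'(3) b(2) by (rule order_trans)
    then have "a = b" by (rule ne[OF a(1) b(1)])
    then show ?thesis using S'(3) b(2) by blast
  qed
  then show "S \<in> irreducible_components T (\<Union>a\<in>A. Z a)"
    unfolding irreducible_components_def using a Z(2)[OF a(1)] by blast
qed

theorem theorem4p2:
  fixes n r :: nat
  assumes "n \<ge> 2" and "1 \<le> r" and "r < n"
  shows "closedin (pencil_zariski n) (symmetric_pencils_rank_le n r) \<and>
    card (irreducible_components (pencil_zariski n) (symmetric_pencils_rank_le n r))
      = r div 2 + 1 \<and>
    (\<forall>\<mu> :: nat \<Rightarrow> complex list.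
      (\<forall>a \<le> r div 2. length (\<mu> a) = r - 2 * a \<and> distinct (\<mu> a)) \<longrightarrow>
        irreducible_components (pencil_zariski n) (symmetric_pencils_rank_le n r)
          = (\<lambda>a. pencil_zariski n closure_of congruence_bundle (K_pencil n r a (\<mu> a)))
              ` {0..r div 2} \<and>
        (\<forall>a \<le> r div 2.
          pencil_zariski n closure_of congruence_bundle (K_pencil n r a (\<mu> a))
            = pencil_euclidean n closure_of congruence_bundle (K_pencil n r a (\<mu> a))))"
proof -
  let ?Z = "\<lambda>a. flag_pencils n (n - r + a) (n - a)" and ?A = "{0..r div 2}" and ?T = "pencil_zariski n"
  have X: "symmetric_pencils_rank_le n r = (\<Union>a\<in>?A. ?Z a)"
    by (rule symmetric_pencils_rank_le_eq) (use assms in simp)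
  have closed: "closedin ?T (?Z a)" if "a \<in> ?A" for a
    using assms that by (intro closedin_flag_pencils) auto
  have irr: "irreducible_set_in ?T (?Z a)" if "a \<in> ?A" for a
    using assms that by (intro irreducible_flag_pencils) auto
  have ne: "a = b" if ab: "a \<in> ?A" "b \<in> ?A" and sub: "?Z a \<subseteq> ?Z b" for a b
  proof -
    \<comment> \<open>Any distinct eigenvalues give a pencil in \<open>?Z a\<close> that lies in no
      other \<open>?Z b\<close>.\<close>
    let ?\<mu> = "map (of_nat :: nat \<Rightarrow> complex) [0..<r - 2 * a]"
    have \<mu>: "length ?\<mu> = r - 2 * a" "distinct ?\<mu>" by (simp_all add: distinct_map inj_on_def)
    have a: "2 * a \<le> r" "2 * b \<le> r" using ab by auto
    have "K_pencil n r a ?\<mu> \<in> ?Z a" using K_pencil_flag[OF assms(3) a(1) \<mu> a(1)] by simp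
    then have "K_pencil n r a ?\<mu> \<in> ?Z b" using sub by blast
    then show "a = b" using K_pencil_flag[OF assms(3) a(1) \<mu> a(2)] by simp
  qed
  have comp: "irreducible_components ?T (symmetric_pencils_rank_le n r) = ?Z ` ?A"
    unfolding X by (rule irreducible_components_finite_union[OF finite_atLeastAtMost closed irr ne])
  have inj: "inj_on ?Z ?A" by (rule inj_onI) (rule ne, auto)
  have "closedin ?T (symmetric_pencils_rank_le n r)"
    unfolding X using closed by (intro closedin_Union) auto
  moreover have "card (irreducible_components ?T (symmetric_pencils_rank_le n r)) = r div 2 + 1"
    unfolding comp card_image[OF inj] by simp
  moreover have "irreducible_components ?T (symmetric_pencils_rank_le n r)
        = (\<lambda>a. ?T closure_of congruence_bundle (K_pencil n r a (\<mu> a))) ` ?A \<and>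
      (\<forall>a \<le> r div 2. ?T closure_of congruence_bundle (K_pencil n r a (\<mu> a))
        = pencil_euclidean n closure_of congruence_bundle (K_pencil n r a (\<mu> a)))"
    if \<mu>: "\<forall>a \<le> r div 2. length (\<mu> a) = r - 2 * a \<and> distinct (\<mu> a)" for \<mu> :: "nat \<Rightarrow> complex list"
  proof -
    have cl: "pencil_euclidean n closure_of congruence_bundle (K_pencil n r a (\<mu> a)) = ?Z a"
      "?T closure_of congruence_bundle (K_pencil n r a (\<mu> a)) = ?Z a" if "a \<le> r div 2" for a
    proof -
      have a: "2 * a \<le> r" "length (\<mu> a) = r - 2 * a" "distinct (\<mu> a)" using \<mu> that by auto
      show "pencil_euclidean n closure_of congruence_bundle (K_pencil n r a (\<mu> a)) = ?Z a"
        "?T closure_of congruence_bundle (K_pencil n r a (\<mu> a)) = ?Z a"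
        using closure_congruence_bundle[OF assms(3) a] by simp_all
    qed
    have "?Z ` ?A = (\<lambda>a. ?T closure_of congruence_bundle (K_pencil n r a (\<mu> a))) ` ?A"
      by (rule image_cong) (simp_all add: cl)
    then show ?thesis unfolding comp using cl by simp
  qed
  ultimately show ?thesis by blast
qed

end
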